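(* Let $\bar\lambda>0$ and $\lambda_1=\dots=\lambda_k=\bar\lambda$. Let $\varphi_1,\dots,\varphi_k\in C^{0,1}(\partial\Omega)$ be non-negative and non-trivial functions with $\varphi_i\varphi_j\equiv0$ on $\partial\Omega$ for $i\ne j$, and suppose that the set $\{\varphi_i>0\}\subset\partial\Omega$ is connected for every $i$. Then, for any minimizer $\mathbf{u}=(u_1,\dots,u_k)$ of $$\inf\Big\{\sum_{i=1}^k\int_\Omega\big(|\nabla u_i|^2-2\lambda_iu_i\big)\,dx\ \Big|\ u_i-\varphi_i\in H^1_0(\Omega),\ u_iu_j\equiv0\text{ in }\Omega\text{ for all }i\ne j\Big\},$$ the positivity set $\{u_i>0\}$ is connected for every $i$.
   Context: $N\ge2$, $\Omega\subset\mathbb{R}^N$ is a bounded smooth domain, $k\in\mathbb{N}$, $k\ge1$. The condition $u_i-\varphi_i\in H^1_0(\Omega)$ means that $u_i\in H^1(\Omega)$ has trace $\varphi_i$ on $\partial\Omega$. Minimizers are identified with their continuous representatives, and $\{u_i>0\}$ denotes the corresponding open subset of $\Omega$. *)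

theory Defs
  imports "HOL-Analysis.Analysis"
begin

section \<open>Smooth functions and smooth domains\<close>

primrec C_diff_on :: "nat \<Rightarrow> 'a::euclidean_space set \<Rightarrow> ('a \<Rightarrow> real) \<Rightarrow> bool" where
  "C_diff_on 0 S f \<longleftrightarrow> continuous_on S f"
| "C_diff_on (Suc m) S f \<longleftrightarrow> (\<forall>x\<in>S. f differentiable (at x)) \<and>
     (\<forall>v. C_diff_on m S (\<lambda>x. frechet_derivative f (at x) v))"

text \<open>Intended for open \<open>S\<close> only, since the derivatives are taken in the full space.\<close>

definition smooth_on :: "'a::euclidean_space set \<Rightarrow> ('a \<Rightarrow> real) \<Rightarrow> bool" where
  "smooth_on S f \<longleftrightarrow> (\<forall>m. C_diff_on m S f)"

text \<open>Near every boundary point the domain is the negativity set of a smooth function without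
  critical points. By the implicit function theorem this says that the boundary is locally a
  smooth graph with the domain on exactly one side of it.\<close>

definition smooth_domain :: "'a::euclidean_space set \<Rightarrow> bool" where
  "smooth_domain \<Omega> \<longleftrightarrow> open \<Omega> \<and> connected \<Omega> \<and> \<Omega> \<noteq> {} \<and>
     (\<forall>p\<in>frontier \<Omega>. \<exists>U \<rho>. open U \<and> p \<in> U \<and> smooth_on U \<rho> \<and>
        (\<forall>x\<in>U. frechet_derivative \<rho> (at x) \<noteq> (\<lambda>v. 0)) \<and>
        \<Omega> \<inter> U = {x\<in>U. \<rho> x < 0})"


section \<open>Sobolev spaces\<close>

text \<open>Elements of the function spaces are represented by functions on the whole space, of which
  only the values in \<open>\<Omega>\<close> matter. All notions in this section depend only on the almost
  everywhere equivalence class in \<open>\<Omega>\<close>.\<close>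

definition L2 :: "'a::euclidean_space set \<Rightarrow> ('a \<Rightarrow> 'b::euclidean_space) set" where
  "L2 \<Omega> = {f. f \<in> borel_measurable (lebesgue_on \<Omega>) \<and>
              integrable (lebesgue_on \<Omega>) (\<lambda>x. (norm (f x))\<^sup>2)}"

definition test_function :: "'a::euclidean_space set \<Rightarrow> ('a \<Rightarrow> real) \<Rightarrow> bool" where
  "test_function \<Omega> \<psi> \<longleftrightarrow> smooth_on UNIV \<psi> \<and>
     compact (closure {x. \<psi> x \<noteq> 0}) \<and> closure {x. \<psi> x \<noteq> 0} \<subseteq> \<Omega>"

definition is_weak_gradient :: "'a::euclidean_space set \<Rightarrow> ('a \<Rightarrow> real) \<Rightarrow> ('a \<Rightarrow> 'a) \<Rightarrow> bool" where
  "is_weak_gradient \<Omega> u g \<longleftrightarrow> (\<forall>\<psi>. test_function \<Omega> \<psi> \<longrightarrow> (\<forall>b\<in>Basis.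
     (LINT x|lebesgue_on \<Omega>. u x * frechet_derivative \<psi> (at x) b) =
     - (LINT x|lebesgue_on \<Omega>. (g x \<bullet> b) * \<psi> x)))"

definition H1 :: "'a::euclidean_space set \<Rightarrow> ('a \<Rightarrow> real) set" where
  "H1 \<Omega> = {u \<in> L2 \<Omega>. \<exists>g\<in>L2 \<Omega>. is_weak_gradient \<Omega> u g}"

text \<open>On \<open>H1 \<Omega>\<close> the weak gradient is unique up to null sets, so the choice is harmless under
  the integrals below.\<close>

definition weak_grad :: "'a::euclidean_space set \<Rightarrow> ('a \<Rightarrow> real) \<Rightarrow> 'a \<Rightarrow> 'a" where
  "weak_grad \<Omega> u = (SOME g. g \<in> L2 \<Omega> \<and> is_weak_gradient \<Omega> u g)"

definition H1_norm :: "'a::euclidean_space set \<Rightarrow> ('a \<Rightarrow> real) \<Rightarrow> real" where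
  "H1_norm \<Omega> u = sqrt ((LINT x|lebesgue_on \<Omega>. (u x)\<^sup>2) +
                        (LINT x|lebesgue_on \<Omega>. (norm (weak_grad \<Omega> u x))\<^sup>2))"

definition H10 :: "'a::euclidean_space set \<Rightarrow> ('a \<Rightarrow> real) set" where
  "H10 \<Omega> = {u \<in> H1 \<Omega>. \<forall>e>0. \<exists>\<psi>. test_function \<Omega> \<psi> \<and> H1_norm \<Omega> (\<lambda>x. u x - \<psi> x) < e}"

text \<open>\<open>u - \<phi> \<in> H10 \<Omega>\<close> for a function \<open>\<phi>\<close> given on the boundary only: \<open>\<phi>\<close> is identified with an
  extension \<open>\<Phi>\<close> that is in \<open>H1 \<Omega>\<close> and continuous up to the boundary, whose trace is therefore
  its restriction \<open>\<phi>\<close>, and \<open>H10 \<Omega>\<close> is the space of functions with zero trace. The condition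
  does not depend on the choice of \<open>\<Phi>\<close>, because a function in \<open>H1 \<Omega>\<close> that is continuous
  on \<open>closure \<Omega>\<close> and vanishes on the boundary belongs to \<open>H10 \<Omega>\<close>. If \<open>\<Omega>\<close> is bounded and \<open>\<phi>\<close>
  is Lipschitz, an extension exists (a Lipschitz one).\<close>

definition has_trace :: "'a::euclidean_space set \<Rightarrow> ('a \<Rightarrow> real) \<Rightarrow> ('a \<Rightarrow> real) \<Rightarrow> bool" where
  "has_trace \<Omega> u \<phi> \<longleftrightarrow> u \<in> H1 \<Omega> \<and>
     (\<exists>\<Phi>. \<Phi> \<in> H1 \<Omega> \<and> continuous_on (closure \<Omega>) \<Phi> \<and> (\<forall>x\<in>frontier \<Omega>. \<Phi> x = \<phi> x) \<and>
          (\<lambda>x. u x - \<Phi> x) \<in> H10 \<Omega>)"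


section \<open>The segregated minimization problem\<close>

definition energy ::
  "'a::euclidean_space set \<Rightarrow> nat \<Rightarrow> (nat \<Rightarrow> real) \<Rightarrow> (nat \<Rightarrow> 'a \<Rightarrow> real) \<Rightarrow> real" where
  "energy \<Omega> k lam u =
     (\<Sum>i=1..k. LINT x|lebesgue_on \<Omega>. (norm (weak_grad \<Omega> (u i) x))\<^sup>2 - 2 * lam i * u i x)"

definition admissible ::
  "'a::euclidean_space set \<Rightarrow> nat \<Rightarrow> (nat \<Rightarrow> 'a \<Rightarrow> real) \<Rightarrow> (nat \<Rightarrow> 'a \<Rightarrow> real) \<Rightarrow> bool" where
  "admissible \<Omega> k \<phi> u \<longleftrightarrow> (\<forall>i\<in>{1..k}. has_trace \<Omega> (u i) (\<phi> i)) \<and>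
     (\<forall>i\<in>{1..k}. \<forall>j\<in>{1..k}. i \<noteq> j \<longrightarrow> (AE x in lebesgue_on \<Omega>. u i x * u j x = 0))"

definition is_minimizer ::
  "'a::euclidean_space set \<Rightarrow> nat \<Rightarrow> (nat \<Rightarrow> real) \<Rightarrow> (nat \<Rightarrow> 'a \<Rightarrow> real) \<Rightarrow>
   (nat \<Rightarrow> 'a \<Rightarrow> real) \<Rightarrow> bool" where
  "is_minimizer \<Omega> k lam \<phi> u \<longleftrightarrow> admissible \<Omega> k \<phi> u \<and>
     (\<forall>v. admissible \<Omega> k \<phi> v \<longrightarrow> energy \<Omega> k lam u \<le> energy \<Omega> k lam v)"

end

theory Submission
  imports Defs "HOL-Computational_Algebra.Polynomial"
begin

text \<open>Suppose \<open>{u\<^sub>i > 0}\<close> is the disjoint union of nonempty open sets \<open>A\<close> and \<open>B\<close>. By comparison with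
  Gaussians of exterior balls, \<open>u\<^sub>i\<close> is positive near the points with \<open>\<phi>\<^sub>i > 0\<close>. As the domain lies
  on one side of its boundary, each such point sees only one of \<open>A\<close> and \<open>B\<close>, and by connectedness
  of \<open>{\<phi>\<^sub>i > 0}\<close> all of them see the same one, say \<open>A\<close>. So \<open>w = u\<^sub>i 1\<^sub>B\<close> has zero trace. Since the
  \<open>\<lambda>\<^sub>i\<close> are equal, \<open>w\<close> can be made a phase of its own or be added to any phase at no change of
  energy, and all these configurations minimize. Let \<open>u\<^sub>j\<close> now be the phases with \<open>w\<close> taken out,
  and \<open>V\<close> their sum. Minimality makes \<open>w - V\<close> and each \<open>w + 2 u\<^sub>j - V\<close> supersolutions and each
  \<open>u\<^sub>j\<close> a subsolution, up to the constant \<open>\<lambda>\<close>, and \<open>- \<Delta> w \<ge> \<lambda>\<close> in \<open>B\<close>.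

  At an interface point with an interior ball, \<open>w\<close> grows at least linearly, so \<open>w - V\<close> forces
  some \<open>u\<^sub>j\<close> to grow linearly on the other side. Where the slope of \<open>u\<^sub>j\<close> is almost maximal,
  \<open>w\<close> and \<open>u\<^sub>j\<close> are the only phases that matter, and \<open>w + 2 u\<^sub>j - V\<close>, close to \<open>w + u\<^sub>j\<close>, has a convex
  kink, which a supersolution cannot have. Hence \<open>B\<close> has no boundary point in the domain, which is
  connected: a contradiction. All differential inequalities are used only as mean value
  inequalities for the mollifiers, so no further regularity of the minimizer is needed.\<close>

section \<open>Smooth functions\<close>

text \<open>What shapes the argument is that the minimizer is only known to be continuous: there is
  no Lipschitz bound and no structure theory of interfaces, hence no blow-up. Its place is taken by
  a quantitative argument at one point where a ball inside {w > 0} touches the zero set of w. All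
  supersolutions come from one source: for any segregated minimizer, twice a phase minus the sum of
  all phases satisfies -\<Delta> f \<ge> -\<lambda>. With w as a separate phase this function is w -
  V; with w merged into phase j it is
  \<open>2 (u\<^sub>j + w) - (V + w) = w + 2 u\<^sub>j - V\<close>. The first makes the slopes on
  the two sides of an interface balance, the second forbids them to have the same sign of
  reflection, and no positive slope satisfies both. Equal multipliers are what makes both
  configurations minimal at once: moving w between phases leaves the linear term unchanged. A normal
  derivative of \<open>u\<^sub>j\<close> need not exist at the touching point. It is replaced by the
  infimum of all upper slopes there, and by a nearby point at which this bound is almost
  attained.\<close>

lemma frechet_derivative_eqI:
  "(f has_derivative D) (at x) \<Longrightarrow> frechet_derivative f (at x) = D"
  by (simp add: frechet_derivative_at[symmetric])

lemma C_diff_on_cong: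
  assumes "open S" "\<And>x. x \<in> S \<Longrightarrow> f x = g x" "C_diff_on m S f"
  shows "C_diff_on m S g"
  using assms(2,3)
proof (induction m arbitrary: f g)
  case 0
  then show ?case by (metis C_diff_on.simps(1) continuous_on_cong)
next
  case (Suc m)
  have D: "(g has_derivative frechet_derivative f (at x)) (at x)" if "x \<in> S" for x
  proof -
    have "(f has_derivative frechet_derivative f (at x)) (at x)"
      using Suc.prems that frechet_derivative_works by auto
    then show ?thesis
      using has_derivative_transform_within_open[OF _ \<open>open S\<close> that] Suc.prems(1) by blast
  qed
  have "C_diff_on m S (\<lambda>x. frechet_derivative g (at x) v)" for v
  proof (rule Suc.IH)
    show "C_diff_on m S (\<lambda>x. frechet_derivative f (at x) v)" using Suc.prems by simp
    show "frechet_derivative f (at x) v = frechet_derivative g (at x) v" if "x \<in> S" for x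
      using frechet_derivative_eqI[OF D[OF that]] by simp
  qed
  then show ?case using D by (auto simp: differentiable_def)
qed

text \<open>\<open>frechet_derivative\<close> is a pointwise choice, awkward to iterate; with this
  rule any explicit formula for the derivative can stand in for it.\<close>

lemma C_diff_on_SucI:
  assumes "open S" "\<And>x. x \<in> S \<Longrightarrow> (f has_derivative f' x) (at x)"
    "\<And>v. C_diff_on m S (\<lambda>x. f' x v)"
  shows "C_diff_on (Suc m) S f"
proof -
  have "C_diff_on m S (\<lambda>x. frechet_derivative f (at x) v)" for v
    by (rule C_diff_on_cong[OF assms(1) _ assms(3)[of v]])
      (use assms(2) frechet_derivative_eqI in metis)
  then show ?thesis using assms(2) by (auto simp: differentiable_def)
qed

lemma C_diff_on_Suc_imp_continuous: "C_diff_on (Suc m) S f \<Longrightarrow> continuous_on S f"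
  by (simp add: continuous_at_imp_continuous_on differentiable_imp_continuous_within)

lemma C_diff_on_SucD: "C_diff_on (Suc m) S f \<Longrightarrow> C_diff_on m S f"
proof (induction m arbitrary: f)
  case 0
  then show ?case using C_diff_on_Suc_imp_continuous C_diff_on.simps(1) by blast
qed simp

lemma C_diff_on_has_derivative:
  "C_diff_on (Suc m) S f \<Longrightarrow> x \<in> S \<Longrightarrow> (f has_derivative frechet_derivative f (at x)) (at x)"
  using frechet_derivative_works by auto

lemma C_diff_on_const: "open S \<Longrightarrow> C_diff_on m S (\<lambda>x. c)"
proof (induction m arbitrary: c)
  case (Suc m)
  show ?case by (rule C_diff_on_SucI[where f'="\<lambda>x v. 0"]) (use Suc in auto)
qed auto

lemma C_diff_on_add:
  "open S \<Longrightarrow> C_diff_on m S f \<Longrightarrow> C_diff_on m S g \<Longrightarrow> C_diff_on m S (\<lambda>x. f x + g x)"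
proof (induction m arbitrary: f g)
  case (Suc m)
  show ?case
    by (rule C_diff_on_SucI[where
          f'="\<lambda>x v. frechet_derivative f (at x) v + frechet_derivative g (at x) v"])
      (use Suc in \<open>auto intro!: has_derivative_add C_diff_on_has_derivative simp del: C_diff_on.simps(2)\<close>,
       use Suc in simp)
qed (auto intro: continuous_intros)

lemma C_diff_on_mult:
  "open S \<Longrightarrow> C_diff_on m S f \<Longrightarrow> C_diff_on m S g \<Longrightarrow> C_diff_on m S (\<lambda>x. f x * g x)"
proof (induction m arbitrary: f g)
  case (Suc m)
  have "C_diff_on m S f" "C_diff_on m S g" using Suc C_diff_on_SucD by blast+
  show ?case
  proof (rule C_diff_on_SucI[where
          f'="\<lambda>x v. f x * frechet_derivative g (at x) v + frechet_derivative f (at x) v * g x"])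
    show "((\<lambda>x. f x * g x) has_derivative
      (\<lambda>v. f x * frechet_derivative g (at x) v + frechet_derivative f (at x) v * g x)) (at x)"
      if "x \<in> S" for x
      using C_diff_on_has_derivative[OF Suc.prems(2) that] C_diff_on_has_derivative[OF Suc.prems(3) that]
      by (rule has_derivative_mult)
    show "C_diff_on m S (\<lambda>x. f x * frechet_derivative g (at x) v + frechet_derivative f (at x) v * g x)" for v
      using Suc \<open>C_diff_on m S f\<close> \<open>C_diff_on m S g\<close> by (intro C_diff_on_add Suc.IH) auto
  qed fact
qed (auto intro: continuous_intros)

text \<open>The outer function comes with the sequence of all its derivatives: the derivative of
  \<open>F n\<close> after \<open>f\<close> involves \<open>F (Suc n)\<close>, so the induction on
  the order needs the claim for every \<open>n\<close> at once. Instances are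
  \<open>bump_deriv\<close> and the constant sequence \<open>exp\<close>.\<close>

lemma C_diff_on_compose_real:
  fixes F :: "nat \<Rightarrow> real \<Rightarrow> real"
  assumes "open S" "\<And>n t. (F n has_real_derivative F (Suc n) t) (at t)"
  shows "C_diff_on m S f \<Longrightarrow> C_diff_on m S (\<lambda>x. F n (f x))"
proof (induction m arbitrary: n)
  case 0
  have "isCont (F n) t" for t using assms(2) DERIV_isCont by blast
  then show ?case using 0
    by (simp, intro continuous_on_compose2[of UNIV "F n" S f]) (auto intro: continuous_at_imp_continuous_on)
next
  case (Suc m)
  show ?case
  proof (rule C_diff_on_SucI[where f'="\<lambda>x v. F (Suc n) (f x) * frechet_derivative f (at x) v"])
    show "((\<lambda>x. F n (f x)) has_derivative (\<lambda>v. F (Suc n) (f x) * frechet_derivative f (at x) v)) (at x)"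
      if "x \<in> S" for x
      using has_derivative_compose[OF C_diff_on_has_derivative[OF Suc.prems that],
        of "F n" "(*) (F (Suc n) (f x))"] assms(2)[of n "f x"]
      by (simp add: has_field_derivative_def)
    show "C_diff_on m S (\<lambda>x. F (Suc n) (f x) * frechet_derivative f (at x) v)" for v
      using Suc C_diff_on_SucD by (intro C_diff_on_mult) (auto intro: assms)
  qed fact
qed

lemma C_diff_on_linear:
  fixes f :: "'a::euclidean_space \<Rightarrow> real"
  assumes "open S" "bounded_linear f"
  shows "C_diff_on m S f"
proof (cases m)
  case 0
  then show ?thesis using assms linear_continuous_on by auto
next
  case (Suc n)
  show ?thesis unfolding Suc
    by (rule C_diff_on_SucI[where f'="\<lambda>x. f"])
      (use assms bounded_linear_imp_has_derivative C_diff_on_const in auto)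
qed

lemma C_diff_on_sum:
  "open S \<Longrightarrow> (\<And>i. i \<in> I \<Longrightarrow> C_diff_on m S (f i)) \<Longrightarrow> C_diff_on m S (\<lambda>x. \<Sum>i\<in>I. f i x)"
  by (induction I rule: infinite_finite_induct) (auto intro: C_diff_on_const C_diff_on_add)

lemma smooth_on_const: "open S \<Longrightarrow> smooth_on S (\<lambda>x. c)"
  and smooth_on_add: "open S \<Longrightarrow> smooth_on S f \<Longrightarrow> smooth_on S g \<Longrightarrow> smooth_on S (\<lambda>x. f x + g x)"
  and smooth_on_mult: "open S \<Longrightarrow> smooth_on S f \<Longrightarrow> smooth_on S g \<Longrightarrow> smooth_on S (\<lambda>x. f x * g x)"
  and smooth_on_linear: "open S \<Longrightarrow> bounded_linear f \<Longrightarrow> smooth_on S f"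
  by (simp_all add: smooth_on_def C_diff_on_const C_diff_on_add C_diff_on_mult C_diff_on_linear)

lemma smooth_on_sum:
  "open S \<Longrightarrow> (\<And>i. i \<in> I \<Longrightarrow> smooth_on S (f i)) \<Longrightarrow> smooth_on S (\<lambda>x. \<Sum>i\<in>I. f i x)"
  by (simp add: smooth_on_def C_diff_on_sum)

lemma smooth_on_compose_real:
  fixes F :: "nat \<Rightarrow> real \<Rightarrow> real"
  assumes "open S" "\<And>n t. (F n has_real_derivative F (Suc n) t) (at t)" "smooth_on S f"
  shows "smooth_on S (\<lambda>x. F n (f x))"
  using assms C_diff_on_compose_real[of S F] by (simp add: smooth_on_def)

lemma smooth_on_has_derivative:
  "smooth_on S f \<Longrightarrow> x \<in> S \<Longrightarrow> (f has_derivative frechet_derivative f (at x)) (at x)"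
  unfolding smooth_on_def using C_diff_on_has_derivative by blast

lemma smooth_on_frechet_derivative:
  "smooth_on S f \<Longrightarrow> smooth_on S (\<lambda>x. frechet_derivative f (at x) v)"
  unfolding smooth_on_def using C_diff_on.simps(2) by blast

lemma smooth_on_imp_continuous_on: "smooth_on S f \<Longrightarrow> continuous_on S f"
  unfolding smooth_on_def using C_diff_on.simps(1) by blast

lemma smooth_on_cong:
  "open S \<Longrightarrow> (\<And>x. x \<in> S \<Longrightarrow> f x = g x) \<Longrightarrow> smooth_on S f \<Longrightarrow> smooth_on S g"
  unfolding smooth_on_def using C_diff_on_cong by blast

lemma smooth_on_minus: "open S \<Longrightarrow> smooth_on S f \<Longrightarrow> smooth_on S (\<lambda>x. - f x)"
  using smooth_on_mult[OF _ smooth_on_const, of S "f" "-1"] by simp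

lemma smooth_on_diff:
  "open S \<Longrightarrow> smooth_on S f \<Longrightarrow> smooth_on S g \<Longrightarrow> smooth_on S (\<lambda>x. f x - g x)"
  using smooth_on_add[OF _ _ smooth_on_minus, of S f g] by simp

lemma smooth_on_power2_norm_diff:
  fixes c :: "'a::euclidean_space"
  assumes "open S" shows "smooth_on S (\<lambda>x. (norm (x - c))\<^sup>2)"
proof -
  have "smooth_on S (\<lambda>x. \<Sum>b\<in>Basis. (x \<bullet> b + - (c \<bullet> b)) * (x \<bullet> b + - (c \<bullet> b)))"
    by (intro smooth_on_sum smooth_on_mult smooth_on_add smooth_on_const assms smooth_on_linear
        bounded_linear_inner_left)
  moreover have "(\<Sum>b\<in>Basis. (x \<bullet> b + - (c \<bullet> b)) * (x \<bullet> b + - (c \<bullet> b))) = (norm (x - c))\<^sup>2" for x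
    unfolding power2_norm_eq_inner by (subst (3) euclidean_inner) (simp add: inner_diff_left)
  ultimately show ?thesis by simp
qed

section \<open>The flat function exp (-1/t) and its derivatives\<close>

text \<open>For t > 0 the derivative of p(1/t) exp (-1/t) is q(1/t) exp (-1/t) with q(s) = s^2 (p(s)
  - p'(s)); this recursion makes \<open>bump_deriv n\<close> the n-th derivative of
  \<open>bump_deriv 0\<close>.\<close>

definition bump_coeff :: "nat \<Rightarrow> real poly" where
  "bump_coeff n = ((\<lambda>p. [:0,0,1:] * (p - pderiv p)) ^^ n) [:1:]"

definition bump_deriv :: "nat \<Rightarrow> real \<Rightarrow> real" where
  "bump_deriv n t = (if t > 0 then poly (bump_coeff n) (1/t) * exp (- (1/t)) else 0)"

lemma poly_over_exp_tendsto_0: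
  fixes p :: "real poly"
  shows "((\<lambda>t. poly p (1/t) * exp (- (1/t))) \<longlongrightarrow> 0) (at_right 0)"
proof -
  have "((\<lambda>s. poly p s * exp (- s)) \<longlongrightarrow> 0) at_top"
  proof -
    have "((\<lambda>s::real. \<Sum>i\<le>degree p. coeff p i * (s ^ i / exp s)) \<longlongrightarrow> (\<Sum>i\<le>degree p. coeff p i * 0)) at_top"
      by (intro tendsto_intros tendsto_power_div_exp_0)
    moreover have "(\<Sum>i\<le>degree p. coeff p i * (s ^ i / exp s)) = poly p s * exp (- s)" for s
      by (simp add: poly_altdef sum_distrib_right exp_minus divide_inverse mult.assoc)
    ultimately show ?thesis by simp
  qed
  moreover have "filterlim (\<lambda>t::real. 1/t) at_top (at_right 0)"
    using filterlim_inverse_at_top_right by (simp add: inverse_eq_divide)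
  ultimately show ?thesis by (rule filterlim_compose)
qed

lemma bump_deriv_DERIV: "(bump_deriv n has_real_derivative bump_deriv (Suc n) t) (at t)"
proof -
  consider "t > 0" | "t < 0" | "t = 0" by linarith
  then show ?thesis
  proof cases
    case 1
    have "((\<lambda>t. poly (bump_coeff n) (1/t) * exp (- (1/t))) has_real_derivative bump_deriv (Suc n) t) (at t)"
      using 1
      by (auto intro!: derivative_eq_intros DERIV_chain2[OF poly_DERIV] simp: bump_deriv_def bump_coeff_def
          field_simps power2_eq_square)
    then show ?thesis
      by (rule has_field_derivative_transform_within_open[where S="{0<..}"])
        (use 1 in \<open>auto simp: bump_deriv_def\<close>)
  next
    case 2
    have "((\<lambda>t. 0) has_real_derivative bump_deriv (Suc n) t) (at t)"
      using 2 by (simp add: bump_deriv_def)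
    then show ?thesis
      by (rule has_field_derivative_transform_within_open[where S="{..<0}"])
        (use 2 in \<open>auto simp: bump_deriv_def\<close>)
  next
    case 3
    have "((\<lambda>h. (bump_deriv n (0 + h) - bump_deriv n 0) / h) \<longlongrightarrow> 0) (at 0)"
    proof (rule filterlim_split_at)
      show "((\<lambda>h. (bump_deriv n (0 + h) - bump_deriv n 0) / h) \<longlongrightarrow> 0) (at_left 0)"
        by (rule tendsto_eventually) (auto simp: eventually_at_filter bump_deriv_def)
      \<comment> \<open>The difference quotient at 0 has the same form again, with the polynomial
        multiplied by X.\<close>
      show "((\<lambda>h. (bump_deriv n (0 + h) - bump_deriv n 0) / h) \<longlongrightarrow> 0) (at_right 0)"
        by (rule Lim_transform_eventually[OF poly_over_exp_tendsto_0[of "[:0,1:] * bump_coeff n"]])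
          (auto simp: eventually_at_filter bump_deriv_def)
    qed
    then show ?thesis using 3 by (subst DERIV_def) (simp add: bump_deriv_def)
  qed
qed

lemma bump_deriv_0: "bump_deriv 0 t = (if t > 0 then exp (- (1/t)) else 0)"
  and bump_deriv_1: "bump_deriv 1 t = (if t > 0 then exp (- (1/t)) / t\<^sup>2 else 0)"
  by (auto simp: bump_deriv_def bump_coeff_def power2_eq_square)

definition grad :: "('a::euclidean_space \<Rightarrow> real) \<Rightarrow> 'a \<Rightarrow> 'a" where
  "grad f x = (\<Sum>b\<in>Basis. frechet_derivative f (at x) b *\<^sub>R b)"

definition laplacian :: "('a::euclidean_space \<Rightarrow> real) \<Rightarrow> 'a \<Rightarrow> real" where
  "laplacian f x = (\<Sum>b\<in>Basis. frechet_derivative (\<lambda>y. frechet_derivative f (at y) b) (at x) b)"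

lemma grad_inner_Basis: "b \<in> Basis \<Longrightarrow> grad f x \<bullet> b = frechet_derivative f (at x) b"
  by (simp add: grad_def inner_sum_left inner_Basis if_distrib cong: if_cong)

lemma has_derivative_grad:
  assumes "(f has_derivative D) (at x)"
  shows "D v = grad f x \<bullet> v"
proof -
  have "D v = D (\<Sum>b\<in>Basis. (v \<bullet> b) *\<^sub>R b)" by (simp add: euclidean_representation)
  also have "\<dots> = (\<Sum>b\<in>Basis. (v \<bullet> b) * D b)"
    using has_derivative_linear[OF assms] by (simp add: linear_sum linear_cmul)
  also have "\<dots> = grad f x \<bullet> v"
    using frechet_derivative_eqI[OF assms]
    by (subst (2) euclidean_inner) (simp add: grad_inner_Basis mult.commute)
  finally show ?thesis .
qed

lemma grad_eqI: "(f has_derivative (\<lambda>v. w \<bullet> v)) (at x) \<Longrightarrow> grad f x = w"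
  by (metis has_derivative_grad inner_commute vector_eq_ldot)

section \<open>Test functions and convolution\<close>

lemma test_functionI:
  assumes "smooth_on UNIV \<psi>" "compact K" "K \<subseteq> \<Omega>" "\<And>x. x \<notin> K \<Longrightarrow> \<psi> x = 0"
  shows "test_function \<Omega> \<psi>"
proof -
  have "closure {x. \<psi> x \<noteq> 0} \<subseteq> K"
    using assms by (intro closure_minimal) (auto intro: compact_imp_closed)
  then show ?thesis
    using assms compact_Int_closed[OF assms(2) closed_closure, of "{x. \<psi> x \<noteq> 0}"]
    by (auto simp: test_function_def Int_absorb1)
qed

lemma test_functionE:
  assumes "test_function \<Omega> \<psi>"
  obtains K where "compact K" "K \<subseteq> \<Omega>" "\<And>x. x \<notin> K \<Longrightarrow> \<psi> x = 0"
proof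
  show "compact (closure {x. \<psi> x \<noteq> 0})" "closure {x. \<psi> x \<noteq> 0} \<subseteq> \<Omega>"
    using assms by (auto simp: test_function_def)
  show "\<psi> x = 0" if "x \<notin> closure {x. \<psi> x \<noteq> 0}" for x
    using that closure_subset[of "{x. \<psi> x \<noteq> 0}"] by auto
qed

lemma test_function_smooth: "test_function \<Omega> \<psi> \<Longrightarrow> smooth_on UNIV \<psi>"
  by (simp add: test_function_def)

lemma frechet_derivative_eq_0_outside:
  assumes "closed K" "\<And>x. x \<notin> K \<Longrightarrow> f x = 0" "x \<notin> K"
  shows "frechet_derivative f (at x) = (\<lambda>v. 0)"
proof (rule frechet_derivative_eqI)
  have "open (- K)" "x \<in> - K" using assms by auto
  then show "(f has_derivative (\<lambda>v. 0)) (at x)"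
    by (rule has_derivative_transform_within_open[OF has_derivative_const]) (use assms in auto)
qed

lemma grad_eq_0_outside:
  assumes "closed K" "\<And>x. x \<notin> K \<Longrightarrow> f x = 0" "x \<notin> K"
  shows "grad f x = 0"
  using frechet_derivative_eq_0_outside[OF assms] by (simp add: grad_def)

lemma test_function_frechet_derivative:
  assumes "test_function \<Omega> \<psi>"
  shows "test_function \<Omega> (\<lambda>x. frechet_derivative \<psi> (at x) v)"
proof -
  obtain K where K: "compact K" "K \<subseteq> \<Omega>" "\<And>x. x \<notin> K \<Longrightarrow> \<psi> x = 0"
    by (rule test_functionE[OF assms]) blast
  show ?thesis
  proof (rule test_functionI[OF _ K(1,2)])
    show "smooth_on UNIV (\<lambda>x. frechet_derivative \<psi> (at x) v)"
      using assms by (intro smooth_on_frechet_derivative test_function_smooth)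
    show "frechet_derivative \<psi> (at x) v = 0" if "x \<notin> K" for x
      using frechet_derivative_eq_0_outside[OF compact_imp_closed[OF K(1)] K(3) that] by simp
  qed
qed

lemma test_function_mult_smooth:
  assumes "test_function \<Omega> \<psi>" "smooth_on UNIV f"
  shows "test_function \<Omega> (\<lambda>x. \<psi> x * f x)"
proof -
  obtain K where K: "compact K" "K \<subseteq> \<Omega>" "\<And>x. x \<notin> K \<Longrightarrow> \<psi> x = 0"
    by (rule test_functionE[OF assms(1)]) blast
  show ?thesis
    by (rule test_functionI[OF _ K(1,2)])
      (use assms K in \<open>auto intro: smooth_on_mult test_function_smooth\<close>)
qed

lemma test_function_cmult: "test_function \<Omega> \<psi> \<Longrightarrow> test_function \<Omega> (\<lambda>x. c * \<psi> x)"
  using test_function_mult_smooth[OF _ smooth_on_const[of UNIV c]] by (simp add: mult.commute)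

lemma test_function_0: "test_function \<Omega> (\<lambda>x. 0)"
  by (rule test_functionI[of _ "{}"]) (auto intro: smooth_on_const)

lemma test_function_add:
  assumes "test_function \<Omega> f" "test_function \<Omega> g"
  shows "test_function \<Omega> (\<lambda>x. f x + g x)"
proof -
  obtain K where K: "compact K" "K \<subseteq> \<Omega>" "\<And>x. x \<notin> K \<Longrightarrow> f x = 0"
    by (rule test_functionE[OF assms(1)]) blast
  obtain L where L: "compact L" "L \<subseteq> \<Omega>" "\<And>x. x \<notin> L \<Longrightarrow> g x = 0"
    by (rule test_functionE[OF assms(2)]) blast
  show ?thesis
    by (rule test_functionI[of _ "K \<union> L"])
      (use assms K L in \<open>auto intro: smooth_on_add test_function_smooth\<close>)
qed

lemma test_function_mono: "test_function A f \<Longrightarrow> A \<subseteq> B \<Longrightarrow> test_function B f"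
  by (auto simp: test_function_def)

lemma test_function_continuous: "test_function A f \<Longrightarrow> continuous_on UNIV f"
  by (simp add: smooth_on_imp_continuous_on test_function_smooth)

lemma test_function_has_derivative:
  "test_function A f \<Longrightarrow> (f has_derivative frechet_derivative f (at x)) (at x)"
  using smooth_on_has_derivative[OF test_function_smooth] by blast

lemma test_function_has_derivative_grad:
  "test_function A f \<Longrightarrow> (f has_derivative (\<lambda>v. grad f x \<bullet> v)) (at x)"
  using test_function_has_derivative[of A f x] has_derivative_grad[of f _ x]
  by (metis (no_types, lifting) ext)

lemma smooth_on_continuous_grad:
  assumes "smooth_on S f" shows "continuous_on S (grad f)"
  unfolding grad_def
  using smooth_on_imp_continuous_on[OF smooth_on_frechet_derivative[OF assms]]
  by (intro continuous_intros) auto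

lemma test_function_continuous_grad: "test_function A f \<Longrightarrow> continuous_on UNIV (grad f)"
  by (simp add: smooth_on_continuous_grad test_function_smooth)

lemma compact_support_uniformly_continuous:
  fixes f :: "'a::euclidean_space \<Rightarrow> 'b::real_normed_vector"
  assumes "continuous_on UNIV f" "compact K" "\<And>x. x \<notin> K \<Longrightarrow> f x = 0"
  shows "uniformly_continuous_on UNIV f"
  unfolding uniformly_continuous_on_def
proof (intro allI impI)
  fix e :: real assume "e > 0"
  define L where "L = {x + y |x y. x \<in> K \<and> y \<in> cball 0 1}"
  have "compact L" unfolding L_def using compact_sums[OF assms(2) compact_cball] .
  then have "uniformly_continuous_on L f"
    by (intro compact_uniformly_continuous continuous_on_subset[OF assms(1)]) auto
  then obtain d where d: "d > 0" "\<And>x y. x \<in> L \<Longrightarrow> y \<in> L \<Longrightarrow> dist y x < d \<Longrightarrow> dist (f y) (f x) < e"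
    using \<open>e > 0\<close> unfolding uniformly_continuous_on_def by metis
  have inK: "y \<in> L" if "x \<in> K" "dist x y \<le> 1" for x y
  proof -
    have "y = x + (y - x)" "y - x \<in> cball 0 1"
      using that by (auto simp: dist_norm norm_minus_commute)
    then show ?thesis using that(1) unfolding L_def by blast
  qed
  show "\<exists>d>0. \<forall>x\<in>UNIV. \<forall>y\<in>UNIV. dist y x < d \<longrightarrow> dist (f y) (f x) < e"
  proof (intro exI[of _ "min d 1"] conjI ballI impI)
    fix x y :: 'a assume *: "dist y x < min d 1"
    show "dist (f y) (f x) < e"
    proof (cases "x \<in> K \<or> y \<in> K")
      case True
      then have "x \<in> L" "y \<in> L" using inK[of x x] inK[of y y] inK[of x y] inK[of y x] *
        by (auto simp: dist_commute)
      then show ?thesis using d * by auto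
    next
      case False
      then show ?thesis using assms(3) \<open>e > 0\<close> by auto
    qed
  qed (use d in auto)
qed

lemma compact_support_bounded:
  fixes f :: "'a::euclidean_space \<Rightarrow> 'b::real_normed_vector"
  assumes "continuous_on UNIV f" "compact K" "\<And>x. x \<notin> K \<Longrightarrow> f x = 0"
  obtains B where "\<And>x. norm (f x) \<le> B" "B > 0"
proof -
  have "bounded (f ` K)"
    using compact_continuous_image[OF continuous_on_subset[OF assms(1)] assms(2)] compact_imp_bounded by simp
  then obtain B where "\<And>x. x \<in> K \<Longrightarrow> norm (f x) \<le> B" "B > 0"
    unfolding bounded_pos by auto
  then show ?thesis using that[of B] assms(3) by (metis less_imp_le norm_zero)
qed

lemma test_function_bounded:
  assumes "test_function A f"
  obtains B where "\<And>x. \<bar>f x\<bar> \<le> B" "B > 0"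
  using test_functionE[OF assms] compact_support_bounded[OF test_function_continuous[OF assms]]
  by (metis real_norm_def)

lemma test_function_grad_bounded:
  assumes "test_function A f"
  obtains B where "\<And>x. norm (grad f x) \<le> B" "B > 0"
proof -
  obtain K where K: "compact K" "K \<subseteq> A" "\<And>x. x \<notin> K \<Longrightarrow> f x = 0"
    by (rule test_functionE[OF assms]) blast
  have "grad f x = 0" if "x \<notin> K" for x
    using grad_eq_0_outside[OF compact_imp_closed[OF K(1)] K(3) that] .
  then show ?thesis
    using compact_support_bounded[OF test_function_continuous_grad[OF assms] K(1)] that by blast
qed

lemma compact_support_integrable:
  fixes f :: "'a::euclidean_space \<Rightarrow> real"
  assumes "continuous_on UNIV f" "compact K" "\<And>x. x \<notin> K \<Longrightarrow> f x = 0"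
  shows "integrable lborel f"
proof -
  have "integrable lborel (\<lambda>x. indicator K x *\<^sub>R f x)"
    by (rule borel_integrable_compact) (use assms continuous_on_subset[OF assms(1)] in auto)
  moreover have "(\<lambda>x. indicator K x *\<^sub>R f x) = f" using assms(3) by (auto simp: indicator_def fun_eq_iff)
  ultimately show ?thesis by simp
qed

lemma test_function_integrable: "test_function A f \<Longrightarrow> integrable lborel f"
  using compact_support_integrable test_function_continuous test_functionE by metis

section \<open>Convolution with a test function\<close>

definition conv :: "('a::euclidean_space \<Rightarrow> real) \<Rightarrow> ('a \<Rightarrow> real) \<Rightarrow> 'a \<Rightarrow> real" where
  "conv f \<psi> x = (LINT y|lborel. f y * \<psi> (x - y))"

lemma integrable_mult_bounded:
  fixes f g :: "'a \<Rightarrow> real"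
  assumes "integrable M f" "g \<in> borel_measurable M" "\<And>x. \<bar>g x\<bar> \<le> B"
  shows "integrable M (\<lambda>x. f x * g x)"
proof (rule Bochner_Integration.integrable_bound[where f="\<lambda>x. B * f x"])
  show "AE x in M. norm (f x * g x) \<le> norm (B * f x)"
  proof (intro AE_I2)
    fix x
    have "0 \<le> B" using assms(3)[of x] by linarith
    have "\<bar>f x\<bar> * \<bar>g x\<bar> \<le> \<bar>f x\<bar> * B" using assms(3) by (intro mult_left_mono) auto
    then show "norm (f x * g x) \<le> norm (B * f x)" using \<open>0 \<le> B\<close> by (simp add: abs_mult mult.commute)
  qed
qed (use assms in auto)

lemma test_function_shift_measurable [measurable]:
  "test_function A \<psi> \<Longrightarrow> (\<lambda>y. \<psi> (x - y)) \<in> borel_measurable borel"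
  by (intro borel_measurable_continuous_onI continuous_on_compose2[OF test_function_continuous, of A \<psi>])
    (auto intro!: continuous_intros)

lemma conv_integrable:
  assumes "integrable lborel f" "test_function A \<psi>"
  shows "integrable lborel (\<lambda>y. f y * \<psi> (x - y))"
proof -
  obtain B where "\<And>x. \<bar>\<psi> x\<bar> \<le> B" using test_function_bounded[OF assms(2)] by metis
  then show ?thesis
    using test_function_shift_measurable[OF assms(2)]
    by (intro integrable_mult_bounded[where B=B] assms(1)) auto
qed

text \<open>No integrability of \<open>f\<close> is required: if it fails, the integral is 0 by
  convention and the bound holds because \<open>g\<close> is nonnegative.\<close>

lemma abs_integral_le:
  fixes f :: "'a \<Rightarrow> real"
  assumes "integrable M g" "\<And>x. \<bar>f x\<bar> \<le> g x"
  shows "\<bar>integral\<^sup>L M f\<bar> \<le> integral\<^sup>L M g"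
proof (cases "integrable M f")
  case True
  have "\<bar>integral\<^sup>L M f\<bar> \<le> (LINT x|M. \<bar>f x\<bar>)" by simp
  also have "\<dots> \<le> integral\<^sup>L M g" using assms True by (intro integral_mono) auto
  finally show ?thesis .
next
  case False
  have "0 \<le> integral\<^sup>L M g" using assms(2) by (intro Bochner_Integration.integral_nonneg) (meson abs_ge_zero order_trans)
  then show ?thesis using False by (simp add: not_integrable_integral_eq)
qed

lemma conv_continuous:
  assumes f: "integrable lborel f" and \<psi>: "test_function A \<psi>"
  shows "continuous_on UNIV (conv f \<psi>)"
  unfolding continuous_on_iff
proof (intro ballI allI impI)
  fix x :: 'a and e :: real assume "e > 0"
  let ?I = "LINT y|lborel. \<bar>f y\<bar>"
  have "?I \<ge> 0" by simp
  obtain K where K: "compact K" "\<And>x. x \<notin> K \<Longrightarrow> \<psi> x = 0" using test_functionE[OF \<psi>] by metis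
  have "uniformly_continuous_on UNIV \<psi>"
    using compact_support_uniformly_continuous[OF test_function_continuous[OF \<psi>] K] .
  moreover have "e / (?I + 1) > 0" using \<open>e > 0\<close> \<open>?I \<ge> 0\<close> by (intro divide_pos_pos) linarith+
  ultimately obtain d where d: "d > 0" "\<And>x y. dist y x < d \<Longrightarrow> dist (\<psi> y) (\<psi> x) < e / (?I + 1)"
    unfolding uniformly_continuous_on_def by (metis UNIV_I)
  show "\<exists>d>0. \<forall>x'\<in>UNIV. dist x' x < d \<longrightarrow> dist (conv f \<psi> x') (conv f \<psi> x) < e"
  proof (intro exI conjI ballI impI)
    fix x' assume x': "dist x' x < d"
    have "conv f \<psi> x' - conv f \<psi> x = (LINT y|lborel. f y * \<psi> (x' - y) - f y * \<psi> (x - y))"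
      unfolding conv_def using conv_integrable[OF f \<psi>] by simp
    also have "\<bar>\<dots>\<bar> \<le> (LINT y|lborel. \<bar>f y\<bar> * (e / (?I + 1)))"
    proof (rule abs_integral_le)
      show "integrable lborel (\<lambda>y. \<bar>f y\<bar> * (e / (?I + 1)))" using f by simp
      fix y
      have "\<bar>\<psi> (x' - y) - \<psi> (x - y)\<bar> \<le> e / (?I + 1)"
        using d(2)[of "x' - y" "x - y"] x' by (simp add: dist_norm)
      then have "\<bar>f y\<bar> * \<bar>\<psi> (x' - y) - \<psi> (x - y)\<bar> \<le> \<bar>f y\<bar> * (e / (?I + 1))"
        by (intro mult_left_mono) auto
      then show "\<bar>f y * \<psi> (x' - y) - f y * \<psi> (x - y)\<bar> \<le> \<bar>f y\<bar> * (e / (?I + 1))"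
        by (simp add: abs_mult right_diff_distrib[symmetric])
    qed
    also have "\<dots> = ?I * (e / (?I + 1))" using f by simp
    also have "\<dots> < e"
    proof -
      have "?I * (e / (?I + 1)) < (?I + 1) * (e / (?I + 1))"
        using \<open>e / (?I + 1) > 0\<close> by (intro mult_strict_right_mono) auto
      then show ?thesis using \<open>?I \<ge> 0\<close> by simp
    qed
    finally show "dist (conv f \<psi> x') (conv f \<psi> x) < e" by (simp add: dist_real_def)
  qed (use d in auto)
qed

text \<open>The point is that \<open>d\<close> does not depend on \<open>z\<close>, so that the
  remainder can be integrated against \<open>f\<close> when a convolution is differentiated.\<close>

lemma test_function_uniform_derivative:
  assumes "test_function A \<psi>" "e > 0"
  shows "\<exists>d>0. \<forall>z h. norm h < d \<longrightarrow>
    \<bar>\<psi> (z + h) - \<psi> z - frechet_derivative \<psi> (at z) h\<bar> \<le> e * norm h"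
proof -
  obtain K where K: "compact K" "\<And>x. x \<notin> K \<Longrightarrow> \<psi> x = 0" using test_functionE[OF assms(1)] by metis
  have "uniformly_continuous_on UNIV (grad \<psi>)"
    using compact_support_uniformly_continuous[OF test_function_continuous_grad[OF assms(1)] K(1)]
      grad_eq_0_outside[of K \<psi>] K compact_imp_closed by blast
  then obtain d where d: "d > 0" "\<And>x y. dist y x < d \<Longrightarrow> dist (grad \<psi> y) (grad \<psi> x) < e"
    using \<open>e > 0\<close> unfolding uniformly_continuous_on_def by (metis UNIV_I)
  have fd: "frechet_derivative \<psi> (at z) = (\<lambda>v. grad \<psi> z \<bullet> v)" for z
    using frechet_derivative_eqI[OF test_function_has_derivative_grad[OF assms(1)]] .
  have "\<bar>\<psi> (z + h) - \<psi> z - frechet_derivative \<psi> (at z) h\<bar> \<le> e * norm h" if "norm h < d" for z h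
  proof -
    have "norm (\<psi> (z + h) - \<psi> z - (\<lambda>v. grad \<psi> z \<bullet> v) (z + h - z)) \<le> norm (z + h - z) * e"
    proof (rule differentiable_bound_linearization[where S="closed_segment z (z + h)" and f'="\<lambda>x v. grad \<psi> x \<bullet> v"])
      show "(\<psi> has_derivative (\<lambda>v. grad \<psi> x \<bullet> v)) (at x within closed_segment z (z + h))" for x
        using test_function_has_derivative_grad[OF assms(1)] has_derivative_at_withinI by blast
      show "z + t *\<^sub>R (z + h - z) \<in> closed_segment z (z + h)" if "t \<in> {0..1}" for t
        using that by (auto simp: in_segment algebra_simps intro!: exI[of _ t])
      show "onorm ((\<lambda>v. grad \<psi> x \<bullet> v) - (\<lambda>v. grad \<psi> z \<bullet> v)) \<le> e" if "x \<in> closed_segment z (z + h)" for x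
      proof (rule onorm_le)
        fix v
        have "dist x z \<le> norm h" using that segment_bound(1)[OF that] by (simp add: dist_norm)
        then have "norm (grad \<psi> x - grad \<psi> z) < e"
          using d(2)[of x z] \<open>norm h < d\<close> by (simp add: dist_norm)
        then show "norm (((\<lambda>v. grad \<psi> x \<bullet> v) - (\<lambda>v. grad \<psi> z \<bullet> v)) v) \<le> e * norm v"
          using Cauchy_Schwarz_ineq2[of "grad \<psi> x - grad \<psi> z" v]
          by (simp add: inner_diff_left) (meson less_imp_le mult_right_mono norm_ge_zero order_trans)
      qed
    qed auto
    then show ?thesis by (simp add: fd mult.commute)
  qed
  then show ?thesis using d(1) by blast
qed

lemma conv_has_derivative:
  assumes f: "integrable lborel f" and \<psi>: "test_function A \<psi>"
  shows "(conv f \<psi> has_derivative (\<lambda>v. conv f (\<lambda>z. frechet_derivative \<psi> (at z) v) x)) (at x)"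
  unfolding has_derivative_at_alt
proof (intro conjI allI impI)
  have int: "integrable lborel (\<lambda>y. f y * frechet_derivative \<psi> (at (x - y)) v)" for x v
    using conv_integrable[OF f test_function_frechet_derivative[OF \<psi>]] by simp
  have lin: "linear (frechet_derivative \<psi> (at z))" for z
    using test_function_has_derivative[OF \<psi>] has_derivative_linear by blast
  have "linear (\<lambda>v. conv f (\<lambda>z. frechet_derivative \<psi> (at z) v) x)"
    unfolding conv_def
    by (rule linearI) (use int in \<open>auto simp: linear_add[OF lin] linear_cmul[OF lin] distrib_left mult.left_commute\<close>)
  then show "bounded_linear (\<lambda>v. conv f (\<lambda>z. frechet_derivative \<psi> (at z) v) x)"
    by (simp add: linear_conv_bounded_linear)
  fix e :: real assume "e > 0"
  let ?I = "LINT y|lborel. \<bar>f y\<bar>"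
  have "?I \<ge> 0" by simp
  have "e / (?I + 1) > 0" using \<open>e > 0\<close> \<open>?I \<ge> 0\<close> by (intro divide_pos_pos) linarith+
  then obtain d where d: "d > 0" "\<And>z h. norm h < d \<Longrightarrow>
      \<bar>\<psi> (z + h) - \<psi> z - frechet_derivative \<psi> (at z) h\<bar> \<le> e / (?I + 1) * norm h"
    using test_function_uniform_derivative[OF \<psi>] by metis
  show "\<exists>d>0. \<forall>y. norm (y - x) < d \<longrightarrow> norm (conv f \<psi> y - conv f \<psi> x -
      conv f (\<lambda>z. frechet_derivative \<psi> (at z) (y - x)) x) \<le> e * norm (y - x)"
  proof (intro exI conjI allI impI)
    fix y assume y: "norm (y - x) < d"
    let ?h = "y - x"
    let ?r = "\<lambda>z. \<psi> (y - z) - \<psi> (x - z) - frechet_derivative \<psi> (at (x - z)) ?h"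
    have "conv f \<psi> y - conv f \<psi> x - conv f (\<lambda>z. frechet_derivative \<psi> (at z) ?h) x
      = (LINT z|lborel. f z * \<psi> (y - z) - f z * \<psi> (x - z) - f z * frechet_derivative \<psi> (at (x - z)) ?h)"
      unfolding conv_def using conv_integrable[OF f \<psi>] int by simp
    also have "\<bar>\<dots>\<bar> \<le> (LINT y|lborel. \<bar>f y\<bar> * (e / (?I + 1) * norm ?h))"
    proof (rule abs_integral_le)
      show "integrable lborel (\<lambda>y. \<bar>f y\<bar> * (e / (?I + 1) * norm ?h))" using f by simp
      fix z
      have "\<bar>?r z\<bar> \<le> e / (?I + 1) * norm ?h"
        using d(2)[OF y, of "x - z"] by (simp add: algebra_simps)
      then have "\<bar>f z\<bar> * \<bar>?r z\<bar> \<le> \<bar>f z\<bar> * (e / (?I + 1) * norm ?h)"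
        by (intro mult_left_mono) auto
      then show "\<bar>f z * \<psi> (y - z) - f z * \<psi> (x - z) - f z * frechet_derivative \<psi> (at (x - z)) ?h\<bar>
          \<le> \<bar>f z\<bar> * (e / (?I + 1) * norm ?h)"
        by (simp add: abs_mult right_diff_distrib[symmetric])
    qed
    also have "\<dots> = ?I * (e / (?I + 1) * norm ?h)" using f by simp
    also have "\<dots> = (?I / (?I + 1)) * (e * norm ?h)" by simp
    also have "\<dots> \<le> 1 * (e * norm ?h)"
    proof (rule mult_right_mono)
      have "0 < ?I + 1" using \<open>?I \<ge> 0\<close> by linarith
      then show "?I / (?I + 1) \<le> 1" by (rule divide_le_eq_1_pos[THEN iffD2]) simp
    qed (use \<open>e > 0\<close> in simp)
    finally show "norm (conv f \<psi> y - conv f \<psi> x - conv f (\<lambda>z. frechet_derivative \<psi> (at z) ?h) x)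
        \<le> e * norm ?h" by simp
  qed (use d in auto)
qed

lemma conv_smooth:
  assumes f: "integrable lborel f" and \<psi>: "test_function A \<psi>"
  shows "smooth_on UNIV (conv f \<psi>)"
  unfolding smooth_on_def
proof
  fix m
  show "C_diff_on m UNIV (conv f \<psi>)" using \<psi>
  proof (induction m arbitrary: \<psi>)
    case 0
    then show ?case using conv_continuous[OF f] by auto
  next
    case (Suc m)
    show ?case
      by (rule C_diff_on_SucI[OF _ conv_has_derivative[OF f Suc.prems]])
        (use Suc.IH[OF test_function_frechet_derivative[OF Suc.prems]] in auto)
  qed
qed

lemma conv_eq_0_outside:
  assumes "\<And>x. x \<notin> K \<Longrightarrow> f x = 0" "\<And>x. x \<notin> L \<Longrightarrow> \<psi> x = 0" "x \<notin> {a + b |a b. a \<in> K \<and> b \<in> L}"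
  shows "conv f \<psi> x = 0"
proof -
  have "f y * \<psi> (x - y) = 0" for y
  proof (rule ccontr)
    assume "f y * \<psi> (x - y) \<noteq> 0"
    then have "y \<in> K" "x - y \<in> L" "x = y + (x - y)" using assms(1,2) by auto
    then show False using assms(3) by blast
  qed
  then show ?thesis unfolding conv_def by (simp only: integral_zero)
qed

text \<open>By translation invariance every difference quotient of \<open>F\<close> has integral 0,
  and dominated convergence passes to the derivative. This is the only form of the divergence
  theorem from which integration by parts is drawn below.\<close>

lemma integral_directional_derivative_eq_0:
  fixes F :: "'a::euclidean_space \<Rightarrow> real"
  assumes F: "\<And>x. (F has_derivative F' x) (at x)" and c: "continuous_on UNIV (\<lambda>x. F' x v)"
    and K: "compact K" "\<And>x. x \<notin> K \<Longrightarrow> F x = 0"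
  shows "(LINT x|lborel. F' x v) = 0"
proof -
  have cF: "continuous_on UNIV F"
    using F by (meson continuous_at_imp_continuous_on has_derivative_continuous)
  have F'0: "F' x v = 0" if "x \<notin> K" for x
  proof -
    have "frechet_derivative F (at x) = (\<lambda>v. 0)"
      using frechet_derivative_eq_0_outside[of K F x] K that compact_imp_closed by blast
    then show ?thesis using frechet_derivative_eqI[OF F, of x] by simp
  qed
  obtain B where B: "\<And>x. \<bar>F' x v\<bar> \<le> B" "B > 0"
    using compact_support_bounded[OF c K(1) F'0] by (metis real_norm_def)
  have intF: "integrable lborel F" using compact_support_integrable[OF cF K] .
  have shift: "integrable lborel (\<lambda>x. F (w + x))" "(LINT x|lborel. F (w + x)) = integral\<^sup>L lborel F" for w
  proof -
    have "integrable (distr lborel borel ((+) w)) F" by (subst lborel_distr_plus) (rule intF)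
    then show "integrable lborel (\<lambda>x. F (w + x))" by (rule integrable_distr[rotated]) simp
    have "integral\<^sup>L (distr lborel borel ((+) w)) F = (LINT x|lborel. F (w + x))"
      using intF by (intro integral_distr) (auto dest: borel_measurable_integrable)
    then show "(LINT x|lborel. F (w + x)) = integral\<^sup>L lborel F" using lborel_distr_plus[of w] by simp
  qed
  let ?q = "\<lambda>n x. (F (inverse (real (Suc n)) *\<^sub>R v + x) - F x) * real (Suc n)"
  define L where "L = {x + y |x y. x \<in> K \<and> y \<in> cball 0 (norm v)}"
  have LI: "y \<in> L" if "x \<in> K" "norm (y - x) \<le> norm v" for x y
  proof -
    have "y = x + (y - x)" "y - x \<in> cball 0 (norm v)" using that by auto
    then show ?thesis using that(1) unfolding L_def by blast
  qed
  have cL: "compact L" unfolding L_def using compact_sums[OF K(1) compact_cball] .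
  \<comment> \<open>The shifts are at most \<open>norm v\<close> long, so all quotients vanish off
    one compact set; on it the mean value theorem bounds them by the bound of the
    derivative.\<close>
  have mvt: "\<bar>?q n x\<bar> \<le> B * indicator L x" for n x
  proof (cases "x \<in> L")
    case True
    let ?t = "inverse (real (Suc n))"
    have t: "?t > 0" by simp
    have der: "((\<lambda>s. F (s *\<^sub>R v + x)) has_real_derivative F' (s *\<^sub>R v + x) v) (at s)" for s
    proof -
      have "((\<lambda>s. F (s *\<^sub>R v + x)) has_derivative (\<lambda>h. F' (s *\<^sub>R v + x) (h *\<^sub>R v))) (at s)"
        by (rule has_derivative_compose[OF _ F]) (auto intro!: derivative_eq_intros)
      moreover have "F' (s *\<^sub>R v + x) (h *\<^sub>R v) = F' (s *\<^sub>R v + x) v * h" for h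
        using has_derivative_linear[OF F] by (simp add: linear_cmul)
      ultimately show ?thesis by (simp add: has_field_derivative_def)
    qed
    obtain s where "F (?t *\<^sub>R v + x) - F (0 *\<^sub>R v + x) = (?t - 0) * F' (s *\<^sub>R v + x) v"
      using MVT2[OF t, of "\<lambda>s. F (s *\<^sub>R v + x)" "\<lambda>s. F' (s *\<^sub>R v + x) v"] der by blast
    then have "?q n x = F' (s *\<^sub>R v + x) v" by (simp add: field_simps)
    then show ?thesis using B(1) True by simp
  next
    case False
    have "x \<notin> K" using False LI[of x x] by auto
    moreover have "inverse (real (Suc n)) *\<^sub>R v + x \<notin> K"
    proof
      assume "inverse (real (Suc n)) *\<^sub>R v + x \<in> K"
      moreover have "norm (x - (inverse (real (Suc n)) *\<^sub>R v + x)) \<le> norm v"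
        using mult_right_mono[of "inverse (real (Suc n))" 1 "norm v"] by (simp add: field_simps)
      ultimately have "x \<in> L" using LI by blast
      with False show False by simp
    qed
    ultimately show ?thesis using K(2) False by simp
  qed
  have lim: "(\<lambda>n. ?q n x) \<longlonglongrightarrow> F' x v" for x
  proof -
    have "((\<lambda>s. F (s *\<^sub>R v + x)) has_real_derivative F' x v) (at 0)"
    proof -
      have "((\<lambda>s. F (s *\<^sub>R v + x)) has_derivative (\<lambda>h. F' (0 *\<^sub>R v + x) (h *\<^sub>R v))) (at 0)"
        by (rule has_derivative_compose[OF _ F]) (auto intro!: derivative_eq_intros)
      moreover have "F' x (h *\<^sub>R v) = F' x v * h" for h
        using has_derivative_linear[OF F] by (simp add: linear_cmul)
      ultimately show ?thesis by (simp add: has_field_derivative_def)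
    qed
    then have "((\<lambda>h. (F (h *\<^sub>R v + x) - F x) / h) \<longlongrightarrow> F' x v) (at 0)"
      by (simp add: DERIV_def)
    moreover have "filterlim (\<lambda>n. inverse (real (Suc n))) (at 0) sequentially"
      using LIMSEQ_inverse_real_of_nat by (auto simp: filterlim_at)
    ultimately have "(\<lambda>n. (F (inverse (real (Suc n)) *\<^sub>R v + x) - F x) / inverse (real (Suc n))) \<longlonglongrightarrow> F' x v"
      by (rule filterlim_compose)
    then show ?thesis by (simp add: field_simps)
  qed
  have "(\<lambda>n. LINT x|lborel. ?q n x) \<longlonglongrightarrow> (LINT x|lborel. F' x v)"
  proof (rule integral_dominated_convergence[where w="\<lambda>x. B * indicator L x"])
    show "integrable lborel (\<lambda>x. B * indicator L x)"
      using cL by (intro integrable_mult_right integrable_real_indicator)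
        (auto intro: emeasure_compact_finite[simplified] borel_compact)
    show "(\<lambda>x. F' x v) \<in> borel_measurable lborel"
      using c by (simp add: borel_measurable_continuous_onI)
    show "?q n \<in> borel_measurable lborel" for n
      using shift(1) intF by (intro borel_measurable_times borel_measurable_diff)
        (auto dest: borel_measurable_integrable)
  qed (use mvt lim in auto)
  moreover have "(LINT x|lborel. ?q n x) = 0" for n
    using shift intF by simp
  ultimately have "(\<lambda>n. 0) \<longlonglongrightarrow> (LINT x|lborel. F' x v)" by (simp only:)
  then show ?thesis by (simp add: LIMSEQ_const_iff)
qed

section \<open>Mollifiers\<close>

definition mollifier_mass :: "'a::euclidean_space itself \<Rightarrow> real" where
  "mollifier_mass _ = (LINT z|lborel. bump_deriv 1 (1 - (norm (z::'a))\<^sup>2))"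

text \<open>The profile is the derivative of the usual bump, not the bump itself, so that a multiple
  of the bump serves as an explicit potential with the same support.\<close>

definition mollifier :: "real \<Rightarrow> 'a::euclidean_space \<Rightarrow> real" where
  "mollifier e z = bump_deriv 1 (1 - (norm (z /\<^sub>R e))\<^sup>2) / (mollifier_mass TYPE('a) * e ^ DIM('a))"

text \<open>The gradient of the potential is \<open>- mollifier e z / e\<^sup>2 * z\<close>, so that \<open>e\<close> times its
  Laplacian is the derivative of the mollifier with respect to \<open>e\<close>.\<close>

definition mollifier_pot :: "real \<Rightarrow> 'a::euclidean_space \<Rightarrow> real" where
  "mollifier_pot e z = bump_deriv 0 (1 - (norm (z /\<^sub>R e))\<^sup>2) / (2 * mollifier_mass TYPE('a) * e ^ DIM('a))"

lemma smooth_on_bump_norm: "smooth_on UNIV (\<lambda>z::'a::euclidean_space. bump_deriv n (1 - (norm (z /\<^sub>R e))\<^sup>2))"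
proof -
  have "smooth_on UNIV (\<lambda>z::'a. 1 - (inverse e)\<^sup>2 * (norm (z - 0))\<^sup>2)"
    by (intro smooth_on_diff smooth_on_const smooth_on_mult smooth_on_power2_norm_diff) auto
  then have "smooth_on UNIV (\<lambda>z::'a. 1 - (norm (z /\<^sub>R e))\<^sup>2)"
    by (rule smooth_on_cong[rotated 2]) (auto simp: power_mult_distrib power_inverse)
  then show ?thesis
    by (rule smooth_on_compose_real[where F=bump_deriv, rotated 2]) (auto intro: bump_deriv_DERIV)
qed

lemma bump_deriv_nonpos: "t \<le> 0 \<Longrightarrow> bump_deriv n t = 0"
  by (simp add: bump_deriv_def)

lemma bump_norm_eq_0:
  assumes "e > 0" "z \<notin> cball 0 e"
  shows "bump_deriv n (1 - (norm (z /\<^sub>R e))\<^sup>2) = 0"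
proof (rule bump_deriv_nonpos)
  have "1 \<le> norm (z /\<^sub>R e)" using assms by (auto simp: field_simps)
  then show "1 - (norm (z /\<^sub>R e))\<^sup>2 \<le> 0" by (simp add: one_le_power)
qed

lemma test_function_bump_norm:
  assumes "e > 0" "cball 0 e \<subseteq> A"
  shows "test_function A (\<lambda>z::'a::euclidean_space. bump_deriv n (1 - (norm (z /\<^sub>R e))\<^sup>2))"
  using assms bump_norm_eq_0[OF assms(1)]
  by (intro test_functionI[of _ "cball 0 e"] smooth_on_bump_norm) auto

lemma bump_deriv_1_nonneg: "bump_deriv 1 t \<ge> 0"
  and bump_deriv_1_pos: "t > 0 \<Longrightarrow> bump_deriv 1 t > 0"
  and bump_deriv_0_nonneg: "bump_deriv 0 t \<ge> 0"
  by (auto simp: bump_deriv_1[unfolded One_nat_def] bump_deriv_0)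

lemma mollifier_mass_pos: "mollifier_mass TYPE('a::euclidean_space) > 0"
proof -
  let ?f = "\<lambda>z::'a. bump_deriv 1 (1 - (norm z)\<^sup>2)"
  have tf: "test_function UNIV ?f" using test_function_bump_norm[of 1 UNIV 1] by simp
  have nn: "0 \<le> ?f z" for z by (rule bump_deriv_1_nonneg)
  have "integral\<^sup>L lborel ?f \<noteq> 0"
  proof
    assume "integral\<^sup>L lborel ?f = 0"
    then have "AE z in lborel. ?f z = 0"
      using integral_nonneg_eq_0_iff_AE[OF test_function_integrable[OF tf]] nn by auto
    then have "AE z in lborel. z \<notin> ball (0::'a) 1"
    proof (rule AE_mp, intro AE_I2 impI)
      fix z assume "?f z = 0"
      then show "z \<notin> ball (0::'a) 1"
        using bump_deriv_1_pos[of "1 - (norm z)\<^sup>2"] abs_square_less_1[of "norm z"] by force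
    qed
    then have "ball (0::'a) 1 \<in> null_sets lborel" by (simp add: AE_iff_null_sets)
    then have "negligible (ball (0::'a) 1)"
      using null_sets_completionI negligible_iff_null_sets by blast
    then show False using open_not_negligible[of "ball (0::'a) 1"] by auto
  qed
  moreover have "integral\<^sup>L lborel ?f \<ge> 0" using nn by simp
  ultimately show ?thesis by (simp add: mollifier_mass_def)
qed

lemma lborel_integral_scaleR:
  fixes f :: "'a::euclidean_space \<Rightarrow> real"
  assumes "c > 0" "integrable lborel f"
  shows "(LINT x|lborel. f x) = c ^ DIM('a) * (LINT x|lborel. f (c *\<^sub>R x))"
proof -
  have "(lborel :: 'a measure) = density (distr lborel borel (\<lambda>x. 0 + c *\<^sub>R x)) (\<lambda>_. ennreal (\<bar>c\<bar> ^ DIM('a)))"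
    using lborel_affine[of c "0::'a"] assms by simp
  then have "(LINT x|lborel. f x) =
     (LINT x|density (distr lborel borel (\<lambda>x. c *\<^sub>R x)) (\<lambda>_. ennreal (\<bar>c\<bar> ^ DIM('a))). f x)" by simp
  also have "\<dots> = (LINT x|distr lborel borel (\<lambda>x::'a. c *\<^sub>R x). c ^ DIM('a) *\<^sub>R f x)"
    using assms by (subst integral_density) (auto dest: borel_measurable_integrable)
  also have "\<dots> = (LINT x|lborel. c ^ DIM('a) *\<^sub>R f (c *\<^sub>R x))"
    using assms by (intro integral_distr) (auto dest: borel_measurable_integrable)
  finally show ?thesis by simp
qed

lemma test_function_mollifier:
  assumes "e > 0" "cball 0 e \<subseteq> A"
  shows "test_function A (mollifier e)"
  unfolding mollifier_def
  using test_function_cmult[OF test_function_bump_norm[OF assms, of 1],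
      of "inverse (mollifier_mass TYPE('a) * e ^ DIM('a))"]
  by (simp only: divide_inverse mult.commute)

lemma test_function_mollifier_pot:
  assumes "e > 0" "cball 0 e \<subseteq> A"
  shows "test_function A (mollifier_pot e)"
  unfolding mollifier_pot_def
  using test_function_cmult[OF test_function_bump_norm[OF assms, of 0],
      of "inverse (2 * mollifier_mass TYPE('a) * e ^ DIM('a))"]
  by (simp only: divide_inverse mult.commute)

lemma mollifier_nonneg: "e > 0 \<Longrightarrow> mollifier e z \<ge> 0"
  unfolding mollifier_def
  by (intro divide_nonneg_pos bump_deriv_1_nonneg mult_pos_pos mollifier_mass_pos) auto

lemma mollifier_pot_nonneg: "e > 0 \<Longrightarrow> mollifier_pot e z \<ge> 0"
  unfolding mollifier_pot_def
  by (intro divide_nonneg_pos bump_deriv_0_nonneg mult_pos_pos mollifier_mass_pos) auto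

lemma mollifier_eq_0: "e > 0 \<Longrightarrow> e \<le> norm z \<Longrightarrow> mollifier e z = 0"
  unfolding mollifier_def by (subst bump_deriv_nonpos) (auto simp: field_simps one_le_power)

lemma mollifier_pot_eq_0: "e > 0 \<Longrightarrow> e \<le> norm z \<Longrightarrow> mollifier_pot e z = 0"
  unfolding mollifier_pot_def by (subst bump_deriv_nonpos) (auto simp: field_simps one_le_power)

lemma mollifier_minus: "mollifier e (- z) = mollifier e z"
  by (simp add: mollifier_def)

lemma mollifier_integral:
  assumes "e > 0"
  shows "(LINT z|lborel. mollifier e (z::'a::euclidean_space)) = 1"
proof -
  let ?C = "mollifier_mass TYPE('a) * e ^ DIM('a)"
  have C: "?C > 0" using assms by (intro mult_pos_pos mollifier_mass_pos) simp
  have "(LINT z|lborel. mollifier e (z::'a)) = e ^ DIM('a) * (LINT z|lborel. mollifier e (e *\<^sub>R (z::'a)))"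
    using assms test_function_integrable[OF test_function_mollifier, of e UNIV]
    by (intro lborel_integral_scaleR) auto
  also have "(LINT z|lborel. mollifier e (e *\<^sub>R (z::'a))) = mollifier_mass TYPE('a) / ?C"
    using assms by (simp add: mollifier_def mollifier_mass_def)
  finally show ?thesis using mollifier_mass_pos[where 'a='a] assms by simp
qed

lemma mollifier_integrable:
  assumes "e > 0" shows "integrable lborel (\<lambda>y. mollifier e (x - y :: 'a::euclidean_space))"
    "(LINT y|lborel. mollifier e (x - y :: 'a)) = 1"
proof -
  have tf: "integrable lborel (mollifier e :: 'a \<Rightarrow> real)"
    using assms test_function_integrable[OF test_function_mollifier, of e UNIV] by auto
  have eq: "mollifier e (x - y) = mollifier e (- x + y)" for y
    using mollifier_minus[of e "x - y"] by simp
  have "integrable (distr lborel borel ((+) (- x))) (mollifier e)" by (subst lborel_distr_plus) (rule tf)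
  then show "integrable lborel (\<lambda>y. mollifier e (x - y))" unfolding eq
    by (rule integrable_distr[rotated]) simp
  have "integral\<^sup>L (distr lborel borel ((+) (- x))) (mollifier e) = (LINT y|lborel. mollifier e (- x + y))"
    using tf by (intro integral_distr) (auto dest: borel_measurable_integrable)
  then show "(LINT y|lborel. mollifier e (x - y)) = 1"
    unfolding eq using lborel_distr_plus[of "- x"] mollifier_integral[OF assms, where 'a='a] by simp
qed

section \<open>Continuity of translations in L1 and L2, convergence of mollifications\<close>

lemma lborel_shift_integral:
  fixes f :: "'a::euclidean_space \<Rightarrow> real"
  assumes "integrable lborel f"
  shows "integrable lborel (\<lambda>x. f (w + x))" "(LINT x|lborel. f (w + x)) = integral\<^sup>L lborel f"
proof -
  have "integrable (distr lborel borel ((+) w)) f" by (subst lborel_distr_plus) (rule assms)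
  then show "integrable lborel (\<lambda>x. f (w + x))" by (rule integrable_distr[rotated]) simp
  have "integral\<^sup>L (distr lborel borel ((+) w)) f = (LINT x|lborel. f (w + x))"
    using assms by (intro integral_distr) (auto dest: borel_measurable_integrable)
  then show "(LINT x|lborel. f (w + x)) = integral\<^sup>L lborel f" using lborel_distr_plus[of w] by simp
qed

text \<open>Only the product of the two indicators needs a limit. It is dominated by the indicator
  of \<open>U\<close> and, \<open>U\<close> being open, is eventually 1 at each point of
  \<open>U\<close>; at boundary points the shifted indicator itself need not converge.\<close>

lemma L1_translation_continuous_open:
  fixes U :: "'a::euclidean_space set"
  assumes U: "open U" "emeasure lborel U < \<infinity>" and h: "h \<longlonglongrightarrow> 0"
  shows "(\<lambda>n. LINT x|lborel. \<bar>indicator U (h n + x) - indicator U x :: real\<bar>) \<longlonglongrightarrow> 0"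
proof -
  let ?i = "indicator U :: 'a \<Rightarrow> real"
  have int: "integrable lborel ?i" using U by (intro integrable_real_indicator) auto
  note sh = lborel_shift_integral[OF int]
  have eq: "\<bar>?i (w + x) - ?i x\<bar> = ?i (w + x) + ?i x - 2 * (?i (w + x) * ?i x)" for w x
    by (auto simp: indicator_def)
  have intp: "integrable lborel (\<lambda>x. ?i (w + x) * ?i x)" for w
    using U by (intro integrable_mult_bounded[where B=1] sh borel_measurable_indicator)
      (auto simp: indicator_def)
  have "(\<lambda>n. LINT x|lborel. ?i (h n + x) * ?i x) \<longlonglongrightarrow> integral\<^sup>L lborel ?i"
  proof (rule integral_dominated_convergence[where w="?i"])
    show "AE x in lborel. (\<lambda>n. ?i (h n + x) * ?i x) \<longlonglongrightarrow> ?i x"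
    proof (intro AE_I2)
      fix x
      show "(\<lambda>n. ?i (h n + x) * ?i x) \<longlonglongrightarrow> ?i x"
      proof (cases "x \<in> U")
        case True
        have "(\<lambda>n. h n + x) \<longlonglongrightarrow> 0 + x" by (intro tendsto_intros h)
        then have "eventually (\<lambda>n. h n + x \<in> U) sequentially"
          using topological_tendstoD[OF _ U(1)] True by simp
        then have "eventually (\<lambda>n. ?i (h n + x) * ?i x = ?i x) sequentially"
          by eventually_elim (use True in auto)
        then show ?thesis by (rule tendsto_eventually)
      qed auto
    qed
  qed (use int intp in \<open>auto dest: borel_measurable_integrable simp: indicator_def\<close>)
  then have "(\<lambda>n. integral\<^sup>L lborel ?i + integral\<^sup>L lborel ?i - 2 * (LINT x|lborel. ?i (h n + x) * ?i x))
    \<longlonglongrightarrow> integral\<^sup>L lborel ?i + integral\<^sup>L lborel ?i - 2 * integral\<^sup>L lborel ?i"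
    by (intro tendsto_intros)
  moreover have "(LINT x|lborel. \<bar>?i (h n + x) - ?i x\<bar>) =
     integral\<^sup>L lborel ?i + integral\<^sup>L lborel ?i - 2 * (LINT x|lborel. ?i (h n + x) * ?i x)" for n
    unfolding eq using sh[of "h n"] int intp by simp
  ultimately show ?thesis by simp
qed

lemma L1_translation_approx:
  fixes f g :: "'a::euclidean_space \<Rightarrow> real"
  assumes "integrable lborel f" "integrable lborel g"
  shows "(LINT x|lborel. \<bar>f (w + x) - f x\<bar>) \<le>
    2 * (LINT x|lborel. \<bar>f x - g x\<bar>) + (LINT x|lborel. \<bar>g (w + x) - g x\<bar>)"
proof -
  note s = lborel_shift_integral(1)
  have i: "integrable lborel (\<lambda>x. \<bar>f x - g x\<bar>)" using assms by auto
  have "(LINT x|lborel. \<bar>f (w + x) - f x\<bar>) \<le>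
    (LINT x|lborel. \<bar>f (w + x) - g (w + x)\<bar> + \<bar>f x - g x\<bar> + \<bar>g (w + x) - g x\<bar>)"
    using s[OF assms(1), of w] s[OF assms(2), of w] assms by (intro integral_mono) auto
  also have "\<dots> = (LINT x|lborel. \<bar>f (w + x) - g (w + x)\<bar>) + (LINT x|lborel. \<bar>f x - g x\<bar>) +
      (LINT x|lborel. \<bar>g (w + x) - g x\<bar>)"
    using s[OF assms(1), of w] s[OF assms(2), of w] assms by simp
  also have "(LINT x|lborel. \<bar>f (w + x) - g (w + x)\<bar>) = (LINT x|lborel. \<bar>f x - g x\<bar>)"
    by (rule lborel_shift_integral(2)[OF i])
  finally show ?thesis by simp
qed

text \<open>The property is stable under sums and dominated limits, so indicators remain; these are
  approximated by open supersets, which is where outer regularity of Lebesgue measure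
  enters.\<close>

lemma L1_translation_continuous:
  fixes f :: "'a::euclidean_space \<Rightarrow> real"
  assumes f: "integrable lborel f" and h: "h \<longlonglongrightarrow> 0"
  shows "(\<lambda>n. LINT x|lborel. \<bar>f (h n + x) - f x\<bar>) \<longlonglongrightarrow> 0"
  using f
proof (induction rule: integrable_induct)
  case (base A c)
  have main: "(\<lambda>n. LINT x|lborel. \<bar>indicator A (h n + x) - indicator A x :: real\<bar>) \<longlonglongrightarrow> 0"
  proof (rule LIMSEQ_I, goal_cases)
    case (1 e)
    have "A \<in> sets lebesgue" using base by (simp add: sets_completionI_sets)
    then obtain U where U: "open U" "A \<subseteq> U" "U - A \<in> lmeasurable" "measure lebesgue (U - A) < e / 4"
      using sets_lebesgue_outer_open[of A "e/4"] 1 by (smt (verit, del_insts) divide_pos_pos emeasure_eq_measure2 ennreal_less_iff measure_nonneg zero_less_numeral)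
    have UA: "U - A \<in> sets borel" "U \<in> sets borel" using base U by auto
    have "emeasure lborel (U - A) < \<infinity>"
      using U(3) UA by (auto simp: fmeasurable_def)
    moreover have "emeasure lborel U = emeasure lborel A + emeasure lborel (U - A)"
      using UA base U(2) by (subst plus_emeasure) (auto simp: Un_absorb1)
    ultimately have fU: "emeasure lborel U < \<infinity>" using base by (simp add: less_top[symmetric])
    have iA: "integrable lborel (indicator A :: 'a \<Rightarrow> real)" using base by (intro integrable_real_indicator) auto
    have iU: "integrable lborel (indicator U :: 'a \<Rightarrow> real)" using fU UA by (intro integrable_real_indicator) auto
    have "(LINT x|lborel. \<bar>indicator A x - indicator U x :: real\<bar>) = (LINT x|lborel. indicator (U - A) x)"
      using U(2) by (intro Bochner_Integration.integral_cong) (auto simp: indicator_def)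
    also have "\<dots> = measure lebesgue (U - A)" using UA by (simp add: measure_completion)
    finally have AU: "(LINT x|lborel. \<bar>indicator A x - indicator U x :: real\<bar>) < e / 4" using U by simp
    have "e / 2 > 0" using 1 by simp
    from LIMSEQ_D[OF L1_translation_continuous_open[OF U(1) fU h] this]
    obtain N where N: "\<And>n. n \<ge> N \<Longrightarrow> (LINT x|lborel. \<bar>indicator U (h n + x) - indicator U x :: real\<bar>) < e / 2"
      by (force simp: abs_less_iff)
    show ?case
    proof (intro exI[of _ N] allI impI)
      fix n assume "n \<ge> N"
      then have "(LINT x|lborel. \<bar>indicator A (h n + x) - indicator A x :: real\<bar>) < e"
        using L1_translation_approx[OF iA iU, of "h n"] N[of n] AU by linarith
      then show "norm ((LINT x|lborel. \<bar>indicator A (h n + x) - indicator A x :: real\<bar>) - 0) < e"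
        by simp
    qed
  qed
  have "(LINT x|lborel. \<bar>indicator A (h n + x) *\<^sub>R c - indicator A x *\<^sub>R c\<bar>) =
     \<bar>c\<bar> * (LINT x|lborel. \<bar>indicator A (h n + x) - indicator A x :: real\<bar>)" for n
    by (subst integral_mult_right_zero[symmetric], rule Bochner_Integration.integral_cong)
      (auto simp: abs_mult[symmetric] algebra_simps)
  then show ?case using tendsto_mult_right_zero[OF main, of "\<bar>c\<bar>"] by simp
next
  case (add f g)
  note s = lborel_shift_integral(1)
  have le: "(LINT x|lborel. \<bar>f (h n + x) + g (h n + x) - (f x + g x)\<bar>) \<le>
    (LINT x|lborel. \<bar>f (h n + x) - f x\<bar>) + (LINT x|lborel. \<bar>g (h n + x) - g x\<bar>)" for n
  proof -
    have "(LINT x|lborel. \<bar>f (h n + x) + g (h n + x) - (f x + g x)\<bar>) \<le>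
      (LINT x|lborel. \<bar>f (h n + x) - f x\<bar> + \<bar>g (h n + x) - g x\<bar>)"
      using s[OF add(1), of "h n"] s[OF add(2), of "h n"] add by (intro integral_mono) auto
    then show ?thesis using s[OF add(1), of "h n"] s[OF add(2), of "h n"] add by simp
  qed
  show ?case
    by (rule tendsto_sandwich[OF _ _ tendsto_const tendsto_add_zero[OF add(3,4)]])
      (use le in \<open>auto intro!: always_eventually\<close>)
next
  case (lim f s)
  have "(\<lambda>i. LINT x|lborel. \<bar>f x - s i x\<bar>) \<longlonglongrightarrow> (LINT x::'a|lborel. (0::real))"
  proof (rule integral_dominated_convergence[where w="\<lambda>x. 3 * \<bar>f x\<bar>" and s="\<lambda>i x. \<bar>f x - s i x\<bar>" and f="\<lambda>x. 0"])
    show "AE x in lborel. (\<lambda>i. \<bar>f x - s i x\<bar>) \<longlonglongrightarrow> 0"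
    proof (intro AE_I2)
      fix x
      have "(\<lambda>i. \<bar>f x - s i x\<bar>) \<longlonglongrightarrow> \<bar>f x - f x\<bar>" by (intro tendsto_intros lim(2)) simp
      then show "(\<lambda>i. \<bar>f x - s i x\<bar>) \<longlonglongrightarrow> 0" by simp
    qed
    show "AE x in lborel. norm \<bar>f x - s i x\<bar> \<le> 3 * \<bar>f x\<bar>" for i
    proof (intro AE_I2)
      fix x show "norm \<bar>f x - s i x\<bar> \<le> 3 * \<bar>f x\<bar>" using lim(3)[of x i] by simp
    qed
  qed (use lim in \<open>auto dest: borel_measurable_integrable\<close>)
  then have c: "(\<lambda>i. LINT x|lborel. \<bar>f x - s i x\<bar>) \<longlonglongrightarrow> 0" by simp
  show ?case
  proof (rule LIMSEQ_I, goal_cases)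
    case (1 e)
    have "e / 4 > 0" using 1 by simp
    from LIMSEQ_D[OF c this] obtain i where i: "(LINT x|lborel. \<bar>f x - s i x\<bar>) < e / 4"
      by (force simp: abs_less_iff)
    have "e / 2 > 0" using 1 by simp
    from LIMSEQ_D[OF lim(5)[of i] this]
    obtain N where N: "\<And>n. n \<ge> N \<Longrightarrow> (LINT x|lborel. \<bar>s i (h n + x) - s i x\<bar>) < e / 2"
      by (force simp: abs_less_iff)
    show ?case
    proof (intro exI[of _ N] allI impI)
      fix n assume "n \<ge> N"
      then have "(LINT x|lborel. \<bar>f (h n + x) - f x\<bar>) < e"
        using L1_translation_approx[OF lim(4) lim(1)[of i], of "h n"] N[of n] i by linarith
      then show "norm ((LINT x|lborel. \<bar>f (h n + x) - f x\<bar>) - 0) < e" by simp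
    qed
  qed
qed

text \<open>Reduces continuity of translations in L2 to the L1 statement for the signed square f
  |f|. The factor 2 is for arguments of opposite sign.\<close>

lemma square_diff_le_signed_squares:
  fixes a b :: real
  shows "(a - b)\<^sup>2 \<le> 2 * \<bar>a * \<bar>a\<bar> - b * \<bar>b\<bar>\<bar>"
proof -
  have same: "(a - b)\<^sup>2 \<le> 2 * \<bar>a * \<bar>a\<bar> - b * \<bar>b\<bar>\<bar>" if "0 \<le> a" "0 \<le> b" for a b :: real
  proof -
    have "a * \<bar>a\<bar> - b * \<bar>b\<bar> = (a - b) * (a + b)" using that by (simp add: algebra_simps)
    moreover have "\<bar>a - b\<bar> * \<bar>a - b\<bar> \<le> \<bar>a - b\<bar> * \<bar>a + b\<bar>" using that by (intro mult_left_mono) auto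
    ultimately show ?thesis
      by (simp add: power2_eq_square abs_mult) (metis abs_mult abs_mult_self_eq abs_ge_zero mult_nonneg_nonneg le_add_same_cancel1 mult_2 order_trans)
  qed
  have opp: "(a - b)\<^sup>2 \<le> 2 * \<bar>a * \<bar>a\<bar> - b * \<bar>b\<bar>\<bar>" if "0 \<le> a" "b \<le> 0" for a b :: real
  proof -
    have "a * \<bar>a\<bar> - b * \<bar>b\<bar> = a\<^sup>2 + b\<^sup>2" using that by (simp add: power2_eq_square)
    moreover have "0 \<le> (a + b)\<^sup>2" by simp
    ultimately show ?thesis by (simp add: power2_sum power2_diff)
  qed
  show ?thesis
    using same[of a b] same[of "-a" "-b"] opp[of a b] opp[of b a]
    by (cases "0 \<le> a"; cases "0 \<le> b") (auto simp: power2_commute abs_minus_commute)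
qed

lemma L2_translation_continuous:
  fixes f :: "'a::euclidean_space \<Rightarrow> real"
  assumes [measurable]: "f \<in> borel_measurable borel" and f: "integrable lborel (\<lambda>x. (f x)\<^sup>2)"
    and "e > 0"
  shows "\<exists>d>0. \<forall>h. norm h < d \<longrightarrow> (\<integral>\<^sup>+x. ennreal ((f (h + x) - f x)\<^sup>2) \<partial>lborel) \<le> ennreal e"
proof (rule ccontr)
  assume "\<not> ?thesis"
  then have "\<forall>d>0. \<exists>h. norm h < d \<and> \<not> (\<integral>\<^sup>+x. ennreal ((f (h + x) - f x)\<^sup>2) \<partial>lborel) \<le> ennreal e"
    by blast
  then have "\<forall>n. \<exists>h. norm h < inverse (real (Suc n)) \<and>
      \<not> (\<integral>\<^sup>+x. ennreal ((f (h + x) - f x)\<^sup>2) \<partial>lborel) \<le> ennreal e" by simp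
  then obtain h where h: "\<And>n. norm (h n) < inverse (real (Suc n))"
    "\<And>n. \<not> (\<integral>\<^sup>+x. ennreal ((f (h n + x) - f x)\<^sup>2) \<partial>lborel) \<le> ennreal e" by metis
  have h0: "h \<longlonglongrightarrow> 0"
    by (rule Lim_null_comparison[OF always_eventually LIMSEQ_inverse_real_of_nat])
      (use less_imp_le[OF h(1)] in blast)
  define s where "s x = f x * \<bar>f x\<bar>" for x
  have s: "integrable lborel s"
    by (rule Bochner_Integration.integrable_bound[OF f]) (auto simp: s_def[abs_def] power2_eq_square abs_mult)
  have "(\<lambda>n. LINT x|lborel. \<bar>s (h n + x) - s x\<bar>) \<longlonglongrightarrow> 0" by (rule L1_translation_continuous[OF s h0])
  moreover have "e / 2 > 0" using \<open>e > 0\<close> by simp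
  ultimately obtain n where n: "(LINT x|lborel. \<bar>s (h n + x) - s x\<bar>) < e / 2"
    using LIMSEQ_D by (smt (verit, best) order_refl real_norm_def)
  have int: "integrable lborel (\<lambda>x. 2 * \<bar>s (h n + x) - s x\<bar>)"
    using s lborel_shift_integral(1)[OF s, of "h n"] by auto
  have "(\<integral>\<^sup>+x. ennreal ((f (h n + x) - f x)\<^sup>2) \<partial>lborel) \<le> (\<integral>\<^sup>+x. ennreal (2 * \<bar>s (h n + x) - s x\<bar>) \<partial>lborel)"
    unfolding s_def by (intro nn_integral_mono ennreal_leI square_diff_le_signed_squares)
  also have "\<dots> = ennreal (LINT x|lborel. 2 * \<bar>s (h n + x) - s x\<bar>)"
    by (rule nn_integral_eq_integral[OF int]) auto
  also have "\<dots> \<le> ennreal e" using n by (intro ennreal_leI) simp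
  finally show False using h(2) by blast
qed

text \<open>Jensen's inequality for the square: the kernel is a probability density, and the two
  sides differ by the variance of \<open>f\<close> under it. The variance is the nonnegative
  integral with \<open>?m\<close>.\<close>

lemma conv_mollifier_L2_bound:
  fixes f :: "'a::euclidean_space \<Rightarrow> real"
  assumes [measurable]: "f \<in> borel_measurable borel" and f: "integrable lborel f" "integrable lborel (\<lambda>x. (f x)\<^sup>2)"
    and "e > 0"
  shows "ennreal ((conv f (mollifier e) x - f x)\<^sup>2) \<le>
    (\<integral>\<^sup>+y. ennreal ((f y - f x)\<^sup>2 * mollifier e (y - x)) \<partial>lborel)"
proof -
  let ?k = "\<lambda>y. mollifier e (x - y)"
  have tf: "test_function UNIV (mollifier e :: 'a \<Rightarrow> real)" using \<open>e > 0\<close> by (intro test_function_mollifier) auto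
  note [measurable] = test_function_shift_measurable[OF tf]
  have k: "integrable lborel ?k" "(LINT y|lborel. ?k y) = 1" using mollifier_integrable[OF \<open>e > 0\<close>] by auto
  obtain B where B: "\<And>z::'a. \<bar>mollifier e z\<bar> \<le> B" using test_function_bounded[OF tf] by metis
  have i1: "integrable lborel (\<lambda>y. f y * ?k y)" by (rule integrable_mult_bounded[OF f(1) _ B]) simp
  have i2: "integrable lborel (\<lambda>y. (f y)\<^sup>2 * ?k y)" by (rule integrable_mult_bounded[OF f(2) _ B]) simp
  let ?m = "conv f (mollifier e) x"
  have m: "(LINT y|lborel. f y * ?k y) = ?m" by (simp add: conv_def)
  have sq: "(f y - c)\<^sup>2 * ?k y = (f y)\<^sup>2 * ?k y - 2 * c * (f y * ?k y) + c\<^sup>2 * ?k y" for y c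
    by (simp add: power2_diff algebra_simps)
  have isq: "integrable lborel (\<lambda>y. (f y - c)\<^sup>2 * ?k y)" for c
    unfolding sq using i1 i2 k by auto
  have val: "(LINT y|lborel. (f y - c)\<^sup>2 * ?k y) = (LINT y|lborel. (f y)\<^sup>2 * ?k y) - 2 * c * ?m + c\<^sup>2" for c
    unfolding sq using i1 i2 k m by simp
  have kn: "0 \<le> ?k y" for y using mollifier_nonneg[OF \<open>e > 0\<close>] .
  have "0 \<le> (LINT y|lborel. (f y - ?m)\<^sup>2 * ?k y)" using kn by (intro Bochner_Integration.integral_nonneg) auto
  then have "(?m - f x)\<^sup>2 \<le> (LINT y|lborel. (f y - f x)\<^sup>2 * ?k y)"
    unfolding val by (simp add: power2_diff power2_eq_square algebra_simps)
  then have "ennreal ((?m - f x)\<^sup>2) \<le> ennreal (LINT y|lborel. (f y - f x)\<^sup>2 * ?k y)" by (rule ennreal_leI)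
  also have "\<dots> = (\<integral>\<^sup>+y. ennreal ((f y - f x)\<^sup>2 * ?k y) \<partial>lborel)"
    by (rule nn_integral_eq_integral[symmetric, OF isq]) (use kn in auto)
  also have "?k = (\<lambda>y. mollifier e (y - x))" using mollifier_minus[of e] by (metis minus_diff_eq)
  finally show ?thesis .
qed

lemma nn_integral_lborel_shift:
  fixes f :: "'a::euclidean_space \<Rightarrow> ennreal"
  assumes [measurable]: "f \<in> borel_measurable borel"
  shows "(\<integral>\<^sup>+y. f y \<partial>lborel) = (\<integral>\<^sup>+z. f (x + z) \<partial>lborel)"
  by (subst lborel_distr_plus[of x, symmetric], subst nn_integral_distr) auto

lemma conv_mollifier_L2_tendsto:
  fixes f :: "'a::euclidean_space \<Rightarrow> real"
  assumes [measurable]: "f \<in> borel_measurable borel" and f: "integrable lborel f" "integrable lborel (\<lambda>x. (f x)\<^sup>2)"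
    and e: "\<And>n. e n > 0" "e \<longlonglongrightarrow> 0"
  shows "integrable lborel (\<lambda>x. (conv f (mollifier (e n)) x - f x)\<^sup>2)"
    "(\<lambda>n. LINT x|lborel. (conv f (mollifier (e n)) x - f x)\<^sup>2) \<longlonglongrightarrow> 0"
proof -
  have tf: "test_function UNIV (mollifier r :: 'a \<Rightarrow> real)" if "r > 0" for r
    using that by (intro test_function_mollifier) auto
  have km: "(mollifier r :: 'a \<Rightarrow> real) \<in> borel_measurable borel" if "r > 0" for r
    using test_function_continuous[OF tf[OF that]] by (rule borel_measurable_continuous_onI)
  have cm: "conv f (mollifier r) \<in> borel_measurable borel" if "r > 0" for r
    using conv_continuous[OF f(1) tf[OF that]] by (rule borel_measurable_continuous_onI)
  \<comment> \<open>After Fubini the squared L2 distance is a kernel average of the squared L2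
    distances between \<open>f\<close> and its translates by vectors shorter than
    \<open>r\<close>.\<close>
  have bound: "(\<integral>\<^sup>+x. ennreal ((conv f (mollifier r) x - f x)\<^sup>2) \<partial>lborel) \<le> ennreal d"
    if r: "r > 0" and d: "\<And>h. norm h < r \<Longrightarrow> (\<integral>\<^sup>+x. ennreal ((f (h + x) - f x)\<^sup>2) \<partial>lborel) \<le> ennreal d" for r d
  proof -
    note [measurable] = km[OF r]
    let ?F = "\<lambda>x z. ennreal ((f (x + z) - f x)\<^sup>2 * mollifier r z)"
    have "(\<integral>\<^sup>+x. ennreal ((conv f (mollifier r) x - f x)\<^sup>2) \<partial>lborel) \<le>
      (\<integral>\<^sup>+x. (\<integral>\<^sup>+y. ennreal ((f y - f x)\<^sup>2 * mollifier r (y - x)) \<partial>lborel) \<partial>lborel)"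
      by (intro nn_integral_mono conv_mollifier_L2_bound f r) simp
    also have "\<dots> = (\<integral>\<^sup>+x. (\<integral>\<^sup>+z. ?F x z \<partial>lborel) \<partial>lborel)"
    proof (rule nn_integral_cong)
      fix x
      show "(\<integral>\<^sup>+y. ennreal ((f y - f x)\<^sup>2 * mollifier r (y - x)) \<partial>lborel) = (\<integral>\<^sup>+z. ?F x z \<partial>lborel)"
        by (subst nn_integral_lborel_shift[where x=x]) auto
    qed
    also have "\<dots> = (\<integral>\<^sup>+z. (\<integral>\<^sup>+x. ?F x z \<partial>lborel) \<partial>lborel)"
      by (rule lborel_pair.Fubini') measurable
    also have "\<dots> = (\<integral>\<^sup>+z. ennreal (mollifier r z) * (\<integral>\<^sup>+x. ennreal ((f (z + x) - f x)\<^sup>2) \<partial>lborel) \<partial>lborel)"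
    proof -
      have "?F x z = ennreal (mollifier r z) * ennreal ((f (z + x) - f x)\<^sup>2)" for x z
        using mollifier_nonneg[OF r, of z] by (simp only: ennreal_mult[symmetric] zero_le_power2 mult.commute add.commute)
      then show ?thesis by (simp add: nn_integral_cmult)
    qed
    also have "\<dots> \<le> (\<integral>\<^sup>+z. ennreal (mollifier r (z::'a)) * ennreal d \<partial>lborel)"
    proof (rule nn_integral_mono)
      fix z :: 'a
      show "ennreal (mollifier r z) * (\<integral>\<^sup>+x. ennreal ((f (z + x) - f x)\<^sup>2) \<partial>lborel) \<le> ennreal (mollifier r z) * ennreal d"
        using d[of z] mollifier_eq_0[OF r, of z] by (cases "norm z < r") (auto intro!: mult_left_mono)
    qed
    also have "\<dots> = ennreal d * (\<integral>\<^sup>+z. ennreal (mollifier r (z::'a)) \<partial>lborel)"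
      by (subst nn_integral_multc) (auto simp: mult.commute)
    also have "(\<integral>\<^sup>+z. ennreal (mollifier r (z::'a)) \<partial>lborel) = ennreal 1"
      using mollifier_nonneg[OF r] mollifier_integral[OF r, where 'a='a] test_function_integrable[OF tf[OF r]]
      by (subst nn_integral_eq_integral) auto
    finally show ?thesis by simp
  qed
  have le: "(LINT x|lborel. (conv f (mollifier r) x - f x)\<^sup>2) \<le> d"
    if "r > 0" "d \<ge> 0" "(\<integral>\<^sup>+x. ennreal ((conv f (mollifier r) x - f x)\<^sup>2) \<partial>lborel) \<le> ennreal d" for r d
    using that(2,3) by (subst integral_eq_nn_integral) (use cm[OF that(1)] in \<open>auto intro: enn2real_leI\<close>)
  show "integrable lborel (\<lambda>x. (conv f (mollifier (e n)) x - f x)\<^sup>2)"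
  proof (rule integrableI_bounded)
    have 2: "(f (h + x) - f x)\<^sup>2 \<le> 2 * (f (h + x))\<^sup>2 + 2 * (f x)\<^sup>2" for h x
      using sum_squares_bound[of "f (h + x)" "- f x"] by (simp add: power2_diff)
    let ?d = "2 * (LINT x|lborel. (f x)\<^sup>2) + 2 * (LINT x|lborel. (f x)\<^sup>2)"
    have "(\<integral>\<^sup>+x. ennreal ((f (h + x) - f x)\<^sup>2) \<partial>lborel) \<le> ennreal ?d" for h
    proof -
      have "(\<integral>\<^sup>+x. ennreal ((f (h + x) - f x)\<^sup>2) \<partial>lborel) \<le> (\<integral>\<^sup>+x. ennreal (2 * (f (h + x))\<^sup>2 + 2 * (f x)\<^sup>2) \<partial>lborel)"
        by (intro nn_integral_mono ennreal_leI 2)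
      also have "\<dots> = ennreal (LINT x|lborel. 2 * (f (h + x))\<^sup>2 + 2 * (f x)\<^sup>2)"
        using f lborel_shift_integral[OF f(2), of h] by (intro nn_integral_eq_integral) auto
      also have "(LINT x|lborel. 2 * (f (h + x))\<^sup>2 + 2 * (f x)\<^sup>2) = ?d"
        using f lborel_shift_integral[OF f(2), of h] by simp
      finally show ?thesis .
    qed
    then have "(\<integral>\<^sup>+x. ennreal ((conv f (mollifier (e n)) x - f x)\<^sup>2) \<partial>lborel) \<le> ennreal ?d"
      by (rule bound[OF e(1)])
    then show "(\<integral>\<^sup>+x. ennreal (norm ((conv f (mollifier (e n)) x - f x)\<^sup>2)) \<partial>lborel) < \<infinity>"
      using order_le_less_trans[OF _ ennreal_less_top] by simp
  qed (use cm[OF e(1)] in simp)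
  show "(\<lambda>n. LINT x|lborel. (conv f (mollifier (e n)) x - f x)\<^sup>2) \<longlonglongrightarrow> 0"
  proof (rule LIMSEQ_I, goal_cases)
    case (1 d)
    then have "d / 2 > 0" by simp
    from L2_translation_continuous[OF assms(1) f(2) this] obtain r where r: "r > 0"
      "\<And>h. norm h < r \<Longrightarrow> (\<integral>\<^sup>+x. ennreal ((f (h + x) - f x)\<^sup>2) \<partial>lborel) \<le> ennreal (d / 2)" by blast
    obtain N where N: "\<And>n. n \<ge> N \<Longrightarrow> e n < r" using LIMSEQ_D[OF e(2) r(1)] by force
    show ?case
    proof (intro exI[of _ N] allI impI)
      fix n assume "n \<ge> N"
      then have "(\<integral>\<^sup>+x. ennreal ((conv f (mollifier (e n)) x - f x)\<^sup>2) \<partial>lborel) \<le> ennreal (d / 2)"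
        using N r by (intro bound e) (meson order_less_trans)
      then have "(LINT x|lborel. (conv f (mollifier (e n)) x - f x)\<^sup>2) \<le> d / 2" using le[OF e(1)] \<open>d / 2 > 0\<close> less_imp_le by blast
      then show "norm ((LINT x|lborel. (conv f (mollifier (e n)) x - f x)\<^sup>2) - 0) < d"
        using 1 by (simp add: abs_of_nonneg)
    qed
  qed
qed

section \<open>Weak gradients\<close>

text \<open>The measure is a parameter because the same estimates serve on
  \<open>lebesgue_on \<Omega>\<close> and, after cutting off, on \<open>lborel\<close>.\<close>

definition sq_int :: "'a measure \<Rightarrow> ('a \<Rightarrow> 'b::euclidean_space) \<Rightarrow> bool" where
  "sq_int M f \<longleftrightarrow> f \<in> borel_measurable M \<and> integrable M (\<lambda>x. (norm (f x))\<^sup>2)"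

lemma L2_iff_sq_int: "f \<in> L2 \<Omega> \<longleftrightarrow> sq_int (lebesgue_on \<Omega>) f"
  by (simp add: L2_def sq_int_def)

lemma sq_int_measurable: "sq_int M f \<Longrightarrow> f \<in> borel_measurable M"
  by (simp add: sq_int_def)

lemma sq_int_bound:
  assumes "sq_int M g" "f \<in> borel_measurable M" "AE x in M. norm (f x) \<le> norm (g x)"
  shows "sq_int M f"
  unfolding sq_int_def
proof
  show "integrable M (\<lambda>x. (norm (f x))\<^sup>2)"
    by (rule Bochner_Integration.integrable_bound[of _ "\<lambda>x. (norm (g x))\<^sup>2"])
      (use assms in \<open>auto simp: sq_int_def power_mono\<close>)
qed fact

lemma sq_int_mult_integrable:
  fixes f g :: "'a \<Rightarrow> real"
  assumes "sq_int M f" "sq_int M g"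
  shows "integrable M (\<lambda>x. f x * g x)"
proof (rule Bochner_Integration.integrable_bound[of _ "\<lambda>x. (f x)\<^sup>2 + (g x)\<^sup>2"])
  have "\<bar>a * b\<bar> \<le> a\<^sup>2 + b\<^sup>2" for a b :: real
    using sum_squares_bound[of "\<bar>a\<bar>" "\<bar>b\<bar>"] mult_nonneg_nonneg[of "\<bar>a\<bar>" "\<bar>b\<bar>"]
    unfolding abs_mult power2_abs by linarith
  then show "AE x in M. norm (f x * g x) \<le> norm ((f x)\<^sup>2 + (g x)\<^sup>2)" by simp
qed (use assms in \<open>auto simp: sq_int_def\<close>)

lemma sq_int_norm: "sq_int M f \<Longrightarrow> sq_int M (\<lambda>x. norm (f x))"
  by (auto simp: sq_int_def intro: borel_measurable_norm)

lemma sq_int_inner_integrable: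
  assumes "sq_int M f" "sq_int M g"
  shows "integrable M (\<lambda>x. f x \<bullet> g x)"
  by (rule Bochner_Integration.integrable_bound[OF sq_int_mult_integrable[OF assms[THEN sq_int_norm]]])
    (use assms in \<open>auto simp: sq_int_def norm_cauchy_schwarz Cauchy_Schwarz_ineq2\<close>)

lemma sq_int_add:
  assumes "sq_int M f" "sq_int M g" shows "sq_int M (\<lambda>x. f x + g x)"
  unfolding sq_int_def
proof
  have "integrable M (\<lambda>x. (norm (f x))\<^sup>2 + 2 * (f x \<bullet> g x) + (norm (g x))\<^sup>2)"
    using assms sq_int_inner_integrable[OF assms] by (auto simp: sq_int_def)
  then show "integrable M (\<lambda>x. (norm (f x + g x))\<^sup>2)"
    by (simp add: power2_norm_eq_inner inner_add inner_commute algebra_simps)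
qed (use assms in \<open>auto simp: sq_int_def\<close>)

lemma sq_int_scaleR:
  assumes "sq_int M f" shows "sq_int M (\<lambda>x. c *\<^sub>R f x)"
  using assms by (auto simp: sq_int_def power_mult_distrib)

lemma sq_int_cmult: "sq_int M f \<Longrightarrow> sq_int M (\<lambda>x. c * f x)" for f :: "'a \<Rightarrow> real"
  using sq_int_scaleR[of M f c] by simp

lemma sq_int_diff: "sq_int M f \<Longrightarrow> sq_int M g \<Longrightarrow> sq_int M (\<lambda>x. f x - g x)"
  using sq_int_add[of M f "\<lambda>x. (-1) *\<^sub>R g x"] sq_int_scaleR[of M g "-1"] by simp

lemma sq_int_0: "sq_int M (\<lambda>x. 0)"
  by (simp add: sq_int_def)

lemma sq_int_bounded_scaleR:
  assumes "sq_int M f" "h \<in> borel_measurable M" "\<And>x. \<bar>h x\<bar> \<le> (B::real)"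
  shows "sq_int M (\<lambda>x. h x *\<^sub>R f x)"
proof (rule sq_int_bound[OF sq_int_scaleR[OF assms(1), of B]])
  have "\<bar>h x\<bar> \<le> \<bar>B\<bar>" for x using assms(3)[of x] by linarith
  then show "AE x in M. norm (h x *\<^sub>R f x) \<le> norm (B *\<^sub>R f x)" by (auto intro!: AE_I2 mult_right_mono)
qed (use assms in \<open>auto simp: sq_int_def\<close>)

lemma sq_int_scaleR_bounded:
  fixes h :: "'a \<Rightarrow> real" and f :: "'a \<Rightarrow> 'b::euclidean_space"
  assumes "sq_int M h" "f \<in> borel_measurable M" "\<And>x. norm (f x) \<le> B"
  shows "sq_int M (\<lambda>x. h x *\<^sub>R f x)"
proof (rule sq_int_bound[OF sq_int_scaleR[OF assms(1), of B]])
  have "norm (f x) \<le> \<bar>B\<bar>" for x using assms(3)[of x] by linarith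
  then show "AE x in M. norm (h x *\<^sub>R f x) \<le> norm (B *\<^sub>R h x)"
    by (auto simp: mult.commute[of "\<bar>h _\<bar>"] abs_mult intro!: AE_I2 mult_right_mono)
qed (use assms in \<open>auto simp: sq_int_def\<close>)

lemma sq_int_integrable:
  fixes f :: "'a \<Rightarrow> real"
  assumes "finite_measure M" "sq_int M f" shows "integrable M f"
proof -
  have "sq_int M (\<lambda>x. 1::real)"
    using assms(1) finite_measure.integrable_const by (auto simp: sq_int_def)
  from sq_int_mult_integrable[OF assms(2) this] show ?thesis by simp
qed

lemma sq_int_inner_Basis:
  assumes "sq_int M f" "b \<in> Basis" shows "sq_int M (\<lambda>x. f x \<bullet> b)"
proof (rule sq_int_bound[OF assms(1)])
  show "(\<lambda>x. f x \<bullet> b) \<in> borel_measurable M"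
    using sq_int_measurable[OF assms(1)] by (intro borel_measurable_inner) auto
qed (use assms(2) in \<open>auto simp: Basis_le_norm\<close>)

lemma integral_Cauchy_Schwarz:
  fixes f g :: "'a \<Rightarrow> real"
  assumes "sq_int M f" "sq_int M g"
  shows "(LINT x|M. f x * g x)\<^sup>2 \<le> (LINT x|M. (f x)\<^sup>2) * (LINT x|M. (g x)\<^sup>2)"
proof -
  let ?F = "LINT x|M. (f x)\<^sup>2" and ?G = "LINT x|M. (g x)\<^sup>2" and ?P = "LINT x|M. f x * g x"
  have q: "0 \<le> ?F - 2 * t * ?P + t\<^sup>2 * ?G" for t
  proof -
    have "0 \<le> (LINT x|M. (f x - t * g x)\<^sup>2)" by simp
    also have "\<dots> = (LINT x|M. (f x)\<^sup>2 - 2 * t * (f x * g x) + t\<^sup>2 * (g x)\<^sup>2)"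
      by (intro Bochner_Integration.integral_cong) (auto simp: power2_diff power_mult_distrib algebra_simps)
    also have "\<dots> = ?F - 2 * t * ?P + t\<^sup>2 * ?G"
      using assms sq_int_mult_integrable[OF assms] by (simp add: sq_int_def)
    finally show ?thesis .
  qed
  have G: "?G \<ge> 0" by simp
  show ?thesis
  proof (cases "?G = 0")
    case True
    have "?P = 0"
    proof (rule ccontr)
      assume P: "?P \<noteq> 0"
      \<comment> \<open>This value of \<open>t\<close> makes the quadratic, which is affine here,
        equal to -1.\<close>
      from q[of "(?F + 1) / (2 * ?P)"] True P show False by simp
    qed
    then show ?thesis by simp
  next
    case False
    with G have "?G > 0" by linarith
    from q[of "?P / ?G"] have "0 \<le> ?F - ?P\<^sup>2 / ?G" using False by (simp add: power2_eq_square)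
    with \<open>?G > 0\<close> show ?thesis by (simp add: field_simps)
  qed
qed

lemma L2_tendsto_integral_mult:
  fixes f :: "'a \<Rightarrow> real"
  assumes "\<And>n. sq_int M (fn n)" "sq_int M f" "sq_int M w" "(\<lambda>n. LINT x|M. (fn n x - f x)\<^sup>2) \<longlonglongrightarrow> 0"
  shows "(\<lambda>n. LINT x|M. fn n x * w x) \<longlonglongrightarrow> (LINT x|M. f x * w x)"
proof -
  let ?W = "LINT x|M. (w x)\<^sup>2"
  have d: "sq_int M (\<lambda>x. fn n x - f x)" for n using sq_int_diff assms by blast
  have "(\<lambda>n. sqrt ((LINT x|M. (fn n x - f x)\<^sup>2) * ?W)) \<longlonglongrightarrow> sqrt (0 * ?W)"
    by (intro tendsto_intros assms)
  then have s: "(\<lambda>n. sqrt ((LINT x|M. (fn n x - f x)\<^sup>2) * ?W)) \<longlonglongrightarrow> 0" by simp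
  have "(\<lambda>n. LINT x|M. (fn n x - f x) * w x) \<longlonglongrightarrow> 0"
  proof (rule Lim_null_comparison[OF _ s], intro always_eventually allI)
    fix n
    show "norm (LINT x|M. (fn n x - f x) * w x) \<le> sqrt ((LINT x|M. (fn n x - f x)\<^sup>2) * ?W)"
      using integral_Cauchy_Schwarz[OF d assms(3)] by (simp add: real_le_rsqrt)
  qed
  moreover have "(LINT x|M. (fn n x - f x) * w x) = (LINT x|M. fn n x * w x) - (LINT x|M. f x * w x)" for n
    using sq_int_mult_integrable[OF assms(1) assms(3)] sq_int_mult_integrable[OF assms(2,3)]
    by (simp add: left_diff_distrib)
  ultimately show ?thesis by (simp add: LIM_zero_iff)
qed

lemma L2_tendsto_AE_subseq:
  fixes f :: "'a \<Rightarrow> 'b::euclidean_space"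
  assumes "\<And>n. sq_int M (fn n)" "sq_int M f" "(\<lambda>n. LINT x|M. (norm (fn n x - f x))\<^sup>2) \<longlonglongrightarrow> 0"
  shows "\<exists>r::nat\<Rightarrow>nat. strict_mono r \<and> (AE x in M. (\<lambda>n. fn (r n) x) \<longlonglongrightarrow> f x)"
proof -
  have "sq_int M (\<lambda>x. fn n x - f x)" for n using sq_int_diff assms by blast
  then have "\<exists>r::nat\<Rightarrow>nat. strict_mono r \<and> (AE x in M. (\<lambda>n. (norm (fn (r n) x - f x))\<^sup>2) \<longlonglongrightarrow> 0)"
    using assms(3) by (intro tendsto_L1_AE_subseq) (auto simp: sq_int_def)
  then obtain r where r: "strict_mono r" "AE x in M. (\<lambda>n. (norm (fn (r n) x - f x))\<^sup>2) \<longlonglongrightarrow> 0" by blast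
  from r(2) have "AE x in M. (\<lambda>n. fn (r n) x) \<longlonglongrightarrow> f x"
  proof eventually_elim
    case (elim x)
    then have "(\<lambda>n. sqrt ((norm (fn (r n) x - f x))\<^sup>2)) \<longlonglongrightarrow> sqrt 0" by (intro tendsto_intros)
    then have "(\<lambda>n. norm (fn (r n) x - f x)) \<longlonglongrightarrow> 0" by simp
    then show ?case by (simp add: LIM_zero_iff tendsto_norm_zero_iff)
  qed
  with r(1) show ?thesis by blast
qed

lemma norm_add_squared_le: "(norm (a + b :: 'a::euclidean_space))\<^sup>2 \<le> 2 * (norm a)\<^sup>2 + 2 * (norm b)\<^sup>2"
proof -
  have "(norm (a + b))\<^sup>2 \<le> (norm a + norm b)\<^sup>2" by (intro power_mono norm_triangle_ineq) auto
  also have "\<dots> \<le> 2 * (norm a)\<^sup>2 + 2 * (norm b)\<^sup>2"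
    using zero_le_power2[of "norm a - norm b"] by (simp add: power2_sum power2_diff)
  finally show ?thesis .
qed

lemma integral_norm_add_squared_le:
  assumes "sq_int M f" "sq_int M g"
  shows "(LINT x|M. (norm (f x + g x))\<^sup>2) \<le> 2 * (LINT x|M. (norm (f x))\<^sup>2) + 2 * (LINT x|M. (norm (g x))\<^sup>2)"
proof -
  have "(LINT x|M. (norm (f x + g x))\<^sup>2) \<le> (LINT x|M. 2 * (norm (f x))\<^sup>2 + 2 * (norm (g x))\<^sup>2)"
    using assms sq_int_add[OF assms] norm_add_squared_le by (intro integral_mono) (auto simp: sq_int_def)
  then show ?thesis using assms by (simp add: sq_int_def)
qed

lemma sq_int_tendsto_0_add:
  assumes "\<And>n. sq_int M (f n)" "\<And>n. sq_int M (g n)"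
    "(\<lambda>n. LINT x|M. (norm (f n x))\<^sup>2) \<longlonglongrightarrow> 0" "(\<lambda>n. LINT x|M. (norm (g n x))\<^sup>2) \<longlonglongrightarrow> 0"
  shows "(\<lambda>n. LINT x|M. (norm (f n x + g n x))\<^sup>2) \<longlonglongrightarrow> 0"
proof (rule tendsto_sandwich[OF _ _ tendsto_const])
  have "(\<lambda>n. 2 * (LINT x|M. (norm (f n x))\<^sup>2) + 2 * (LINT x|M. (norm (g n x))\<^sup>2)) \<longlonglongrightarrow> 2 * 0 + 2 * 0"
    by (intro tendsto_intros assms)
  then show "(\<lambda>n. 2 * (LINT x|M. (norm (f n x))\<^sup>2) + 2 * (LINT x|M. (norm (g n x))\<^sup>2)) \<longlonglongrightarrow> 0" by simp
qed (use integral_norm_add_squared_le[OF assms(1,2)] in auto)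

lemma sq_int_tendsto_0_bound:
  fixes f :: "nat \<Rightarrow> 'a \<Rightarrow> 'b::euclidean_space" and g :: "nat \<Rightarrow> 'a \<Rightarrow> 'c::euclidean_space"
  assumes "\<And>n. sq_int M (g n)" "\<And>n. f n \<in> borel_measurable M" "\<And>n. AE x in M. norm (f n x) \<le> norm (g n x)"
    "(\<lambda>n. LINT x|M. (norm (g n x))\<^sup>2) \<longlonglongrightarrow> 0"
  shows "(\<lambda>n. LINT x|M. (norm (f n x))\<^sup>2) \<longlonglongrightarrow> 0"
proof (rule tendsto_sandwich[OF _ _ tendsto_const assms(4)])
  have "(LINT x|M. (norm (f n x))\<^sup>2) \<le> (LINT x|M. (norm (g n x))\<^sup>2)" for n
    using assms(1)[of n] sq_int_bound[OF assms(1)[of n] assms(2)[of n] assms(3)[of n]] assms(3)[of n]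
    by (intro integral_mono_AE) (auto simp: sq_int_def power_mono)
  then show "\<forall>\<^sub>F n in sequentially. (LINT x|M. (norm (f n x))\<^sup>2) \<le> (LINT x|M. (norm (g n x))\<^sup>2)" by simp
qed auto

section \<open>From functions on the domain to Borel functions on the whole space\<close>

text \<open>Translation, Fubini and convolution are carried out with Borel functions on
  \<open>lborel\<close>. The representative vanishes everywhere outside \<open>T\<close>, not merely
  almost everywhere, so that supports of convolutions can be computed.\<close>

lemma lebesgue_on_borel_rep:
  fixes f :: "'a::euclidean_space \<Rightarrow> real"
  assumes "f \<in> borel_measurable (lebesgue_on \<Omega>)" "\<Omega> \<in> sets borel" "T \<in> sets borel"
    "AE x in lebesgue_on \<Omega>. x \<notin> T \<longrightarrow> f x = 0" "T \<subseteq> \<Omega>"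
  shows "\<exists>f'\<in>borel_measurable borel. (AE x in lebesgue_on \<Omega>. f' x = f x) \<and> (\<forall>x. x \<notin> T \<longrightarrow> f' x = 0)"
proof -
  have "\<Omega> \<inter> space lebesgue \<in> sets lebesgue" using assms by auto
  then have "(\<lambda>x. indicator \<Omega> x * f x) \<in> borel_measurable lebesgue"
    using assms(1) borel_measurable_restrict_space_iff[of \<Omega> lebesgue f] by (simp add: mult.commute)
  then obtain g where g: "g \<in> borel_measurable lborel" "AE x in lborel. indicator \<Omega> x * f x = g x"
    using completion_ex_borel_measurable_real by blast
  show ?thesis
  proof (intro bexI[of _ "\<lambda>x. indicator T x * g x"] conjI allI impI)
    have "AE x in lebesgue. indicator \<Omega> x * f x = g x" using g(2) by (rule AE_completion)
    then have "AE x in lebesgue_on \<Omega>. indicator \<Omega> x * f x = g x" "AE x in lebesgue_on \<Omega>. x \<in> \<Omega>"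
      using assms(2) by (auto simp: AE_restrict_space_iff)
    then show "AE x in lebesgue_on \<Omega>. indicator T x * g x = f x"
      using assms(4) by eventually_elim (auto simp: indicator_def)
    show "(\<lambda>x. indicator T x * g x) \<in> borel_measurable borel" using assms g by simp
  qed auto
qed

lemma lebesgue_on_borel_rep_vec:
  fixes f :: "'a::euclidean_space \<Rightarrow> 'b::euclidean_space"
  assumes "f \<in> borel_measurable (lebesgue_on \<Omega>)" "\<Omega> \<in> sets borel" "T \<in> sets borel"
    "AE x in lebesgue_on \<Omega>. x \<notin> T \<longrightarrow> f x = 0" "T \<subseteq> \<Omega>"
  shows "\<exists>f'\<in>borel_measurable borel. (AE x in lebesgue_on \<Omega>. f' x = f x) \<and> (\<forall>x. x \<notin> T \<longrightarrow> f' x = 0)"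
proof -
  have "\<exists>f'\<in>borel_measurable borel. (AE x in lebesgue_on \<Omega>. f' x = f x \<bullet> b) \<and> (\<forall>x. x \<notin> T \<longrightarrow> f' x = 0)" for b
    using assms by (intro lebesgue_on_borel_rep) auto
  then obtain F where F: "\<And>b. F b \<in> borel_measurable borel" "\<And>b. AE x in lebesgue_on \<Omega>. F b x = f x \<bullet> b"
    "\<And>b x. x \<notin> T \<Longrightarrow> F b x = 0" by metis
  show ?thesis
  proof (intro bexI[of _ "\<lambda>x. \<Sum>b\<in>Basis. F b x *\<^sub>R b"] conjI)
    have "AE x in lebesgue_on \<Omega>. \<forall>b\<in>Basis. F b x = f x \<bullet> b"
      using F(2) by (intro AE_finite_allI) auto
    then show "AE x in lebesgue_on \<Omega>. (\<Sum>b\<in>Basis. F b x *\<^sub>R b) = f x"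
      by eventually_elim (auto simp: euclidean_representation)
  qed (use F in auto)
qed

lemma lebesgue_on_integral_eq:
  fixes p q :: "'a::euclidean_space \<Rightarrow> real"
  assumes "p \<in> borel_measurable (lebesgue_on \<Omega>)" "q \<in> borel_measurable borel" "\<Omega> \<in> sets borel"
    "AE x in lebesgue_on \<Omega>. q x = p x" "\<And>x. x \<notin> \<Omega> \<Longrightarrow> q x = 0"
  shows "(LINT x|lebesgue_on \<Omega>. p x) = (LINT x|lborel. q x)"
    "integrable (lebesgue_on \<Omega>) p \<longleftrightarrow> integrable lborel q"
proof -
  have \<Omega>: "\<Omega> \<inter> space lebesgue \<in> sets lebesgue" using assms by auto
  have q: "q \<in> borel_measurable (lebesgue_on \<Omega>)"
    using assms(2) by (intro measurable_restrict_space1 measurable_completion) simp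
  have ind: "(\<lambda>x. indicator \<Omega> x *\<^sub>R q x) = q" using assms(5) by (auto simp: indicator_def fun_eq_iff)
  have "(LINT x|lebesgue_on \<Omega>. p x) = (LINT x|lebesgue_on \<Omega>. q x)"
    using assms q by (intro integral_cong_AE) auto
  also have "\<dots> = (LINT x|lebesgue. q x)"
    unfolding integral_restrict_space[OF \<Omega>] ind ..
  also have "\<dots> = (LINT x|lborel. q x)" using assms(2) by (intro integral_completion) simp
  finally show "(LINT x|lebesgue_on \<Omega>. p x) = (LINT x|lborel. q x)" .
  have "integrable (lebesgue_on \<Omega>) p \<longleftrightarrow> integrable (lebesgue_on \<Omega>) q"
    using assms q by (intro integrable_cong_AE) auto
  also have "\<dots> \<longleftrightarrow> integrable lebesgue q" unfolding integrable_restrict_space[OF \<Omega>] ind ..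
  also have "\<dots> \<longleftrightarrow> integrable lborel q" using assms(2) by (intro integrable_completion) simp
  finally show "integrable (lebesgue_on \<Omega>) p \<longleftrightarrow> integrable lborel q" .
qed

lemma continuous_imp_measurable_lebesgue_on:
  fixes f :: "'a::euclidean_space \<Rightarrow> 'b::euclidean_space"
  assumes "continuous_on UNIV f"
  shows "f \<in> borel_measurable (lebesgue_on \<Omega>)"
  using borel_measurable_continuous_onI[OF assms]
  by (intro measurable_restrict_space1 measurable_completion) simp

text \<open>The cutoff is the indicator of a neighbourhood of \<open>K\<close>, mollified at a smaller scale.\<close>

lemma cutoff_exists:
  fixes K :: "'a::euclidean_space set"
  assumes "compact K" "open \<Omega>" "K \<subseteq> \<Omega>"
  obtains \<eta> V where "test_function \<Omega> \<eta>" "open V" "K \<subseteq> V" "V \<subseteq> \<Omega>" "\<And>x. x \<in> V \<Longrightarrow> \<eta> x = 1"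
    "\<And>x. 0 \<le> \<eta> x" "\<And>x. \<eta> x \<le> 1"
proof (cases "K = {}")
  case True
  show ?thesis by (rule that[of "\<lambda>x. 0" "{}"]) (auto simp: True test_function_0)
next
  case False
  obtain d where d: "d > 0" "(\<Union>x\<in>K. cball x d) \<subseteq> \<Omega>"
    using compact_subset_open_imp_cball_epsilon_subset[OF assms] by blast
  define r where "r = d / 3"
  have r: "r > 0" using d by (simp add: r_def)
  define L where "L = {x + y |x y. x \<in> K \<and> y \<in> cball 0 (2 * r)}"
  have L: "compact L" unfolding L_def by (rule compact_sums[OF assms(1) compact_cball])
  have LI: "y \<in> L" if "x \<in> K" "dist x y \<le> 2 * r" for x y
  proof -
    have "y = x + (y - x)" "y - x \<in> cball 0 (2 * r)" using that by (auto simp: dist_norm norm_minus_commute)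
    then show ?thesis using that(1) unfolding L_def by blast
  qed
  define N where "N = {x + y |x y. x \<in> L \<and> y \<in> cball 0 r}"
  have N: "compact N" unfolding N_def by (rule compact_sums[OF L compact_cball])
  have N\<Omega>: "N \<subseteq> \<Omega>"
  proof
    fix x assume "x \<in> N"
    then obtain k y z where *: "k \<in> K" "norm y \<le> 2 * r" "norm z \<le> r" "x = k + y + z"
      unfolding N_def L_def by auto
    have "k - x = - (y + z)" using *(4) by simp
    then have "dist k x = norm (y + z)" by (metis dist_norm norm_minus_cancel)
    then have "dist k x \<le> d" using norm_triangle_ineq[of y z] *(2,3) by (simp add: r_def)
    then show "x \<in> \<Omega>" using d(2) *(1) by force
  qed
  define \<eta> where "\<eta> = conv (indicator L) (mollifier r)"
  have tm: "test_function UNIV (mollifier r :: 'a \<Rightarrow> real)" using r by (intro test_function_mollifier) auto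
  have iL: "integrable lborel (indicator L :: 'a \<Rightarrow> real)"
    using L by (intro integrable_real_indicator) (auto intro: emeasure_compact_finite[simplified] borel_compact)
  show ?thesis
  proof (rule that[of \<eta> "\<Union>x\<in>K. ball x r"])
    show "test_function \<Omega> \<eta>"
    proof (rule test_functionI[OF _ N N\<Omega>])
      show "smooth_on UNIV \<eta>" unfolding \<eta>_def by (rule conv_smooth[OF iL tm])
      show "\<eta> x = 0" if "x \<notin> N" for x
        unfolding \<eta>_def
      proof (rule conv_eq_0_outside[of L _ "cball 0 r"])
        show "mollifier r z = 0" if "z \<notin> cball 0 r" for z :: 'a
          using that r by (intro mollifier_eq_0) auto
      qed (use \<open>x \<notin> N\<close> N_def in auto)
    qed
    show "(\<Union>x\<in>K. ball x r) \<subseteq> \<Omega>" using d r by (force simp: r_def)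
    show "\<eta> x = 1" if x: "x \<in> (\<Union>x\<in>K. ball x r)" for x
    proof -
      have eq: "indicator L y * mollifier r (x - y) = mollifier r (x - y)" for y
      proof (cases "norm (x - y) < r")
        case True
        obtain k where "k \<in> K" "dist k x < r" using x by auto
        then have "y \<in> L" using True dist_triangle[of k y x] by (intro LI[of k]) (auto simp: dist_norm)
        then show ?thesis by simp
      qed (use mollifier_eq_0[OF r, of "x - y"] in auto)
      then show ?thesis unfolding \<eta>_def conv_def eq using mollifier_integrable[OF r] by simp
    qed
    show "0 \<le> \<eta> x" for x unfolding \<eta>_def conv_def
      using mollifier_nonneg[OF r] by (intro Bochner_Integration.integral_nonneg mult_nonneg_nonneg) auto
    show "\<eta> x \<le> 1" for x
    proof -
      have "\<eta> x \<le> (LINT y|lborel. mollifier r (x - y))" unfolding \<eta>_def conv_def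
        using mollifier_nonneg[OF r] mollifier_integrable[OF r, of x] conv_integrable[OF iL tm]
        by (intro integral_mono) (auto simp: indicator_def)
      then show ?thesis unfolding mollifier_integrable(2)[OF r] .
    qed
  qed (use r in auto)
qed

section \<open>Calculus of weak gradients\<close>

text \<open>A relation in place of the chosen \<open>weak_grad\<close>: gradients can then be given
  by formulas, and uniqueness almost everywhere links them to \<open>weak_grad\<close> when
  needed.\<close>

definition wgrad :: "'a::euclidean_space set \<Rightarrow> ('a \<Rightarrow> real) \<Rightarrow> ('a \<Rightarrow> 'a) \<Rightarrow> bool" where
  "wgrad \<Omega> u g \<longleftrightarrow> sq_int (lebesgue_on \<Omega>) u \<and> sq_int (lebesgue_on \<Omega>) g \<and> is_weak_gradient \<Omega> u g"

lemma H1_iff_wgrad: "u \<in> H1 \<Omega> \<longleftrightarrow> (\<exists>g. wgrad \<Omega> u g)"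
  by (auto simp: H1_def wgrad_def L2_iff_sq_int)

lemma wgrad_weak_grad: "u \<in> H1 \<Omega> \<Longrightarrow> wgrad \<Omega> u (weak_grad \<Omega> u)"
proof -
  assume u: "u \<in> H1 \<Omega>"
  then have "\<exists>g. g \<in> L2 \<Omega> \<and> is_weak_gradient \<Omega> u g" by (auto simp: H1_def)
  from someI_ex[OF this] show ?thesis
    using u by (auto simp: weak_grad_def wgrad_def L2_iff_sq_int H1_def)
qed

lemma compact_support_lebesgue_on_integrable:
  fixes f :: "'a::euclidean_space \<Rightarrow> real"
  assumes "continuous_on UNIV f" "compact K" "\<And>x. x \<notin> K \<Longrightarrow> f x = 0" "open \<Omega>"
  shows "integrable (lebesgue_on \<Omega>) f"
proof -
  have "integrable lborel f" by (rule compact_support_integrable[OF assms(1-3)])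
  then have "integrable lebesgue f"
    using integrable_completion[of f lborel] by (auto dest: borel_measurable_integrable)
  then show ?thesis using assms(4)
    by (subst integrable_restrict_space) (auto intro: integrable_mult_indicator simp del: real_scaleR_def)
qed

lemma test_function_sq_int:
  assumes "test_function A \<psi>" "open \<Omega>"
  shows "sq_int (lebesgue_on \<Omega>) \<psi>" "sq_int (lebesgue_on \<Omega>) (grad \<psi>)"
    "integrable (lebesgue_on \<Omega>) \<psi>"
proof -
  obtain K where K: "compact K" "K \<subseteq> A" "\<And>x. x \<notin> K \<Longrightarrow> \<psi> x = 0"
    by (rule test_functionE[OF assms(1)]) blast
  have g0: "grad \<psi> x = 0" if "x \<notin> K" for x
    using grad_eq_0_outside[of K \<psi> x] K that compact_imp_closed by blast
  note c = test_function_continuous[OF assms(1)] test_function_continuous_grad[OF assms(1)]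
  show "integrable (lebesgue_on \<Omega>) \<psi>"
    by (rule compact_support_lebesgue_on_integrable[OF c(1) K(1,3) assms(2)])
  show "sq_int (lebesgue_on \<Omega>) \<psi>" unfolding sq_int_def
    by (intro conjI continuous_imp_measurable_lebesgue_on c
        compact_support_lebesgue_on_integrable[OF _ K(1) _ assms(2)] continuous_intros) (simp add: K(3))
  show "sq_int (lebesgue_on \<Omega>) (grad \<psi>)" unfolding sq_int_def
    by (intro conjI continuous_imp_measurable_lebesgue_on c
        compact_support_lebesgue_on_integrable[OF _ K(1) _ assms(2)] continuous_intros) (simp add: g0)
qed

lemma test_function_measurable:
  assumes "test_function A \<psi>"
  shows "\<psi> \<in> borel_measurable (lebesgue_on \<Omega>)" "grad \<psi> \<in> borel_measurable (lebesgue_on \<Omega>)"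
    "\<psi> \<in> borel_measurable borel" "grad \<psi> \<in> borel_measurable borel"
  using test_function_continuous[OF assms] test_function_continuous_grad[OF assms]
  by (auto intro: continuous_imp_measurable_lebesgue_on borel_measurable_continuous_onI)

lemma grad_mult:
  assumes "(f has_derivative (\<lambda>v. a \<bullet> v)) (at x)" "(g has_derivative (\<lambda>v. b \<bullet> v)) (at x)"
  shows "grad (\<lambda>x. f x * g x) x = f x *\<^sub>R b + g x *\<^sub>R a"
proof (rule grad_eqI)
  show "((\<lambda>x. f x * g x) has_derivative (\<lambda>v. (f x *\<^sub>R b + g x *\<^sub>R a) \<bullet> v)) (at x)"
    using has_derivative_mult[OF assms] by (simp add: inner_add_left mult.commute)
qed

lemma frechet_derivative_eq_grad:
  "test_function A \<psi> \<Longrightarrow> frechet_derivative \<psi> (at x) v = grad \<psi> x \<bullet> v"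
  using frechet_derivative_eqI[OF test_function_has_derivative_grad, of A \<psi> x] by simp

lemma wgradD:
  assumes "wgrad \<Omega> u g"
  shows "sq_int (lebesgue_on \<Omega>) u" "sq_int (lebesgue_on \<Omega>) g"
    "test_function \<Omega> \<psi> \<Longrightarrow> b \<in> Basis \<Longrightarrow>
      (LINT x|lebesgue_on \<Omega>. u x * (grad \<psi> x \<bullet> b)) = - (LINT x|lebesgue_on \<Omega>. (g x \<bullet> b) * \<psi> x)"
  using assms by (auto simp: wgrad_def is_weak_gradient_def frechet_derivative_eq_grad)

lemma wgradI:
  assumes "sq_int (lebesgue_on \<Omega>) u" "sq_int (lebesgue_on \<Omega>) g"
    "\<And>\<psi> b. test_function \<Omega> \<psi> \<Longrightarrow> b \<in> Basis \<Longrightarrow>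
      (LINT x|lebesgue_on \<Omega>. u x * (grad \<psi> x \<bullet> b)) = - (LINT x|lebesgue_on \<Omega>. (g x \<bullet> b) * \<psi> x)"
  shows "wgrad \<Omega> u g"
  using assms by (auto simp: wgrad_def is_weak_gradient_def frechet_derivative_eq_grad)

lemma wgrad_in_H1: "wgrad \<Omega> u g \<Longrightarrow> u \<in> H1 \<Omega>"
  using H1_iff_wgrad by blast

lemma wgrad_add:
  assumes "open \<Omega>" "wgrad \<Omega> u g" "wgrad \<Omega> v h"
  shows "wgrad \<Omega> (\<lambda>x. u x + v x) (\<lambda>x. g x + h x)"
proof (rule wgradI)
  fix \<psi> and b :: 'a assume \<psi>: "test_function \<Omega> \<psi>" and b: "b \<in> Basis"
  note t = test_function_sq_int[OF \<psi> assms(1)]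
  note i = sq_int_mult_integrable[OF wgradD(1)[OF assms(2)] sq_int_inner_Basis[OF t(2) b]]
    sq_int_mult_integrable[OF wgradD(1)[OF assms(3)] sq_int_inner_Basis[OF t(2) b]]
    sq_int_mult_integrable[OF sq_int_inner_Basis[OF wgradD(2)[OF assms(2)] b] t(1)]
    sq_int_mult_integrable[OF sq_int_inner_Basis[OF wgradD(2)[OF assms(3)] b] t(1)]
  show "(LINT x|lebesgue_on \<Omega>. (u x + v x) * (grad \<psi> x \<bullet> b)) =
        - (LINT x|lebesgue_on \<Omega>. ((g x + h x) \<bullet> b) * \<psi> x)"
    using wgradD(3)[OF assms(2) \<psi> b] wgradD(3)[OF assms(3) \<psi> b] i
    by (simp add: distrib_right inner_add_left)
qed (rule sq_int_add; rule wgradD(1,2)[OF assms(2)] wgradD(1,2)[OF assms(3)])+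

lemma wgrad_cmult:
  assumes "wgrad \<Omega> u g" shows "wgrad \<Omega> (\<lambda>x. c * u x) (\<lambda>x. c *\<^sub>R g x)"
proof (rule wgradI)
  show "(LINT x|lebesgue_on \<Omega>. c * u x * (grad \<psi> x \<bullet> b)) =
        - (LINT x|lebesgue_on \<Omega>. (c *\<^sub>R g x \<bullet> b) * \<psi> x)" if "test_function \<Omega> \<psi>" "b \<in> Basis" for \<psi> b
    using wgradD(3)[OF assms that] by (simp add: mult.assoc)
qed (rule sq_int_cmult sq_int_scaleR, rule wgradD[OF assms])+

lemma wgrad_diff:
  assumes "open \<Omega>" "wgrad \<Omega> u g" "wgrad \<Omega> v h"
  shows "wgrad \<Omega> (\<lambda>x. u x - v x) (\<lambda>x. g x - h x)"
  using wgrad_add[OF assms(1,2) wgrad_cmult[OF assms(3), of "-1"]] by simp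

lemma wgrad_0: "wgrad \<Omega> (\<lambda>x. 0) (\<lambda>x. 0)"
  by (rule wgradI) (auto simp: sq_int_0)

lemma wgrad_sum:
  assumes "open \<Omega>" "\<And>i. i \<in> I \<Longrightarrow> wgrad \<Omega> (u i) (g i)"
  shows "wgrad \<Omega> (\<lambda>x. \<Sum>i\<in>I. u i x) (\<lambda>x. \<Sum>i\<in>I. g i x)"
  using assms(2)
  by (induction I rule: infinite_finite_induct) (auto intro: wgrad_0 wgrad_add[OF assms(1)])

text \<open>The factor is moved onto the test function. The support of \<eta> may leave \<Omega>,
  because the product with a test function of \<Omega> is again supported in \<Omega>.\<close>

lemma wgrad_test_mult:
  assumes "open \<Omega>" "wgrad \<Omega> u g" "test_function A \<eta>"
  shows "wgrad \<Omega> (\<lambda>x. \<eta> x * u x) (\<lambda>x. \<eta> x *\<^sub>R g x + u x *\<^sub>R grad \<eta> x)"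
proof (rule wgradI)
  obtain B where B: "\<And>x. \<bar>\<eta> x\<bar> \<le> B" using test_function_bounded[OF assms(3)] by metis
  obtain C where C: "\<And>x. norm (grad \<eta> x) \<le> C" using test_function_grad_bounded[OF assms(3)] by metis
  note m = test_function_measurable(1,2)[OF assms(3), of \<Omega>]
  note ug = wgradD(1,2)[OF assms(2)]
  have s1: "sq_int (lebesgue_on \<Omega>) (\<lambda>x. \<eta> x * u x)"
    using sq_int_bounded_scaleR[OF ug(1) m(1) B] by simp
  have s2: "sq_int (lebesgue_on \<Omega>) (\<lambda>x. \<eta> x *\<^sub>R g x)"
    by (rule sq_int_bounded_scaleR[OF ug(2) m(1) B])
  have s3: "sq_int (lebesgue_on \<Omega>) (\<lambda>x. u x *\<^sub>R grad \<eta> x)"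
    by (rule sq_int_scaleR_bounded[OF ug(1) m(2) C])
  show "sq_int (lebesgue_on \<Omega>) (\<lambda>x. \<eta> x * u x)" by (rule s1)
  show "sq_int (lebesgue_on \<Omega>) (\<lambda>x. \<eta> x *\<^sub>R g x + u x *\<^sub>R grad \<eta> x)" by (rule sq_int_add[OF s2 s3])
  fix \<psi> and b :: 'a assume \<psi>: "test_function \<Omega> \<psi>" and b: "b \<in> Basis"
  note t = test_function_sq_int[OF \<psi> assms(1)]
  have tm: "test_function \<Omega> (\<lambda>x. \<psi> x * \<eta> x)"
    by (rule test_function_mult_smooth[OF \<psi> test_function_smooth[OF assms(3)]])
  have gr: "grad (\<lambda>x. \<psi> x * \<eta> x) x = \<psi> x *\<^sub>R grad \<eta> x + \<eta> x *\<^sub>R grad \<psi> x" for x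
    by (rule grad_mult[OF test_function_has_derivative_grad[OF \<psi>] test_function_has_derivative_grad[OF assms(3)]])
  note i = sq_int_mult_integrable[OF s1 sq_int_inner_Basis[OF t(2) b]]
     sq_int_mult_integrable[OF sq_int_inner_Basis[OF s2 b] t(1)]
     sq_int_mult_integrable[OF sq_int_inner_Basis[OF s3 b] t(1)]
  have "(LINT x|lebesgue_on \<Omega>. \<eta> x * u x * (grad \<psi> x \<bullet> b)) + (LINT x|lebesgue_on \<Omega>. (u x *\<^sub>R grad \<eta> x \<bullet> b) * \<psi> x)
    = (LINT x|lebesgue_on \<Omega>. u x * (grad (\<lambda>x. \<psi> x * \<eta> x) x \<bullet> b))"
    unfolding gr using i by (subst Bochner_Integration.integral_add[symmetric])
      (auto intro!: Bochner_Integration.integral_cong simp: inner_add_left algebra_simps)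
  also have "\<dots> = - (LINT x|lebesgue_on \<Omega>. (g x \<bullet> b) * (\<psi> x * \<eta> x))"
    by (rule wgradD(3)[OF assms(2) tm b])
  also have "(\<lambda>x. (g x \<bullet> b) * (\<psi> x * \<eta> x)) = (\<lambda>x. (\<eta> x *\<^sub>R g x \<bullet> b) * \<psi> x)" by (auto simp: algebra_simps)
  finally show "(LINT x|lebesgue_on \<Omega>. \<eta> x * u x * (grad \<psi> x \<bullet> b)) =
        - (LINT x|lebesgue_on \<Omega>. ((\<eta> x *\<^sub>R g x + u x *\<^sub>R grad \<eta> x) \<bullet> b) * \<psi> x)"
    using i(2,3) by (simp add: inner_add_left distrib_right)
qed

lemma C_diff_on_reflect:
  fixes f :: "'a::euclidean_space \<Rightarrow> real"
  shows "C_diff_on m UNIV f \<Longrightarrow> C_diff_on m UNIV (\<lambda>y. f (x - y))"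
proof (induction m arbitrary: f)
  case 0
  then have "continuous_on UNIV f" by simp
  then have "continuous_on UNIV (\<lambda>y. f (x - y))"
    by (rule continuous_on_compose2) (auto intro: continuous_intros)
  then show ?case by simp
next
  case (Suc m)
  show ?case
  proof (rule C_diff_on_SucI[where f'="\<lambda>y v. frechet_derivative f (at (x - y)) (- v)"])
    show "((\<lambda>y. f (x - y)) has_derivative (\<lambda>v. frechet_derivative f (at (x - y)) (- v))) (at y)" for y
      by (rule has_derivative_compose[OF _ C_diff_on_has_derivative[OF Suc.prems]])
        (auto intro!: derivative_eq_intros)
    show "C_diff_on m UNIV (\<lambda>y. frechet_derivative f (at (x - y)) (- v))" for v
      using Suc.IH[of "\<lambda>y. frechet_derivative f (at y) (- v)"] Suc.prems by simp
  qed auto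
qed

lemma test_function_reflect:
  assumes "test_function UNIV \<psi>" shows "test_function UNIV (\<lambda>y. \<psi> (x - y))"
proof -
  obtain K where K: "compact K" "K \<subseteq> UNIV" "\<And>x. x \<notin> K \<Longrightarrow> \<psi> x = 0"
    by (rule test_functionE[OF assms]) blast
  show ?thesis
  proof (rule test_functionI[of _ "(\<lambda>y. x - y) ` K"])
    show "smooth_on UNIV (\<lambda>y. \<psi> (x - y))"
      using test_function_smooth[OF assms] C_diff_on_reflect by (auto simp: smooth_on_def)
    show "compact ((\<lambda>y. x - y) ` K)" by (intro compact_continuous_image continuous_intros K)
    show "\<psi> (x - y) = 0" if "y \<notin> (\<lambda>y. x - y) ` K" for y
      using that K(3)[of "x - y"] by (metis diff_diff_eq2 add_diff_cancel_left' image_eqI)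
  qed auto
qed

lemma grad_reflect:
  assumes "test_function UNIV \<psi>" shows "grad (\<lambda>y. \<psi> (x - y)) y = - grad \<psi> (x - y)"
proof (rule grad_eqI)
  show "((\<lambda>y. \<psi> (x - y)) has_derivative (\<lambda>v. - grad \<psi> (x - y) \<bullet> v)) (at y)"
    by (rule has_derivative_eq_rhs[OF has_derivative_compose[OF _ test_function_has_derivative_grad[OF assms]]])
      (auto intro!: derivative_eq_intros simp: fun_eq_iff)
qed

lemma test_function_mollifier_UNIV: "e > 0 \<Longrightarrow> test_function UNIV (mollifier e)"
  by (rule test_function_mollifier) auto

text \<open>Whole-space functions with compact support and a weak gradient, with Borel representatives,
  so that they can be mollified.\<close>

definition compact_wgrad :: "'a::euclidean_space set \<Rightarrow> ('a \<Rightarrow> real) \<Rightarrow> ('a \<Rightarrow> 'a) \<Rightarrow> bool" where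
  "compact_wgrad K f G \<longleftrightarrow> compact K \<and> (\<forall>x. x \<notin> K \<longrightarrow> f x = 0) \<and> (\<forall>x. x \<notin> K \<longrightarrow> G x = 0) \<and>
     sq_int lborel f \<and> sq_int lborel G \<and>
     (\<forall>\<psi>. test_function UNIV \<psi> \<longrightarrow> (\<forall>b\<in>Basis.
        (LINT x|lborel. f x * (grad \<psi> x \<bullet> b)) = - (LINT x|lborel. (G x \<bullet> b) * \<psi> x)))"

lemma compact_sq_int_integrable:
  fixes f :: "'a::euclidean_space \<Rightarrow> real"
  assumes "compact K" "\<And>x. x \<notin> K \<Longrightarrow> f x = 0" "sq_int lborel f"
  shows "integrable lborel f"
proof -
  have "integrable lborel (indicator K :: 'a \<Rightarrow> real)" using assms(1)
    by (intro integrable_real_indicator) (auto intro: emeasure_compact_finite[simplified] borel_compact)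
  moreover have "(\<lambda>x. (norm (indicator K x :: real))\<^sup>2) = indicator K" by (auto simp: indicator_def)
  ultimately have "sq_int lborel (indicator K :: 'a \<Rightarrow> real)"
    by (simp add: sq_int_def borel_measurable_integrable del: real_norm_def)
  from sq_int_mult_integrable[OF assms(3) this]
  have "integrable lborel (\<lambda>x. f x * indicator K x)" .
  moreover have "(\<lambda>x. f x * indicator K x) = f" using assms(2) by (auto simp: indicator_def fun_eq_iff)
  ultimately show ?thesis by simp
qed

lemma compact_wgrad_mollify:
  assumes "compact_wgrad K f G" "e > 0"
  shows "test_function {x + y |x y. x \<in> K \<and> y \<in> cball 0 e} (conv f (mollifier e))"
    "b \<in> Basis \<Longrightarrow> grad (conv f (mollifier e)) x \<bullet> b = conv (\<lambda>y. G y \<bullet> b) (mollifier e) x"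
proof -
  note fG = assms(1)[unfolded compact_wgrad_def]
  have f: "integrable lborel f" using fG compact_sq_int_integrable by blast
  note tm = test_function_mollifier_UNIV[OF assms(2)]
  show "test_function {x + y |x y. x \<in> K \<and> y \<in> cball 0 e} (conv f (mollifier e))"
  proof (rule test_functionI[of _ "{x + y |x y. x \<in> K \<and> y \<in> cball 0 e}"])
    show "smooth_on UNIV (conv f (mollifier e))" by (rule conv_smooth[OF f tm])
    show "compact {x + y |x y. x \<in> K \<and> y \<in> cball 0 e}" using fG compact_sums compact_cball by blast
    show "conv f (mollifier e) x = 0" if "x \<notin> {x + y |x y. x \<in> K \<and> y \<in> cball 0 e}" for x
    proof (rule conv_eq_0_outside[OF _ _ that])
      show "mollifier e z = 0" if "z \<notin> cball 0 e" for z :: 'a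
        using that by (intro mollifier_eq_0[OF assms(2)]) auto
    qed (use fG in auto)
  qed simp
  assume b: "b \<in> Basis"
  have "grad (conv f (mollifier e)) x \<bullet> b = conv f (\<lambda>z. frechet_derivative (mollifier e) (at z) b) x"
    using frechet_derivative_eqI[OF conv_has_derivative[OF f tm, of x]] b
    by (simp add: grad_inner_Basis)
  also have "\<dots> = - (LINT y|lborel. f y * (grad (\<lambda>y. mollifier e (x - y)) y \<bullet> b))"
    by (simp add: conv_def frechet_derivative_eq_grad[OF tm] grad_reflect[OF tm])
  also have "\<dots> = (LINT y|lborel. (G y \<bullet> b) * mollifier e (x - y))"
  proof -
    have "(LINT x|lborel. f x * (grad \<psi> x \<bullet> b)) = - (LINT x|lborel. (G x \<bullet> b) * \<psi> x)"
      if "test_function UNIV \<psi>" for \<psi> using fG that b by blast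
    from this[OF test_function_reflect[OF tm]] show ?thesis by simp
  qed
  finally show "grad (conv f (mollifier e)) x \<bullet> b = conv (\<lambda>y. G y \<bullet> b) (mollifier e) x"
    by (simp add: conv_def)
qed

lemma compact_wgrad_approx:
  assumes "compact_wgrad K f G" "d > 0"
  obtains F where "\<And>n. test_function {x + y |x y. x \<in> K \<and> y \<in> cball 0 d} (F n)"
    "(\<lambda>n. LINT x|lborel. (F n x - f x)\<^sup>2) \<longlonglongrightarrow> 0"
    "(\<lambda>n. LINT x|lborel. (norm (grad (F n) x - G x))\<^sup>2) \<longlonglongrightarrow> 0"
proof -
  note fG = assms(1)[unfolded compact_wgrad_def]
  define e where "e n = d * inverse (real (Suc n))" for n
  have e: "e n > 0" "e n \<le> d" for n
    using assms(2) mult_left_mono[of "inverse (real (Suc n))" 1 d] by (auto simp: e_def field_simps)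
  have e0: "e \<longlonglongrightarrow> 0" unfolding e_def
    using tendsto_mult_right_zero[OF LIMSEQ_inverse_real_of_nat] by simp
  show ?thesis
  proof (rule that[of "\<lambda>n. conv f (mollifier (e n))"])
    show "test_function {x + y |x y. x \<in> K \<and> y \<in> cball 0 d} (conv f (mollifier (e n)))" for n
    proof (rule test_function_mono[OF compact_wgrad_mollify(1)[OF assms(1) e(1)]])
      have "cball 0 (e n) \<subseteq> cball (0::'a) d" using e(2) by (intro subset_cball)
      then show "{x + y |x y. x \<in> K \<and> y \<in> cball 0 (e n)} \<subseteq> {x + y |x y. x \<in> K \<and> y \<in> cball 0 d}" by blast
    qed
    have f: "f \<in> borel_measurable borel" "integrable lborel f" "integrable lborel (\<lambda>x. (f x)\<^sup>2)"
      using fG compact_sq_int_integrable[of K f] by (auto simp: sq_int_def)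
    show "(\<lambda>n. LINT x|lborel. (conv f (mollifier (e n)) x - f x)\<^sup>2) \<longlonglongrightarrow> 0"
      by (rule conv_mollifier_L2_tendsto(2)[OF f e(1) e0])
    have G: "(\<lambda>x. G x \<bullet> b) \<in> borel_measurable borel" "integrable lborel (\<lambda>x. G x \<bullet> b)"
      "integrable lborel (\<lambda>x. (G x \<bullet> b)\<^sup>2)" if "b \<in> Basis" for b
    proof -
      have "sq_int lborel (\<lambda>x. G x \<bullet> b)" using fG that sq_int_inner_Basis by blast
      then show "(\<lambda>x. G x \<bullet> b) \<in> borel_measurable borel" "integrable lborel (\<lambda>x. G x \<bullet> b)"
        "integrable lborel (\<lambda>x. (G x \<bullet> b)\<^sup>2)"
        using fG compact_sq_int_integrable[of K "\<lambda>x. G x \<bullet> b"] by (auto simp: sq_int_def)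
    qed
    have "(norm (grad (conv f (mollifier (e n))) x - G x))\<^sup>2 =
        (\<Sum>b\<in>Basis. (conv (\<lambda>y. G y \<bullet> b) (mollifier (e n)) x - G x \<bullet> b)\<^sup>2)" for n x
      by (subst power2_norm_eq_inner, subst euclidean_inner)
        (auto simp: inner_diff_left compact_wgrad_mollify(2)[OF assms(1) e(1)] power2_eq_square)
    then have "(LINT x|lborel. (norm (grad (conv f (mollifier (e n))) x - G x))\<^sup>2) =
        (\<Sum>b\<in>Basis. LINT x|lborel. (conv (\<lambda>y. G y \<bullet> b) (mollifier (e n)) x - G x \<bullet> b)\<^sup>2)" for n
      using conv_mollifier_L2_tendsto(1)[OF G e(1) e0]
      by (simp add: Bochner_Integration.integral_sum)
    moreover have "(\<lambda>n. \<Sum>b\<in>Basis. LINT x|lborel. (conv (\<lambda>y. G y \<bullet> b) (mollifier (e n)) x - G x \<bullet> b)\<^sup>2) \<longlonglongrightarrow> (\<Sum>b\<in>(Basis :: 'a set). 0)"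
      by (intro tendsto_sum conv_mollifier_L2_tendsto(2) G e e0)
    ultimately show "(\<lambda>n. LINT x|lborel. (norm (grad (conv f (mollifier (e n))) x - G x))\<^sup>2) \<longlonglongrightarrow> 0" by simp
  qed
qed

lemma grad_eq_0_if_const:
  assumes "open V" "x \<in> V" "\<And>y. y \<in> V \<Longrightarrow> f y = c"
  shows "grad f x = 0"
proof (rule grad_eqI)
  have "(f has_derivative (\<lambda>v. 0)) (at x)"
    by (rule has_derivative_transform_within_open[OF has_derivative_const assms(1,2)]) (simp add: assms(3))
  then show "(f has_derivative (\<lambda>v. 0 \<bullet> v)) (at x)" by simp
qed

text \<open>After multiplication by a cutoff the function can be extended by zero without creating a
  jump, so that it has a weak gradient in the whole space and can be mollified.\<close>

lemma wgrad_cutoff_rep: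
  assumes "open \<Omega>" "wgrad \<Omega> u g" "test_function \<Omega> \<eta>"
  obtains K f G where "compact_wgrad K f G" "K \<subseteq> \<Omega>"
    "AE x in lebesgue_on \<Omega>. f x = \<eta> x * u x"
    "AE x in lebesgue_on \<Omega>. G x = \<eta> x *\<^sub>R g x + u x *\<^sub>R grad \<eta> x"
proof -
  obtain K where K: "compact K" "K \<subseteq> \<Omega>" "\<And>x. x \<notin> K \<Longrightarrow> \<eta> x = 0"
    by (rule test_functionE[OF assms(3)]) blast
  have g0: "grad \<eta> x = 0" if "x \<notin> K" for x
    using grad_eq_0_outside[of K \<eta> x] K that compact_imp_closed by blast
  let ?U = "\<lambda>x. \<eta> x * u x" and ?H = "\<lambda>x. \<eta> x *\<^sub>R g x + u x *\<^sub>R grad \<eta> x"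
  have w: "wgrad \<Omega> ?U ?H" by (rule wgrad_test_mult[OF assms])
  note wm = wgradD(1,2)[OF w, THEN sq_int_measurable]
  have \<Omega>: "\<Omega> \<in> sets borel" and Kb: "K \<in> sets borel" using assms(1) K(1) by (auto intro: borel_compact)
  obtain f where f: "f \<in> borel_measurable borel" "AE x in lebesgue_on \<Omega>. f x = ?U x" "\<And>x. x \<notin> K \<Longrightarrow> f x = 0"
    using lebesgue_on_borel_rep[OF wm(1) \<Omega> Kb _ K(2)] K(3) by auto
  have "AE x in lebesgue_on \<Omega>. x \<notin> K \<longrightarrow> ?H x = 0" using K(3) g0 by auto
  from lebesgue_on_borel_rep_vec[OF wm(2) \<Omega> Kb this K(2)]
  obtain G where G: "G \<in> borel_measurable borel" "AE x in lebesgue_on \<Omega>. G x = ?H x" "\<And>x. x \<notin> K \<Longrightarrow> G x = 0"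
    by auto
  have out: "f x = 0" "G x = 0" if "x \<notin> \<Omega>" for x using that K(2) f(3) G(3) by auto
  have sf: "sq_int lborel f"
    unfolding sq_int_def
  proof
    have "integrable (lebesgue_on \<Omega>) (\<lambda>x. (norm (?U x))\<^sup>2) \<longleftrightarrow> integrable lborel (\<lambda>x. (norm (f x))\<^sup>2)"
      by (rule lebesgue_on_integral_eq(2)[OF _ _ \<Omega>]) (use wm f out in \<open>auto\<close>)
    then show "integrable lborel (\<lambda>x. (norm (f x))\<^sup>2)" using wgradD(1)[OF w] by (simp add: sq_int_def)
  qed (use f in simp)
  have sG: "sq_int lborel G"
    unfolding sq_int_def
  proof
    have "integrable (lebesgue_on \<Omega>) (\<lambda>x. (norm (?H x))\<^sup>2) \<longleftrightarrow> integrable lborel (\<lambda>x. (norm (G x))\<^sup>2)"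
      by (rule lebesgue_on_integral_eq(2)[OF _ _ \<Omega>]) (use wm G out in \<open>auto\<close>)
    then show "integrable lborel (\<lambda>x. (norm (G x))\<^sup>2)" using wgradD(2)[OF w] by (simp add: sq_int_def)
  qed (use G in simp)
  \<comment> \<open>This second cutoff is 1 near \<open>K\<close>: it makes a test function of
    \<Omega> out of a whole-space one and changes neither its values nor its gradient where
    \<open>f\<close> and \<open>G\<close> live.\<close>
  obtain \<zeta> V where \<zeta>: "test_function \<Omega> \<zeta>" "open V" "K \<subseteq> V" "\<And>x. x \<in> V \<Longrightarrow> \<zeta> x = 1"
    by (rule cutoff_exists[OF K(1) assms(1) K(2)]) blast
  have weak: "(LINT x|lborel. f x * (grad \<psi> x \<bullet> b)) = - (LINT x|lborel. (G x \<bullet> b) * \<psi> x)"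
    if \<psi>: "test_function UNIV \<psi>" and b: "b \<in> Basis" for \<psi> b
  proof -
    let ?\<psi> = "\<lambda>x. \<zeta> x * \<psi> x"
    have t: "test_function \<Omega> ?\<psi>"
      by (rule test_function_mult_smooth[OF \<zeta>(1) test_function_smooth[OF \<psi>]])
    have gr: "grad ?\<psi> x = grad \<psi> x" if "x \<in> K" for x
      using grad_mult[OF test_function_has_derivative_grad[OF \<zeta>(1)] test_function_has_derivative_grad[OF \<psi>], of x]
        grad_eq_0_if_const[OF \<zeta>(2) _ \<zeta>(4), of x] \<zeta>(3,4) that by auto
    have "(LINT x|lborel. f x * (grad \<psi> x \<bullet> b)) = (LINT x|lborel. f x * (grad ?\<psi> x \<bullet> b))"
    proof (rule Bochner_Integration.integral_cong)
      show "f x * (grad \<psi> x \<bullet> b) = f x * (grad ?\<psi> x \<bullet> b)" for x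
        by (cases "x \<in> K") (simp_all add: gr f(3))
    qed simp
    also have "\<dots> = (LINT x|lebesgue_on \<Omega>. ?U x * (grad ?\<psi> x \<bullet> b))"
    proof (rule lebesgue_on_integral_eq(1)[OF _ _ \<Omega>, symmetric])
      show "AE x in lebesgue_on \<Omega>. f x * (grad ?\<psi> x \<bullet> b) = ?U x * (grad ?\<psi> x \<bullet> b)"
        using f(2) by eventually_elim simp
    qed (use wm f test_function_measurable[OF t] out in \<open>auto intro!: borel_measurable_times borel_measurable_inner\<close>)
    also have "\<dots> = - (LINT x|lebesgue_on \<Omega>. (?H x \<bullet> b) * ?\<psi> x)" by (rule wgradD(3)[OF w t b])
    also have "(LINT x|lebesgue_on \<Omega>. (?H x \<bullet> b) * ?\<psi> x) = (LINT x|lborel. (G x \<bullet> b) * ?\<psi> x)"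
    proof (rule lebesgue_on_integral_eq(1)[OF _ _ \<Omega>])
      show "AE x in lebesgue_on \<Omega>. (G x \<bullet> b) * ?\<psi> x = (?H x \<bullet> b) * ?\<psi> x"
        using G(2) by eventually_elim simp
    qed (use wm G test_function_measurable[OF t] out in \<open>auto intro!: borel_measurable_times borel_measurable_inner\<close>)
    also have "\<dots> = (LINT x|lborel. (G x \<bullet> b) * \<psi> x)"
    proof (rule Bochner_Integration.integral_cong)
      show "(G x \<bullet> b) * ?\<psi> x = (G x \<bullet> b) * \<psi> x" for x using \<zeta>(3,4) G(3) by (cases "x \<in> K") auto
    qed simp
    finally show ?thesis .
  qed
  have "compact_wgrad K f G"
    unfolding compact_wgrad_def using K(1) f(3) G(3) sf sG weak by auto
  then show ?thesis using that K(2) f(2) G(2) by blast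
qed

text \<open>Locally the components of the gradient integrate to 0 against every test function, in
  particular against reflected mollifiers. Their mollifications therefore vanish, yet converge to
  them in L2.\<close>

lemma wgrad_unique_0:
  assumes "open \<Omega>" "wgrad \<Omega> u g" "AE x in lebesgue_on \<Omega>. u x = 0"
  shows "AE x in lebesgue_on \<Omega>. g x = 0"
proof -
  obtain C :: "nat \<Rightarrow> 'a set" where C: "\<And>n. compact (C n)" "\<And>n. C n \<subseteq> \<Omega>" "\<Omega> = (\<Union>n. C n)"
    using open_Union_compact_subsets[OF assms(1)] by metis
  have "AE x in lebesgue_on \<Omega>. x \<in> C n \<longrightarrow> g x = 0" for n
  proof -
    obtain \<eta> V where \<eta>: "test_function \<Omega> \<eta>" "C n \<subseteq> V" "\<And>x. x \<in> V \<Longrightarrow> \<eta> x = 1"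
      by (rule cutoff_exists[OF C(1) assms(1) C(2)]) blast
    obtain K f G where R: "compact_wgrad K f G" "K \<subseteq> \<Omega>"
      "AE x in lebesgue_on \<Omega>. f x = \<eta> x * u x"
      "AE x in lebesgue_on \<Omega>. G x = \<eta> x *\<^sub>R g x + u x *\<^sub>R grad \<eta> x"
      by (rule wgrad_cutoff_rep[OF assms(1,2) \<eta>(1)])
    note fG = R(1)[unfolded compact_wgrad_def]
    have f0: "AE x in lebesgue_on \<Omega>. f x = 0" using R(3) assms(3) by eventually_elim simp
    have \<Omega>: "\<Omega> \<in> sets borel" using assms(1) by simp
    have "AE x in lebesgue. f x = 0"
    proof -
      have "AE x in lebesgue. x \<in> \<Omega> \<longrightarrow> f x = 0" using f0 \<Omega> by (simp add: AE_restrict_space_iff)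
      then show ?thesis by eventually_elim (use fG R(2) in blast)
    qed
    then have f0': "AE x in lborel. f x = 0" by (simp add: AE_completion_iff)
    have Gb: "AE x in lborel. G x \<bullet> b = 0" if b: "b \<in> Basis" for b
    proof -
      let ?h = "\<lambda>x. G x \<bullet> b"
      have sh: "sq_int lborel ?h" using fG b sq_int_inner_Basis by blast
      have ih: "integrable lborel ?h" using fG sh compact_sq_int_integrable[of K ?h] by auto
      have z: "(LINT x|lborel. ?h x * \<psi> x) = 0" if \<psi>: "test_function UNIV \<psi>" for \<psi>
      proof -
        have "(LINT x|lborel. f x * (grad \<psi> x \<bullet> b)) = 0"
          using f0' by (intro integral_eq_zero_AE) (auto elim: eventually_mono)
        then show ?thesis using fG \<psi> b by auto
      qed
      have "conv ?h (mollifier (inverse (real (Suc n)))) x = 0" for n x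
        unfolding conv_def by (intro z test_function_reflect test_function_mollifier_UNIV) simp
      moreover have "(\<lambda>n. LINT x|lborel. (conv ?h (mollifier (inverse (real (Suc n)))) x - ?h x)\<^sup>2) \<longlonglongrightarrow> 0"
        using sh ih by (intro conv_mollifier_L2_tendsto LIMSEQ_inverse_real_of_nat) (auto simp: sq_int_def)
      ultimately have "(LINT x|lborel. (?h x)\<^sup>2) = 0" by (simp add: LIMSEQ_const_iff)
      then have "AE x in lborel. (?h x)\<^sup>2 = 0"
        using sh by (subst (asm) integral_nonneg_eq_0_iff_AE) (auto simp: sq_int_def)
      then show ?thesis by simp
    qed
    have "AE x in lborel. \<forall>b\<in>Basis. G x \<bullet> b = 0" using Gb by (intro AE_finite_allI) auto
    then have "AE x in lborel. G x = 0" by eventually_elim (simp add: euclidean_all_zero_iff)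
    then have "AE x in lebesgue. G x = 0" by (rule AE_completion)
    then have "AE x in lebesgue_on \<Omega>. G x = 0" using \<Omega> by (auto simp: AE_restrict_space_iff elim: eventually_mono)
    then show ?thesis using R(4) assms(3)
    proof eventually_elim
      case (elim x)
      then show ?case using \<eta>(2,3) by auto
    qed
  qed
  then have "AE x in lebesgue_on \<Omega>. \<forall>n. x \<in> C n \<longrightarrow> g x = 0" by (intro AE_all_countable[THEN iffD2] allI)
  moreover have "AE x in lebesgue_on \<Omega>. x \<in> \<Omega>" using assms(1) by (simp add: AE_restrict_space_iff)
  ultimately show ?thesis by eventually_elim (use C(3) in auto)
qed

lemma wgrad_unique:
  assumes "open \<Omega>" "wgrad \<Omega> u g" "wgrad \<Omega> v h" "AE x in lebesgue_on \<Omega>. u x = v x"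
  shows "AE x in lebesgue_on \<Omega>. g x = h x"
proof -
  have "AE x in lebesgue_on \<Omega>. g x - h x = 0"
    by (rule wgrad_unique_0[OF assms(1) wgrad_diff[OF assms(1-3)]]) (use assms(4) in auto)
  then show ?thesis by simp
qed

section \<open>Chain rule and positive part\<close>

lemma integral_by_parts_compose:
  assumes "test_function A F" "test_function B \<psi>" and \<beta>: "\<And>t. (\<beta> has_real_derivative \<beta>' t) (at t)"
    and c: "continuous_on UNIV \<beta>'"
  shows "(LINT x|lborel. \<beta> (F x) * (grad \<psi> x \<bullet> b)) = - (LINT x|lborel. \<beta>' (F x) * (grad F x \<bullet> b) * \<psi> x)"
proof -
  obtain K where K: "compact K" "K \<subseteq> B" "\<And>x. x \<notin> K \<Longrightarrow> \<psi> x = 0"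
    by (rule test_functionE[OF assms(2)]) blast
  have g0: "grad \<psi> x = 0" if "x \<notin> K" for x
    using grad_eq_0_outside[of K \<psi> x] K that compact_imp_closed by blast
  have c\<beta>: "continuous_on UNIV \<beta>"
    by (rule continuous_at_imp_continuous_on) (use \<beta> DERIV_isCont in blast)
  note co = continuous_on_compose2[OF c\<beta> test_function_continuous[OF assms(1)]]
    continuous_on_compose2[OF c test_function_continuous[OF assms(1)]]
    test_function_continuous[OF assms(2)] test_function_continuous_grad[OF assms(1)]
    test_function_continuous_grad[OF assms(2)]
  have c1: "continuous_on UNIV (\<lambda>x. \<beta> (F x) * (grad \<psi> x \<bullet> b))" by (intro continuous_intros co) auto
  have c2: "continuous_on UNIV (\<lambda>x. \<beta>' (F x) * (grad F x \<bullet> b) * \<psi> x)" by (intro continuous_intros co) auto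
  let ?F' = "\<lambda>x v. \<beta> (F x) * (grad \<psi> x \<bullet> v) + \<beta>' (F x) * (grad F x \<bullet> v) * \<psi> x"
  have "(LINT x|lborel. ?F' x b) = 0"
  proof (rule integral_directional_derivative_eq_0[OF _ _ K(1)])
    show "((\<lambda>x. \<beta> (F x) * \<psi> x) has_derivative ?F' x) (at x)" for x
    proof -
      have "((\<lambda>x. \<beta> (F x)) has_derivative (\<lambda>v. \<beta>' (F x) * (grad F x \<bullet> v))) (at x)"
        by (rule has_derivative_compose[OF test_function_has_derivative_grad[OF assms(1)]])
          (use \<beta> in \<open>simp add: has_field_derivative_def\<close>)
      from has_derivative_mult[OF this test_function_has_derivative_grad[OF assms(2)]] show ?thesis by simp
    qed
    show "continuous_on UNIV (\<lambda>x. ?F' x b)" by (intro continuous_on_add c1 c2)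
  qed (simp add: K(3))
  moreover have "integrable lborel (\<lambda>x. \<beta> (F x) * (grad \<psi> x \<bullet> b))"
    by (rule compact_support_integrable[OF c1 K(1)]) (simp add: g0)
  moreover have "integrable lborel (\<lambda>x. \<beta>' (F x) * (grad F x \<bullet> b) * \<psi> x)"
    by (rule compact_support_integrable[OF c2 K(1)]) (simp add: K(3))
  ultimately show ?thesis by simp
qed

text \<open>The chain rule is exact for smooth approximations \<open>F n\<close> of \<open>u\<close>
  cut off near the support of the test function. The left side passes to the limit in L2 as \<beta>
  is Lipschitz. On the right \<open>\<beta>' (F n)\<close> converges only almost everywhere along a
  subsequence, so that side is split in two.\<close>

lemma wgrad_compose:
  fixes \<beta> :: "real \<Rightarrow> real"
  assumes "open \<Omega>" "wgrad \<Omega> u g" and \<beta>: "\<And>t. (\<beta> has_real_derivative \<beta>' t) (at t)"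
    and c: "continuous_on UNIV \<beta>'" and B: "\<And>t. \<bar>\<beta>' t\<bar> \<le> B" and "\<beta> 0 = 0"
  shows "wgrad \<Omega> (\<lambda>x. \<beta> (u x)) (\<lambda>x. \<beta>' (u x) *\<^sub>R g x)"
proof (rule wgradI)
  note ug = wgradD(1,2)[OF assms(2)]
  have "B \<ge> 0" using B[of 0] by linarith
  have lip: "\<bar>\<beta> s - \<beta> t\<bar> \<le> B * \<bar>s - t\<bar>" for s t
    using field_differentiable_bound[of UNIV \<beta> \<beta>' B s t] \<beta> B by auto
  have c\<beta>: "continuous_on UNIV \<beta>"
    by (rule continuous_at_imp_continuous_on) (use \<beta> DERIV_isCont in blast)
  have [measurable]: "\<beta> \<in> borel_measurable borel" "\<beta>' \<in> borel_measurable borel"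
    using c\<beta> c by (auto intro: borel_measurable_continuous_onI)
  note [measurable] = ug[THEN sq_int_measurable]
  show "sq_int (lebesgue_on \<Omega>) (\<lambda>x. \<beta> (u x))"
    by (rule sq_int_bound[OF sq_int_cmult[OF ug(1), of B]])
      (use lip[of "u _" 0] \<open>B \<ge> 0\<close> \<open>\<beta> 0 = 0\<close> in \<open>auto simp: abs_mult\<close>)
  show "sq_int (lebesgue_on \<Omega>) (\<lambda>x. \<beta>' (u x) *\<^sub>R g x)"
    by (rule sq_int_bounded_scaleR[OF ug(2) _ B]) simp
  fix \<psi> and b :: 'a assume \<psi>: "test_function \<Omega> \<psi>" and b: "b \<in> Basis"
  obtain L where L: "compact L" "L \<subseteq> \<Omega>" "\<And>x. x \<notin> L \<Longrightarrow> \<psi> x = 0"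
    by (rule test_functionE[OF \<psi>]) blast
  have g0: "grad \<psi> x = 0" if "x \<notin> L" for x
    using grad_eq_0_outside[of L \<psi> x] L that compact_imp_closed by blast
  obtain \<eta> V where \<eta>: "test_function \<Omega> \<eta>" "open V" "L \<subseteq> V" "\<And>x. x \<in> V \<Longrightarrow> \<eta> x = 1"
    by (rule cutoff_exists[OF L(1) assms(1) L(2)]) blast
  obtain K f G where R: "compact_wgrad K f G" "K \<subseteq> \<Omega>"
      "AE x in lebesgue_on \<Omega>. f x = \<eta> x * u x"
      "AE x in lebesgue_on \<Omega>. G x = \<eta> x *\<^sub>R g x + u x *\<^sub>R grad \<eta> x"
    by (rule wgrad_cutoff_rep[OF assms(1,2) \<eta>(1)])
  note fG = R(1)[unfolded compact_wgrad_def]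
  obtain F where F: "\<And>n. test_function {x + y |x y. x \<in> K \<and> y \<in> cball 0 1} (F n)"
    "(\<lambda>n. LINT x|lborel. (F n x - f x)\<^sup>2) \<longlonglongrightarrow> 0"
    "(\<lambda>n. LINT x|lborel. (norm (grad (F n) x - G x))\<^sup>2) \<longlonglongrightarrow> 0"
    by (rule compact_wgrad_approx[OF R(1), of 1]) auto
  have tsq: "sq_int lborel \<psi>" "sq_int lborel (grad \<psi>)" if tf: "test_function A \<psi>" for \<psi> :: "'a \<Rightarrow> real" and A
  proof -
    obtain L where L: "compact L" "L \<subseteq> A" "\<And>x. x \<notin> L \<Longrightarrow> \<psi> x = 0"
      by (rule test_functionE[OF tf]) blast
    have g0: "grad \<psi> x = 0" if "x \<notin> L" for x
      using grad_eq_0_outside[of L \<psi> x] L that compact_imp_closed by blast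
    note co = test_function_continuous[OF tf] test_function_continuous_grad[OF tf]
    show "sq_int lborel \<psi>" unfolding sq_int_def using test_function_measurable[OF tf]
      by (intro conjI compact_support_integrable[OF _ L(1)] continuous_intros co) (auto simp: L(3))
    show "sq_int lborel (grad \<psi>)" unfolding sq_int_def using test_function_measurable[OF tf]
      by (intro conjI compact_support_integrable[OF _ L(1)] continuous_intros co) (auto simp: g0)
  qed
  have f: "sq_int lborel f" and G: "sq_int lborel G" using fG by auto
  note [measurable] = sq_int_measurable[OF f, simplified] sq_int_measurable[OF G, simplified]
    test_function_measurable(3,4)[OF F(1)] test_function_measurable(3,4)[OF \<psi>]
  have s\<psi>: "sq_int lborel (\<lambda>x. grad \<psi> x \<bullet> b)" using sq_int_inner_Basis[OF tsq(2)[OF \<psi>] b] .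
  have s\<beta>: "sq_int lborel (\<lambda>x. \<beta> (h x))" if "sq_int lborel h" for h :: "'a \<Rightarrow> real"
  proof (rule sq_int_bound[OF sq_int_cmult[OF that, of B]])
    have [measurable]: "h \<in> borel_measurable borel" using sq_int_measurable[OF that] by simp
    show "(\<lambda>x. \<beta> (h x)) \<in> borel_measurable lborel" by simp
    show "AE x in lborel. norm (\<beta> (h x)) \<le> norm (B * h x)"
      using lip[of "h _" 0] \<open>B \<ge> 0\<close> \<open>\<beta> 0 = 0\<close> by (auto simp: abs_mult)
  qed
  have fn: "sq_int lborel (F n)" and gn: "sq_int lborel (grad (F n))" for n using tsq[OF F(1)] by auto
  obtain r where r: "strict_mono r" "AE x in lborel. (\<lambda>n. F (r n) x) \<longlonglongrightarrow> f x"
    using L2_tendsto_AE_subseq[of lborel F f] fn f F(2) by auto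
  have lhs: "(\<lambda>n. LINT x|lborel. \<beta> (F n x) * (grad \<psi> x \<bullet> b)) \<longlonglongrightarrow> (LINT x|lborel. \<beta> (f x) * (grad \<psi> x \<bullet> b))"
  proof (rule L2_tendsto_integral_mult)
    have "(\<lambda>n. LINT x|lborel. (norm (\<beta> (F n x) - \<beta> (f x)))\<^sup>2) \<longlonglongrightarrow> 0"
    proof (rule sq_int_tendsto_0_bound[where g="\<lambda>n x. B * (F n x - f x)"])
      show "AE x in lborel. norm (\<beta> (F n x) - \<beta> (f x)) \<le> norm (B * (F n x - f x))" for n
        using lip \<open>B \<ge> 0\<close> by (auto simp: abs_mult)
      show "(\<lambda>n. LINT x|lborel. (norm (B * (F n x - f x)))\<^sup>2) \<longlonglongrightarrow> 0"
        using tendsto_mult_right_zero[OF F(2), of "B\<^sup>2"] by (simp add: power_mult_distrib)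
    qed (auto intro!: sq_int_cmult sq_int_diff fn f)
    then show "(\<lambda>n. LINT x|lborel. (\<beta> (F n x) - \<beta> (f x))\<^sup>2) \<longlonglongrightarrow> 0" by simp
  qed (auto intro!: s\<beta> fn f s\<psi>)
  define w where "w n x = \<beta>' (F n x) * \<psi> x" for n x
  have sw: "sq_int lborel (w n)" for n unfolding w_def
    using sq_int_bounded_scaleR[OF tsq(1)[OF \<psi>] _ B, of "\<lambda>x. F n x"] by simp
  have s\<beta>\<psi>: "sq_int lborel (\<lambda>x. \<beta>' (f x) * \<psi> x)"
    using sq_int_bounded_scaleR[OF tsq(1)[OF \<psi>] _ B, of f] by simp
  have sGb: "sq_int lborel (\<lambda>x. G x \<bullet> b)" and sgb: "sq_int lborel (\<lambda>x. grad (F n) x \<bullet> b)" for n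
    using sq_int_inner_Basis[OF G b] sq_int_inner_Basis[OF gn b] by auto
  \<comment> \<open>First half: the gradients converge in L2 and \<open>w n\<close> stays bounded in
    L2, whatever \<open>\<beta>' (F n)\<close> does.\<close>
  have 1: "(\<lambda>n. LINT x|lborel. (grad (F n) x \<bullet> b - G x \<bullet> b) * w n x) \<longlonglongrightarrow> 0"
  proof (rule Lim_null_comparison)
    let ?W = "B\<^sup>2 * (LINT x|lborel. (\<psi> x)\<^sup>2)"
    have "(\<lambda>n. sqrt ((LINT x|lborel. (norm (grad (F n) x - G x))\<^sup>2) * ?W)) \<longlonglongrightarrow> sqrt (0 * ?W)"
      by (intro tendsto_intros F)
    then show "(\<lambda>n. sqrt ((LINT x|lborel. (norm (grad (F n) x - G x))\<^sup>2) * ?W)) \<longlonglongrightarrow> 0" by simp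
    have "\<bar>LINT x|lborel. (grad (F n) x \<bullet> b - G x \<bullet> b) * w n x\<bar> \<le>
      sqrt ((LINT x|lborel. (norm (grad (F n) x - G x))\<^sup>2) * ?W)" for n
    proof (rule real_le_rsqrt)
      have "\<bar>LINT x|lborel. (grad (F n) x \<bullet> b - G x \<bullet> b) * w n x\<bar>\<^sup>2 \<le>
        (LINT x|lborel. (grad (F n) x \<bullet> b - G x \<bullet> b)\<^sup>2) * (LINT x|lborel. (w n x)\<^sup>2)"
        using integral_Cauchy_Schwarz[OF sq_int_diff[OF sgb sGb] sw] by simp
      also have "\<dots> \<le> (LINT x|lborel. (norm (grad (F n) x - G x))\<^sup>2) * ?W"
      proof (rule mult_mono)
        show "(LINT x|lborel. (grad (F n) x \<bullet> b - G x \<bullet> b)\<^sup>2) \<le> (LINT x|lborel. (norm (grad (F n) x - G x))\<^sup>2)"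
        proof (rule integral_mono)
          show "integrable lborel (\<lambda>x. (grad (F n) x \<bullet> b - G x \<bullet> b)\<^sup>2)"
            using sq_int_diff[OF sgb sGb] by (simp add: sq_int_def)
          show "integrable lborel (\<lambda>x. (norm (grad (F n) x - G x))\<^sup>2)"
            using sq_int_diff[OF gn G] by (simp add: sq_int_def)
          show "(grad (F n) x \<bullet> b - G x \<bullet> b)\<^sup>2 \<le> (norm (grad (F n) x - G x))\<^sup>2" for x
            using Basis_le_norm[OF b, of "grad (F n) x - G x"]
            by (simp add: inner_diff_left[symmetric] abs_le_square_iff[symmetric])
        qed
        have "(LINT x|lborel. (w n x)\<^sup>2) \<le> (LINT x|lborel. B\<^sup>2 * (\<psi> x)\<^sup>2)"
        proof (rule integral_mono)
          show "(w n x)\<^sup>2 \<le> B\<^sup>2 * (\<psi> x)\<^sup>2" for x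
            using B[of "F n x"] \<open>B \<ge> 0\<close>
            by (auto simp: w_def power_mult_distrib abs_le_square_iff[symmetric] intro!: mult_right_mono)
        qed (use sw tsq(1)[OF \<psi>] in \<open>auto simp: sq_int_def\<close>)
        then show "(LINT x|lborel. (w n x)\<^sup>2) \<le> ?W" by simp
      qed auto
      finally show "\<bar>LINT x|lborel. (grad (F n) x \<bullet> b - G x \<bullet> b) * w n x\<bar>\<^sup>2 \<le>
        (LINT x|lborel. (norm (grad (F n) x - G x))\<^sup>2) * ?W" .
    qed
    then show "\<forall>\<^sub>F n in sequentially. norm (LINT x|lborel. (grad (F n) x \<bullet> b - G x \<bullet> b) * w n x) \<le>
      sqrt ((LINT x|lborel. (norm (grad (F n) x - G x))\<^sup>2) * ?W)" by simp
  qed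
  \<comment> \<open>Second half: with the gradient frozen at \<open>G\<close>, almost everywhere
    convergence and the bound on \<beta>' allow dominated convergence along
    \<open>r\<close>.\<close>
  have 2: "(\<lambda>n. LINT x|lborel. (G x \<bullet> b) * w (r n) x) \<longlonglongrightarrow> (LINT x|lborel. (G x \<bullet> b) * (\<beta>' (f x) * \<psi> x))"
  proof (rule integral_dominated_convergence[where w="\<lambda>x. B * \<bar>(G x \<bullet> b) * \<psi> x\<bar>"])
    show "integrable lborel (\<lambda>x. B * \<bar>(G x \<bullet> b) * \<psi> x\<bar>)"
      using sq_int_mult_integrable[OF sGb tsq(1)[OF \<psi>]] by auto
    show "AE x in lborel. (\<lambda>n. (G x \<bullet> b) * w (r n) x) \<longlonglongrightarrow> (G x \<bullet> b) * (\<beta>' (f x) * \<psi> x)"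
      using r(2)
    proof eventually_elim
      case (elim x)
      then have "(\<lambda>n. \<beta>' (F (r n) x)) \<longlonglongrightarrow> \<beta>' (f x)"
        using continuous_on_tendsto_compose[OF c] by auto
      then show ?case unfolding w_def by (intro tendsto_intros)
    qed
    show "AE x in lborel. norm ((G x \<bullet> b) * w (r n) x) \<le> B * \<bar>(G x \<bullet> b) * \<psi> x\<bar>" for n
    proof (rule AE_I2)
      fix x
      have "\<bar>\<beta>' (F (r n) x)\<bar> * \<bar>(G x \<bullet> b) * \<psi> x\<bar> \<le> B * \<bar>(G x \<bullet> b) * \<psi> x\<bar>" by (intro mult_right_mono B) simp
      then show "norm ((G x \<bullet> b) * w (r n) x) \<le> B * \<bar>(G x \<bullet> b) * \<psi> x\<bar>"
        by (simp add: w_def abs_mult mult_ac)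
    qed
  qed (auto simp: w_def)
  have "(\<lambda>n. LINT x|lborel. (grad (F (r n)) x \<bullet> b) * w (r n) x) \<longlonglongrightarrow> 0 + (LINT x|lborel. (G x \<bullet> b) * (\<beta>' (f x) * \<psi> x))"
  proof -
    have "(LINT x|lborel. (grad (F n) x \<bullet> b) * w n x) =
      (LINT x|lborel. (grad (F n) x \<bullet> b - G x \<bullet> b) * w n x) + (LINT x|lborel. (G x \<bullet> b) * w n x)" for n
      using sq_int_mult_integrable[OF sgb sw] sq_int_mult_integrable[OF sGb sw] by (simp add: left_diff_distrib)
    then show ?thesis
      using tendsto_add[OF LIMSEQ_subseq_LIMSEQ[OF 1 r(1)] 2] by (simp add: o_def)
  qed
  moreover have "(LINT x|lborel. (grad (F n) x \<bullet> b) * w n x) = - (LINT x|lborel. \<beta> (F n x) * (grad \<psi> x \<bullet> b))" for n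
    using integral_by_parts_compose[OF F(1) \<psi> \<beta> c] by (simp add: w_def mult_ac)
  ultimately have "(\<lambda>n. - (LINT x|lborel. \<beta> (F (r n) x) * (grad \<psi> x \<bullet> b))) \<longlonglongrightarrow> (LINT x|lborel. (G x \<bullet> b) * (\<beta>' (f x) * \<psi> x))"
    by simp
  moreover have "(\<lambda>n. - (LINT x|lborel. \<beta> (F (r n) x) * (grad \<psi> x \<bullet> b))) \<longlonglongrightarrow> - (LINT x|lborel. \<beta> (f x) * (grad \<psi> x \<bullet> b))"
    using LIMSEQ_subseq_LIMSEQ[OF lhs r(1)] by (intro tendsto_minus) (simp add: o_def)
  ultimately have eq: "- (LINT x|lborel. \<beta> (f x) * (grad \<psi> x \<bullet> b)) = (LINT x|lborel. (G x \<bullet> b) * (\<beta>' (f x) * \<psi> x))"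
    using LIMSEQ_unique by blast
  have \<Omega>: "\<Omega> \<in> sets borel" using assms(1) by simp
  note [measurable] = test_function_measurable(1,2)[OF \<psi>, of \<Omega>]
  have "(LINT x|lebesgue_on \<Omega>. \<beta> (u x) * (grad \<psi> x \<bullet> b)) = (LINT x|lborel. \<beta> (f x) * (grad \<psi> x \<bullet> b))"
  proof (rule lebesgue_on_integral_eq(1)[OF _ _ \<Omega>])
    show "AE x in lebesgue_on \<Omega>. \<beta> (f x) * (grad \<psi> x \<bullet> b) = \<beta> (u x) * (grad \<psi> x \<bullet> b)"
      using R(3)
    proof eventually_elim
      case (elim x)
      then show ?case using \<eta>(3,4) g0 by (cases "x \<in> L") auto
    qed
    have "grad \<psi> x = 0" if "x \<notin> \<Omega>" for x using that L(2) by (intro g0) auto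
    then show "\<beta> (f x) * (grad \<psi> x \<bullet> b) = 0" if "x \<notin> \<Omega>" for x using that by simp
  qed auto
  moreover have "(LINT x|lebesgue_on \<Omega>. (\<beta>' (u x) *\<^sub>R g x \<bullet> b) * \<psi> x) = (LINT x|lborel. (G x \<bullet> b) * (\<beta>' (f x) * \<psi> x))"
  proof (rule lebesgue_on_integral_eq(1)[OF _ _ \<Omega>])
    show "AE x in lebesgue_on \<Omega>. (G x \<bullet> b) * (\<beta>' (f x) * \<psi> x) = (\<beta>' (u x) *\<^sub>R g x \<bullet> b) * \<psi> x"
      using R(3,4)
    proof eventually_elim
      case (elim x)
      show ?case
      proof (cases "x \<in> L")
        case True
        then have "\<eta> x = 1" "grad \<eta> x = 0" using \<eta>(3,4) grad_eq_0_if_const[OF \<eta>(2) _ \<eta>(4)] by auto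
        then show ?thesis using elim by simp
      qed (simp add: L(3))
    qed
  qed (use L in auto)
  ultimately show "(LINT x|lebesgue_on \<Omega>. \<beta> (u x) * (grad \<psi> x \<bullet> b)) =
        - (LINT x|lebesgue_on \<Omega>. (\<beta>' (u x) *\<^sub>R g x \<bullet> b) * \<psi> x)"
    using eq by simp
qed

text \<open>\<open>smooth_pos d\<close> vanishes on the negative half line, so that the limit gradient below carries
  the indicator of \<open>u > 0\<close> and no contribution from \<open>u = 0\<close>.\<close>

definition smooth_pos :: "real \<Rightarrow> real \<Rightarrow> real" where
  "smooth_pos d t = (if t > 0 then sqrt (t\<^sup>2 + d\<^sup>2) - d else 0)"

definition smooth_pos_deriv :: "real \<Rightarrow> real \<Rightarrow> real" where
  "smooth_pos_deriv d t = max t 0 / sqrt ((max t 0)\<^sup>2 + d\<^sup>2)"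

lemma smooth_pos_DERIV:
  assumes "d > 0" shows "(smooth_pos d has_real_derivative smooth_pos_deriv d t) (at t)"
proof -
  have D: "((\<lambda>t. sqrt (t\<^sup>2 + d\<^sup>2) - d) has_real_derivative t / sqrt (t\<^sup>2 + d\<^sup>2)) (at t)" for t
  proof -
    have "t\<^sup>2 + d\<^sup>2 > 0" using assms by (simp add: add_nonneg_pos)
    then show ?thesis by (auto intro!: derivative_eq_intros simp: field_simps)
  qed
  consider "t > 0" | "t < 0" | "t = 0" by linarith
  then show ?thesis
  proof cases
    case 1
    have "((\<lambda>t. sqrt (t\<^sup>2 + d\<^sup>2) - d) has_real_derivative smooth_pos_deriv d t) (at t)"
      using D[of t] 1 by (simp add: smooth_pos_deriv_def)
    then show ?thesis
      by (rule has_field_derivative_transform_within_open[where S="{0<..}"])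
        (use 1 in \<open>auto simp: smooth_pos_def\<close>)
  next
    case 2
    have "((\<lambda>t. 0) has_real_derivative smooth_pos_deriv d t) (at t)"
      using 2 by (simp add: smooth_pos_deriv_def)
    then show ?thesis
      by (rule has_field_derivative_transform_within_open[where S="{..<0}"])
        (use 2 in \<open>auto simp: smooth_pos_def\<close>)
  next
    case 3
    have "((\<lambda>h. (smooth_pos d (0 + h) - smooth_pos d 0) / h) \<longlongrightarrow> 0) (at 0)"
    proof (rule filterlim_split_at)
      show "((\<lambda>h. (smooth_pos d (0 + h) - smooth_pos d 0) / h) \<longlongrightarrow> 0) (at_left 0)"
        by (rule tendsto_eventually) (auto simp: eventually_at_filter smooth_pos_def)
      have "((\<lambda>h. (sqrt ((0 + h)\<^sup>2 + d\<^sup>2) - d - (sqrt (0\<^sup>2 + d\<^sup>2) - d)) / h) \<longlongrightarrow> 0) (at 0)"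
        using D[of 0] by (simp add: DERIV_def)
      then have "((\<lambda>h. (sqrt (h\<^sup>2 + d\<^sup>2) - d) / h) \<longlongrightarrow> 0) (at_right 0)"
        using assms by (auto intro: filterlim_mono[OF _ order_refl at_le])
      then show "((\<lambda>h. (smooth_pos d (0 + h) - smooth_pos d 0) / h) \<longlongrightarrow> 0) (at_right 0)"
        by (rule Lim_transform_eventually) (auto simp: eventually_at_filter smooth_pos_def)
    qed
    then show ?thesis using 3 by (subst DERIV_def) (simp add: smooth_pos_deriv_def)
  qed
qed

lemma smooth_pos_deriv_bound:
  assumes "d > 0" shows "\<bar>smooth_pos_deriv d t\<bar> \<le> 1"
proof -
  have "max t 0 \<le> sqrt ((max t 0)\<^sup>2 + d\<^sup>2)" by (rule real_le_rsqrt) simp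
  moreover have "0 < sqrt ((max t 0)\<^sup>2 + d\<^sup>2)" using assms by (simp add: add_nonneg_pos)
  ultimately show ?thesis by (simp add: smooth_pos_deriv_def)
qed

lemma smooth_pos_deriv_continuous:
  assumes "d > 0" shows "continuous_on UNIV (smooth_pos_deriv d)"
proof -
  have "0 < (max t 0)\<^sup>2 + d\<^sup>2" for t :: real using assms by (simp add: add_nonneg_pos)
  then have "(max t 0)\<^sup>2 + d\<^sup>2 \<noteq> 0" for t :: real by (metis less_irrefl)
  then show ?thesis unfolding smooth_pos_deriv_def by (intro continuous_intros) auto
qed

lemma smooth_pos_bound: "d > 0 \<Longrightarrow> \<bar>smooth_pos d t\<bar> \<le> \<bar>t\<bar>"
proof -
  assume "d > 0"
  have "sqrt (t\<^sup>2 + d\<^sup>2) \<le> \<bar>t\<bar> + d"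
    using \<open>d > 0\<close> by (intro real_le_lsqrt) (auto simp: power2_sum)
  moreover have "d \<le> sqrt (t\<^sup>2 + d\<^sup>2)" by (rule real_le_rsqrt) simp
  ultimately show ?thesis by (auto simp: smooth_pos_def)
qed

lemma wgrad_pos:
  assumes "open \<Omega>" "wgrad \<Omega> u g"
  shows "wgrad \<Omega> (\<lambda>x. max (u x) 0) (\<lambda>x. if u x > 0 then g x else 0)"
proof (rule wgradI)
  note ug = wgradD(1,2)[OF assms(2)]
  note [measurable] = ug[THEN sq_int_measurable]
  show sp: "sq_int (lebesgue_on \<Omega>) (\<lambda>x. max (u x) 0)" by (rule sq_int_bound[OF ug(1)]) auto
  show sg: "sq_int (lebesgue_on \<Omega>) (\<lambda>x. if u x > 0 then g x else 0)" by (rule sq_int_bound[OF ug(2)]) auto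
  fix \<psi> and b :: 'a assume \<psi>: "test_function \<Omega> \<psi>" and b: "b \<in> Basis"
  note [measurable] = test_function_measurable(1,2)[OF \<psi>, of \<Omega>]
  define d where "d n = inverse (real (Suc n))" for n
  have d: "d n > 0" "d \<longlonglongrightarrow> 0" for n unfolding d_def using LIMSEQ_inverse_real_of_nat by auto
  have w: "wgrad \<Omega> (\<lambda>x. smooth_pos (d n) (u x)) (\<lambda>x. smooth_pos_deriv (d n) (u x) *\<^sub>R g x)" for n
    by (rule wgrad_compose[OF assms smooth_pos_DERIV smooth_pos_deriv_continuous smooth_pos_deriv_bound])
      (use d in \<open>auto simp: smooth_pos_def\<close>)
  note wm = wgradD(1,2)[OF w, THEN sq_int_measurable]
  have [measurable]: "smooth_pos_deriv (d n) \<in> borel_measurable borel" for n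
    by (rule borel_measurable_continuous_onI[OF smooth_pos_deriv_continuous[OF d(1)]])
  note t = test_function_sq_int[OF \<psi> assms(1)]
  have p: "(\<lambda>n. smooth_pos (d n) s) \<longlonglongrightarrow> max s 0" for s
  proof (cases "s > 0")
    case True
    have "(\<lambda>n. sqrt (s\<^sup>2 + (d n)\<^sup>2) - d n) \<longlonglongrightarrow> sqrt (s\<^sup>2 + 0\<^sup>2) - 0" by (intro tendsto_intros d)
    then show ?thesis using True by (simp add: smooth_pos_def)
  qed (auto simp: smooth_pos_def)
  have p': "(\<lambda>n. smooth_pos_deriv (d n) s) \<longlonglongrightarrow> (if s > 0 then 1 else 0)" for s
  proof (cases "s > 0")
    case True
    have "(\<lambda>n. s / sqrt (s\<^sup>2 + (d n)\<^sup>2)) \<longlonglongrightarrow> s / sqrt (s\<^sup>2 + 0\<^sup>2)" using True by (intro tendsto_intros d) auto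
    then show ?thesis using True by (simp add: smooth_pos_deriv_def)
  qed (auto simp: smooth_pos_deriv_def)
  have 1: "(\<lambda>n. LINT x|lebesgue_on \<Omega>. smooth_pos (d n) (u x) * (grad \<psi> x \<bullet> b)) \<longlonglongrightarrow>
    (LINT x|lebesgue_on \<Omega>. max (u x) 0 * (grad \<psi> x \<bullet> b))"
  proof (rule integral_dominated_convergence[where w="\<lambda>x. \<bar>u x * (grad \<psi> x \<bullet> b)\<bar>"])
    show "integrable (lebesgue_on \<Omega>) (\<lambda>x. \<bar>u x * (grad \<psi> x \<bullet> b)\<bar>)"
      using sq_int_mult_integrable[OF ug(1) sq_int_inner_Basis[OF t(2) b]] by auto
    show "AE x in lebesgue_on \<Omega>. (\<lambda>n. smooth_pos (d n) (u x) * (grad \<psi> x \<bullet> b)) \<longlonglongrightarrow> max (u x) 0 * (grad \<psi> x \<bullet> b)"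
      by (intro AE_I2 tendsto_intros p)
    show "AE x in lebesgue_on \<Omega>. norm (smooth_pos (d n) (u x) * (grad \<psi> x \<bullet> b)) \<le> \<bar>u x * (grad \<psi> x \<bullet> b)\<bar>" for n
      using smooth_pos_bound[OF d(1)] by (auto simp: abs_mult intro!: AE_I2 mult_right_mono)
  qed (use wm in auto)
  have 2: "(\<lambda>n. LINT x|lebesgue_on \<Omega>. (smooth_pos_deriv (d n) (u x) *\<^sub>R g x \<bullet> b) * \<psi> x) \<longlonglongrightarrow>
    (LINT x|lebesgue_on \<Omega>. ((if u x > 0 then g x else 0) \<bullet> b) * \<psi> x)"
  proof (rule integral_dominated_convergence[where w="\<lambda>x. \<bar>(g x \<bullet> b) * \<psi> x\<bar>"])
    show "integrable (lebesgue_on \<Omega>) (\<lambda>x. \<bar>(g x \<bullet> b) * \<psi> x\<bar>)"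
      using sq_int_mult_integrable[OF sq_int_inner_Basis[OF ug(2) b] t(1)] by auto
    have "(if u x > 0 then g x else 0) = (if u x > 0 then 1 else 0) *\<^sub>R g x" for x by simp
    then show "AE x in lebesgue_on \<Omega>. (\<lambda>n. (smooth_pos_deriv (d n) (u x) *\<^sub>R g x \<bullet> b) * \<psi> x) \<longlonglongrightarrow>
        ((if u x > 0 then g x else 0) \<bullet> b) * \<psi> x"
      by (simp only:) (intro AE_I2 tendsto_intros p')
    show "AE x in lebesgue_on \<Omega>. norm ((smooth_pos_deriv (d n) (u x) *\<^sub>R g x \<bullet> b) * \<psi> x) \<le> \<bar>(g x \<bullet> b) * \<psi> x\<bar>" for n
    proof (rule AE_I2)
      fix x
      have "\<bar>smooth_pos_deriv (d n) (u x)\<bar> * \<bar>(g x \<bullet> b) * \<psi> x\<bar> \<le> 1 * \<bar>(g x \<bullet> b) * \<psi> x\<bar>"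
        by (intro mult_right_mono smooth_pos_deriv_bound d) simp
      then show "norm ((smooth_pos_deriv (d n) (u x) *\<^sub>R g x \<bullet> b) * \<psi> x) \<le> \<bar>(g x \<bullet> b) * \<psi> x\<bar>"
        by (simp add: abs_mult mult_ac)
    qed
  qed (use wm in \<open>auto intro!: borel_measurable_times borel_measurable_inner\<close>)
  have "(\<lambda>n. - (LINT x|lebesgue_on \<Omega>. (smooth_pos_deriv (d n) (u x) *\<^sub>R g x \<bullet> b) * \<psi> x)) \<longlonglongrightarrow>
      - (LINT x|lebesgue_on \<Omega>. ((if u x > 0 then g x else 0) \<bullet> b) * \<psi> x)" by (intro tendsto_minus 2)
  then show "(LINT x|lebesgue_on \<Omega>. max (u x) 0 * (grad \<psi> x \<bullet> b)) =
        - (LINT x|lebesgue_on \<Omega>. ((if u x > 0 then g x else 0) \<bullet> b) * \<psi> x)"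
    using LIMSEQ_unique[OF 1] wgradD(3)[OF w \<psi> b] by simp
qed

text \<open>Write u as positive part minus negative part: the gradient formula for the difference is
  0 on {u = 0}, and it equals \<open>g\<close> almost everywhere by uniqueness.\<close>

lemma wgrad_0_on_zero_set:
  assumes "open \<Omega>" "wgrad \<Omega> u g"
  shows "AE x in lebesgue_on \<Omega>. u x = 0 \<longrightarrow> g x = 0"
proof -
  note p = wgrad_pos[OF assms]
  note m = wgrad_pos[OF assms(1) wgrad_cmult[OF assms(2), of "-1"]]
  have "AE x in lebesgue_on \<Omega>. (if u x > 0 then g x else 0) - (if -1 * u x > 0 then -1 *\<^sub>R g x else 0) = g x"
    by (rule wgrad_unique[OF assms(1) wgrad_diff[OF assms(1) p m] assms(2)]) (auto simp: max_def)
  then show ?thesis by eventually_elim (auto split: if_splits)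
qed

section \<open>Functions with zero trace\<close>

lemma smooth_wgrad:
  assumes "open \<Omega>" "smooth_on UNIV f" "sq_int (lebesgue_on \<Omega>) f" "sq_int (lebesgue_on \<Omega>) (grad f)"
  shows "wgrad \<Omega> f (grad f)"
proof (rule wgradI[OF assms(3,4)])
  fix \<psi> and b :: 'a assume \<psi>: "test_function \<Omega> \<psi>" and b: "b \<in> Basis"
  obtain L where L: "compact L" "L \<subseteq> \<Omega>" "\<And>x. x \<notin> L \<Longrightarrow> \<psi> x = 0"
    by (rule test_functionE[OF \<psi>]) blast
  have g0: "grad \<psi> x = 0" if "x \<notin> L" for x
    using grad_eq_0_outside[of L \<psi> x] L that compact_imp_closed by blast
  have df: "(f has_derivative (\<lambda>v. grad f x \<bullet> v)) (at x)" for x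
    using smooth_on_has_derivative[OF assms(2), of x] has_derivative_grad[of f _ x]
    by (metis (no_types, lifting) UNIV_I ext)
  note co = smooth_on_imp_continuous_on[OF assms(2)] smooth_on_continuous_grad[OF assms(2)]
    test_function_continuous[OF \<psi>] test_function_continuous_grad[OF \<psi>]
  have c1: "continuous_on UNIV (\<lambda>x. f x * (grad \<psi> x \<bullet> b))"
    and c2: "continuous_on UNIV (\<lambda>x. (grad f x \<bullet> b) * \<psi> x)" by (intro continuous_intros co)+
  have i: "integrable lborel (\<lambda>x. f x * (grad \<psi> x \<bullet> b))" "integrable lborel (\<lambda>x. (grad f x \<bullet> b) * \<psi> x)"
    using compact_support_integrable[OF c1 L(1)] compact_support_integrable[OF c2 L(1)] g0 L(3) by auto
  have "(LINT x|lborel. f x * (grad \<psi> x \<bullet> b) + (grad f x \<bullet> b) * \<psi> x) = 0"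
    by (rule integral_directional_derivative_eq_0[OF has_derivative_mult[OF df
          test_function_has_derivative_grad[OF \<psi>]] _ L(1)])
      (use L(3) in \<open>auto intro: continuous_on_add c1 c2\<close>)
  then have eq: "(LINT x|lborel. f x * (grad \<psi> x \<bullet> b)) = - (LINT x|lborel. (grad f x \<bullet> b) * \<psi> x)"
    using i by simp
  have out: "\<psi> x = 0" "grad \<psi> x = 0" if "x \<notin> \<Omega>" for x using that L(2,3) g0 by auto
  have "(LINT x|lebesgue_on \<Omega>. f x * (grad \<psi> x \<bullet> b)) = (LINT x|lborel. f x * (grad \<psi> x \<bullet> b))"
    using assms(1) c1 out by (intro lebesgue_on_integral_eq)
      (auto intro: continuous_imp_measurable_lebesgue_on borel_measurable_continuous_onI)
  moreover have "(LINT x|lebesgue_on \<Omega>. (grad f x \<bullet> b) * \<psi> x) = (LINT x|lborel. (grad f x \<bullet> b) * \<psi> x)"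
    using assms(1) c2 out by (intro lebesgue_on_integral_eq)
      (auto intro: continuous_imp_measurable_lebesgue_on borel_measurable_continuous_onI)
  ultimately show "(LINT x|lebesgue_on \<Omega>. f x * (grad \<psi> x \<bullet> b)) =
      - (LINT x|lebesgue_on \<Omega>. (grad f x \<bullet> b) * \<psi> x)" using eq by simp
qed

lemma test_function_wgrad: "open \<Omega> \<Longrightarrow> test_function A \<psi> \<Longrightarrow> wgrad \<Omega> \<psi> (grad \<psi>)"
  by (rule smooth_wgrad) (auto intro: test_function_smooth test_function_sq_int)

lemma continuous_bounded_sq_int:
  fixes f :: "'a::euclidean_space \<Rightarrow> 'b::euclidean_space"
  assumes "bounded \<Omega>" "open \<Omega>" "continuous_on UNIV f"
  shows "sq_int (lebesgue_on \<Omega>) f"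
  unfolding sq_int_def
proof
  show "f \<in> borel_measurable (lebesgue_on \<Omega>)" by (rule continuous_imp_measurable_lebesgue_on[OF assms(3)])
  have c: "continuous_on UNIV (\<lambda>x. (norm (f x))\<^sup>2)" using assms(3) by (intro continuous_intros)
  have "integrable lborel (\<lambda>x. indicator (closure \<Omega>) x *\<^sub>R (norm (f x))\<^sup>2)"
    using assms by (intro borel_integrable_compact continuous_on_subset[OF c]) auto
  from integrable_mult_indicator[OF _ this, of \<Omega>]
  have "integrable lborel (\<lambda>x. indicator \<Omega> x *\<^sub>R (indicator (closure \<Omega>) x *\<^sub>R (norm (f x))\<^sup>2))"
    using assms(2) by simp
  moreover have "(\<lambda>x. indicator \<Omega> x *\<^sub>R (indicator (closure \<Omega>) x *\<^sub>R (norm (f x))\<^sup>2)) =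
      (\<lambda>x. indicator \<Omega> x *\<^sub>R (norm (f x))\<^sup>2)"
    using closure_subset by (auto simp: indicator_def fun_eq_iff)
  ultimately have "integrable lborel (\<lambda>x. indicator \<Omega> x *\<^sub>R (norm (f x))\<^sup>2)" by (simp only:)
  then show "integrable (lebesgue_on \<Omega>) (\<lambda>x. (norm (f x))\<^sup>2)"
    using assms(2) c by (subst integrable_restrict_space)
      (auto simp: integrable_completion borel_measurable_integrable)
qed

lemma smooth_bounded_wgrad:
  "bounded \<Omega> \<Longrightarrow> open \<Omega> \<Longrightarrow> smooth_on UNIV f \<Longrightarrow> wgrad \<Omega> f (grad f)"
  by (rule smooth_wgrad)
    (auto intro: continuous_bounded_sq_int smooth_on_imp_continuous_on smooth_on_continuous_grad)

lemma wgrad_const: "bounded \<Omega> \<Longrightarrow> open \<Omega> \<Longrightarrow> wgrad \<Omega> (\<lambda>x. c) (\<lambda>x. 0)"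
proof -
  assume "bounded \<Omega>" "open \<Omega>"
  moreover have "grad (\<lambda>x::'a. c) = (\<lambda>x. 0)" by (rule ext, rule grad_eq_0_if_const[of UNIV]) auto
  ultimately show ?thesis using smooth_bounded_wgrad[OF _ _ smooth_on_const, of \<Omega> c] by simp
qed

text \<open>Convergence in H1 as two L2 limits with named gradients, so that explicit gradients can
  be used throughout; \<open>H1_norm\<close> would bring back the chosen ones.\<close>

definition H1_tendsto ::
  "'a::euclidean_space set \<Rightarrow> (nat \<Rightarrow> 'a \<Rightarrow> real) \<Rightarrow> (nat \<Rightarrow> 'a \<Rightarrow> 'a) \<Rightarrow> ('a \<Rightarrow> real) \<Rightarrow> ('a \<Rightarrow> 'a) \<Rightarrow> bool" where
  "H1_tendsto \<Omega> un gn u g \<longleftrightarrow> (\<forall>n. wgrad \<Omega> (un n) (gn n)) \<and> wgrad \<Omega> u g \<and>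
     (\<lambda>n. LINT x|lebesgue_on \<Omega>. (norm (un n x - u x))\<^sup>2) \<longlonglongrightarrow> 0 \<and>
     (\<lambda>n. LINT x|lebesgue_on \<Omega>. (norm (gn n x - g x))\<^sup>2) \<longlonglongrightarrow> 0"

lemma H1_tendsto_const: "wgrad \<Omega> u g \<Longrightarrow> H1_tendsto \<Omega> (\<lambda>n. u) (\<lambda>n. g) u g"
  by (simp add: H1_tendsto_def)

lemma H1_tendsto_add:
  assumes "open \<Omega>" "H1_tendsto \<Omega> un gn u g" "H1_tendsto \<Omega> vn hn v h"
  shows "H1_tendsto \<Omega> (\<lambda>n x. un n x + vn n x) (\<lambda>n x. gn n x + hn n x) (\<lambda>x. u x + v x) (\<lambda>x. g x + h x)"
proof -
  note a = assms(2,3)[unfolded H1_tendsto_def]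
  have s: "sq_int (lebesgue_on \<Omega>) (\<lambda>x. un n x - u x)" "sq_int (lebesgue_on \<Omega>) (\<lambda>x. vn n x - v x)"
    "sq_int (lebesgue_on \<Omega>) (\<lambda>x. gn n x - g x)" "sq_int (lebesgue_on \<Omega>) (\<lambda>x. hn n x - h x)" for n
    using a by (auto intro!: sq_int_diff dest: wgradD(1,2))
  have "(\<lambda>n. LINT x|lebesgue_on \<Omega>. (norm ((un n x - u x) + (vn n x - v x)))\<^sup>2) \<longlonglongrightarrow> 0"
    "(\<lambda>n. LINT x|lebesgue_on \<Omega>. (norm ((gn n x - g x) + (hn n x - h x)))\<^sup>2) \<longlonglongrightarrow> 0"
    using a by (intro sq_int_tendsto_0_add s; simp)+
  then show ?thesis
    using a wgrad_add[OF assms(1)] by (simp add: H1_tendsto_def algebra_simps)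
qed

lemma H1_tendsto_cmult:
  assumes "H1_tendsto \<Omega> un gn u g"
  shows "H1_tendsto \<Omega> (\<lambda>n x. c * un n x) (\<lambda>n x. c *\<^sub>R gn n x) (\<lambda>x. c * u x) (\<lambda>x. c *\<^sub>R g x)"
proof -
  note a = assms[unfolded H1_tendsto_def]
  have "(\<lambda>n. c\<^sup>2 * (LINT x|lebesgue_on \<Omega>. (norm (un n x - u x))\<^sup>2)) \<longlonglongrightarrow> 0"
    "(\<lambda>n. c\<^sup>2 * (LINT x|lebesgue_on \<Omega>. (norm (gn n x - g x))\<^sup>2)) \<longlonglongrightarrow> 0"
    using a by (intro tendsto_mult_right_zero; simp)+
  moreover have "(norm (c * s - c * t))\<^sup>2 = c\<^sup>2 * (norm (s - t))\<^sup>2" for s t :: real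
    by (simp add: right_diff_distrib[symmetric] power_mult_distrib)
  moreover have "(norm (c *\<^sub>R s - c *\<^sub>R t))\<^sup>2 = c\<^sup>2 * (norm (s - t))\<^sup>2" for s t :: 'a
    by (simp add: scaleR_right_diff_distrib[symmetric] power_mult_distrib)
  moreover have "wgrad \<Omega> (\<lambda>x. c * un n x) (\<lambda>x. c *\<^sub>R gn n x)" for n using a by (intro wgrad_cmult) auto
  ultimately show ?thesis using a wgrad_cmult[of \<Omega> u g c] by (simp add: H1_tendsto_def)
qed

lemma H1_tendsto_diff:
  assumes "open \<Omega>" "H1_tendsto \<Omega> un gn u g" "H1_tendsto \<Omega> vn hn v h"
  shows "H1_tendsto \<Omega> (\<lambda>n x. un n x - vn n x) (\<lambda>n x. gn n x - hn n x) (\<lambda>x. u x - v x) (\<lambda>x. g x - h x)"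
  using H1_tendsto_add[OF assms(1,2) H1_tendsto_cmult[OF assms(3), of "-1"]] by simp

lemma H1_tendsto_subseq:
  "H1_tendsto \<Omega> un gn u g \<Longrightarrow> strict_mono r \<Longrightarrow> H1_tendsto \<Omega> (\<lambda>n. un (r n)) (\<lambda>n. gn (r n)) u g"
  unfolding H1_tendsto_def
  using LIMSEQ_subseq_LIMSEQ[of "\<lambda>n. LINT x|lebesgue_on \<Omega>. (norm (un n x - u x))\<^sup>2" 0 r]
    LIMSEQ_subseq_LIMSEQ[of "\<lambda>n. LINT x|lebesgue_on \<Omega>. (norm (gn n x - g x))\<^sup>2" 0 r]
  by (auto simp: o_def)

lemma H1_tendsto_cong_limit:
  assumes "open \<Omega>" "H1_tendsto \<Omega> un gn u g" "wgrad \<Omega> v h" "AE x in lebesgue_on \<Omega>. u x = v x"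
  shows "H1_tendsto \<Omega> un gn v h"
proof -
  note a = assms(2)[unfolded H1_tendsto_def]
  have g: "AE x in lebesgue_on \<Omega>. g x = h x" using wgrad_unique[OF assms(1) _ assms(3,4)] a by blast
  have wn: "wgrad \<Omega> (un n) (gn n)" for n using a by blast
  have m: "u \<in> borel_measurable (lebesgue_on \<Omega>)" "g \<in> borel_measurable (lebesgue_on \<Omega>)"
    "v \<in> borel_measurable (lebesgue_on \<Omega>)" "h \<in> borel_measurable (lebesgue_on \<Omega>)"
    "un n \<in> borel_measurable (lebesgue_on \<Omega>)" "gn n \<in> borel_measurable (lebesgue_on \<Omega>)" for n
    using a wgradD(1,2)[OF wn] wgradD(1,2)[OF assms(3)] by (auto dest: wgradD(1,2) simp: sq_int_def)
  note [measurable] = m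
  have "(LINT x|lebesgue_on \<Omega>. (norm (un n x - v x))\<^sup>2) = (LINT x|lebesgue_on \<Omega>. (norm (un n x - u x))\<^sup>2)"
    "(LINT x|lebesgue_on \<Omega>. (norm (gn n x - h x))\<^sup>2) = (LINT x|lebesgue_on \<Omega>. (norm (gn n x - g x))\<^sup>2)" for n
    using assms(4) g by (intro integral_cong_AE; (measurable, fail)?; auto elim: eventually_mono)+
  then show ?thesis using a assms(3) by (simp add: H1_tendsto_def)
qed

text \<open>Continuity of the positive part in H1, along a subsequence. The delicate points are
  those with u = 0, where the indicators of {un > 0} may oscillate; there the limit gradient
  vanishes almost everywhere.\<close>

lemma H1_tendsto_pos:
  assumes "open \<Omega>" "H1_tendsto \<Omega> un gn u g"
  shows "\<exists>r. strict_mono r \<and> H1_tendsto \<Omega> (\<lambda>n x. max (un (r n) x) 0)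
    (\<lambda>n x. if un (r n) x > 0 then gn (r n) x else 0) (\<lambda>x. max (u x) 0) (\<lambda>x. if u x > 0 then g x else 0)"
proof -
  note a = assms(2)[unfolded H1_tendsto_def]
  have w: "wgrad \<Omega> (un n) (gn n)" "wgrad \<Omega> u g" for n using a by auto
  have un: "sq_int (lebesgue_on \<Omega>) (un n)" and gn: "sq_int (lebesgue_on \<Omega>) (gn n)"
    and u: "sq_int (lebesgue_on \<Omega>) u" and g: "sq_int (lebesgue_on \<Omega>) g" for n
    using wgradD(1,2)[OF w(1)] wgradD(1,2)[OF w(2)] by auto
  have m[measurable]: "un n \<in> borel_measurable (lebesgue_on \<Omega>)" "gn n \<in> borel_measurable (lebesgue_on \<Omega>)"
    "u \<in> borel_measurable (lebesgue_on \<Omega>)" "g \<in> borel_measurable (lebesgue_on \<Omega>)" for n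
    using un gn u g by (auto simp: sq_int_def)
  obtain r where r: "strict_mono r" "AE x in lebesgue_on \<Omega>. (\<lambda>n. un (r n) x) \<longlonglongrightarrow> u x"
    using L2_tendsto_AE_subseq[where fn=un, OF un u] a by auto
  have wr: "H1_tendsto \<Omega> (\<lambda>n. un (r n)) (\<lambda>n. gn (r n)) u g" by (rule H1_tendsto_subseq[OF assms(2) r(1)])
  note b = wr[unfolded H1_tendsto_def]
  have 1: "(\<lambda>n. LINT x|lebesgue_on \<Omega>. (norm (max (un (r n) x) 0 - max (u x) 0))\<^sup>2) \<longlonglongrightarrow> 0"
    by (rule sq_int_tendsto_0_bound[where g="\<lambda>n x. un (r n) x - u x"])
      (use b in \<open>auto intro!: sq_int_diff un u AE_I2\<close>)
  \<comment> \<open>The difference of the gradients is split: \<open>?p\<close> is controlled by L2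
    convergence of \<open>gn\<close>, and \<open>?q\<close> compares indicators applied to the fixed
    function \<open>g\<close>, which dominated convergence handles.\<close>
  let ?p = "\<lambda>n x. if un (r n) x > 0 then gn (r n) x - g x else 0"
  let ?q = "\<lambda>n x. (if un (r n) x > 0 then g x else 0) - (if u x > 0 then g x else 0)"
  have p: "(\<lambda>n. LINT x|lebesgue_on \<Omega>. (norm (?p n x))\<^sup>2) \<longlonglongrightarrow> 0"
    by (rule sq_int_tendsto_0_bound[where g="\<lambda>n x. gn (r n) x - g x"])
      (use b in \<open>auto intro!: sq_int_diff gn g\<close>)
  have sp: "sq_int (lebesgue_on \<Omega>) (?p n)" for n
    by (rule sq_int_bound[OF sq_int_diff[OF gn[of "r n"] g]]) auto
  have sq: "sq_int (lebesgue_on \<Omega>) (?q n)" for n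
    by (rule sq_int_bound[OF g]) auto
  have q: "(\<lambda>n. LINT x|lebesgue_on \<Omega>. (norm (?q n x))\<^sup>2) \<longlonglongrightarrow> (LINT x|lebesgue_on \<Omega>. 0)"
  proof (rule integral_dominated_convergence[where w="\<lambda>x. (norm (g x))\<^sup>2"])
    show "AE x in lebesgue_on \<Omega>. (\<lambda>n. (norm (?q n x))\<^sup>2) \<longlonglongrightarrow> 0"
      using r(2) wgrad_0_on_zero_set[OF assms(1) w(2)]
    proof eventually_elim
      case (elim x)
      consider "u x > 0" | "u x < 0" | "u x = 0" by linarith
      then have "eventually (\<lambda>n. (norm (?q n x))\<^sup>2 = 0) sequentially"
      proof cases
        case 1
        then have "eventually (\<lambda>n. un (r n) x > 0) sequentially" using order_tendstoD(1)[OF elim(1)] by blast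
        then show ?thesis by eventually_elim (use 1 in auto)
      next
        case 2
        then have "eventually (\<lambda>n. un (r n) x < 0) sequentially" using order_tendstoD(2)[OF elim(1)] by blast
        then show ?thesis by eventually_elim (use 2 in auto)
      qed (use elim(2) in auto)
      then show ?case by (rule tendsto_eventually)
    qed
    show "AE x in lebesgue_on \<Omega>. norm ((norm (?q n x))\<^sup>2) \<le> (norm (g x))\<^sup>2" for n by auto
  qed (use g in \<open>auto simp: sq_int_def\<close>)
  have "(\<lambda>n. LINT x|lebesgue_on \<Omega>. (norm (?p n x + ?q n x))\<^sup>2) \<longlonglongrightarrow> 0"
    using q by (intro sq_int_tendsto_0_add sp sq p) simp
  moreover have "?p n x + ?q n x = (if un (r n) x > 0 then gn (r n) x else 0) - (if u x > 0 then g x else 0)" for n x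
    by auto
  ultimately show ?thesis
    using r(1) 1 wgrad_pos[OF assms(1) w(1)] wgrad_pos[OF assms(1) w(2)]
    unfolding H1_tendsto_def by (intro exI[of _ r]) simp
qed

lemma H1_norm_eq:
  assumes "open \<Omega>" "wgrad \<Omega> u g"
  shows "H1_norm \<Omega> u = sqrt ((LINT x|lebesgue_on \<Omega>. (norm (u x))\<^sup>2) + (LINT x|lebesgue_on \<Omega>. (norm (g x))\<^sup>2))"
proof -
  have w: "wgrad \<Omega> u (weak_grad \<Omega> u)" by (rule wgrad_weak_grad[OF wgrad_in_H1[OF assms(2)]])
  note [measurable] = wgradD(2)[OF w, THEN sq_int_measurable] wgradD(2)[OF assms(2), THEN sq_int_measurable]
  have "AE x in lebesgue_on \<Omega>. weak_grad \<Omega> u x = g x" by (rule wgrad_unique[OF assms(1) w assms(2)]) simp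
  then have "(LINT x|lebesgue_on \<Omega>. (norm (weak_grad \<Omega> u x))\<^sup>2) = (LINT x|lebesgue_on \<Omega>. (norm (g x))\<^sup>2)"
    by (intro integral_cong_AE) (auto elim: eventually_mono)
  then show ?thesis by (simp add: H1_norm_def)
qed

lemma H1_tendsto_iff_norm:
  assumes "open \<Omega>" "\<And>n. wgrad \<Omega> (un n) (gn n)" "wgrad \<Omega> u g"
  shows "H1_tendsto \<Omega> un gn u g \<longleftrightarrow> (\<lambda>n. H1_norm \<Omega> (\<lambda>x. u x - un n x)) \<longlonglongrightarrow> 0"
proof -
  let ?a = "\<lambda>n. LINT x|lebesgue_on \<Omega>. (norm (un n x - u x))\<^sup>2"
  let ?b = "\<lambda>n. LINT x|lebesgue_on \<Omega>. (norm (gn n x - g x))\<^sup>2"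
  have N: "H1_norm \<Omega> (\<lambda>x. u x - un n x) = sqrt (?a n + ?b n)" for n
    using H1_norm_eq[OF assms(1) wgrad_diff[OF assms(1,3,2)], of n] by (simp add: norm_minus_commute power2_commute)
  have nn: "0 \<le> ?a n" "0 \<le> ?b n" for n by auto
  have "?a \<longlonglongrightarrow> 0 \<and> ?b \<longlonglongrightarrow> 0 \<longleftrightarrow> (\<lambda>n. sqrt (?a n + ?b n)) \<longlonglongrightarrow> 0"
  proof
    assume "?a \<longlonglongrightarrow> 0 \<and> ?b \<longlonglongrightarrow> 0"
    then have "(\<lambda>n. sqrt (?a n + ?b n)) \<longlonglongrightarrow> sqrt (0 + 0)" by (intro tendsto_intros) auto
    then show "(\<lambda>n. sqrt (?a n + ?b n)) \<longlonglongrightarrow> 0" by simp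
  next
    assume "(\<lambda>n. sqrt (?a n + ?b n)) \<longlonglongrightarrow> 0"
    then have "(\<lambda>n. (sqrt (?a n + ?b n))\<^sup>2) \<longlonglongrightarrow> 0\<^sup>2" by (intro tendsto_intros)
    then have s: "(\<lambda>n. ?a n + ?b n) \<longlonglongrightarrow> 0" using nn by simp
    have "?a \<longlonglongrightarrow> 0" by (rule tendsto_sandwich[OF _ _ tendsto_const s]) (use nn in auto)
    moreover have "?b \<longlonglongrightarrow> 0" by (rule tendsto_sandwich[OF _ _ tendsto_const s]) (use nn in auto)
    ultimately show "?a \<longlonglongrightarrow> 0 \<and> ?b \<longlonglongrightarrow> 0" by blast
  qed
  then show ?thesis using assms(2,3) unfolding H1_tendsto_def N by auto
qed

section \<open>The space H10 and its order structure\<close>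

lemma H10_iff:
  assumes "open \<Omega>"
  shows "u \<in> H10 \<Omega> \<longleftrightarrow> (\<exists>g \<psi>. (\<forall>n. test_function \<Omega> (\<psi> n)) \<and> H1_tendsto \<Omega> \<psi> (\<lambda>n. grad (\<psi> n)) u g)"
proof
  assume u: "u \<in> H10 \<Omega>"
  then obtain g where g: "wgrad \<Omega> u g" by (auto simp: H10_def H1_iff_wgrad)
  have "\<forall>n. \<exists>\<psi>. test_function \<Omega> \<psi> \<and> H1_norm \<Omega> (\<lambda>x. u x - \<psi> x) < inverse (real (Suc n))"
    using u by (auto simp: H10_def)
  then obtain \<psi> where \<psi>: "\<And>n. test_function \<Omega> (\<psi> n)"
    "\<And>n. H1_norm \<Omega> (\<lambda>x. u x - \<psi> n x) < inverse (real (Suc n))" by metis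
  have "(\<lambda>n. H1_norm \<Omega> (\<lambda>x. u x - \<psi> n x)) \<longlonglongrightarrow> 0"
    by (rule tendsto_sandwich[OF _ _ tendsto_const LIMSEQ_inverse_real_of_nat])
      (use less_imp_le[OF \<psi>(2)] in \<open>auto simp: H1_norm_def intro!: always_eventually\<close>)
  then have "H1_tendsto \<Omega> \<psi> (\<lambda>n. grad (\<psi> n)) u g"
    using H1_tendsto_iff_norm[where un=\<psi>, OF assms test_function_wgrad[OF assms \<psi>(1)] g] by blast
  with \<psi>(1) show "\<exists>g \<psi>. (\<forall>n. test_function \<Omega> (\<psi> n)) \<and> H1_tendsto \<Omega> \<psi> (\<lambda>n. grad (\<psi> n)) u g" by blast
next
  assume "\<exists>g \<psi>. (\<forall>n. test_function \<Omega> (\<psi> n)) \<and> H1_tendsto \<Omega> \<psi> (\<lambda>n. grad (\<psi> n)) u g"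
  then obtain g \<psi> where \<psi>: "\<And>n. test_function \<Omega> (\<psi> n)" and t: "H1_tendsto \<Omega> \<psi> (\<lambda>n. grad (\<psi> n)) u g"
    by blast
  have g: "wgrad \<Omega> u g" using t by (simp add: H1_tendsto_def)
  have l: "(\<lambda>n. H1_norm \<Omega> (\<lambda>x. u x - \<psi> n x)) \<longlonglongrightarrow> 0"
    using H1_tendsto_iff_norm[where un=\<psi>, OF assms test_function_wgrad[OF assms \<psi>] g] t by blast
  have "\<exists>\<psi>. test_function \<Omega> \<psi> \<and> H1_norm \<Omega> (\<lambda>x. u x - \<psi> x) < e" if "e > 0" for e
  proof -
    obtain n where "H1_norm \<Omega> (\<lambda>x. u x - \<psi> n x) < e"
      using eventually_happens[OF order_tendstoD(2)[OF l \<open>e > 0\<close>]] by auto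
    with \<psi> show ?thesis by blast
  qed
  then show "u \<in> H10 \<Omega>" using wgrad_in_H1[OF g] by (auto simp: H10_def)
qed

lemma H10_in_H1: "u \<in> H10 \<Omega> \<Longrightarrow> u \<in> H1 \<Omega>"
  by (simp add: H10_def)

lemma H10_add:
  assumes "open \<Omega>" "u \<in> H10 \<Omega>" "v \<in> H10 \<Omega>" shows "(\<lambda>x. u x + v x) \<in> H10 \<Omega>"
proof -
  obtain g \<psi> h \<xi> where *: "\<And>n. test_function \<Omega> (\<psi> n)" "H1_tendsto \<Omega> \<psi> (\<lambda>n. grad (\<psi> n)) u g"
    "\<And>n. test_function \<Omega> (\<xi> n)" "H1_tendsto \<Omega> \<xi> (\<lambda>n. grad (\<xi> n)) v h"
    using assms(2,3) unfolding H10_iff[OF assms(1)] by blast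
  have "grad (\<lambda>x. \<psi> n x + \<xi> n x) = (\<lambda>x. grad (\<psi> n) x + grad (\<xi> n) x)" for n
    by (rule ext, rule grad_eqI) (simp add: inner_add_left has_derivative_add[OF
          test_function_has_derivative_grad[OF *(1)] test_function_has_derivative_grad[OF *(3)]])
  then show ?thesis
    unfolding H10_iff[OF assms(1)]
    using H1_tendsto_add[OF assms(1) *(2,4)] test_function_add[OF *(1,3)]
    by (intro exI[of _ "\<lambda>x. g x + h x"] exI[of _ "\<lambda>n x. \<psi> n x + \<xi> n x"]) simp
qed

lemma H10_cmult:
  assumes "open \<Omega>" "u \<in> H10 \<Omega>" shows "(\<lambda>x. c * u x) \<in> H10 \<Omega>"
proof -
  obtain g \<psi> where *: "\<And>n. test_function \<Omega> (\<psi> n)" "H1_tendsto \<Omega> \<psi> (\<lambda>n. grad (\<psi> n)) u g"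
    using assms(2) unfolding H10_iff[OF assms(1)] by blast
  have "grad (\<lambda>x. c * \<psi> n x) = (\<lambda>x. c *\<^sub>R grad (\<psi> n) x)" for n
    by (rule ext, rule grad_eqI) (simp add: has_derivative_mult_right[OF
          test_function_has_derivative_grad[OF *(1)]])
  then show ?thesis
    unfolding H10_iff[OF assms(1)]
    using H1_tendsto_cmult[OF *(2), of c] test_function_cmult[OF *(1)]
    by (intro exI[of _ "\<lambda>x. c *\<^sub>R g x"] exI[of _ "\<lambda>n x. c * \<psi> n x"]) simp
qed

lemma H10_diff:
  "open \<Omega> \<Longrightarrow> u \<in> H10 \<Omega> \<Longrightarrow> v \<in> H10 \<Omega> \<Longrightarrow> (\<lambda>x. u x - v x) \<in> H10 \<Omega>"
  using H10_add[of \<Omega> u "\<lambda>x. -1 * v x"] H10_cmult[of \<Omega> v "-1"] by simp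

lemma test_function_H10: "open \<Omega> \<Longrightarrow> test_function \<Omega> \<psi> \<Longrightarrow> \<psi> \<in> H10 \<Omega>"
  unfolding H10_iff using H1_tendsto_const[OF test_function_wgrad, of \<Omega> \<Omega> \<psi>] by fast

lemma H10_0: "open \<Omega> \<Longrightarrow> (\<lambda>x. 0) \<in> H10 \<Omega>"
  by (rule test_function_H10[OF _ test_function_0])

text \<open>Choose for each \<open>un n\<close> a test function within 1/(n+1); these test functions
  have the same H1 limit.\<close>

lemma H10_closed:
  assumes "open \<Omega>" "\<And>n. un n \<in> H10 \<Omega>" "H1_tendsto \<Omega> un gn u g"
  shows "u \<in> H10 \<Omega>"
proof -
  have w: "wgrad \<Omega> (un n) (gn n)" "wgrad \<Omega> u g" for n using assms(3) by (auto simp: H1_tendsto_def)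
  have "\<exists>\<psi>. test_function \<Omega> \<psi> \<and> H1_norm \<Omega> (\<lambda>x. un n x - \<psi> x) < inverse (real (Suc n))" for n
    using assms(2)[of n] by (auto simp: H10_def)
  then obtain \<psi> where \<psi>: "\<And>n. test_function \<Omega> (\<psi> n)"
    "\<And>n. H1_norm \<Omega> (\<lambda>x. un n x - \<psi> n x) < inverse (real (Suc n))" by metis
  let ?d = "\<lambda>n x. un n x - \<psi> n x" and ?dg = "\<lambda>n x. gn n x - grad (\<psi> n) x"
  have wd: "wgrad \<Omega> (?d n) (?dg n)" for n by (rule wgrad_diff[OF assms(1) w(1) test_function_wgrad[OF assms(1) \<psi>(1)]])
  have "(\<lambda>n. H1_norm \<Omega> (?d n)) \<longlonglongrightarrow> 0"
    by (rule tendsto_sandwich[OF _ _ tendsto_const LIMSEQ_inverse_real_of_nat])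
      (use less_imp_le[OF \<psi>(2)] in \<open>auto simp: H1_norm_def intro!: always_eventually\<close>)
  moreover have "H1_norm \<Omega> (\<lambda>x. 0 - ?d n x) = H1_norm \<Omega> (?d n)" for n
    using H1_norm_eq[OF assms(1) wd, of n] H1_norm_eq[OF assms(1) wgrad_diff[OF assms(1) wgrad_0 wd], of n]
    by (simp add: norm_minus_commute power2_commute)
  ultimately have "H1_tendsto \<Omega> ?d ?dg (\<lambda>x. 0) (\<lambda>x. 0)"
    using H1_tendsto_iff_norm[OF assms(1) wd wgrad_0] by simp
  from H1_tendsto_diff[OF assms(1,3) this]
  have "H1_tendsto \<Omega> \<psi> (\<lambda>n. grad (\<psi> n)) u g" by simp
  then show ?thesis unfolding H10_iff[OF assms(1)] using \<psi>(1) by blast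
qed

text \<open>Mollification at scales below the distance from the support to the complement of
  \<Omega> yields test functions of \<Omega> itself.\<close>

lemma H10_compact_support:
  assumes "open \<Omega>" "wgrad \<Omega> v g" "compact K" "K \<subseteq> \<Omega>" "AE x in lebesgue_on \<Omega>. x \<notin> K \<longrightarrow> v x = 0"
  shows "v \<in> H10 \<Omega>"
proof -
  obtain \<eta> V where \<eta>: "test_function \<Omega> \<eta>" "open V" "K \<subseteq> V" "\<And>x. x \<in> V \<Longrightarrow> \<eta> x = 1"
    by (rule cutoff_exists[OF assms(3,1,4)]) blast
  obtain L f G where R: "compact_wgrad L f G" "L \<subseteq> \<Omega>"
      "AE x in lebesgue_on \<Omega>. f x = \<eta> x * v x"
      "AE x in lebesgue_on \<Omega>. G x = \<eta> x *\<^sub>R g x + v x *\<^sub>R grad \<eta> x"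
    by (rule wgrad_cutoff_rep[OF assms(1,2) \<eta>(1)])
  note fG = R(1)[unfolded compact_wgrad_def]
  have "AE x in lebesgue_on \<Omega>. \<eta> x * v x = v x"
    using assms(5) by eventually_elim (use \<eta>(3,4) in force)
  then have fv: "AE x in lebesgue_on \<Omega>. f x = v x"
    and Gg: "AE x in lebesgue_on \<Omega>. G x = g x"
    using R(3,4) wgrad_unique[OF assms(1) wgrad_test_mult[OF assms(1,2) \<eta>(1)] assms(2)]
    by (auto elim: eventually_elim2)
  obtain d where d: "d > 0" "(\<Union>x\<in>L. cball x d) \<subseteq> \<Omega>"
    using compact_subset_open_imp_cball_epsilon_subset[OF _ assms(1) R(2)] fG by blast
  obtain F where F: "\<And>n. test_function {x + y |x y. x \<in> L \<and> y \<in> cball 0 d} (F n)"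
    "(\<lambda>n. LINT x|lborel. (F n x - f x)\<^sup>2) \<longlonglongrightarrow> 0"
    "(\<lambda>n. LINT x|lborel. (norm (grad (F n) x - G x))\<^sup>2) \<longlonglongrightarrow> 0"
    by (rule compact_wgrad_approx[OF R(1) d(1)]) blast
  have "{x + y |x y. x \<in> L \<and> y \<in> cball 0 d} \<subseteq> \<Omega>"
  proof clarify
    fix x y :: 'a assume "x \<in> L" "y \<in> cball 0 d"
    then have "x + y \<in> cball x d" by (simp add: dist_norm)
    then show "x + y \<in> \<Omega>" using d(2) \<open>x \<in> L\<close> by blast
  qed
  then have t: "test_function \<Omega> (F n)" for n using test_function_mono[OF F(1)] by blast
  have \<Omega>: "\<Omega> \<in> sets borel" using assms(1) by simp
  have out: "F n x = 0" "grad (F n) x = 0" "f x = 0" "G x = 0" if "x \<notin> \<Omega>" for n x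
  proof -
    obtain C where C: "compact C" "C \<subseteq> \<Omega>" "\<And>x. x \<notin> C \<Longrightarrow> F n x = 0"
      by (rule test_functionE[OF t[of n]]) blast
    then show "F n x = 0" "grad (F n) x = 0"
      using that grad_eq_0_outside[of C "F n" x] compact_imp_closed by blast+
    show "f x = 0" "G x = 0" using fG R(2) that by blast+
  qed
  have [measurable]: "f \<in> borel_measurable borel" "G \<in> borel_measurable borel" using fG by (auto simp: sq_int_def)
  note [measurable] = wgradD(1,2)[OF assms(2), THEN sq_int_measurable] test_function_measurable[OF t]
  have "(LINT x|lebesgue_on \<Omega>. (norm (F n x - v x))\<^sup>2) = (LINT x|lborel. (F n x - f x)\<^sup>2)" for n
    by (rule lebesgue_on_integral_eq(1)[OF _ _ \<Omega>]) (use fv out in \<open>auto elim: eventually_mono\<close>)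
  moreover have "(LINT x|lebesgue_on \<Omega>. (norm (grad (F n) x - g x))\<^sup>2) = (LINT x|lborel. (norm (grad (F n) x - G x))\<^sup>2)" for n
    by (rule lebesgue_on_integral_eq(1)[OF _ _ \<Omega>]) (use Gg out in \<open>auto elim: eventually_mono\<close>)
  ultimately have "H1_tendsto \<Omega> F (\<lambda>n. grad (F n)) v g"
    unfolding H1_tendsto_def using assms(2) test_function_wgrad[OF assms(1) t] F(2,3) by simp
  then show ?thesis unfolding H10_iff[OF assms(1)] using t by blast
qed

text \<open>If \<open>\<psi>\<^sub>n\<close> are test functions converging to \<open>h\<close>, then \<open>min v (\<Phi> + \<psi>\<^sub>n - 1 / (n + 1))\<close> has
  a positive part with compact support in \<open>\<Omega>\<close>, and these functions converge to \<open>v\<close>.\<close>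

lemma H10_dominated:
  assumes \<Omega>: "open \<Omega>" "bounded \<Omega>" and \<Phi>: "\<Phi> \<in> H1 \<Omega>" "continuous_on (closure \<Omega>) \<Phi>" and h: "h \<in> H10 \<Omega>"
    and v: "v \<in> H1 \<Omega>" "AE x in lebesgue_on \<Omega>. 0 \<le> v x \<and> v x \<le> max (\<Phi> x + h x) 0"
    and bd: "\<And>p. p \<in> frontier \<Omega> \<Longrightarrow>
      \<Phi> p \<le> 0 \<or> (\<exists>U. open U \<and> p \<in> U \<and> (AE x in lebesgue_on \<Omega>. x \<in> U \<longrightarrow> v x = 0))"
  shows "v \<in> H10 \<Omega>"
proof -
  obtain \<Phi>g vg where w\<Phi>: "wgrad \<Omega> \<Phi> \<Phi>g" and wv: "wgrad \<Omega> v vg" using \<Phi>(1) v(1) by (auto simp: H1_iff_wgrad)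
  obtain hg \<psi> where \<psi>: "\<And>n. test_function \<Omega> (\<psi> n)" and ht: "H1_tendsto \<Omega> \<psi> (\<lambda>n. grad (\<psi> n)) h hg"
    using h unfolding H10_iff[OF \<Omega>(1)] by blast
  define d where "d n = inverse (real (Suc n))" for n
  have d: "d n > 0" "d \<longlonglongrightarrow> 0" for n unfolding d_def using LIMSEQ_inverse_real_of_nat by auto
  have dt: "H1_tendsto \<Omega> (\<lambda>n x. d n) (\<lambda>n x. 0) (\<lambda>x. 0) (\<lambda>x. 0)"
  proof -
    have "(\<lambda>n. measure (lebesgue_on \<Omega>) (space (lebesgue_on \<Omega>)) * (d n)\<^sup>2) \<longlonglongrightarrow>
        measure (lebesgue_on \<Omega>) (space (lebesgue_on \<Omega>)) * 0\<^sup>2" by (intro tendsto_intros d)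
    then show ?thesis using wgrad_const[OF \<Omega>(2,1)] wgrad_0 by (simp add: H1_tendsto_def)
  qed
  let ?z = "\<lambda>n x. \<Phi> x + \<psi> n x - d n"
  have zt: "H1_tendsto \<Omega> ?z (\<lambda>n x. \<Phi>g x + grad (\<psi> n) x) (\<lambda>x. \<Phi> x + h x) (\<lambda>x. \<Phi>g x + hg x)"
    using H1_tendsto_diff[OF \<Omega>(1) H1_tendsto_add[OF \<Omega>(1) H1_tendsto_const[OF w\<Phi>] ht] dt] by simp
  from H1_tendsto_pos[OF \<Omega>(1) this] obtain r where r: "strict_mono r"
    "H1_tendsto \<Omega> (\<lambda>n x. max (?z (r n) x) 0) (\<lambda>n x. if ?z (r n) x > 0 then \<Phi>g x + grad (\<psi> (r n)) x else 0)
      (\<lambda>x. max (\<Phi> x + h x) 0) (\<lambda>x. if \<Phi> x + h x > 0 then \<Phi>g x + hg x else 0)" by blast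
  let ?y = "\<lambda>n x. v x - max (?z (r n) x) 0"
  from H1_tendsto_pos[OF \<Omega>(1) H1_tendsto_diff[OF \<Omega>(1) H1_tendsto_const[OF wv] r(2)]]
  obtain s yg y\<^sub>0 where s: "strict_mono s"
    "H1_tendsto \<Omega> (\<lambda>n x. max (?y (s n) x) 0) yg (\<lambda>x. max (v x - max (\<Phi> x + h x) 0) 0) y\<^sub>0" by blast
  \<comment> \<open>The assumed domination says that the excess of \<open>v\<close> over the limit
    has no positive part. Hence the truncations \<open>?m n\<close>, which are \<open>min\<close> of
    \<open>v\<close> and \<open>max (?z (r (s n)) x) 0\<close>, tend to \<open>v\<close>.\<close>
  have "AE x in lebesgue_on \<Omega>. max (v x - max (\<Phi> x + h x) 0) 0 = 0"
    using v(2) by eventually_elim auto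
  from H1_tendsto_cong_limit[OF \<Omega>(1) s(2) wgrad_0 this]
  have yt: "H1_tendsto \<Omega> (\<lambda>n x. max (?y (s n) x) 0) yg (\<lambda>x. 0) (\<lambda>x. 0)" .
  let ?m = "\<lambda>n x. v x - max (?y (s n) x) 0"
  have mt: "H1_tendsto \<Omega> ?m (\<lambda>n x. vg x - yg n x) v vg"
    using H1_tendsto_diff[OF \<Omega>(1) H1_tendsto_const[OF wv] yt] by simp
  have "?m n \<in> H10 \<Omega>" for n
  proof -
    define j where "j = r (s n)"
    obtain L where L: "compact L" "L \<subseteq> \<Omega>" "\<And>x. x \<notin> L \<Longrightarrow> \<psi> j x = 0"
      by (rule test_functionE[OF \<psi>]) blast
    \<comment> \<open>Off the support \<open>L\<close> of the test function, \<open>?z j\<close> is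
      positive only where \<Phi> > \<open>d j\<close>, hence only in \<open>S\<close>. The part of
      \<open>S\<close> on the frontier is compact and covered by finitely many sets on which
      \<open>v\<close> vanishes; removing them leaves a compact subset of \<Omega>.\<close>
    define S where "S = {x \<in> closure \<Omega>. \<Phi> x \<ge> d j}"
    have S: "compact S"
    proof -
      have "S = closure \<Omega> \<inter> \<Phi> -` {d j..}" by (auto simp: S_def)
      then have "closed S" using continuous_closed_preimage[OF \<Phi>(2) closed_closure, of "{d j..}"] by simp
      moreover have "bounded S" using \<Omega>(2) by (auto simp: S_def intro: bounded_subset[OF bounded_closure])
      ultimately show ?thesis by (simp add: compact_eq_bounded_closed)
    qed
    have "\<exists>U. open U \<and> p \<in> U \<and> (AE x in lebesgue_on \<Omega>. x \<in> U \<longrightarrow> v x = 0)" if "p \<in> S \<inter> frontier \<Omega>" for p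
      using bd[of p] that d(1)[of j] by (auto simp: S_def)
    then obtain U where U: "\<And>p. p \<in> S \<inter> frontier \<Omega> \<Longrightarrow> open (U p)" "\<And>p. p \<in> S \<inter> frontier \<Omega> \<Longrightarrow> p \<in> U p"
      "\<And>p. p \<in> S \<inter> frontier \<Omega> \<Longrightarrow> AE x in lebesgue_on \<Omega>. x \<in> U p \<longrightarrow> v x = 0" by metis
    have cS: "compact (S \<inter> frontier \<Omega>)" using S frontier_closed by (rule compact_Int_closed)
    have cov: "S \<inter> frontier \<Omega> \<subseteq> (\<Union>p\<in>S \<inter> frontier \<Omega>. U p)" using U(2) by blast
    obtain D where D: "D \<subseteq> S \<inter> frontier \<Omega>" "finite D" "S \<inter> frontier \<Omega> \<subseteq> (\<Union>p\<in>D. U p)"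
      by (rule compactE_image[OF cS _ cov]) (use U(1) in auto)
    let ?W = "\<Union>p\<in>D. U p"
    have W: "open ?W" using D(1) U(1) by blast
    have "AE x in lebesgue_on \<Omega>. \<forall>p\<in>D. x \<in> U p \<longrightarrow> v x = 0"
      using D U(3) by (intro AE_finite_allI) auto
    then have vW: "AE x in lebesgue_on \<Omega>. x \<in> ?W \<longrightarrow> v x = 0" by eventually_elim auto
    let ?K = "L \<union> (S - ?W)"
    show ?thesis
    proof (rule H10_compact_support[OF \<Omega>(1)])
      show "wgrad \<Omega> (?m n) (\<lambda>x. vg x - yg n x)" using mt by (simp add: H1_tendsto_def)
      show "compact ?K" using L(1) S W by (intro compact_Un compact_diff)
      have "S - ?W \<subseteq> \<Omega>" using D(3) \<Omega>(1) by (auto simp: S_def frontier_def interior_open)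
      with L(2) show "?K \<subseteq> \<Omega>" by auto
      have "AE x in lebesgue_on \<Omega>. x \<in> \<Omega>" using \<Omega>(1) by (simp add: AE_restrict_space_iff)
      with v(2) vW show "AE x in lebesgue_on \<Omega>. x \<notin> ?K \<longrightarrow> ?m n x = 0"
      proof eventually_elim
        case (elim x)
        show ?case
        proof
          assume x: "x \<notin> ?K"
          have "v x = 0 \<or> ?z j x \<le> 0"
            using elim x L(3)[of x] closure_subset[of \<Omega>] by (auto simp: S_def)
          then show "?m n x = 0" using elim(1) by (auto simp: j_def)
        qed
      qed
    qed
  qed
  from H10_closed[OF \<Omega>(1) this mt] show ?thesis .
qed

lemma H10_pos:
  assumes "open \<Omega>" "bounded \<Omega>" "h \<in> H10 \<Omega>" shows "(\<lambda>x. max (h x) 0) \<in> H10 \<Omega>"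
proof (rule H10_dominated[OF assms(1,2) _ _ assms(3), of "\<lambda>x. 0"])
  obtain g where "wgrad \<Omega> h g" using H10_in_H1[OF assms(3)] by (auto simp: H1_iff_wgrad)
  from wgrad_in_H1[OF wgrad_pos[OF assms(1) this]] show "(\<lambda>x. max (h x) 0) \<in> H1 \<Omega>" .
  show "(\<lambda>x. 0) \<in> H1 \<Omega>" using wgrad_in_H1[OF wgrad_0] .
qed auto

text \<open>\<open>H10 \<Omega>\<close> is an order ideal in \<open>H1 \<Omega>\<close>. It gives
  competitors the right trace: they differ from the minimizer by at most a multiple of a function in
  H10.\<close>

lemma H10_abs_bound:
  assumes \<Omega>: "open \<Omega>" "bounded \<Omega>" and w: "w \<in> H10 \<Omega>" and v: "v \<in> H1 \<Omega>"
    and le: "AE x in lebesgue_on \<Omega>. \<bar>v x\<bar> \<le> \<bar>w x\<bar>"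
  shows "v \<in> H10 \<Omega>"
proof -
  obtain g where g: "wgrad \<Omega> v g" using v by (auto simp: H1_iff_wgrad)
  have "(\<lambda>x. max (w x) 0 + max (-1 * w x) 0) \<in> H10 \<Omega>"
    by (intro H10_add H10_pos H10_cmult \<Omega> w)
  then have a: "(\<lambda>x. \<bar>w x\<bar>) \<in> H10 \<Omega>" by (rule back_subst[where P="\<lambda>f. f \<in> H10 \<Omega>"]) auto
  have 0: "(\<lambda>x. 0) \<in> H1 \<Omega>" using wgrad_in_H1[OF wgrad_0] .
  have p: "(\<lambda>x. max (v x) 0) \<in> H10 \<Omega>"
    by (rule H10_dominated[OF \<Omega> 0 _ a wgrad_in_H1[OF wgrad_pos[OF \<Omega>(1) g]]])
      (use le in \<open>auto elim: eventually_mono\<close>)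
  have m: "(\<lambda>x. max (-1 * v x) 0) \<in> H10 \<Omega>"
    by (rule H10_dominated[OF \<Omega> 0 _ a wgrad_in_H1[OF wgrad_pos[OF \<Omega>(1) wgrad_cmult[OF g]]]])
      (use le in \<open>auto elim: eventually_mono\<close>)
  have "(\<lambda>x. max (v x) 0 - max (-1 * v x) 0) \<in> H10 \<Omega>" by (rule H10_diff[OF \<Omega>(1) p m])
  then show ?thesis by (rule back_subst[where P="\<lambda>f. f \<in> H10 \<Omega>"]) auto
qed

lemma H1_diff:
  assumes "open \<Omega>" "u \<in> H1 \<Omega>" "v \<in> H1 \<Omega>" shows "(\<lambda>x. u x - v x) \<in> H1 \<Omega>"
  using assms wgrad_diff[OF assms(1)] unfolding H1_iff_wgrad by blast

lemma has_trace_perturb: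
  assumes "open \<Omega>" "has_trace \<Omega> u \<phi>" "(\<lambda>x. v x - u x) \<in> H10 \<Omega>"
  shows "has_trace \<Omega> v \<phi>"
proof -
  obtain \<Phi> where \<Phi>: "u \<in> H1 \<Omega>" "\<Phi> \<in> H1 \<Omega>" "continuous_on (closure \<Omega>) \<Phi>"
    "\<forall>x\<in>frontier \<Omega>. \<Phi> x = \<phi> x" "(\<lambda>x. u x - \<Phi> x) \<in> H10 \<Omega>"
    using assms(2) by (auto simp: has_trace_def)
  have "(\<lambda>x. (v x - u x) + (u x - \<Phi> x)) \<in> H10 \<Omega>" by (rule H10_add[OF assms(1,3) \<Phi>(5)])
  moreover have "v \<in> H1 \<Omega>"
  proof -
    obtain a b where "wgrad \<Omega> (\<lambda>x. v x - u x) a" "wgrad \<Omega> u b"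
      using H10_in_H1[OF assms(3)] \<Phi>(1) by (auto simp: H1_iff_wgrad)
    from wgrad_in_H1[OF wgrad_add[OF assms(1) this]] show ?thesis by simp
  qed
  ultimately show ?thesis using \<Phi>(2-4) by (auto simp: has_trace_def)
qed

text \<open>Away from the level \<open>u \<le> d\<close> the part \<open>B\<close> of the positivity set can be cut out with a smooth
  cutoff.\<close>

lemma wgrad_restrict_component:
  assumes \<Omega>: "open \<Omega>" "bounded \<Omega>" and w: "wgrad \<Omega> u g" and c: "continuous_on \<Omega> u"
    and AB: "open A" "open B" "A \<inter> B = {}" "{x \<in> \<Omega>. u x > 0} = A \<union> B"
    and nn: "\<And>x. x \<in> \<Omega> \<Longrightarrow> u x \<ge> 0"
  shows "wgrad \<Omega> (\<lambda>x. if x \<in> B then u x else 0) (\<lambda>x. if x \<in> B then g x else 0)"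
proof (rule wgradI)
  note ug = wgradD(1,2)[OF w]
  note [measurable] = ug[THEN sq_int_measurable]
  have B\<Omega>: "B \<subseteq> \<Omega>" using AB(4) by blast
  have "B \<in> sets borel" using AB(2) by simp
  then have [measurable]: "B \<in> sets (lebesgue_on \<Omega>)"
    using B\<Omega> \<Omega>(1) by (subst sets_restrict_space_iff) auto
  show "sq_int (lebesgue_on \<Omega>) (\<lambda>x. if x \<in> B then u x else 0)" by (rule sq_int_bound[OF ug(1)]) auto
  show "sq_int (lebesgue_on \<Omega>) (\<lambda>x. if x \<in> B then g x else 0)" by (rule sq_int_bound[OF ug(2)]) auto
  fix \<psi> and b :: 'a assume \<psi>: "test_function \<Omega> \<psi>" and b: "b \<in> Basis"
  note [measurable] = test_function_measurable(1,2)[OF \<psi>, of \<Omega>]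
  note t = test_function_sq_int[OF \<psi> \<Omega>(1)]
  obtain K where K: "compact K" "K \<subseteq> \<Omega>" "\<And>x. x \<notin> K \<Longrightarrow> \<psi> x = 0"
    by (rule test_functionE[OF \<psi>]) blast
  have g0: "grad \<psi> x = 0" if "x \<notin> K" for x
    using grad_eq_0_outside[of K \<psi> x] K that compact_imp_closed by blast
  have cut: "(LINT x|lebesgue_on \<Omega>. (if x \<in> B then max (u x - d) 0 else 0) * (grad \<psi> x \<bullet> b)) =
    - (LINT x|lebesgue_on \<Omega>. ((if x \<in> B \<and> u x > d then g x else 0) \<bullet> b) * \<psi> x)" if d: "d > 0" for d
  proof -
    have wd: "wgrad \<Omega> (\<lambda>x. max (u x - d) 0) (\<lambda>x. if u x - d > 0 then g x - 0 else 0)"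
      by (rule wgrad_pos[OF \<Omega>(1) wgrad_diff[OF \<Omega>(1) w wgrad_const[OF \<Omega>(2,1)]]])
    \<comment> \<open>On the support of \<psi>, a point with u > d lies in \<open>A\<close> or in
      the compact set \<open>C\<close> inside \<open>B\<close>. A cutoff supported in
      \<open>B\<close> that is 1 near \<open>C\<close> is thus locally constant wherever the
      truncated function is nonzero, and its gradient never contributes.\<close>
    define C where "C = {x \<in> K. u x \<ge> d} - A"
    have "compact {x \<in> K. u x \<ge> d}"
    proof -
      have eq: "{x \<in> K. u x \<ge> d} = K \<inter> u -` {d..}" by auto
      have "closed {x \<in> K. u x \<ge> d}" unfolding eq
        by (rule continuous_closed_preimage[OF continuous_on_subset[OF c K(2)] compact_imp_closed[OF K(1)]]) simp
      then have "compact (K \<inter> {x \<in> K. u x \<ge> d})" by (rule compact_Int_closed[OF K(1)])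
      moreover have "K \<inter> {x \<in> K. u x \<ge> d} = {x \<in> K. u x \<ge> d}" by auto
      ultimately show ?thesis by simp
    qed
    then have C: "compact C" unfolding C_def using AB(1) by (rule compact_diff)
    have CB: "C \<subseteq> B" using AB(4) K(2) d by (force simp: C_def)
    obtain \<zeta> V where \<zeta>: "test_function B \<zeta>" "open V" "C \<subseteq> V" "\<And>x. x \<in> V \<Longrightarrow> \<zeta> x = 1"
      by (rule cutoff_exists[OF C AB(2) CB]) blast
    obtain M where M: "M \<subseteq> B" "\<And>x. x \<notin> M \<Longrightarrow> \<zeta> x = 0"
      by (rule test_functionE[OF \<zeta>(1)]) blast
    let ?\<psi> = "\<lambda>x. \<psi> x * \<zeta> x"
    have tp: "test_function \<Omega> ?\<psi>"
      by (rule test_function_mult_smooth[OF \<psi> test_function_smooth[OF \<zeta>(1)]])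
    have gp: "grad ?\<psi> x = \<psi> x *\<^sub>R grad \<zeta> x + \<zeta> x *\<^sub>R grad \<psi> x" for x
      by (rule grad_mult[OF test_function_has_derivative_grad[OF \<psi>] test_function_has_derivative_grad[OF \<zeta>(1)]])
    have onC: "\<zeta> x = 1 \<and> grad \<zeta> x = 0" if "x \<in> C" for x
      using that \<zeta>(2-4) grad_eq_0_if_const[of V x \<zeta> 1] by auto
    have onA: "\<zeta> x = 0 \<and> grad \<zeta> x = 0" if "x \<in> A" for x
    proof -
      have "\<zeta> y = 0" if "y \<in> A" for y using that M AB(3) by blast
      then show ?thesis using grad_eq_0_if_const[of A x \<zeta> 0] AB(1) that by simp
    qed
    have case_x: "x \<notin> K \<or> u x \<le> d \<or> (x \<in> A \<and> x \<notin> B) \<or> (x \<in> C \<and> x \<in> B)" if "x \<in> \<Omega>" for x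
      using AB(3,4) that d CB by (force simp: C_def)
    have "(LINT x|lebesgue_on \<Omega>. (if x \<in> B then max (u x - d) 0 else 0) * (grad \<psi> x \<bullet> b)) =
        (LINT x|lebesgue_on \<Omega>. max (u x - d) 0 * (grad ?\<psi> x \<bullet> b))"
    proof (rule Bochner_Integration.integral_cong)
      fix x assume "x \<in> space (lebesgue_on \<Omega>)"
      then have "x \<in> \<Omega>" by simp
      then show "(if x \<in> B then max (u x - d) 0 else 0) * (grad \<psi> x \<bullet> b) = max (u x - d) 0 * (grad ?\<psi> x \<bullet> b)"
        using case_x[of x] onA[of x] onC[of x] K(3)[of x] g0[of x] by (auto simp: gp)
    qed simp
    also have "\<dots> = - (LINT x|lebesgue_on \<Omega>. ((if u x - d > 0 then g x - 0 else 0) \<bullet> b) * ?\<psi> x)"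
      by (rule wgradD(3)[OF wd tp b])
    also have "(LINT x|lebesgue_on \<Omega>. ((if u x - d > 0 then g x - 0 else 0) \<bullet> b) * ?\<psi> x) =
       (LINT x|lebesgue_on \<Omega>. ((if x \<in> B \<and> u x > d then g x else 0) \<bullet> b) * \<psi> x)"
    proof (rule Bochner_Integration.integral_cong)
      fix x assume "x \<in> space (lebesgue_on \<Omega>)"
      then have "x \<in> \<Omega>" by simp
      then show "((if u x - d > 0 then g x - 0 else 0) \<bullet> b) * ?\<psi> x = ((if x \<in> B \<and> u x > d then g x else 0) \<bullet> b) * \<psi> x"
        using case_x[of x] onA[of x] onC[of x] K(3)[of x] by auto
    qed simp
    finally show ?thesis .
  qed
  define d where "d n = inverse (real (Suc n))" for n
  have d: "d n > 0" "d \<longlonglongrightarrow> 0" for n unfolding d_def using LIMSEQ_inverse_real_of_nat by auto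
  have 1: "(\<lambda>n. LINT x|lebesgue_on \<Omega>. (if x \<in> B then max (u x - d n) 0 else 0) * (grad \<psi> x \<bullet> b)) \<longlonglongrightarrow>
    (LINT x|lebesgue_on \<Omega>. (if x \<in> B then u x else 0) * (grad \<psi> x \<bullet> b))"
  proof (rule integral_dominated_convergence[where w="\<lambda>x. \<bar>u x * (grad \<psi> x \<bullet> b)\<bar>"])
    show "integrable (lebesgue_on \<Omega>) (\<lambda>x. \<bar>u x * (grad \<psi> x \<bullet> b)\<bar>)"
      using sq_int_mult_integrable[OF ug(1) sq_int_inner_Basis[OF t(2) b]] by auto
    show "AE x in lebesgue_on \<Omega>. (\<lambda>n. (if x \<in> B then max (u x - d n) 0 else 0) * (grad \<psi> x \<bullet> b)) \<longlonglongrightarrow>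
        (if x \<in> B then u x else 0) * (grad \<psi> x \<bullet> b)"
    proof (rule AE_I2)
      fix x assume "x \<in> space (lebesgue_on \<Omega>)"
      then have "u x \<ge> 0" using nn by simp
      have "(\<lambda>n. max (u x - d n) 0) \<longlonglongrightarrow> max (u x - 0) 0" by (intro tendsto_intros d)
      then show "(\<lambda>n. (if x \<in> B then max (u x - d n) 0 else 0) * (grad \<psi> x \<bullet> b)) \<longlonglongrightarrow>
        (if x \<in> B then u x else 0) * (grad \<psi> x \<bullet> b)" using \<open>u x \<ge> 0\<close> by (auto intro!: tendsto_intros)
    qed
    show "AE x in lebesgue_on \<Omega>. norm ((if x \<in> B then max (u x - d n) 0 else 0) * (grad \<psi> x \<bullet> b)) \<le>
        \<bar>u x * (grad \<psi> x \<bullet> b)\<bar>" for n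
    proof (rule AE_I2)
      fix x assume "x \<in> space (lebesgue_on \<Omega>)"
      then have "u x \<ge> 0" using nn by simp
      then show "norm ((if x \<in> B then max (u x - d n) 0 else 0) * (grad \<psi> x \<bullet> b)) \<le> \<bar>u x * (grad \<psi> x \<bullet> b)\<bar>"
        using less_imp_le[OF d(1)[of n]] by (auto simp: abs_mult intro!: mult_right_mono)
    qed
  qed simp_all
  have 2: "(\<lambda>n. LINT x|lebesgue_on \<Omega>. ((if x \<in> B \<and> u x > d n then g x else 0) \<bullet> b) * \<psi> x) \<longlonglongrightarrow>
    (LINT x|lebesgue_on \<Omega>. ((if x \<in> B then g x else 0) \<bullet> b) * \<psi> x)"
  proof (rule integral_dominated_convergence[where w="\<lambda>x. \<bar>(g x \<bullet> b) * \<psi> x\<bar>"])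
    show "integrable (lebesgue_on \<Omega>) (\<lambda>x. \<bar>(g x \<bullet> b) * \<psi> x\<bar>)"
      using sq_int_mult_integrable[OF sq_int_inner_Basis[OF ug(2) b] t(1)] by auto
    show "AE x in lebesgue_on \<Omega>. (\<lambda>n. ((if x \<in> B \<and> u x > d n then g x else 0) \<bullet> b) * \<psi> x) \<longlonglongrightarrow>
        ((if x \<in> B then g x else 0) \<bullet> b) * \<psi> x"
    proof (rule AE_I2)
      fix x
      have "eventually (\<lambda>n. x \<in> B \<longrightarrow> u x > d n) sequentially"
      proof (cases "x \<in> B")
        case True
        then have "u x > 0" using AB(4) by blast
        from order_tendstoD(2)[OF d(2) this] show ?thesis by eventually_elim simp
      qed simp
      then have "eventually (\<lambda>n. ((if x \<in> B \<and> u x > d n then g x else 0) \<bullet> b) * \<psi> x =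
        ((if x \<in> B then g x else 0) \<bullet> b) * \<psi> x) sequentially" by eventually_elim auto
      then show "(\<lambda>n. ((if x \<in> B \<and> u x > d n then g x else 0) \<bullet> b) * \<psi> x) \<longlonglongrightarrow>
        ((if x \<in> B then g x else 0) \<bullet> b) * \<psi> x" by (rule tendsto_eventually)
    qed
  qed (auto simp: abs_mult)
  have "(\<lambda>n. - (LINT x|lebesgue_on \<Omega>. ((if x \<in> B \<and> u x > d n then g x else 0) \<bullet> b) * \<psi> x)) \<longlonglongrightarrow>
    - (LINT x|lebesgue_on \<Omega>. ((if x \<in> B then g x else 0) \<bullet> b) * \<psi> x)" by (intro tendsto_minus 2)
  then show "(LINT x|lebesgue_on \<Omega>. (if x \<in> B then u x else 0) * (grad \<psi> x \<bullet> b)) =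
        - (LINT x|lebesgue_on \<Omega>. ((if x \<in> B then g x else 0) \<bullet> b) * \<psi> x)"
    using LIMSEQ_unique[OF 1] cut[OF d(1)] by simp
qed

section \<open>Variational inequalities for minimizers\<close>

text \<open>The energy density, with gradients as a separate argument so that competitors keep their
  explicit ones. Energies are compared by comparing these densities pointwise.\<close>

definition phase_density :: "nat \<Rightarrow> real \<Rightarrow> (nat \<Rightarrow> 'a \<Rightarrow> real) \<Rightarrow> (nat \<Rightarrow> 'a \<Rightarrow> 'b::euclidean_space) \<Rightarrow> 'a \<Rightarrow> real" where
  "phase_density k \<mu> u G x = (\<Sum>i=1..k. (norm (G i x))\<^sup>2 - 2 * \<mu> * u i x)"

lemma bounded_open_finite_measure:
  assumes "open \<Omega>" "bounded \<Omega>" shows "finite_measure (lebesgue_on \<Omega>)"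
proof (rule finite_measureI)
  have "emeasure lebesgue \<Omega> < \<infinity>"
    using bounded_set_imp_lmeasurable[OF assms(2)] assms(1) by (auto simp: fmeasurable_def)
  then show "emeasure (lebesgue_on \<Omega>) (space (lebesgue_on \<Omega>)) \<noteq> \<infinity>"
    using assms(1) by (simp add: emeasure_restrict_space)
qed

lemma energy_eq:
  assumes \<Omega>: "open \<Omega>" "bounded \<Omega>" and w: "\<And>i. i \<in> {1..k} \<Longrightarrow> wgrad \<Omega> (u i) (G i)"
    and lam: "\<And>i. i \<in> {1..k} \<Longrightarrow> lam i = \<mu>"
  shows "energy \<Omega> k lam u = (LINT x|lebesgue_on \<Omega>. phase_density k \<mu> u G x)"
    "integrable (lebesgue_on \<Omega>) (phase_density k \<mu> u G)"
proof -
  have fin: "finite_measure (lebesgue_on \<Omega>)" by (rule bounded_open_finite_measure[OF \<Omega>])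
  have i: "integrable (lebesgue_on \<Omega>) (\<lambda>x. (norm (G i x))\<^sup>2 - 2 * \<mu> * u i x)" if "i \<in> {1..k}" for i
    using wgradD(1,2)[OF w[OF that]] sq_int_integrable[OF fin] by (auto simp: sq_int_def[of _ "G i"])
  show "integrable (lebesgue_on \<Omega>) (phase_density k \<mu> u G)" unfolding phase_density_def
    using i by (intro Bochner_Integration.integrable_sum) auto
  have "(LINT x|lebesgue_on \<Omega>. (norm (weak_grad \<Omega> (u i) x))\<^sup>2 - 2 * lam i * u i x) =
        (LINT x|lebesgue_on \<Omega>. (norm (G i x))\<^sup>2 - 2 * \<mu> * u i x)" if "i \<in> {1..k}" for i
  proof -
    have wg: "wgrad \<Omega> (u i) (weak_grad \<Omega> (u i))" by (rule wgrad_weak_grad[OF wgrad_in_H1[OF w[OF that]]])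
    note [measurable] = wgradD(1,2)[OF wg, THEN sq_int_measurable] wgradD(2)[OF w[OF that], THEN sq_int_measurable]
    have "AE x in lebesgue_on \<Omega>. weak_grad \<Omega> (u i) x = G i x"
      by (rule wgrad_unique[OF \<Omega>(1) wg w[OF that]]) simp
    then show ?thesis using lam[OF that] by (intro integral_cong_AE) (auto elim: eventually_mono)
  qed
  then have "energy \<Omega> k lam u = (\<Sum>i=1..k. LINT x|lebesgue_on \<Omega>. (norm (G i x))\<^sup>2 - 2 * \<mu> * u i x)"
    unfolding energy_def by (intro sum.cong) auto
  also have "\<dots> = (LINT x|lebesgue_on \<Omega>. phase_density k \<mu> u G x)" unfolding phase_density_def
    using i by (intro Bochner_Integration.integral_sum[symmetric]) auto
  finally show "energy \<Omega> k lam u = (LINT x|lebesgue_on \<Omega>. phase_density k \<mu> u G x)" .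
qed

locale segregated_minimizer =
  fixes \<Omega> :: "'a::euclidean_space set" and k :: nat and lam :: "nat \<Rightarrow> real" and \<mu> :: real
    and \<phi> u :: "nat \<Rightarrow> 'a \<Rightarrow> real" and G :: "nat \<Rightarrow> 'a \<Rightarrow> 'a"
  assumes open_dom: "open \<Omega>" and bounded_dom: "bounded \<Omega>" and lam: "\<And>i. i \<in> {1..k} \<Longrightarrow> lam i = \<mu>"
    and lam_pos: "\<mu> > 0" and data_nonneg: "\<And>i p. i \<in> {1..k} \<Longrightarrow> p \<in> frontier \<Omega> \<Longrightarrow> \<phi> i p \<ge> 0"
    and minimizer: "is_minimizer \<Omega> k lam \<phi> u"
    and wgrad: "\<And>i. i \<in> {1..k} \<Longrightarrow> wgrad \<Omega> (u i) (G i)"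
begin

abbreviation "M \<equiv> lebesgue_on \<Omega>"

lemma competitor:
  assumes w: "\<And>i. i \<in> {1..k} \<Longrightarrow> wgrad \<Omega> (v i) (H i)"
    and d: "\<And>i. i \<in> {1..k} \<Longrightarrow> (\<lambda>x. v i x - u i x) \<in> H10 \<Omega>"
    and s: "\<And>i j. i \<in> {1..k} \<Longrightarrow> j \<in> {1..k} \<Longrightarrow> i \<noteq> j \<Longrightarrow> AE x in M. v i x * v j x = 0"
  shows "(LINT x|M. phase_density k \<mu> u G x) \<le> (LINT x|M. phase_density k \<mu> v H x)"
    "integrable M (phase_density k \<mu> u G)" "integrable M (phase_density k \<mu> v H)"
proof -
  have "admissible \<Omega> k \<phi> v"
    using minimizer s has_trace_perturb[OF open_dom _ d] unfolding is_minimizer_def admissible_def by auto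
  then have "energy \<Omega> k lam u \<le> energy \<Omega> k lam v" using minimizer by (auto simp: is_minimizer_def)
  then show "(LINT x|M. phase_density k \<mu> u G x) \<le> (LINT x|M. phase_density k \<mu> v H x)"
    using energy_eq(1)[OF open_dom bounded_dom wgrad lam] energy_eq(1)[OF open_dom bounded_dom w lam] by simp
  show "integrable M (phase_density k \<mu> u G)" by (rule energy_eq(2)[OF open_dom bounded_dom wgrad lam])
  show "integrable M (phase_density k \<mu> v H)" by (rule energy_eq(2)[OF open_dom bounded_dom w lam])
qed

lemma segregated_AE:
  "AE x in M. \<forall>i\<in>{1..k}. \<forall>j\<in>{1..k}. i \<noteq> j \<longrightarrow> u i x * u j x = 0"
proof -
  have "AE x in M. i \<noteq> j \<longrightarrow> u i x * u j x = 0" if "i \<in> {1..k}" "j \<in> {1..k}" for i j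
    using minimizer that by (cases "i = j") (auto simp: is_minimizer_def admissible_def)
  then show ?thesis by (intro AE_finite_allI) auto
qed

lemma grad_zero_AE: "AE x in M. \<forall>i\<in>{1..k}. u i x = 0 \<longrightarrow> G i x = 0"
  by (intro AE_finite_allI wgrad_0_on_zero_set[OF open_dom wgrad]) auto

lemma has_trace: "i \<in> {1..k} \<Longrightarrow> has_trace \<Omega> (u i) (\<phi> i)"
  using minimizer by (auto simp: is_minimizer_def admissible_def)

text \<open>Replacing \<open>u i\<close> by its positive part drops a gradient term and raises the
  linear term by 2 \<mu> times the negative part; since \<mu> > 0, minimality forces the negative
  part to vanish.\<close>

lemma nonneg_AE: assumes i: "i \<in> {1..k}" shows "AE x in M. u i x \<ge> 0"
proof -
  let ?n = "\<lambda>x. max (-1 * u i x) 0"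
  have wn: "wgrad \<Omega> ?n (\<lambda>x. if -1 * u i x > 0 then -1 *\<^sub>R G i x else 0)"
    by (rule wgrad_pos[OF open_dom wgrad_cmult[OF wgrad[OF i]]])
  \<comment> \<open>As the data are nonnegative, so is the boundary value of the extension, and the
    negative part has zero trace.\<close>
  have n: "?n \<in> H10 \<Omega>"
  proof -
    obtain \<Phi> where \<Phi>: "\<Phi> \<in> H1 \<Omega>" "continuous_on (closure \<Omega>) \<Phi>"
      "\<forall>x\<in>frontier \<Omega>. \<Phi> x = \<phi> i x" "(\<lambda>x. u i x - \<Phi> x) \<in> H10 \<Omega>"
      using has_trace[OF i] by (auto simp: has_trace_def)
    show ?thesis
    proof (rule H10_dominated[OF open_dom bounded_dom _ _ H10_cmult[OF open_dom \<Phi>(4), of "-1"]])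
      show "(\<lambda>x. -1 * \<Phi> x) \<in> H1 \<Omega>" using \<Phi>(1) wgrad_cmult[of \<Omega> \<Phi> _ "-1"] unfolding H1_iff_wgrad by blast
      show "continuous_on (closure \<Omega>) (\<lambda>x. -1 * \<Phi> x)" by (intro continuous_intros \<Phi>)
      show "?n \<in> H1 \<Omega>" by (rule wgrad_in_H1[OF wn])
      show "-1 * \<Phi> p \<le> 0 \<or> (\<exists>U. open U \<and> p \<in> U \<and> (AE x in M. x \<in> U \<longrightarrow> ?n x = 0))"
        if "p \<in> frontier \<Omega>" for p using \<Phi>(3) that data_nonneg[OF i that] by auto
    qed auto
  qed
  define v where "v j x = (if j = i then max (u i x) 0 else u j x)" for j x
  define H where "H j x = (if j = i then (if u i x > 0 then G i x else 0) else G j x)" for j x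
  have w: "wgrad \<Omega> (v j) (H j)" if "j \<in> {1..k}" for j
    using wgrad_pos[OF open_dom wgrad[OF i]] wgrad[OF that] by (cases "j = i") (auto simp: v_def[abs_def] H_def[abs_def])
  have d: "(\<lambda>x. v j x - u j x) \<in> H10 \<Omega>" if "j \<in> {1..k}" for j
  proof (cases "j = i")
    case True
    then have "(\<lambda>x. v j x - u j x) = ?n" by (auto simp: v_def max_def)
    then show ?thesis using n by simp
  next
    case False
    then show ?thesis using H10_0[OF open_dom] by (simp add: v_def)
  qed
  have s: "AE x in M. v j x * v l x = 0" if "j \<in> {1..k}" "l \<in> {1..k}" "j \<noteq> l" for j l
    using segregated_AE
  proof eventually_elim
    case (elim x)
    then have "u j x * u l x = 0" using that by blast
    then show ?case by (auto simp: v_def)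
  qed
  note c = competitor[OF w d s]
  have "phase_density k \<mu> v H x + 2 * \<mu> * ?n x \<le> phase_density k \<mu> u G x" for x
  proof -
    have "(\<Sum>j=1..k. (norm (H j x))\<^sup>2 - 2 * \<mu> * v j x + (if j = i then 2 * \<mu> * ?n x else 0)) \<le>
      (\<Sum>j=1..k. (norm (G j x))\<^sup>2 - 2 * \<mu> * u j x)"
      by (rule sum_mono) (auto simp: v_def H_def max_def algebra_simps)
    then show ?thesis using i by (simp add: phase_density_def sum.distrib)
  qed
  moreover have ni: "integrable M ?n"
    by (rule sq_int_integrable[OF bounded_open_finite_measure[OF open_dom bounded_dom] wgradD(1)[OF wn]])
  ultimately have "(LINT x|M. phase_density k \<mu> v H x + 2 * \<mu> * ?n x) \<le> (LINT x|M. phase_density k \<mu> u G x)"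
    using c by (intro integral_mono) auto
  then have "2 * \<mu> * (LINT x|M. ?n x) \<le> 0" using c ni by simp
  then have "(LINT x|M. ?n x) \<le> 0" using lam_pos by (simp add: mult_le_0_iff)
  then have "(LINT x|M. ?n x) = 0" by (intro antisym Bochner_Integration.integral_nonneg) auto
  then have "AE x in M. ?n x = 0" using ni by (subst (asm) integral_nonneg_eq_0_iff_AE) auto
  then show ?thesis by eventually_elim (auto simp: max_def split: if_splits)
qed

lemma nonneg_all_AE: "AE x in M. \<forall>i\<in>{1..k}. u i x \<ge> 0"
  using nonneg_AE by (intro AE_finite_allI) auto

text \<open>One-sided first variation: subtract, divide by t and let t tend to 0 from the right.
  Only t > 0 is available, since the competitors below are built for that sign alone; hence an
  inequality.\<close>

lemma quadratic_expansion:
  fixes g h :: "'a \<Rightarrow> 'a"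
  assumes "sq_int M g" "sq_int M h" "integrable M r" "integrable M s"
    and le: "\<And>t. t > 0 \<Longrightarrow> (LINT x|M. (norm (g x))\<^sup>2 - r x) \<le> (LINT x|M. (norm (g x + t *\<^sub>R h x))\<^sup>2 - (r x + t * s x))"
  shows "(LINT x|M. s x) \<le> 2 * (LINT x|M. g x \<bullet> h x)"
proof -
  let ?g = "LINT x|M. (norm (g x))\<^sup>2" and ?h = "LINT x|M. (norm (h x))\<^sup>2" and ?p = "LINT x|M. g x \<bullet> h x"
  let ?r = "LINT x|M. r x" and ?s = "LINT x|M. s x"
  have i: "integrable M (\<lambda>x. (norm (g x))\<^sup>2)" "integrable M (\<lambda>x. (norm (h x))\<^sup>2)" "integrable M (\<lambda>x. g x \<bullet> h x)"
    using assms sq_int_inner_integrable[OF assms(1,2)] by (auto simp: sq_int_def)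
  have t: "?s \<le> 2 * ?p + t * ?h" if "t > 0" for t
  proof -
    have "(norm (g x + t *\<^sub>R h x))\<^sup>2 = (norm (g x))\<^sup>2 + 2 * t * (g x \<bullet> h x) + t\<^sup>2 * (norm (h x))\<^sup>2" for x
      by (simp add: power2_norm_eq_inner inner_add inner_commute power2_eq_square[of t] algebra_simps)
    then have "?g - ?r \<le> ?g + 2 * t * ?p + t\<^sup>2 * ?h - (?r + t * ?s)"
      using le[OF that] i assms(3,4) by simp
    then have "t * ?s \<le> t * (2 * ?p + t * ?h)" by (simp add: power2_eq_square algebra_simps)
    then show ?thesis using that by simp
  qed
  have "((\<lambda>t. 2 * ?p + t * ?h) \<longlongrightarrow> 2 * ?p + 0 * ?h) (at_right 0)" by (intro tendsto_intros)
  then show ?thesis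
    by (intro tendsto_lowerbound[where F="at_right 0" and f="\<lambda>t. 2 * ?p + t * ?h"])
      (auto simp: eventually_at_filter t)
qed

lemma wgrad_hat:
  "wgrad \<Omega> (\<lambda>x. 2 * u i x - (\<Sum>j=1..k. u j x)) (\<lambda>x. 2 *\<^sub>R G i x - (\<Sum>j=1..k. G j x))" if "i \<in> {1..k}"
  by (intro wgrad_diff wgrad_cmult wgrad_sum wgrad open_dom that) auto

text \<open>The competitor reads off the phases from \<open>f + t \<psi>\<close>, where \<open>f = 2 u\<^sub>i - U\<close> with
  \<open>U\<close> the sum of all phases: its positive part is phase \<open>i\<close>, and the others share its negative part.\<close>

lemma hat_supersolution:
  assumes i: "i \<in> {1..k}" and \<psi>: "\<psi> \<in> H10 \<Omega>" "wgrad \<Omega> \<psi> \<psi>g" "AE x in M. \<psi> x \<ge> 0"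
    and \<sigma>: "\<sigma> = -1 \<or> \<sigma> = 1 \<and> (AE x in M. \<psi> x > 0 \<longrightarrow> u i x > 0)"
  shows "\<sigma> * \<mu> * (LINT x|M. \<psi> x) \<le> (LINT x|M. (2 *\<^sub>R G i x - (\<Sum>j=1..k. G j x)) \<bullet> \<psi>g x)"
proof -
  let ?f = "\<lambda>x. 2 * u i x - (\<Sum>j=1..k. u j x)" and ?F = "\<lambda>x. 2 *\<^sub>R G i x - (\<Sum>j=1..k. G j x)"
  note wf = wgrad_hat[OF i]
  have fin: "finite_measure M" by (rule bounded_open_finite_measure[OF open_dom bounded_dom])
  have ui: "integrable M (\<lambda>x. u j x)" if "j \<in> {1..k}" for j
    using sq_int_integrable[OF fin wgradD(1)[OF wgrad[OF that]]] .
  have \<psi>i: "integrable M \<psi>" using sq_int_integrable[OF fin wgradD(1)[OF \<psi>(2)]] .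
  have "(LINT x|M. 2 * \<mu> * (\<sigma> * \<psi> x)) \<le> 2 * (LINT x|M. ?F x \<bullet> \<psi>g x)"
  proof (rule quadratic_expansion[where r="\<lambda>x. 2 * \<mu> * (\<Sum>j=1..k. u j x)"])
    show "sq_int M ?F" "sq_int M \<psi>g" using wgradD(2)[OF wf] wgradD(2)[OF \<psi>(2)] .
    show "integrable M (\<lambda>x. 2 * \<mu> * (\<Sum>j=1..k. u j x))" using ui by auto
    show "integrable M (\<lambda>x. 2 * \<mu> * (\<sigma> * \<psi> x))" using \<psi>i by auto
    fix t :: real assume t: "t > 0"
    define v where "v j x = (if j = i then max (?f x + t * \<psi> x) 0 else max (u j x - t * \<psi> x) 0)" for j x
    define H where "H j x = (if j = i then (if ?f x + t * \<psi> x > 0 then ?F x + t *\<^sub>R \<psi>g x else 0)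
      else (if u j x - t * \<psi> x > 0 then G j x - t *\<^sub>R \<psi>g x else 0))" for j x
    have w: "wgrad \<Omega> (v j) (H j)" if "j \<in> {1..k}" for j
      using wgrad_pos[OF open_dom wgrad_add[OF open_dom wf wgrad_cmult[OF \<psi>(2), of t]]]
        wgrad_pos[OF open_dom wgrad_diff[OF open_dom wgrad[OF that] wgrad_cmult[OF \<psi>(2), of t]]]
      by (cases "j = i") (auto simp: v_def[abs_def] H_def[abs_def])
    have single: "\<exists>l\<in>{1..k}. \<forall>j\<in>{1..k}. j \<noteq> l \<longrightarrow> a j = 0"
      if "\<forall>i\<in>{1..k}. \<forall>j\<in>{1..k}. i \<noteq> j \<longrightarrow> a i * a j = 0" for a :: "nat \<Rightarrow> real"
    proof (cases "\<exists>l\<in>{1..k}. a l \<noteq> 0")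
      case True then show ?thesis using that by (metis mult_eq_0_iff)
    next
      case False then show ?thesis using i by blast
    qed
    have sumD: "(\<Sum>j=1..k. a j) = a l" if "l \<in> {1..k}" "\<forall>j\<in>{1..k}. j \<noteq> l \<longrightarrow> a j = 0"
      for l and a :: "nat \<Rightarrow> 'c::comm_monoid_add"
      using that by (subst sum.remove[of _ l]) (auto intro!: sum.neutral)
    \<comment> \<open>At almost every point there is an active phase \<open>l\<close> off which all
      phases and gradients vanish (\<open>l = i\<close> if all are zero). So \<open>?f\<close> is
      \<open>u l\<close> or \<open>- u l\<close> there, and the claims reduce to comparing a few
      numbers and two gradients.\<close>
    have pw: "AE x in M. (\<forall>j\<in>{1..k}. \<forall>l\<in>{1..k}. j \<noteq> l \<longrightarrow> v j x * v l x = 0) \<and>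
        (\<forall>j\<in>{1..k}. \<bar>v j x - u j x\<bar> \<le> t * \<psi> x) \<and>
        phase_density k \<mu> v H x \<le> (norm (?F x + t *\<^sub>R \<psi>g x))\<^sup>2 - (2 * \<mu> * (\<Sum>j=1..k. u j x) + t * (2 * \<mu> * (\<sigma> * \<psi> x))) \<and>
        phase_density k \<mu> u G x = (norm (?F x))\<^sup>2 - 2 * \<mu> * (\<Sum>j=1..k. u j x)"
    proof -
      have "AE x in M. \<sigma> = -1 \<or> \<sigma> = 1 \<and> (\<psi> x > 0 \<longrightarrow> u i x > 0)"
        using \<sigma> by (auto elim: eventually_mono)
      with segregated_AE grad_zero_AE nonneg_all_AE \<psi>(3) show ?thesis
      proof eventually_elim
        case (elim x)
        obtain l where l: "l \<in> {1..k}" "\<forall>j\<in>{1..k}. j \<noteq> l \<longrightarrow> u j x = 0"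
          using single[of "\<lambda>j. u j x"] elim(1) by blast
        have l': "\<forall>j\<in>{1..k}. j \<noteq> l \<longrightarrow> G j x = 0" using l elim(2) by blast
        have U: "(\<Sum>j=1..k. u j x) = u l x" by (rule sumD[OF l])
        have GS: "(\<Sum>j=1..k. G j x) = G l x" by (rule sumD[OF l(1) l'])
        have ul: "u l x \<ge> 0" using elim(3) l(1) by blast
        have f: "?f x = (if l = i then u i x else - u l x)" unfolding U using l(2) i by auto
        have F: "?F x = (if l = i then G i x else - G l x)" unfolding GS using l' i by (auto simp: scaleR_2)
        have t\<psi>: "t * \<psi> x \<ge> 0" using t elim(4) by simp
        have vj: "v j x = 0 \<and> H j x = 0" if "j \<in> {1..k}" "j \<noteq> i" "j \<noteq> l" for j
          using that l(2) t\<psi> by (auto simp: v_def H_def)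
        have den: "phase_density k \<mu> u G x = (norm (?F x))\<^sup>2 - 2 * \<mu> * (\<Sum>j=1..k. u j x)"
        proof -
          have "phase_density k \<mu> u G x = (norm (G l x))\<^sup>2 - 2 * \<mu> * u l x"
            unfolding phase_density_def by (rule sumD[OF l(1)]) (use l(2) l' in auto)
          then show ?thesis unfolding U F by auto
        qed
        \<comment> \<open>The mass may be counted as gained (\<sigma> = 1) only where phase
          \<open>i\<close> is active; elsewhere it may eat into phase \<open>l\<close>, which is the
          loss allowed by \<sigma> = -1.\<close>
        have \<sigma>t: "\<sigma> * (t * \<psi> x) \<le> (if l = i then t * \<psi> x else - (t * \<psi> x))"
        proof -
          have "\<psi> x = 0" if "l \<noteq> i" "\<sigma> = 1" using that elim(4,5) l(2) i by force
          then show ?thesis using elim(5) t\<psi> by auto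
        qed
        show ?case
        proof (cases "l = i")
          case True
          have one: "\<forall>j\<in>{1..k}. j \<noteq> i \<longrightarrow> v j x = 0 \<and> H j x = 0" using vj True by blast
          have vi: "v i x = u i x + t * \<psi> x" using f ul t\<psi> True by (auto simp: v_def)
          have "phase_density k \<mu> v H x = (norm (H i x))\<^sup>2 - 2 * \<mu> * v i x"
            unfolding phase_density_def by (rule sumD[OF i]) (use one in auto)
          also have "\<dots> \<le> (norm (?F x + t *\<^sub>R \<psi>g x))\<^sup>2 - 2 * \<mu> * v i x" by (auto simp: H_def)
          also have "\<dots> \<le> (norm (?F x + t *\<^sub>R \<psi>g x))\<^sup>2 - 2 * \<mu> * (u l x + \<sigma> * (t * \<psi> x))"
            using \<sigma>t True lam_pos by (simp add: vi)
          finally have "phase_density k \<mu> v H x \<le>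
            (norm (?F x + t *\<^sub>R \<psi>g x))\<^sup>2 - (2 * \<mu> * (\<Sum>j=1..k. u j x) + t * (2 * \<mu> * (\<sigma> * \<psi> x)))"
            unfolding U by (simp add: algebra_simps)
          moreover have "\<forall>j\<in>{1..k}. \<bar>v j x - u j x\<bar> \<le> t * \<psi> x"
            using one vi l(2) True t\<psi> by (metis abs_of_nonneg add_diff_cancel_left' diff_self abs_zero order_refl)
          moreover have "\<forall>j\<in>{1..k}. \<forall>l\<in>{1..k}. j \<noteq> l \<longrightarrow> v j x * v l x = 0"
            using one by (metis mult_zero_left mult_zero_right)
          ultimately show ?thesis using den by blast
        next
          case False
          have vi: "v i x = max (t * \<psi> x - u l x) 0" "v l x = max (u l x - t * \<psi> x) 0"
            using f False by (auto simp: v_def)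
          \<comment> \<open>At most one of the two truncations is positive, and both candidate
            gradients equal \<open>?F x + t *\<^sub>R \<psi>g x\<close> up to sign.\<close>
          have H: "(norm (H i x))\<^sup>2 + (norm (H l x))\<^sup>2 \<le> (norm (?F x + t *\<^sub>R \<psi>g x))\<^sup>2"
            using False f F norm_minus_commute[of "G l x" "t *\<^sub>R \<psi>g x"] by (auto simp: H_def)
          have "phase_density k \<mu> v H x = (\<Sum>j\<in>{i,l}. (norm (H j x))\<^sup>2 - 2 * \<mu> * v j x)"
            unfolding phase_density_def by (rule sum.mono_neutral_right) (use i l(1) vj in auto)
          also have "\<dots> = (norm (H i x))\<^sup>2 + (norm (H l x))\<^sup>2 - 2 * \<mu> * (v i x + v l x)"
            using False by (auto simp: algebra_simps)
          also have "\<dots> \<le> (norm (?F x + t *\<^sub>R \<psi>g x))\<^sup>2 - 2 * \<mu> * (u l x + \<sigma> * (t * \<psi> x))"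
          proof -
            have "u l x + \<sigma> * (t * \<psi> x) \<le> v i x + v l x" using \<sigma>t False vi by auto
            then have "2 * \<mu> * (u l x + \<sigma> * (t * \<psi> x)) \<le> 2 * \<mu> * (v i x + v l x)"
              using lam_pos by (intro mult_left_mono) auto
            then show ?thesis using H by linarith
          qed
          finally have "phase_density k \<mu> v H x \<le>
            (norm (?F x + t *\<^sub>R \<psi>g x))\<^sup>2 - (2 * \<mu> * (\<Sum>j=1..k. u j x) + t * (2 * \<mu> * (\<sigma> * \<psi> x)))"
            unfolding U by (simp add: algebra_simps)
          moreover have "\<bar>v j x - u j x\<bar> \<le> t * \<psi> x" if "j \<in> {1..k}" for j
          proof -
            consider "j = i" | "j = l" | "j \<noteq> i" "j \<noteq> l" by blast
            then show ?thesis
            proof cases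
              case 1 then show ?thesis using vi ul t\<psi> l(2) i False by auto
            next
              case 2 then show ?thesis using vi ul t\<psi> by auto
            next
              case 3 then show ?thesis using vj[OF that] l(2) that t\<psi> by auto
            qed
          qed
          moreover have "v j x * v m x = 0" if "j \<in> {1..k}" "m \<in> {1..k}" "j \<noteq> m" for j m
          proof -
            have il: "v i x = 0 \<or> v l x = 0" using vi by auto
            have "v j x = 0 \<or> v m x = 0"
            proof (rule ccontr)
              assume nz: "\<not> ?thesis"
              then have "j = i \<or> j = l" "m = i \<or> m = l" using vj that by blast+
              then have "v i x \<noteq> 0 \<and> v l x \<noteq> 0" using nz \<open>j \<noteq> m\<close> by auto
              with il show False by blast
            qed
            then show ?thesis by simp
          qed
          ultimately show ?thesis using den by blast
        qed
      qed
    qed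
    have d: "(\<lambda>x. v j x - u j x) \<in> H10 \<Omega>" if "j \<in> {1..k}" for j
    proof (rule H10_abs_bound[OF open_dom bounded_dom H10_cmult[OF open_dom \<psi>(1), of t]])
      show "(\<lambda>x. v j x - u j x) \<in> H1 \<Omega>"
        by (rule wgrad_in_H1[OF wgrad_diff[OF open_dom w[OF that] wgrad[OF that]]])
      show "AE x in M. \<bar>v j x - u j x\<bar> \<le> \<bar>t * \<psi> x\<bar>"
        using pw
      proof eventually_elim
        case (elim x)
        then have "\<bar>v j x - u j x\<bar> \<le> t * \<psi> x" using that by blast
        then show ?case by linarith
      qed
    qed
    have s: "AE x in M. v j x * v l x = 0" if "j \<in> {1..k}" "l \<in> {1..k}" "j \<noteq> l" for j l
      using pw by eventually_elim (use that in blast)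
    note c = competitor[OF w d s]
    have iF: "integrable M (\<lambda>x. (norm (?F x + t *\<^sub>R \<psi>g x))\<^sup>2 - (2 * \<mu> * (\<Sum>j=1..k. u j x) + t * (2 * \<mu> * (\<sigma> * \<psi> x))))"
      using sq_int_add[OF wgradD(2)[OF wf] sq_int_scaleR[OF wgradD(2)[OF \<psi>(2)], of t]] ui \<psi>i
      by (intro Bochner_Integration.integrable_diff Bochner_Integration.integrable_add
          integrable_mult_right Bochner_Integration.integrable_sum) (auto simp: sq_int_def)
    have "(LINT x|M. (norm (?F x))\<^sup>2 - 2 * \<mu> * (\<Sum>j=1..k. u j x)) = (LINT x|M. phase_density k \<mu> u G x)"
    proof (rule integral_cong_AE)
      show "AE x in M. (norm (?F x))\<^sup>2 - 2 * \<mu> * (\<Sum>j=1..k. u j x) = phase_density k \<mu> u G x"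
        using pw by eventually_elim simp
      show "(\<lambda>x. (norm (?F x))\<^sup>2 - 2 * \<mu> * (\<Sum>j=1..k. u j x)) \<in> borel_measurable M"
        using wgradD(2)[OF wf] ui by (auto simp: sq_int_def)
    qed (use c in auto)
    also have "\<dots> \<le> (LINT x|M. phase_density k \<mu> v H x)" by (rule c(1))
    also have "\<dots> \<le> (LINT x|M. (norm (?F x + t *\<^sub>R \<psi>g x))\<^sup>2 - (2 * \<mu> * (\<Sum>j=1..k. u j x) + t * (2 * \<mu> * (\<sigma> * \<psi> x))))"
      using pw by (intro integral_mono_AE c iF) (auto elim: eventually_mono)
    finally show "(LINT x|M. (norm (?F x))\<^sup>2 - 2 * \<mu> * (\<Sum>j=1..k. u j x)) \<le>
      (LINT x|M. (norm (?F x + t *\<^sub>R \<psi>g x))\<^sup>2 - (2 * \<mu> * (\<Sum>j=1..k. u j x) + t * (2 * \<mu> * (\<sigma> * \<psi> x))))" .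
  qed
  then show ?thesis by (simp add: mult_ac)
qed

text \<open>The competitor lowers phase \<open>i\<close> to the positive part of u - t \<psi> and
  leaves the others alone; this shrinks its positivity set, so segregation is kept for any
  nonnegative \<psi>.\<close>

lemma subsolution:
  assumes i: "i \<in> {1..k}" and \<psi>: "\<psi> \<in> H10 \<Omega>" "wgrad \<Omega> \<psi> \<psi>g" "AE x in M. \<psi> x \<ge> 0"
  shows "(LINT x|M. G i x \<bullet> \<psi>g x) \<le> \<mu> * (LINT x|M. \<psi> x)"
proof -
  have fin: "finite_measure M" by (rule bounded_open_finite_measure[OF open_dom bounded_dom])
  have ui: "integrable M (\<lambda>x. u i x)" using sq_int_integrable[OF fin wgradD(1)[OF wgrad[OF i]]] .
  have \<psi>i: "integrable M \<psi>" using sq_int_integrable[OF fin wgradD(1)[OF \<psi>(2)]] .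
  have "(LINT x|M. - (2 * \<mu> * \<psi> x)) \<le> 2 * (LINT x|M. G i x \<bullet> (-1 *\<^sub>R \<psi>g x))"
  proof (rule quadratic_expansion[where r="\<lambda>x. 2 * \<mu> * u i x"])
    show "sq_int M (G i)" "sq_int M (\<lambda>x. -1 *\<^sub>R \<psi>g x)"
      using wgradD(2)[OF wgrad[OF i]] sq_int_scaleR[OF wgradD(2)[OF \<psi>(2)], of "-1"] .
    show "integrable M (\<lambda>x. 2 * \<mu> * u i x)" "integrable M (\<lambda>x. - (2 * \<mu> * \<psi> x))" using ui \<psi>i by auto
    fix t :: real assume t: "t > 0"
    define v where "v j x = (if j = i then max (u i x - t * \<psi> x) 0 else u j x)" for j x
    define H where "H j x = (if j = i then (if u i x - t * \<psi> x > 0 then G i x - t *\<^sub>R \<psi>g x else 0) else G j x)" for j x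
    have w: "wgrad \<Omega> (v j) (H j)" if "j \<in> {1..k}" for j
      using wgrad_pos[OF open_dom wgrad_diff[OF open_dom wgrad[OF i] wgrad_cmult[OF \<psi>(2), of t]]] wgrad[OF that]
      by (cases "j = i") (auto simp: v_def[abs_def] H_def[abs_def])
    have d: "(\<lambda>x. v j x - u j x) \<in> H10 \<Omega>" if "j \<in> {1..k}" for j
    proof (rule H10_abs_bound[OF open_dom bounded_dom H10_cmult[OF open_dom \<psi>(1), of t]])
      show "(\<lambda>x. v j x - u j x) \<in> H1 \<Omega>"
        by (rule wgrad_in_H1[OF wgrad_diff[OF open_dom w[OF that] wgrad[OF that]]])
      show "AE x in M. \<bar>v j x - u j x\<bar> \<le> \<bar>t * \<psi> x\<bar>"
        using nonneg_AE[OF i] \<psi>(3) by eventually_elim (use t in \<open>auto simp: v_def max_def\<close>)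
    qed
    have s: "AE x in M. v j x * v l x = 0" if "j \<in> {1..k}" "l \<in> {1..k}" "j \<noteq> l" for j l
      using segregated_AE nonneg_AE[OF i] \<psi>(3)
    proof eventually_elim
      case (elim x)
      then have "u j x * u l x = 0" using that by blast
      moreover have "t * \<psi> x \<ge> 0" using t elim by simp
      ultimately show ?case by (auto simp: v_def)
    qed
    note c = competitor[OF w d s]
    let ?a = "\<lambda>x. (norm (G i x))\<^sup>2 - 2 * \<mu> * u i x" and ?b = "\<lambda>x. (norm (H i x))\<^sup>2 - 2 * \<mu> * v i x"
    have diff: "phase_density k \<mu> v H x - phase_density k \<mu> u G x = ?b x - ?a x" for x
      unfolding phase_density_def using i
      by (subst (1 2) sum.remove[of _ i]) (auto intro!: sum.cong simp: v_def H_def)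
    have ia: "integrable M ?a" and ib: "integrable M ?b"
      using wgradD(1,2)[OF wgrad[OF i]] wgradD(1,2)[OF w[OF i]] sq_int_integrable[OF fin]
      by (auto simp: sq_int_def[of _ "G i"] sq_int_def[of _ "H i"])
    have "0 \<le> (LINT x|M. phase_density k \<mu> v H x - phase_density k \<mu> u G x)" using c by simp
    then have ab: "(LINT x|M. ?a x) \<le> (LINT x|M. ?b x)" unfolding diff using ia ib by simp
    also have "\<dots> \<le> (LINT x|M. (norm (G i x + t *\<^sub>R (-1 *\<^sub>R \<psi>g x)))\<^sup>2 - (2 * \<mu> * u i x + t * - (2 * \<mu> * \<psi> x)))"
    proof (rule integral_mono[OF ib])
      show "integrable M (\<lambda>x. (norm (G i x + t *\<^sub>R (-1 *\<^sub>R \<psi>g x)))\<^sup>2 - (2 * \<mu> * u i x + t * - (2 * \<mu> * \<psi> x)))"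
        using sq_int_add[OF wgradD(2)[OF wgrad[OF i]] sq_int_scaleR[OF wgradD(2)[OF \<psi>(2)], of "-t"]] ui \<psi>i
        by (auto simp: sq_int_def)
      fix x
      have "2 * \<mu> * (u i x - t * \<psi> x) \<le> 2 * \<mu> * v i x"
        using lam_pos by (intro mult_left_mono) (auto simp: v_def)
      moreover have "(norm (H i x))\<^sup>2 \<le> (norm (G i x + t *\<^sub>R (-1 *\<^sub>R \<psi>g x)))\<^sup>2" by (auto simp: H_def)
      moreover have "2 * \<mu> * (u i x - t * \<psi> x) = 2 * \<mu> * u i x + t * - (2 * \<mu> * \<psi> x)"
        by (simp add: algebra_simps)
      ultimately show "?b x \<le> (norm (G i x + t *\<^sub>R (-1 *\<^sub>R \<psi>g x)))\<^sup>2 - (2 * \<mu> * u i x + t * - (2 * \<mu> * \<psi> x))"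
        by linarith
    qed
    finally show "(LINT x|M. ?a x) \<le> (LINT x|M. (norm (G i x + t *\<^sub>R (-1 *\<^sub>R \<psi>g x)))\<^sup>2 - (2 * \<mu> * u i x + t * - (2 * \<mu> * \<psi> x)))" .
  qed
  then show ?thesis by simp
qed

end

section \<open>Mean value inequalities\<close>

lemma bump_deriv_has_derivative: "(bump_deriv n has_derivative (\<lambda>h. h * bump_deriv (Suc n) t)) (at t)"
  by (rule has_derivative_eq_rhs[OF bump_deriv_DERIV[unfolded has_field_derivative_def]]) (auto simp: mult.commute)

lemma norm_scaled_has_derivative:
  fixes x :: "'a::euclidean_space"
  shows "((\<lambda>y. 1 - (norm ((x - y) /\<^sub>R e))\<^sup>2) has_derivative (\<lambda>v. 2 * ((x - y) \<bullet> v) / e\<^sup>2)) (at y)"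
proof -
  have eq: "(norm (z /\<^sub>R e))\<^sup>2 = (z \<bullet> z) * inverse (e\<^sup>2)" for z :: 'a
    by (simp add: power_mult_distrib power_inverse power2_norm_eq_inner mult.commute)
  show ?thesis unfolding eq
    by (auto intro!: derivative_eq_intros ext simp: inner_commute divide_inverse)
qed

lemma mollifier_pot_DERIV:
  fixes x :: "'a::euclidean_space"
  assumes "e > 0"
  shows "((\<lambda>y. mollifier_pot e (x - y)) has_derivative (\<lambda>v. mollifier e (x - y) / e\<^sup>2 * ((x - y) \<bullet> v))) (at y)"
proof -
  let ?C = "mollifier_mass TYPE('a) * e ^ DIM('a)"
  have n: "((\<lambda>y. 1 - (norm ((x - y) /\<^sub>R e))\<^sup>2) has_derivative (\<lambda>v. 2 * ((x - y) \<bullet> v) / e\<^sup>2)) (at y)"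
    by (rule norm_scaled_has_derivative)
  have b: "(bump_deriv 0 has_derivative (\<lambda>h. h * bump_deriv 1 (1 - (norm ((x - y) /\<^sub>R e))\<^sup>2))) (at (1 - (norm ((x - y) /\<^sub>R e))\<^sup>2))"
    by (rule bump_deriv_has_derivative[of 0, folded One_nat_def])
  have "((\<lambda>y. bump_deriv 0 (1 - (norm ((x - y) /\<^sub>R e))\<^sup>2) * inverse (2 * ?C)) has_derivative
     (\<lambda>v. (2 * ((x - y) \<bullet> v) / e\<^sup>2) * bump_deriv 1 (1 - (norm ((x - y) /\<^sub>R e))\<^sup>2) * inverse (2 * ?C))) (at y)"
    by (rule has_derivative_mult_left[OF has_derivative_compose[OF n b]])
  moreover have "(\<lambda>y. mollifier_pot e (x - y)) = (\<lambda>y. bump_deriv 0 (1 - (norm ((x - y) /\<^sub>R e))\<^sup>2) * inverse (2 * ?C))"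
    by (simp only: mollifier_pot_def divide_inverse mult.assoc)
  moreover have "(2 * ((x - y) \<bullet> v) / e\<^sup>2) * bump_deriv 1 (1 - (norm ((x - y) /\<^sub>R e))\<^sup>2) * inverse (2 * ?C) =
    mollifier e (x - y) / e\<^sup>2 * ((x - y) \<bullet> v)" for v
  proof -
    have "(2 * A / E) * B * inverse (2 * C) = B / C / E * A" for A B C E :: real
      by (cases "C = 0"; cases "E = 0") (simp_all add: field_simps)
    then show ?thesis unfolding mollifier_def .
  qed
  ultimately show ?thesis by (simp only:)
qed

text \<open>The scale derivative of the mollifier: the first term differentiates the profile, the
  second the normalizing power of the scale.\<close>

definition mollifier_rate :: "real \<Rightarrow> 'a::euclidean_space \<Rightarrow> real" where
  "mollifier_rate t z = bump_deriv 2 (1 - (norm (z /\<^sub>R t))\<^sup>2) * (2 * (norm z)\<^sup>2 / t ^ 3) /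
     (mollifier_mass TYPE('a) * t ^ DIM('a)) - DIM('a) * mollifier t z / t"

lemma mollifier_DERIV_scale:
  fixes z :: "'a::euclidean_space"
  assumes "t > 0"
  shows "((\<lambda>t. mollifier t z) has_real_derivative mollifier_rate t z) (at t)"
proof -
  let ?m = "mollifier_mass TYPE('a)"
  have m: "?m \<noteq> 0" using mollifier_mass_pos[where 'a='a] by simp
  have eq: "1 - (norm (z /\<^sub>R s))\<^sup>2 = 1 - (norm z)\<^sup>2 / s\<^sup>2" for s
    by (simp add: power_mult_distrib power_inverse divide_inverse mult.commute)
  have n: "((\<lambda>s. 1 - (norm z)\<^sup>2 / s\<^sup>2) has_real_derivative 2 * (norm z)\<^sup>2 / t ^ 3) (at t)"
    using assms by (auto intro!: derivative_eq_intros simp: field_simps power2_eq_square power3_eq_cube)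
  have b: "((\<lambda>s. bump_deriv 1 (1 - (norm z)\<^sup>2 / s\<^sup>2)) has_real_derivative
      bump_deriv 2 (1 - (norm z)\<^sup>2 / t\<^sup>2) * (2 * (norm z)\<^sup>2 / t ^ 3)) (at t)"
    using DERIV_chain2[OF bump_deriv_DERIV n, of 1] by (simp add: numeral_2_eq_2)
  have p: "((\<lambda>s. ?m * s ^ DIM('a)) has_real_derivative ?m * (DIM('a) * t ^ (DIM('a) - 1))) (at t)"
    by (auto intro!: derivative_eq_intros)
  have c: "?m * t ^ DIM('a) \<noteq> 0" using m assms by simp
  have tp: "t ^ DIM('a) = t * t ^ (DIM('a) - 1)" by (simp add: power_eq_if)
  have "((\<lambda>s. bump_deriv 1 (1 - (norm z)\<^sup>2 / s\<^sup>2) / (?m * s ^ DIM('a))) has_real_derivative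
    (bump_deriv 2 (1 - (norm z)\<^sup>2 / t\<^sup>2) * (2 * (norm z)\<^sup>2 / t ^ 3) * (?m * t ^ DIM('a)) -
     bump_deriv 1 (1 - (norm z)\<^sup>2 / t\<^sup>2) * (?m * (DIM('a) * t ^ (DIM('a) - 1)))) /
     ((?m * t ^ DIM('a)) * (?m * t ^ DIM('a)))) (at t)"
    by (rule DERIV_divide[OF b p c])
  moreover have "(bump_deriv 2 (1 - (norm z)\<^sup>2 / t\<^sup>2) * (2 * (norm z)\<^sup>2 / t ^ 3) * (?m * t ^ DIM('a)) -
     bump_deriv 1 (1 - (norm z)\<^sup>2 / t\<^sup>2) * (?m * (DIM('a) * t ^ (DIM('a) - 1)))) /
     ((?m * t ^ DIM('a)) * (?m * t ^ DIM('a))) = mollifier_rate t z"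
  proof -
    have alg: "(A * (m * p) - B * (m * (D * q))) / ((m * p) * (m * p)) = A / (m * p) - D * (B / (m * p)) / t"
      if "m \<noteq> 0" "p = t * q" "q \<noteq> 0" for A B m p q D :: real
      using that assms by (simp add: field_simps)
    show ?thesis unfolding mollifier_rate_def mollifier_def eq
      by (rule alg[OF m tp]) (use assms in simp)
  qed
  ultimately show ?thesis unfolding mollifier_def eq by simp
qed

text \<open>The identity behind the mean value inequalities: it turns the derivative of a mean in
  its scale into a Laplacian falling on a nonnegative, compactly supported kernel.\<close>

lemma laplacian_mollifier_pot:
  fixes x :: "'a::euclidean_space"
  assumes "e > 0"
  shows "e * laplacian (\<lambda>y. mollifier_pot e (x - y)) y = mollifier_rate e (x - y)"
proof -
  let ?C = "mollifier_mass TYPE('a) * e ^ DIM('a)"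
  let ?z = "x - y"
  let ?A = "bump_deriv 2 (1 - (norm (?z /\<^sub>R e))\<^sup>2) / ?C"
  have fd: "frechet_derivative (\<lambda>y. mollifier_pot e (x - y)) (at y) b = mollifier e (x - y) / e\<^sup>2 * ((x - y) \<bullet> b)" for y b
    using frechet_derivative_eqI[OF mollifier_pot_DERIV[OF assms, of x y]] by simp
  have n: "((\<lambda>y. 1 - (norm ((x - y) /\<^sub>R e))\<^sup>2) has_derivative (\<lambda>v. 2 * (?z \<bullet> v) / e\<^sup>2)) (at y)"
    by (rule norm_scaled_has_derivative)
  have b1: "(bump_deriv 1 has_derivative (\<lambda>h. h * bump_deriv 2 (1 - (norm (?z /\<^sub>R e))\<^sup>2))) (at (1 - (norm (?z /\<^sub>R e))\<^sup>2))"
    by (rule bump_deriv_has_derivative[of 1, unfolded Suc_1])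
  have "((\<lambda>y. bump_deriv 1 (1 - (norm ((x - y) /\<^sub>R e))\<^sup>2) * inverse ?C) has_derivative
     (\<lambda>v. (2 * (?z \<bullet> v) / e\<^sup>2) * bump_deriv 2 (1 - (norm (?z /\<^sub>R e))\<^sup>2) * inverse ?C)) (at y)"
    by (rule has_derivative_mult_left[OF has_derivative_compose[OF n b1]])
  moreover have "(\<lambda>y. mollifier e (x - y)) = (\<lambda>y. bump_deriv 1 (1 - (norm ((x - y) /\<^sub>R e))\<^sup>2) * inverse ?C)"
    by (simp only: mollifier_def divide_inverse)
  moreover have "(\<lambda>v. (2 * (?z \<bullet> v) / e\<^sup>2) * bump_deriv 2 (1 - (norm (?z /\<^sub>R e))\<^sup>2) * inverse ?C) =
      (\<lambda>v. ?A * (2 * (?z \<bullet> v) / e\<^sup>2))" by (simp only: divide_inverse mult_ac)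
  ultimately have dm: "((\<lambda>y. mollifier e (x - y)) has_derivative (\<lambda>v. ?A * (2 * (?z \<bullet> v) / e\<^sup>2))) (at y)" by simp
  have "frechet_derivative (\<lambda>y. mollifier e (x - y) / e\<^sup>2 * ((x - y) \<bullet> b)) (at y) b =
     ?A * 2 / e ^ 4 * (?z \<bullet> b)\<^sup>2 - mollifier e ?z / e\<^sup>2" if "b \<in> Basis" for b
  proof -
    have "((\<lambda>y. mollifier e (x - y) * ((x - y) \<bullet> b) * inverse (e\<^sup>2)) has_derivative
      (\<lambda>v. (mollifier e ?z * ((0 - v) \<bullet> b) + ?A * (2 * (?z \<bullet> v) / e\<^sup>2) * (?z \<bullet> b)) * inverse (e\<^sup>2))) (at y)"
      by (intro has_derivative_mult_left has_derivative_mult dm has_derivative_inner_left derivative_intros)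
    then have "((\<lambda>y. mollifier e (x - y) / e\<^sup>2 * ((x - y) \<bullet> b)) has_derivative
      (\<lambda>v. (mollifier e ?z * ((0 - v) \<bullet> b) + ?A * (2 * (?z \<bullet> v) / e\<^sup>2) * (?z \<bullet> b)) * inverse (e\<^sup>2))) (at y)"
      by (simp add: divide_inverse mult_ac)
    from frechet_derivative_eqI[OF this] show ?thesis
      using that by (simp add: inner_same_Basis divide_inverse power2_eq_square power4_eq_xxxx algebra_simps)
  qed
  then have "laplacian (\<lambda>y. mollifier_pot e (x - y)) y = (\<Sum>b\<in>Basis. ?A * 2 / e ^ 4 * (?z \<bullet> b)\<^sup>2 - mollifier e ?z / e\<^sup>2)"
    unfolding laplacian_def fd by (intro sum.cong) auto
  also have "\<dots> = ?A * 2 / e ^ 4 * (\<Sum>b\<in>Basis. (?z \<bullet> b)\<^sup>2) - DIM('a) * (mollifier e ?z / e\<^sup>2)"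
    by (simp add: sum_subtractf sum_distrib_left)
  also have "(\<Sum>b\<in>Basis. (?z \<bullet> b)\<^sup>2) = (norm ?z)\<^sup>2"
    unfolding power2_norm_eq_inner by (subst (2) euclidean_inner) (simp add: power2_eq_square)
  finally have L: "laplacian (\<lambda>y. mollifier_pot e (x - y)) y =
     ?A * 2 / e ^ 4 * (norm ?z)\<^sup>2 - DIM('a) * (mollifier e ?z / e\<^sup>2)" .
  have alg: "e * (B / C * 2 / e ^ 4 * N - D * (m / e\<^sup>2)) = B * (2 * N / e ^ 3) / C - D * m / e" for B C N D m :: real
    using assms by (cases "C = 0") (simp_all add: field_simps power2_eq_square power3_eq_cube power4_eq_xxxx)
  show ?thesis unfolding L mollifier_rate_def by (rule alg)
qed

text \<open>The potential has the same integral at every scale, twice this constant; integrating t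
  times it over 0 < t < e gives \<open>mean_const\<close> times e^2, the second-order coefficient of
  all mean value inequalities.\<close>

definition mean_const :: "'a::euclidean_space itself \<Rightarrow> real" where
  "mean_const _ = (LINT z|lborel. mollifier_pot 1 (z::'a)) / 2"

lemma mollifier_pot_integral:
  fixes x :: "'a::euclidean_space"
  assumes "e > 0"
  shows "(LINT y|lborel. mollifier_pot e (x - y)) = 2 * mean_const TYPE('a)"
proof -
  have tp: "test_function UNIV (mollifier_pot e :: 'a \<Rightarrow> real)" using assms by (intro test_function_mollifier_pot) auto
  have i: "integrable lborel (mollifier_pot e :: 'a \<Rightarrow> real)" by (rule test_function_integrable[OF tp])
  have "(LINT y|lborel. mollifier_pot e (x - y)) = (LINT y|lborel. mollifier_pot e (- x + y))"
    by (rule Bochner_Integration.integral_cong) (auto simp: mollifier_pot_def norm_minus_commute)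
  also have "\<dots> = (LINT z|lborel. mollifier_pot e (z::'a))" by (rule lborel_shift_integral(2)[OF i])
  also have "\<dots> = e ^ DIM('a) * (LINT z|lborel. mollifier_pot e (e *\<^sub>R (z::'a)))"
    by (rule lborel_integral_scaleR[OF assms i])
  also have "(LINT z|lborel. mollifier_pot e (e *\<^sub>R (z::'a))) = (LINT z|lborel. inverse (e ^ DIM('a)) * mollifier_pot 1 (z::'a))"
    by (rule Bochner_Integration.integral_cong) (use assms in \<open>auto simp: mollifier_pot_def field_simps\<close>)
  finally show ?thesis using assms by (simp add: mean_const_def)
qed

lemma mean_const_pos: "mean_const TYPE('a::euclidean_space) > 0"
proof -
  let ?f = "mollifier_pot 1 :: 'a \<Rightarrow> real"
  have tf: "test_function UNIV ?f" by (rule test_function_mollifier_pot) auto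
  have nn: "0 \<le> ?f z" for z by (rule mollifier_pot_nonneg) simp
  have "integral\<^sup>L lborel ?f \<noteq> 0"
  proof
    assume "integral\<^sup>L lborel ?f = 0"
    then have "AE z in lborel. ?f z = 0"
      using integral_nonneg_eq_0_iff_AE[OF test_function_integrable[OF tf]] nn by auto
    then have "AE z in lborel. z \<notin> ball (0::'a) 1"
    proof (rule AE_mp, intro AE_I2 impI)
      fix z assume "?f z = 0"
      then have "bump_deriv 0 (1 - (norm z)\<^sup>2) = 0"
        using mollifier_mass_pos[where 'a='a] by (simp add: mollifier_pot_def)
      then show "z \<notin> ball (0::'a) 1"
        using abs_square_less_1[of "norm z"] by (auto simp: bump_deriv_0 split: if_splits)
    qed
    then have "ball (0::'a) 1 \<in> null_sets lborel" by (simp add: AE_iff_null_sets)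
    then have "negligible (ball (0::'a) 1)"
      using null_sets_completionI negligible_iff_null_sets by blast
    then show False using open_not_negligible[of "ball (0::'a) 1"] by auto
  qed
  moreover have "integral\<^sup>L lborel ?f \<ge> 0" using nn by simp
  ultimately show ?thesis by (simp add: mean_const_def)
qed

lemma conv_mollifier_cong:
  assumes "e > 0" "\<And>y. y \<in> ball x e \<Longrightarrow> u y = v y"
  shows "conv u (mollifier e) x = conv v (mollifier e) x"
  unfolding conv_def
proof (rule Bochner_Integration.integral_cong)
  show "u y * mollifier e (x - y) = v y * mollifier e (x - y)" for y
    using assms mollifier_eq_0[OF assms(1), of "x - y"] by (cases "y \<in> ball x e") (auto simp: dist_norm)
qed simp

lemma conv_mollifier_integrable:
  fixes u :: "'a::euclidean_space \<Rightarrow> real"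
  assumes "e > 0" "continuous_on (cball x e) u"
  shows "integrable lborel (\<lambda>y. u y * mollifier e (x - y))"
proof -
  have c: "continuous_on UNIV (\<lambda>y. mollifier e (x - y))"
    using test_function_continuous[OF test_function_reflect[OF test_function_mollifier_UNIV[OF assms(1)]]] .
  have "integrable lborel (\<lambda>y. indicator (cball x e) y *\<^sub>R (u y * mollifier e (x - y)))"
    by (intro borel_integrable_compact continuous_on_mult assms continuous_on_subset[OF c]) auto
  moreover have "(\<lambda>y. indicator (cball x e) y *\<^sub>R (u y * mollifier e (x - y))) = (\<lambda>y. u y * mollifier e (x - y))"
  proof
    show "indicator (cball x e) y *\<^sub>R (u y * mollifier e (x - y)) = u y * mollifier e (x - y)" for y
      using mollifier_eq_0[OF assms(1), of "x - y"] by (cases "y \<in> cball x e") (auto simp: dist_norm)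
  qed
  ultimately show ?thesis by simp
qed

lemma conv_mollifier_mono:
  assumes "e > 0" "continuous_on (cball x e) u" "continuous_on (cball x e) v" "\<And>y. y \<in> ball x e \<Longrightarrow> u y \<le> v y"
  shows "conv u (mollifier e) x \<le> conv v (mollifier e) x"
  unfolding conv_def
proof (rule integral_mono)
  show "u y * mollifier e (x - y) \<le> v y * mollifier e (x - y)" for y
    using assms(4)[of y] mollifier_eq_0[OF assms(1), of "x - y"] mollifier_nonneg[OF assms(1), of "x - y"]
    by (cases "y \<in> ball x e") (auto simp: dist_norm intro: mult_right_mono)
qed (use assms conv_mollifier_integrable in auto)

lemma conv_mollifier_const: "e > 0 \<Longrightarrow> conv (\<lambda>y. c) (mollifier e) x = c"
  using mollifier_integrable[of e x] by (simp add: conv_def)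

lemma conv_mollifier_linear:
  assumes "e > 0" "continuous_on (cball x e) u" "continuous_on (cball x e) v"
  shows "conv (\<lambda>y. a * u y + b * v y) (mollifier e) x = a * conv u (mollifier e) x + b * conv v (mollifier e) x"
  unfolding conv_def
  using conv_mollifier_integrable[OF assms(1,2)] conv_mollifier_integrable[OF assms(1,3)]
  by (simp add: distrib_right mult.assoc)

lemma conv_mollifier_tendsto:
  assumes "open \<Omega>" "continuous_on \<Omega> u" "x \<in> \<Omega>"
  shows "((\<lambda>e. conv u (mollifier e) x) \<longlongrightarrow> u x) (at_right 0)"
proof (rule tendstoI)
  fix d :: real assume "d > 0"
  obtain r where r: "r > 0" "cball x r \<subseteq> \<Omega>" using assms open_contains_cball by blast
  obtain s where s: "s > 0" "\<And>y. y \<in> \<Omega> \<Longrightarrow> dist y x < s \<Longrightarrow> dist (u y) (u x) < d / 2"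
    using assms(2,3) half_gt_zero[OF \<open>d > 0\<close>] unfolding continuous_on_iff by blast
  have "dist (conv u (mollifier e) x) (u x) < d" if e: "0 < e" "e < min r s" for e
  proof -
    have c: "continuous_on (cball x e) u"
      using e r by (intro continuous_on_subset[OF assms(2)]) (meson less_imp_le min_less_iff_conj order_trans subset_cball)
    have "\<bar>u y - u x\<bar> \<le> d / 2" if "y \<in> ball x e" for y
    proof -
      have "y \<in> \<Omega>" "dist y x < s" using that e r(2) by (auto simp: dist_commute)
      from s(2)[OF this] show ?thesis by (simp add: dist_real_def)
    qed
    then have "u x - d / 2 \<le> u y \<and> u y \<le> u x + d / 2" if "y \<in> ball x e" for y
      using that by (smt (verit, best))
    then have "conv u (mollifier e) x \<le> conv (\<lambda>y. u x + d / 2) (mollifier e) x"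
      "conv (\<lambda>y. u x - d / 2) (mollifier e) x \<le> conv u (mollifier e) x"
      using e c by (intro conv_mollifier_mono; simp)+
    then have "\<bar>conv u (mollifier e) x - u x\<bar> \<le> d / 2" unfolding conv_mollifier_const[OF e(1)] by linarith
    then show ?thesis using \<open>d > 0\<close> unfolding dist_real_def by linarith
  qed
  then show "\<forall>\<^sub>F e in at_right 0. dist (conv u (mollifier e) x) (u x) < d"
    using r(1) s(1) by (intro eventually_at_rightI[of 0 "min r s"]) auto
qed

lemma integral_eq_cbox:
  fixes f :: "'a::euclidean_space \<Rightarrow> real"
  assumes "continuous_on UNIV f" "\<And>y. y \<notin> cbox a b \<Longrightarrow> f y = 0"
  shows "(LINT y|lborel. f y) = integral (cbox a b) f"
proof -
  have "integrable lborel f" by (rule compact_support_integrable[OF assms(1) compact_cbox assms(2)])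
  then have "(LINT y|lborel. f y) = integral UNIV f" by (simp add: integral_lborel)
  also have "\<dots> = integral UNIV (\<lambda>y. if y \<in> cbox a b then f y else 0)"
    by (rule arg_cong[where f="integral UNIV"]) (auto simp: assms(2))
  also have "\<dots> = integral (cbox a b) f" by (rule integral_restrict_UNIV)
  finally show ?thesis .
qed

text \<open>All derivatives fall on the kernel, so continuity of \<open>u\<close> suffices. For
  scales below \<open>T\<close> the kernels live in one box, to which differentiation under the
  integral sign applies.\<close>

lemma conv_mollifier_DERIV:
  fixes u :: "'a::euclidean_space \<Rightarrow> real"
  assumes c: "continuous_on UNIV u" and "t > 0"
  shows "((\<lambda>t. conv u (mollifier t) x) has_real_derivative
    t * (LINT y|lborel. u y * laplacian (\<lambda>y. mollifier_pot t (x - y)) y)) (at t)"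
proof -
  define T where "T = t + 1"
  obtain a b where ab: "cball x T \<subseteq> cbox a b"
    by (rule bounded_subset_cbox_symmetric[OF bounded_cball, of x T]) blast
  define U where "U = {0<..<T}"
  have U: "t \<in> U" "convex U" "open U" using \<open>t > 0\<close> by (auto simp: U_def T_def)
  have bc: "continuous_on UNIV (bump_deriv n)" for n
    by (rule continuous_at_imp_continuous_on) (use bump_deriv_DERIV DERIV_isCont in blast)
  have cm: "continuous_on UNIV (\<lambda>y. u y * mollifier s (x - y))" if "s \<in> U" for s
  proof -
    have "s > 0" using that by (simp add: U_def)
    from test_function_continuous[OF test_function_reflect[OF test_function_mollifier_UNIV[OF this]]]
    show ?thesis by (intro continuous_on_mult c)
  qed
  have "((\<lambda>s. integral (cbox a b) (\<lambda>y. u y * mollifier s (x - y))) has_field_derivative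
      integral (cbox a b) (\<lambda>y. u y * mollifier_rate t (x - y))) (at t within U)"
  proof (rule leibniz_rule_field_derivative[OF _ _ _ U(1,2)])
    fix s y assume s: "s \<in> U"
    then have "s > 0" by (simp add: U_def)
    from DERIV_cmult[OF mollifier_DERIV_scale[OF this]]
    show "((\<lambda>s. u y * mollifier s (x - y)) has_field_derivative u y * mollifier_rate s (x - y)) (at s within U)"
      by (rule DERIV_subset) simp
    show "(\<lambda>y. u y * mollifier s (x - y)) integrable_on cbox a b"
      by (rule integrable_continuous) (rule continuous_on_subset[OF cm[OF s]], simp)
  next
    have "continuous_on (U \<times> cbox a b) (\<lambda>p. u (snd p) * mollifier_rate (fst p) (x - snd p))"
      unfolding mollifier_rate_def mollifier_def
      using mollifier_mass_pos[where 'a='a]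
      by (intro continuous_intros continuous_on_compose2[OF c] continuous_on_compose2[OF bc]) (auto simp: U_def)
    then show "continuous_on (U \<times> cbox a b) (\<lambda>(s, y). u y * mollifier_rate s (x - y))"
      by (simp add: case_prod_beta)
  qed
  then have D: "((\<lambda>s. integral (cbox a b) (\<lambda>y. u y * mollifier s (x - y))) has_real_derivative
      integral (cbox a b) (\<lambda>y. u y * mollifier_rate t (x - y))) (at t)"
    unfolding at_within_open[OF U(1,3)] .
  have out: "mollifier s (x - y) = 0" if "s \<in> U" "y \<notin> cbox a b" for s y
  proof (rule mollifier_eq_0)
    have "y \<notin> cball x T" using ab that(2) by blast
    then show "s \<le> norm (x - y)" using that(1) by (simp add: U_def dist_norm)
  qed (use that in \<open>simp add: U_def\<close>)
  have "((\<lambda>t. conv u (mollifier t) x) has_real_derivative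
      integral (cbox a b) (\<lambda>y. u y * mollifier_rate t (x - y))) (at t)"
  proof (rule has_field_derivative_transform_within_open[OF D U(3,1)])
    show "integral (cbox a b) (\<lambda>y. u y * mollifier s (x - y)) = conv u (mollifier s) x" if "s \<in> U" for s
      unfolding conv_def by (rule integral_eq_cbox[symmetric, OF cm[OF that]]) (simp add: out[OF that])
  qed
  moreover have "integral (cbox a b) (\<lambda>y. u y * mollifier_rate t (x - y)) =
      t * (LINT y|lborel. u y * laplacian (\<lambda>y. mollifier_pot t (x - y)) y)"
  proof -
    have tp: "test_function UNIV (\<lambda>y. mollifier_pot t (x - y))"
      by (intro test_function_reflect test_function_mollifier_pot) (use \<open>t > 0\<close> in auto)
    have cl: "continuous_on UNIV (laplacian (\<lambda>y. mollifier_pot t (x - y)))"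
      unfolding laplacian_def
      by (intro continuous_on_sum test_function_continuous[OF test_function_frechet_derivative[OF
            test_function_frechet_derivative[OF tp]]])
    have r: "mollifier_rate t (x - y) = t * laplacian (\<lambda>y. mollifier_pot t (x - y)) y" for y
      by (rule laplacian_mollifier_pot[OF \<open>t > 0\<close>, symmetric])
    have "mollifier_rate t (x - y) = 0" if "y \<notin> cbox a b" for y
    proof -
      have "y \<notin> cball x T" using ab that by blast
      then have "t \<le> norm (x - y)" by (simp add: T_def dist_norm)
      then have "1 \<le> norm ((x - y) /\<^sub>R t)" using \<open>t > 0\<close> by (simp add: divide_inverse_commute[symmetric])
      then have "bump_deriv 2 (1 - (norm ((x - y) /\<^sub>R t))\<^sup>2) = 0"
        by (intro bump_deriv_nonpos) (simp add: one_le_power del: norm_scaleR)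
      then show ?thesis using out[OF U(1) that] by (simp add: mollifier_rate_def)
    qed
    then have "integral (cbox a b) (\<lambda>y. u y * mollifier_rate t (x - y)) = (LINT y|lborel. u y * mollifier_rate t (x - y))"
    proof (intro integral_eq_cbox[symmetric])
      show "continuous_on UNIV (\<lambda>y. u y * mollifier_rate t (x - y))"
        unfolding r by (intro continuous_on_mult continuous_on_const c cl)
    qed simp
    also have "\<dots> = t * (LINT y|lborel. u y * laplacian (\<lambda>y. mollifier_pot t (x - y)) y)"
      unfolding r by (subst integral_mult_right_zero[symmetric]) (simp add: mult_ac)
    finally show ?thesis .
  qed
  ultimately show ?thesis by simp
qed

lemma wgrad_integral_laplacian:
  assumes \<Omega>: "open \<Omega>" and w: "wgrad \<Omega> u G" and \<psi>: "test_function \<Omega> \<psi>"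
  shows "(LINT x|lebesgue_on \<Omega>. G x \<bullet> grad \<psi> x) = - (LINT x|lebesgue_on \<Omega>. u x * laplacian \<psi> x)"
proof -
  have tb: "test_function \<Omega> (\<lambda>x. frechet_derivative \<psi> (at x) b)" for b
    by (rule test_function_frechet_derivative[OF \<psi>])
  have gb: "grad (\<lambda>x. frechet_derivative \<psi> (at x) b) x \<bullet> b = frechet_derivative (\<lambda>y. frechet_derivative \<psi> (at y) b) (at x) b"
    if "b \<in> Basis" for x b by (rule grad_inner_Basis[OF that])
  have i1: "integrable (lebesgue_on \<Omega>) (\<lambda>x. (G x \<bullet> b) * (grad \<psi> x \<bullet> b))" if "b \<in> Basis" for b
    using sq_int_mult_integrable[OF sq_int_inner_Basis[OF wgradD(2)[OF w] that]
        sq_int_inner_Basis[OF test_function_sq_int(2)[OF \<psi> \<Omega>] that]] .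
  have i2: "integrable (lebesgue_on \<Omega>) (\<lambda>x. u x * (grad (\<lambda>x. frechet_derivative \<psi> (at x) b) x \<bullet> b))" if "b \<in> Basis" for b
    using sq_int_mult_integrable[OF wgradD(1)[OF w] sq_int_inner_Basis[OF test_function_sq_int(2)[OF tb \<Omega>] that]] .
  have "(LINT x|lebesgue_on \<Omega>. G x \<bullet> grad \<psi> x) = (\<Sum>b\<in>Basis. LINT x|lebesgue_on \<Omega>. (G x \<bullet> b) * (grad \<psi> x \<bullet> b))"
    using i1 by (subst euclidean_inner) (simp add: Bochner_Integration.integral_sum)
  also have "\<dots> = (\<Sum>b\<in>Basis. - (LINT x|lebesgue_on \<Omega>. u x * (grad (\<lambda>x. frechet_derivative \<psi> (at x) b) x \<bullet> b)))"
    using wgradD(3)[OF w tb] by (intro sum.cong) (auto simp: frechet_derivative_eq_grad[OF \<psi>])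
  also have "\<dots> = - (LINT x|lebesgue_on \<Omega>. (\<Sum>b\<in>Basis. u x * (grad (\<lambda>x. frechet_derivative \<psi> (at x) b) x \<bullet> b)))"
    using i2 by (simp add: Bochner_Integration.integral_sum sum_negf)
  also have "(\<lambda>x. \<Sum>b\<in>Basis. u x * (grad (\<lambda>x. frechet_derivative \<psi> (at x) b) x \<bullet> b)) = (\<lambda>x. u x * laplacian \<psi> x)"
    using gb by (auto simp: laplacian_def sum_distrib_left intro!: sum.cong)
  finally show ?thesis .
qed

text \<open>The derivative of the mean with respect to its scale \<open>t\<close> is \<open>t\<close> times the weak form of the
  Laplacian, tested with the potential of the mollifier.\<close>

lemma mean_value_supersolution:
  fixes u :: "'a::euclidean_space \<Rightarrow> real"
  assumes \<Omega>: "open \<Omega>" and w: "wgrad \<Omega> u G" and c: "continuous_on \<Omega> u" and e: "e > 0" "cball x e \<subseteq> \<Omega>"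
    and sup: "\<And>\<psi>. test_function \<Omega> \<psi> \<Longrightarrow> (\<And>y. 0 \<le> \<psi> y) \<Longrightarrow> (\<And>y. y \<notin> cball x e \<Longrightarrow> \<psi> y = 0) \<Longrightarrow>
      a * (LINT y|lebesgue_on \<Omega>. \<psi> y) \<le> (LINT y|lebesgue_on \<Omega>. G y \<bullet> grad \<psi> y)"
  shows "conv u (mollifier e) x \<le> u x - a * mean_const TYPE('a) * e\<^sup>2"
proof -
  \<comment> \<open>Only values in \<open>cball x e\<close> enter the means; the continuous
    extension makes the scale derivative available.\<close>
  obtain v where v: "continuous_on UNIV v" "\<And>y. y \<in> cball x e \<Longrightarrow> v y = u y"
    using Tietze_unbounded[of "cball x e" u UNIV] continuous_on_subset[OF c e(2)] by auto
  let ?P = "mean_const TYPE('a)"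
  \<comment> \<open>The corrected mean is nonincreasing in the scale, by \<open>sup\<close> applied
    to the potential of scale t, and tends to the value at \<open>x\<close> as the scale goes to
    0.\<close>
  let ?g = "\<lambda>t. conv v (mollifier t) x + a * ?P * t\<^sup>2"
  let ?g' = "\<lambda>t. t * (LINT y|lborel. v y * laplacian (\<lambda>y. mollifier_pot t (x - y)) y) + a * ?P * (2 * t)"
  have D: "(?g has_real_derivative ?g' t) (at t)" if "t > 0" for t
    by (auto intro!: derivative_eq_intros conv_mollifier_DERIV[OF v(1) that])
  have neg: "?g' t \<le> 0" if t: "0 < t" "t \<le> e" for t
  proof -
    let ?\<psi> = "\<lambda>y. mollifier_pot t (x - y)"
    have zero: "?\<psi> y = 0" if "y \<notin> cball x t" for y
      using that t by (intro mollifier_pot_eq_0) (auto simp: dist_norm)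
    have tU: "test_function UNIV ?\<psi>"
      by (intro test_function_reflect test_function_mollifier_pot) (use t in auto)
    have sub: "cball x t \<subseteq> cball x e" using t by (intro subset_cball) auto
    have tp: "test_function \<Omega> ?\<psi>"
      using sub e(2) zero by (intro test_functionI[OF test_function_smooth[OF tU], of "cball x t"]) auto
    have lz: "laplacian ?\<psi> y = 0" if "y \<notin> cball x t" for y
    proof -
      have "frechet_derivative ?\<psi> (at z) = (\<lambda>v. 0)" if "z \<notin> cball x t" for z
        by (rule frechet_derivative_eq_0_outside[OF closed_cball zero that])
      then have "frechet_derivative (\<lambda>z. frechet_derivative ?\<psi> (at z) b) (at y) = (\<lambda>v. 0)" for b
        by (intro frechet_derivative_eq_0_outside[OF closed_cball _ that]) simp
      then show ?thesis by (simp add: laplacian_def)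
    qed
    have cl: "continuous_on UNIV (laplacian ?\<psi>)"
      unfolding laplacian_def
      by (intro continuous_on_sum test_function_continuous[OF test_function_frechet_derivative[OF
            test_function_frechet_derivative[OF tU]]])
    have "a * (LINT y|lebesgue_on \<Omega>. ?\<psi> y) \<le> (LINT y|lebesgue_on \<Omega>. G y \<bullet> grad ?\<psi> y)"
      by (rule sup[OF tp]) (use zero sub mollifier_pot_nonneg t in auto)
    also have "\<dots> = - (LINT y|lebesgue_on \<Omega>. u y * laplacian ?\<psi> y)" by (rule wgrad_integral_laplacian[OF \<Omega> w tp])
    also have "(LINT y|lebesgue_on \<Omega>. u y * laplacian ?\<psi> y) = (LINT y|lborel. v y * laplacian ?\<psi> y)"
    proof (rule lebesgue_on_integral_eq(1))
      show "(\<lambda>y. u y * laplacian ?\<psi> y) \<in> borel_measurable (lebesgue_on \<Omega>)"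
        using wgradD(1)[OF w] continuous_imp_measurable_lebesgue_on[OF cl, of \<Omega>] by (auto simp: sq_int_def)
      show "(\<lambda>y. v y * laplacian ?\<psi> y) \<in> borel_measurable borel"
        by (intro borel_measurable_continuous_onI continuous_on_mult v cl)
      show "AE y in lebesgue_on \<Omega>. v y * laplacian ?\<psi> y = u y * laplacian ?\<psi> y"
      proof (intro AE_I2)
        fix y show "v y * laplacian ?\<psi> y = u y * laplacian ?\<psi> y"
          using v(2)[of y] lz[of y] sub by (cases "y \<in> cball x t") auto
      qed
      show "v y * laplacian ?\<psi> y = 0" if "y \<notin> \<Omega>" for y
      proof -
        have "y \<notin> cball x t" using that sub e(2) by blast
        then show ?thesis using lz by simp
      qed
    qed (use \<Omega> in auto)
    also have "(LINT y|lebesgue_on \<Omega>. ?\<psi> y) = (LINT y|lborel. ?\<psi> y)"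
    proof (rule lebesgue_on_integral_eq(1))
      show "?\<psi> y = 0" if "y \<notin> \<Omega>" for y using zero[of y] that sub e(2) by blast
    qed (use test_function_measurable[OF tp] \<Omega> in auto)
    also have "\<dots> = 2 * ?P" by (rule mollifier_pot_integral[OF t(1)])
    finally have "(LINT y|lborel. v y * laplacian ?\<psi> y) + a * ?P * 2 \<le> 0" by simp
    from mult_left_mono[OF this, of t] show ?thesis using t by (simp add: algebra_simps)
  qed
  have mono: "?g e \<le> ?g s" if s: "0 < s" "s \<le> e" for s
  proof (rule DERIV_nonpos_imp_nonincreasing[OF s(2)])
    fix t assume "s \<le> t" "t \<le> e"
    then show "\<exists>y. (?g has_real_derivative y) (at t) \<and> y \<le> 0" using D[of t] neg[of t] s by auto
  qed
  have "((\<lambda>s. ?g s) \<longlongrightarrow> v x + a * ?P * 0\<^sup>2) (at_right 0)"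
    by (intro tendsto_intros conv_mollifier_tendsto[of UNIV] v) auto
  then have "?g e \<le> v x + a * ?P * 0\<^sup>2"
  proof (rule tendsto_lowerbound)
    show "\<forall>\<^sub>F s in at_right 0. ?g e \<le> ?g s" using mono e(1) by (intro eventually_at_rightI[of 0 e]) auto
  qed simp
  moreover have "conv v (mollifier e) x = conv u (mollifier e) x"
    using e(1) v(2) by (intro conv_mollifier_cong) auto
  ultimately show ?thesis using v(2)[of x] e(1) by simp
qed

lemma smooth_green:
  assumes \<Omega>: "bounded \<Omega>" "open \<Omega>" and f: "smooth_on UNIV f" and \<psi>: "test_function \<Omega> \<psi>"
  shows "(LINT x|lebesgue_on \<Omega>. grad f x \<bullet> grad \<psi> x) = - (LINT x|lebesgue_on \<Omega>. laplacian f x * \<psi> x)"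
proof -
  have fb: "smooth_on UNIV (\<lambda>x. frechet_derivative f (at x) b)" for b
    by (rule smooth_on_frechet_derivative[OF f])
  note wf = smooth_bounded_wgrad[OF \<Omega> f] note wb = smooth_bounded_wgrad[OF \<Omega> fb]
  note t = test_function_sq_int[OF \<psi> \<Omega>(2)]
  have i1: "integrable (lebesgue_on \<Omega>) (\<lambda>x. (grad f x \<bullet> b) * (grad \<psi> x \<bullet> b))" if "b \<in> Basis" for b
    using sq_int_mult_integrable[OF sq_int_inner_Basis[OF wgradD(2)[OF wf] that] sq_int_inner_Basis[OF t(2) that]] .
  have i2: "integrable (lebesgue_on \<Omega>) (\<lambda>x. (grad (\<lambda>x. frechet_derivative f (at x) b) x \<bullet> b) * \<psi> x)" if "b \<in> Basis" for b
    using sq_int_mult_integrable[OF sq_int_inner_Basis[OF wgradD(2)[OF wb] that] t(1)] .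
  have "(LINT x|lebesgue_on \<Omega>. grad f x \<bullet> grad \<psi> x) = (\<Sum>b\<in>Basis. LINT x|lebesgue_on \<Omega>. (grad f x \<bullet> b) * (grad \<psi> x \<bullet> b))"
    using i1 by (subst euclidean_inner) (simp add: Bochner_Integration.integral_sum)
  also have "\<dots> = (\<Sum>b\<in>Basis. - (LINT x|lebesgue_on \<Omega>. (grad (\<lambda>x. frechet_derivative f (at x) b) x \<bullet> b) * \<psi> x))"
    using wgradD(3)[OF wb \<psi>] by (intro sum.cong) (auto simp: grad_inner_Basis)
  also have "\<dots> = - (LINT x|lebesgue_on \<Omega>. (\<Sum>b\<in>Basis. (grad (\<lambda>x. frechet_derivative f (at x) b) x \<bullet> b) * \<psi> x))"
    using i2 by (simp add: Bochner_Integration.integral_sum sum_negf)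
  also have "(\<lambda>x. \<Sum>b\<in>Basis. (grad (\<lambda>x. frechet_derivative f (at x) b) x \<bullet> b) * \<psi> x) = (\<lambda>x. laplacian f x * \<psi> x)"
    by (auto simp: laplacian_def sum_distrib_right grad_inner_Basis intro!: sum.cong)
  finally show ?thesis .
qed

lemma smooth_on_laplacian: "open S \<Longrightarrow> smooth_on S f \<Longrightarrow> smooth_on S (laplacian f)"
  unfolding laplacian_def by (intro smooth_on_sum smooth_on_frechet_derivative)

lemma smooth_mean:
  fixes f :: "'a::euclidean_space \<Rightarrow> real"
  assumes f: "smooth_on UNIV f" and "e > 0" and l: "\<And>y. y \<in> cball x e \<Longrightarrow> laplacian f y \<le> - a"
  shows "conv f (mollifier e) x \<le> f x - a * mean_const TYPE('a) * e\<^sup>2"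
proof -
  let ?\<Omega> = "ball x (e + 1)"
  have \<Omega>: "bounded ?\<Omega>" "open ?\<Omega>" by auto
  show ?thesis
  proof (rule mean_value_supersolution[OF \<Omega>(2) smooth_bounded_wgrad[OF \<Omega> f] _ \<open>e > 0\<close>])
    show "continuous_on ?\<Omega> f" using smooth_on_imp_continuous_on[OF f] continuous_on_subset by blast
    show "cball x e \<subseteq> ?\<Omega>" by auto
    fix \<psi> assume \<psi>: "test_function ?\<Omega> \<psi>" "\<And>y. 0 \<le> \<psi> y" "\<And>y. y \<notin> cball x e \<Longrightarrow> \<psi> y = 0"
    note t = test_function_sq_int[OF \<psi>(1) \<Omega>(2)]
    have sl: "sq_int (lebesgue_on ?\<Omega>) (laplacian f)"
      by (intro continuous_bounded_sq_int \<Omega> smooth_on_imp_continuous_on smooth_on_laplacian f) auto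
    have "a * (LINT y|lebesgue_on ?\<Omega>. \<psi> y) = (LINT y|lebesgue_on ?\<Omega>. a * \<psi> y)" by simp
    also have "\<dots> \<le> (LINT y|lebesgue_on ?\<Omega>. - (laplacian f y * \<psi> y))"
    proof (rule integral_mono)
      show "integrable (lebesgue_on ?\<Omega>) (\<lambda>y. a * \<psi> y)" using t(3) by simp
      show "integrable (lebesgue_on ?\<Omega>) (\<lambda>y. - (laplacian f y * \<psi> y))"
        using sq_int_mult_integrable[OF sl t(1)] by simp
      fix y show "a * \<psi> y \<le> - (laplacian f y * \<psi> y)"
      proof (cases "y \<in> cball x e")
        case True
        from mult_right_mono[OF l[OF this] \<psi>(2)[of y]] show ?thesis by simp
      qed (simp add: \<psi>(3))
    qed
    also have "\<dots> = (LINT y|lebesgue_on ?\<Omega>. grad f y \<bullet> grad \<psi> y)"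
      using smooth_green[OF \<Omega> f \<psi>(1)] by simp
    finally show "a * (LINT y|lebesgue_on ?\<Omega>. \<psi> y) \<le> (LINT y|lebesgue_on ?\<Omega>. grad f y \<bullet> grad \<psi> y)" .
  qed
qed

lemma power2_norm_diff_has_derivative:
  fixes q :: "'a::euclidean_space"
  shows "((\<lambda>y. (norm (y - q))\<^sup>2) has_derivative (\<lambda>v. 2 * ((y - q) \<bullet> v))) (at y)"
  unfolding power2_norm_eq_inner by (auto intro!: derivative_eq_intros ext simp: inner_commute)

lemma laplacian_power2_norm:
  fixes q :: "'a::euclidean_space"
  shows "laplacian (\<lambda>y. c * (norm (y - q))\<^sup>2 + d) x = c * 2 * DIM('a)"
proof -
  have "((\<lambda>y. c * (norm (y - q))\<^sup>2 + d) has_derivative (\<lambda>v. c * (2 * ((y - q) \<bullet> v)))) (at y)" for y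
    using has_derivative_add[OF has_derivative_mult_right[OF power2_norm_diff_has_derivative] has_derivative_const]
    by simp
  from frechet_derivative_eqI[OF this]
  have fd: "frechet_derivative (\<lambda>y. c * (norm (y - q))\<^sup>2 + d) (at y) b = c * (2 * ((y - q) \<bullet> b))" for y b by simp
  have "((\<lambda>y. c * (2 * ((y - q) \<bullet> b))) has_derivative (\<lambda>v. c * (2 * (v \<bullet> b)))) (at x)" for b
    by (auto intro!: derivative_eq_intros)
  from frechet_derivative_eqI[OF this]
  have "frechet_derivative (\<lambda>y. c * (2 * ((y - q) \<bullet> b))) (at x) b = c * 2" if "b \<in> Basis" for b
    using that by (simp add: inner_same_Basis)
  then show ?thesis unfolding laplacian_def fd by simp
qed

lemma smooth_on_power2_norm_affine:
  fixes q :: "'a::euclidean_space"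
  shows "smooth_on UNIV (\<lambda>y. c * (norm (y - q))\<^sup>2 + d)"
  by (intro smooth_on_add smooth_on_mult smooth_on_const smooth_on_power2_norm_diff) auto

text \<open>The Laplacian is constant, so the one-sided estimate applied to the function and to its
  negative gives equality.\<close>

lemma conv_power2_norm:
  fixes q :: "'a::euclidean_space"
  assumes "e > 0"
  shows "conv (\<lambda>y. c * (norm (y - q))\<^sup>2 + d) (mollifier e) x =
    c * (norm (x - q))\<^sup>2 + d + c * 2 * DIM('a) * mean_const TYPE('a) * e\<^sup>2"
proof (rule antisym)
  show "conv (\<lambda>y. c * (norm (y - q))\<^sup>2 + d) (mollifier e) x \<le>
    c * (norm (x - q))\<^sup>2 + d + c * 2 * DIM('a) * mean_const TYPE('a) * e\<^sup>2"
    using smooth_mean[OF smooth_on_power2_norm_affine \<open>e > 0\<close>, of x c q d "- (c * 2 * DIM('a))"]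
    by (simp add: laplacian_power2_norm)
  have "conv (\<lambda>y. (- c) * (norm (y - q))\<^sup>2 + (- d)) (mollifier e) x \<le>
    (- c) * (norm (x - q))\<^sup>2 + (- d) - c * 2 * DIM('a) * mean_const TYPE('a) * e\<^sup>2"
    by (rule smooth_mean[OF smooth_on_power2_norm_affine \<open>e > 0\<close>]) (rule eq_refl[OF trans[OF laplacian_power2_norm]], simp)
  moreover have "conv (\<lambda>y. (- c) * (norm (y - q))\<^sup>2 + (- d)) (mollifier e) x =
    - conv (\<lambda>y. c * (norm (y - q))\<^sup>2 + d) (mollifier e) x"
    unfolding conv_def by (simp add: algebra_simps flip: Bochner_Integration.integral_minus)
  ultimately show "c * (norm (x - q))\<^sup>2 + d + c * 2 * DIM('a) * mean_const TYPE('a) * e\<^sup>2 \<le>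
    conv (\<lambda>y. c * (norm (y - q))\<^sup>2 + d) (mollifier e) x" by simp
qed

section \<open>Gaussian barriers and two-sided kernel bounds\<close>

text \<open>Hopf's barrier. It is used outside a ball twice: for the growth of the phases at a
  touching ball and for positivity at the boundary.\<close>

definition gaussian :: "real \<Rightarrow> 'a::euclidean_space \<Rightarrow> 'a \<Rightarrow> real" where
  "gaussian \<alpha> q y = exp (- \<alpha> * (norm (y - q))\<^sup>2)"

lemma smooth_on_gaussian:
  fixes q :: "'a::euclidean_space"
  shows "smooth_on UNIV (gaussian \<alpha> q)"
proof -
  have "smooth_on UNIV (\<lambda>y. - \<alpha> * (norm (y - q))\<^sup>2 + 0)" by (rule smooth_on_power2_norm_affine)
  then show ?thesis
    using smooth_on_compose_real[of UNIV "\<lambda>n. exp" "\<lambda>y. - \<alpha> * (norm (y - q))\<^sup>2" 0] DERIV_exp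
    by (simp add: gaussian_def[abs_def])
qed

lemma laplacian_gaussian:
  fixes q :: "'a::euclidean_space"
  shows "laplacian (\<lambda>y. A * gaussian \<alpha> q y + d) x = A * (4 * \<alpha>\<^sup>2 * (norm (x - q))\<^sup>2 - 2 * \<alpha> * DIM('a)) * gaussian \<alpha> q x"
proof -
  let ?g = "gaussian \<alpha> q"
  have dg: "(?g has_derivative (\<lambda>v. ?g y * (- \<alpha> * (2 * ((y - q) \<bullet> v))))) (at y)" for y
    unfolding gaussian_def[abs_def]
    by (rule has_derivative_eq_rhs, (rule derivative_eq_intros power2_norm_diff_has_derivative refl)+) (auto simp: algebra_simps)
  have "((\<lambda>y. A * ?g y + d) has_derivative (\<lambda>v. A * (?g y * (- \<alpha> * (2 * ((y - q) \<bullet> v)))))) (at y)" for y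
    by (rule has_derivative_eq_rhs, (rule derivative_eq_intros dg refl)+) auto
  from frechet_derivative_eqI[OF this]
  have fd: "frechet_derivative (\<lambda>y. A * ?g y + d) (at y) b = A * (?g y * (- \<alpha> * (2 * ((y - q) \<bullet> b))))" for y b by simp
  have "((\<lambda>y. A * (?g y * (- \<alpha> * (2 * ((y - q) \<bullet> b))))) has_derivative
     (\<lambda>v. A * (?g x * (- \<alpha> * (2 * (v \<bullet> b))) + ?g x * (- \<alpha> * (2 * ((x - q) \<bullet> v))) * (- \<alpha> * (2 * ((x - q) \<bullet> b)))))) (at x)" for b
    by (rule has_derivative_eq_rhs, (rule derivative_eq_intros dg refl)+) auto
  from frechet_derivative_eqI[OF this]
  have "frechet_derivative (\<lambda>y. A * (?g y * (- \<alpha> * (2 * ((y - q) \<bullet> b))))) (at x) b =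
     A * ?g x * (4 * \<alpha>\<^sup>2 * ((x - q) \<bullet> b)\<^sup>2) - A * ?g x * (2 * \<alpha>)" if "b \<in> Basis" for b
    using that by (simp add: inner_same_Basis power2_eq_square algebra_simps)
  then have "laplacian (\<lambda>y. A * ?g y + d) x = (\<Sum>b\<in>Basis. A * ?g x * (4 * \<alpha>\<^sup>2 * ((x - q) \<bullet> b)\<^sup>2) - A * ?g x * (2 * \<alpha>))"
    unfolding laplacian_def fd by (intro sum.cong) auto
  also have "\<dots> = A * ?g x * (4 * \<alpha>\<^sup>2 * (\<Sum>b\<in>Basis. ((x - q) \<bullet> b)\<^sup>2)) - DIM('a) * (A * ?g x * (2 * \<alpha>))"
    by (simp add: sum_subtractf sum_distrib_left)
  also have "(\<Sum>b\<in>Basis. ((x - q) \<bullet> b)\<^sup>2) = (norm (x - q))\<^sup>2"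
    unfolding power2_norm_eq_inner by (subst (2) euclidean_inner) (simp add: power2_eq_square)
  finally show ?thesis by (simp add: algebra_simps)
qed

lemma smooth_on_gaussian_affine:
  fixes q :: "'a::euclidean_space"
  shows "smooth_on UNIV (\<lambda>y. A * gaussian \<alpha> q y + d)"
  by (intro smooth_on_add smooth_on_mult smooth_on_const smooth_on_gaussian) auto

text \<open>The Laplacian changes sign on the sphere of radius R when \<alpha> is half of DIM / R^2;
  the chosen \<alpha> is twice that threshold, which leaves a positive lower bound everywhere
  outside the ball.\<close>

lemma gaussian_subharmonic:
  fixes q :: "'a::euclidean_space" and \<alpha> :: real
  assumes "R > 0" "\<alpha> = DIM('a) / R\<^sup>2" "norm (x - q) \<ge> R"
  shows "4 * \<alpha>\<^sup>2 * (norm (x - q))\<^sup>2 - 2 * \<alpha> * DIM('a) \<ge> 2 * (real DIM('a))\<^sup>2 / R\<^sup>2"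
proof -
  have "R\<^sup>2 \<le> (norm (x - q))\<^sup>2" using assms by (intro power_mono) auto
  then have "4 * \<alpha>\<^sup>2 * R\<^sup>2 \<le> 4 * \<alpha>\<^sup>2 * (norm (x - q))\<^sup>2" by (intro mult_left_mono) auto
  moreover have "4 * \<alpha>\<^sup>2 * R\<^sup>2 - 2 * \<alpha> * DIM('a) = 2 * (real DIM('a))\<^sup>2 / R\<^sup>2"
    using assms(1) by (simp add: assms(2) power_divide power2_eq_square field_simps)
  ultimately show ?thesis by linarith
qed

lemma mollifier_scale:
  fixes z :: "'a::euclidean_space"
  shows "mollifier s z = mollifier 1 (z /\<^sub>R s) / s ^ DIM('a)"
  by (simp add: mollifier_def)

lemma mollifier_upper:
  obtains C where "C > 0" "\<And>s (z::'a::euclidean_space). s > 0 \<Longrightarrow> mollifier s z \<le> C / s ^ DIM('a)"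
proof -
  obtain B where B: "\<And>z::'a. \<bar>mollifier 1 z\<bar> \<le> B" "B > 0"
    using test_function_bounded[OF test_function_mollifier_UNIV[of 1]] by auto
  have "mollifier s z \<le> B / s ^ DIM('a)" if "s > 0" for s and z :: 'a
    unfolding mollifier_scale[of s] using B(1)[of "z /\<^sub>R s"] that by (intro divide_right_mono) auto
  then show ?thesis using that B(2) by blast
qed

text \<open>The kernel vanishes at the edge of its support, so it is comparable to the reciprocal
  power of its scale only away from the edge. With the upper bound this compares kernels of
  different scales, a substitute for a Harnack inequality.\<close>

lemma mollifier_lower:
  assumes "0 < \<theta>" "\<theta> < 1"
  obtains c where "c > 0" "\<And>s (z::'a::euclidean_space). s > 0 \<Longrightarrow> norm z \<le> (1 - \<theta>) * s \<Longrightarrow> c / s ^ DIM('a) \<le> mollifier s z"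
proof -
  let ?t = "1 - (1 - \<theta>)\<^sup>2"
  have "(1 - \<theta>)\<^sup>2 < 1" using assms by (simp add: abs_square_less_1)
  then have t: "?t > 0" by simp
  let ?c = "exp (- (1 / ?t)) / mollifier_mass TYPE('a)"
  have c: "?c > 0" using mollifier_mass_pos[where 'a='a] by simp
  have "?c / s ^ DIM('a) \<le> mollifier s z" if s: "s > 0" and z: "norm z \<le> (1 - \<theta>) * s" for s and z :: 'a
  proof -
    let ?n = "norm (z /\<^sub>R s)"
    have n: "?n \<le> 1 - \<theta>" using s z by (simp add: field_simps)
    have n2: "?n\<^sup>2 \<le> (1 - \<theta>)\<^sup>2" by (rule power_mono[OF n]) simp
    let ?r = "1 - ?n\<^sup>2"
    have r: "?r \<ge> ?t" "?r > 0" "?r \<le> 1" using n2 t by auto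
    have "exp (- (1 / ?t)) \<le> exp (- (1 / ?r))" using r t by (simp add: frac_le)
    also have "\<dots> \<le> exp (- (1 / ?r)) / ?r\<^sup>2"
    proof -
      have "?r\<^sup>2 \<le> 1" using r by (intro power_le_one) auto
      then show ?thesis using r(2) by (intro mult_imp_le_div_pos) auto
    qed
    also have "\<dots> = bump_deriv 1 ?r" unfolding bump_deriv_1 using r(2) by simp
    finally have "exp (- (1 / ?t)) \<le> bump_deriv 1 ?r" .
    then have "exp (- (1 / ?t)) / (mollifier_mass TYPE('a) * s ^ DIM('a)) \<le> mollifier s z"
      unfolding mollifier_def using s mollifier_mass_pos[where 'a='a] by (intro divide_right_mono) auto
    then show ?thesis by simp
  qed
  with c that show ?thesis by blast
qed

lemma conv_mollifier_lower:
  fixes h :: "'a::euclidean_space \<Rightarrow> real"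
  assumes "s > 0" "continuous_on (cball x s) h" "\<And>y. y \<in> ball x s \<Longrightarrow> 0 \<le> h y"
    and ball: "ball y \<rho> \<subseteq> ball x s" "\<rho> > 0" "0 \<le> \<eta>" "0 \<le> c"
    and low: "\<And>z. z \<in> ball y \<rho> \<Longrightarrow> \<eta> \<le> h z" "\<And>z. z \<in> ball y \<rho> \<Longrightarrow> c / s ^ DIM('a) \<le> mollifier s (x - z)"
  shows "\<eta> * c * unit_ball_vol (DIM('a)) * (\<rho> / s) ^ DIM('a) \<le> conv h (mollifier s) x"
proof -
  have "(LINT z|lborel. indicator (ball y \<rho>) z * (\<eta> * (c / s ^ DIM('a)))) \<le> conv h (mollifier s) x"
    unfolding conv_def
  proof (rule integral_mono)
    show "integrable lborel (\<lambda>z. indicator (ball y \<rho>) z * (\<eta> * (c / s ^ DIM('a))))"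
      by (intro integrable_mult_left integrable_real_indicator) (use emeasure_lborel_ball_finite[of y \<rho>] in auto)
    show "integrable lborel (\<lambda>z. h z * mollifier s (x - z))" by (rule conv_mollifier_integrable[OF assms(1,2)])
    fix z
    show "indicator (ball y \<rho>) z * (\<eta> * (c / s ^ DIM('a))) \<le> h z * mollifier s (x - z)"
    proof (cases "z \<in> ball y \<rho>")
      case True
      have "\<eta> * (c / s ^ DIM('a)) \<le> h z * mollifier s (x - z)"
        using low(1)[OF True] ball(3,4) assms(1) by (intro mult_mono low True) auto
      then show ?thesis using True by simp
    next
      case False
      have "0 \<le> h z * mollifier s (x - z)"
        using assms(3)[of z] mollifier_nonneg[OF assms(1)] mollifier_eq_0[OF assms(1), of "x - z"]
        by (cases "z \<in> ball x s") (auto simp: dist_norm intro: mult_nonneg_nonneg)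
      then show ?thesis using False by simp
    qed
  qed
  moreover have "(LINT z|lborel. indicator (ball y \<rho>) z * (\<eta> * (c / s ^ DIM('a)))) =
      \<eta> * c * unit_ball_vol (DIM('a)) * (\<rho> / s) ^ DIM('a)"
  proof -
    have "(LINT z|lborel. indicator (ball y \<rho>) z * (\<eta> * (c / s ^ DIM('a)))) = measure lborel (ball y \<rho>) * (\<eta> * (c / s ^ DIM('a)))"
      by simp
    also have "measure lborel (ball y \<rho>) = unit_ball_vol (DIM('a)) * \<rho> ^ DIM('a)"
      using content_ball[of \<rho> y] ball(2) by simp
    finally show ?thesis by (simp add: power_divide)
  qed
  ultimately show ?thesis by simp
qed

section \<open>The interface of a free phase\<close>

text \<open>The minimizer is forgotten; what remains are pointwise properties and, as mean value
  inequalities, -\<Delta> w \<ge> a in {w > 0}, -\<Delta> (w - V) \<ge> -a,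
  \<open>-\<Delta> (w + 2 u\<^sub>j - V) \<ge> -a\<close> and
  \<open>-\<Delta> u\<^sub>j \<le> a\<close>, with V the sum of the phases. The last three hold
  across interfaces.\<close>

locale interface =
  fixes \<Omega> :: "'a::euclidean_space set" and J :: "nat set" and w :: "'a \<Rightarrow> real" and u :: "nat \<Rightarrow> 'a \<Rightarrow> real"
    and a :: real
  assumes open_dom: "open \<Omega>" and finite_J: "finite J" and a_pos: "a > 0"
    and cont_w: "continuous_on \<Omega> w" and cont_u: "\<And>j. j \<in> J \<Longrightarrow> continuous_on \<Omega> (u j)"
    and w_nonneg: "\<And>x. x \<in> \<Omega> \<Longrightarrow> w x \<ge> 0" and u_nonneg: "\<And>j x. j \<in> J \<Longrightarrow> x \<in> \<Omega> \<Longrightarrow> u j x \<ge> 0"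
    and seg_w: "\<And>j x. j \<in> J \<Longrightarrow> x \<in> \<Omega> \<Longrightarrow> w x * u j x = 0"
    and seg_u: "\<And>i j x. i \<in> J \<Longrightarrow> j \<in> J \<Longrightarrow> i \<noteq> j \<Longrightarrow> x \<in> \<Omega> \<Longrightarrow> u i x * u j x = 0"
    and torsion: "\<And>x e. e > 0 \<Longrightarrow> cball x e \<subseteq> {x \<in> \<Omega>. w x > 0} \<Longrightarrow>
      conv w (mollifier e) x \<le> w x - a * mean_const TYPE('a) * e\<^sup>2"
    and super_w: "\<And>x e. e > 0 \<Longrightarrow> cball x e \<subseteq> \<Omega> \<Longrightarrow>
      conv (\<lambda>y. w y - (\<Sum>l\<in>J. u l y)) (mollifier e) x \<le> w x - (\<Sum>l\<in>J. u l x) + a * mean_const TYPE('a) * e\<^sup>2"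
    and super_wu: "\<And>x e j. j \<in> J \<Longrightarrow> e > 0 \<Longrightarrow> cball x e \<subseteq> \<Omega> \<Longrightarrow>
      conv (\<lambda>y. w y + 2 * u j y - (\<Sum>l\<in>J. u l y)) (mollifier e) x
        \<le> w x + 2 * u j x - (\<Sum>l\<in>J. u l x) + a * mean_const TYPE('a) * e\<^sup>2"
    and sub_u: "\<And>x e j. j \<in> J \<Longrightarrow> e > 0 \<Longrightarrow> cball x e \<subseteq> \<Omega> \<Longrightarrow>
      u j x \<le> conv (u j) (mollifier e) x + a * mean_const TYPE('a) * e\<^sup>2"
begin

definition "V x = (\<Sum>l\<in>J. u l x)"

lemma cont_V: "continuous_on \<Omega> V"
  unfolding V_def[abs_def] by (intro continuous_intros cont_u)

lemma u_le_V: "j \<in> J \<Longrightarrow> x \<in> \<Omega> \<Longrightarrow> u j x \<le> V x"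
  unfolding V_def using finite_J u_nonneg by (intro member_le_sum) auto

lemma V_eq: assumes "j \<in> J" "x \<in> \<Omega>" "u j x > 0" shows "V x = u j x" "w x = 0"
proof -
  have "u l x = 0" if "l \<in> J - {j}" for l using seg_u[of l j x] that assms by auto
  then show "V x = u j x" unfolding V_def using assms(1) finite_J by (simp add: sum.remove)
  show "w x = 0" using seg_w[of j x] assms by auto
qed

lemma V_cases: assumes "x \<in> \<Omega>" shows "V x = 0 \<or> (\<exists>j\<in>J. V x = u j x \<and> u j x > 0)"
proof (cases "\<exists>j\<in>J. u j x > 0")
  case True then show ?thesis using V_eq assms by blast
next
  case False
  then have "u j x = 0" if "j \<in> J" for j using u_nonneg[OF that assms] that by force
  then show ?thesis by (simp add: V_def)
qed

end

locale touching_ball = interface +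
  fixes q :: 'a and R \<delta> :: real and x\<^sub>0 :: 'a
  assumes R: "R > 0" and \<delta>: "\<delta> > 0" and ball_pos: "ball q R \<subseteq> {x \<in> \<Omega>. w x > 0}"
    and big_ball: "cball q (R + \<delta>) \<subseteq> \<Omega>" and x0: "norm (x\<^sub>0 - q) = R" "w x\<^sub>0 = 0"
begin

text \<open>A smooth substitute for the signed distance to the sphere: zero on it with unit
  gradient, and with constant Laplacian DIM / R, so that its means are known exactly.\<close>

definition "g x = (1 / (2 * R)) * (norm (x - q))\<^sup>2 + (- R / 2)"

lemma cball_dom: "cball q R \<subseteq> \<Omega>" using big_ball \<delta> by (meson less_add_same_cancel1 less_imp_le order_trans subset_cball)

lemma u_zero_in:
  assumes "j \<in> J" "norm (x - q) \<le> R" shows "u j x = 0"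
proof -
  have cl: "closure (ball q R) = cball q R" using R by simp
  have "continuous_on (closure (ball q R)) (u j)" using cont_u[OF assms(1)] cball_dom cl continuous_on_subset by metis
  moreover have "u j y = 0" if "y \<in> ball q R" for y using seg_w[OF assms(1), of y] ball_pos that by force
  moreover have "x \<in> closure (ball q R)" using assms(2) cl by (simp add: dist_norm norm_minus_commute)
  ultimately show ?thesis by (rule continuous_constant_on_closure)
qed

lemma V_zero_in: "norm (x - q) \<le> R \<Longrightarrow> V x = 0"
  using u_zero_in by (simp add: V_def)

lemma g_factor: "g x = (norm (x - q) - R) * (norm (x - q) + R) / (2 * R)"
  using R by (simp add: g_def power2_eq_square field_simps)

lemma g_ge: "norm (x - q) \<ge> R \<Longrightarrow> g x \<ge> norm (x - q) - R"
proof -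
  assume "norm (x - q) \<ge> R"
  then have "(norm (x - q) - R) * (2 * R) \<le> (norm (x - q) - R) * (norm (x - q) + R)" by (intro mult_left_mono) auto
  then show ?thesis unfolding g_factor using R by (simp add: pos_le_divide_eq)
qed

lemma g_nonneg: "norm (x - q) \<ge> R \<Longrightarrow> g x \<ge> 0" using g_ge by fastforce

lemma g_nonpos: "norm (x - q) \<le> R \<Longrightarrow> g x \<le> 0"
  unfolding g_factor using R by (intro divide_nonpos_pos mult_nonpos_nonneg) (auto intro: add_nonneg_nonneg)

lemma minus_g_ge: "norm (x - q) \<le> R \<Longrightarrow> (R - norm (x - q)) / 2 \<le> - g x"
proof -
  assume "norm (x - q) \<le> R"
  then have "(R - norm (x - q)) * R \<le> (R - norm (x - q)) * (norm (x - q) + R)" by (intro mult_left_mono) auto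
  then show ?thesis unfolding g_factor using R by (simp add: field_simps)
qed

lemma g_expand:
  assumes "norm (p - q) = R"
  shows "g (p + v) = v \<bullet> ((p - q) /\<^sub>R R) + (norm v)\<^sup>2 / (2 * R)"
proof -
  have "(norm (p + v - q))\<^sup>2 = (norm (p - q))\<^sup>2 + 2 * (v \<bullet> (p - q)) + (norm v)\<^sup>2"
    unfolding power2_norm_eq_inner by (simp add: inner_add inner_diff inner_commute algebra_simps)
  then have "g (p + v) = (R\<^sup>2 + 2 * (v \<bullet> (p - q)) + (norm v)\<^sup>2) / (2 * R) - R / 2"
    using assms by (simp add: g_def)
  also have "\<dots> = (v \<bullet> (p - q)) / R + (norm v)\<^sup>2 / (2 * R)"
    using R by (simp add: field_simps power2_eq_square)
  finally show ?thesis by (simp only: inner_scaleR_right divide_inverse mult.commute)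
qed

lemma g_upper:
  assumes "norm (p - q) = R" "norm (y - p) \<le> r" "r \<le> R"
  shows "g y \<le> 2 * r"
proof -
  have r: "0 \<le> r" using assms(2) norm_ge_zero[of "y - p"] by linarith
  have "(y - p) \<bullet> ((p - q) /\<^sub>R R) \<le> norm (y - p) * norm ((p - q) /\<^sub>R R)" by (rule norm_cauchy_schwarz)
  also have "\<dots> = norm (y - p)" using assms(1) R by simp
  finally have 1: "(y - p) \<bullet> ((p - q) /\<^sub>R R) \<le> r" using assms(2) by linarith
  have "(norm (y - p))\<^sup>2 \<le> r * R" unfolding power2_eq_square using assms r by (intro mult_mono) auto
  then have "(norm (y - p))\<^sup>2 / (2 * R) \<le> r * R / (2 * R)" using R by (intro divide_right_mono) auto
  then have "(norm (y - p))\<^sup>2 / (2 * R) \<le> r" using R r by simp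
  then show ?thesis using 1 g_expand[OF assms(1), of "y - p"] by simp
qed

lemma cont_g: "continuous_on S g"
  unfolding g_def[abs_def] by (intro continuous_intros)

lemma conv_g: "e > 0 \<Longrightarrow> conv g (mollifier e) x = g x + real DIM('a) / R * mean_const TYPE('a) * e\<^sup>2"
  unfolding g_def[abs_def] by (subst conv_power2_norm) simp_all

text \<open>Chosen so that the Laplacian of \<open>c\<^sub>1 * g x\<close> is a / 2. The other half
  of a is the strict gap that excludes an interior minimum.\<close>

definition "c\<^sub>1 = R * a / (2 * real DIM('a))"

lemma c1_pos: "c\<^sub>1 > 0" using R a_pos by (simp add: c\<^sub>1_def)

text \<open>Since \<open>w\<close> is strictly superharmonic in its positivity set, it dominates the torsion function
  of the ball.\<close>

lemma w_lower:
  assumes "norm (x - q) \<le> R" shows "c\<^sub>1 * (- g x) \<le> w x"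
proof (rule ccontr)
  assume *: "\<not> ?thesis"
  let ?h = "\<lambda>y. w y + c\<^sub>1 * g y"
  have ch: "continuous_on (cball q R) ?h"
    by (intro continuous_intros continuous_on_subset[OF cont_w cball_dom] cont_g)
  obtain m where m: "m \<in> cball q R" "\<And>y. y \<in> cball q R \<Longrightarrow> ?h m \<le> ?h y"
    using continuous_attains_inf[OF compact_cball _ ch] R by auto
  have hm: "?h m < 0" using m(2)[of x] assms * by (simp add: dist_norm norm_minus_commute)
  have "m \<in> ball q R"
  proof (rule ccontr)
    assume "m \<notin> ball q R"
    then have "norm (m - q) = R" using m(1) by (simp add: dist_norm norm_minus_commute)
    then have "g m = 0" "w m \<ge> 0" using w_nonneg m(1) cball_dom by (auto simp: g_factor)
    then show False using hm by simp
  qed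
  then obtain e where e: "e > 0" "cball m e \<subseteq> ball q R" using open_contains_cball open_ball by blast
  have sub: "cball m e \<subseteq> cball q R" using e(2) ball_subset_cball by blast
  have cw: "continuous_on (cball m e) w" using cont_w sub cball_dom continuous_on_subset by blast
  \<comment> \<open>At an interior minimum the mean is at least the value, whereas
    \<open>torsion\<close> and the exact mean of \<open>g\<close> make it smaller by half of the
    torsion gain.\<close>
  have "?h m = conv (\<lambda>y. ?h m) (mollifier e) m" by (rule conv_mollifier_const[OF e(1), symmetric])
  also have "\<dots> \<le> conv ?h (mollifier e) m"
  proof (rule conv_mollifier_mono[OF e(1) _ continuous_on_subset[OF ch sub]])
    show "?h m \<le> ?h y" if "y \<in> ball m e" for y using that sub ball_subset_cball by (intro m(2)) blast
  qed simp
  also have "\<dots> = 1 * conv w (mollifier e) m + c\<^sub>1 * conv g (mollifier e) m"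
    using conv_mollifier_linear[OF e(1) cw cont_g, of 1 c\<^sub>1] by simp
  also have "\<dots> \<le> (w m - a * mean_const TYPE('a) * e\<^sup>2) + c\<^sub>1 * (g m + real DIM('a) / R * mean_const TYPE('a) * e\<^sup>2)"
    using torsion[OF e(1), of m] e(2) ball_pos conv_g[OF e(1)] by auto
  also have "\<dots> = ?h m - a / 2 * mean_const TYPE('a) * e\<^sup>2"
    using R by (simp add: c\<^sub>1_def field_simps)
  also have "\<dots> < ?h m" using a_pos mean_const_pos[where 'a='a] e(1) by simp
  finally show False by simp
qed

text \<open>Linear growth from above by comparison with an inverted Gaussian in an annulus around
  the ball. The phases vanish on the inner sphere and are bounded on the outer one; as
  \<open>sub_u\<close> holds across interfaces, nothing about their positivity sets is
  needed.\<close>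

lemma u_upper:
  obtains A where "A \<ge> 0" "\<And>x j. R \<le> norm (x - q) \<Longrightarrow> norm (x - q) \<le> R + \<delta> \<Longrightarrow> j \<in> J \<Longrightarrow> u j x \<le> A * g x"
proof -
  define \<alpha> where "\<alpha> = DIM('a) / R\<^sup>2"
  have \<alpha>: "\<alpha> > 0" using R by (simp add: \<alpha>_def)
  let ?E = "exp (- \<alpha> * R\<^sup>2)" and ?F = "exp (- \<alpha> * (R + \<delta>)\<^sup>2)"
  have EF: "?F < ?E" "0 < ?F" "?E \<le> 1" using \<alpha> R \<delta> by (auto simp: power2_eq_square mult_strict_mono')
  have "compact (V ` cball q (R + \<delta>))"
    by (intro compact_continuous_image continuous_on_subset[OF cont_V big_ball]) auto
  then obtain S where S: "S > 0" "\<And>x. x \<in> cball q (R + \<delta>) \<Longrightarrow> V x \<le> S"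
    using compact_imp_bounded[of "V ` cball q (R + \<delta>)"] unfolding bounded_pos by force
  define l where "l = 2 * (real DIM('a))\<^sup>2 / R\<^sup>2 * ?F"
  have l: "l > 0" using R by (simp add: l_def)
  \<comment> \<open>The first summand lifts the barrier above sup V on the outer sphere, the second
    makes -\<Delta> b \<ge> P l > a in the annulus.\<close>
  define P where "P = S / (?E - ?F) + 2 * a / l"
  have P: "P > 0" "P * (?E - ?F) \<ge> S" "P * l > a"
  proof -
    have p1: "S / (?E - ?F) > 0" and p2: "2 * a / l > 0" using S EF l a_pos by auto
    then show "P > 0" by (simp add: P_def)
    have "P * (?E - ?F) \<ge> S / (?E - ?F) * (?E - ?F)" using p2 EF unfolding P_def by (intro mult_right_mono) auto
    moreover have "S / (?E - ?F) * (?E - ?F) = S" by (rule nonzero_eq_divide_eq[THEN iffD1, OF _ refl]) (use EF in linarith)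
    ultimately show "P * (?E - ?F) \<ge> S" by linarith
    have "P * l \<ge> 2 * a / l * l" using p1 l unfolding P_def by (intro mult_right_mono) auto
    then show "P * l > a" using l a_pos by simp
  qed
  define b where "b y = (- P) * gaussian \<alpha> q y + P * ?E" for y
  have cb: "continuous_on T b" for T
    using smooth_on_imp_continuous_on[OF smooth_on_gaussian_affine, of "- P" \<alpha> q "P * ?E"] continuous_on_subset
    unfolding b_def[abs_def] by blast
  have bval: "b y = P * (?E - exp (- \<alpha> * (norm (y - q))\<^sup>2))" for y
    by (simp add: b_def gaussian_def algebra_simps)
  let ?Q = "cball q (R + \<delta>) - ball q R"
  have main: "u j x \<le> b x" if j: "j \<in> J" and x: "x \<in> ?Q" for j x
  proof (rule ccontr)
    assume *: "\<not> ?thesis"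
    \<comment> \<open>A positive maximum of the difference would lie inside the annulus, where its
      mean would exceed its value, as P l > a.\<close>
    let ?h = "\<lambda>y. u j y - b y"
    have Q: "compact ?Q" by (intro compact_diff) auto
    have Q\<Omega>: "?Q \<subseteq> \<Omega>" using big_ball by blast
    have ch: "continuous_on ?Q ?h" by (intro continuous_intros cb continuous_on_subset[OF cont_u[OF j] Q\<Omega>])
    obtain m where m: "m \<in> ?Q" "\<And>y. y \<in> ?Q \<Longrightarrow> ?h y \<le> ?h m"
      using continuous_attains_sup[OF Q _ ch] x by blast
    have hm: "?h m > 0" using m(2)[OF x] * by simp
    have n1: "norm (m - q) \<noteq> R"
    proof
      assume "norm (m - q) = R"
      then show False using hm u_zero_in[OF j, of m] by (simp add: bval)
    qed
    have n2: "norm (m - q) \<noteq> R + \<delta>"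
    proof
      assume n: "norm (m - q) = R + \<delta>"
      then have "u j m \<le> S" using u_le_V[OF j] S(2)[of m] m(1) Q\<Omega> by force
      then show False using hm P(2) n by (simp add: bval)
    qed
    have "m \<in> ball q (R + \<delta>) - cball q R" using m(1) n1 n2 by (auto simp: dist_norm norm_minus_commute)
    moreover have "open (ball q (R + \<delta>) - cball q R)" by (intro open_Diff) auto
    ultimately obtain e where e: "e > 0" "cball m e \<subseteq> ball q (R + \<delta>) - cball q R"
      using open_contains_cball by blast
    have sub: "cball m e \<subseteq> ?Q" using e(2) by force
    have cu: "continuous_on (cball m e) (u j)" using cont_u[OF j] sub Q\<Omega> continuous_on_subset by blast
    have lap: "laplacian b y \<le> - (P * l)" if "y \<in> cball m e" for y
    proof -
      have n: "R \<le> norm (y - q)" "norm (y - q) \<le> R + \<delta>" using that sub by (auto simp: dist_norm norm_minus_commute)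
      have "?F \<le> gaussian \<alpha> q y" using n \<alpha> R by (simp add: gaussian_def power_mono)
      then have "l \<le> (4 * \<alpha>\<^sup>2 * (norm (y - q))\<^sup>2 - 2 * \<alpha> * DIM('a)) * gaussian \<alpha> q y"
      proof -
        have "0 \<le> 2 * (real DIM('a))\<^sup>2 / R\<^sup>2" by simp
        then have "0 \<le> 4 * \<alpha>\<^sup>2 * (norm (y - q))\<^sup>2 - 2 * \<alpha> * DIM('a)"
          using gaussian_subharmonic[OF R \<alpha>_def n(1)] by linarith
        with \<open>?F \<le> gaussian \<alpha> q y\<close> gaussian_subharmonic[OF R \<alpha>_def n(1)] EF(2) show ?thesis
          unfolding l_def by (intro mult_mono) auto
      qed
      then have "P * l \<le> P * ((4 * \<alpha>\<^sup>2 * (norm (y - q))\<^sup>2 - 2 * \<alpha> * DIM('a)) * gaussian \<alpha> q y)"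
        using P(1) by (intro mult_left_mono) auto
      then show ?thesis unfolding b_def[abs_def] laplacian_gaussian by simp
    qed
    have "conv b (mollifier e) m \<le> b m - P * l * mean_const TYPE('a) * e\<^sup>2"
      using lap unfolding b_def[abs_def] by (intro smooth_mean smooth_on_gaussian_affine e(1))
    moreover have "u j m \<le> conv (u j) (mollifier e) m + a * mean_const TYPE('a) * e\<^sup>2"
      using sub_u[OF j e(1)] sub Q\<Omega> by blast
    moreover have "conv ?h (mollifier e) m = 1 * conv (u j) (mollifier e) m + (-1) * conv b (mollifier e) m"
      using conv_mollifier_linear[OF e(1) cu cb, of 1 "-1"] by simp
    moreover have "conv ?h (mollifier e) m \<le> conv (\<lambda>y. ?h m) (mollifier e) m"
    proof (rule conv_mollifier_mono[OF e(1) continuous_on_subset[OF ch sub]])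
      show "?h y \<le> ?h m" if "y \<in> ball m e" for y using that sub ball_subset_cball by (intro m(2)) blast
    qed simp
    ultimately have "P * l * mean_const TYPE('a) * e\<^sup>2 \<le> a * mean_const TYPE('a) * e\<^sup>2"
      unfolding conv_mollifier_const[OF e(1)] by linarith
    moreover have "a * (mean_const TYPE('a) * e\<^sup>2) < P * l * (mean_const TYPE('a) * e\<^sup>2)"
      using P(3) mean_const_pos[where 'a='a] e(1) by (intro mult_strict_right_mono) auto
    ultimately show False by (simp add: mult_ac)
  qed
  \<comment> \<open>The barrier is at most linear in \<open>g\<close>, because 1 - exp (-s) \<le> s
    and |x - q|^2 - R^2 is 2 R times \<open>g\<close>.\<close>
  have bg: "b x \<le> P * \<alpha> * 2 * R * g x" if that: "R \<le> norm (x - q)" for x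
  proof -
    have "?E - exp (- \<alpha> * (norm (x - q))\<^sup>2) \<le> \<alpha> * 2 * R * g x"
    proof -
      let ?s = "\<alpha> * ((norm (x - q))\<^sup>2 - R\<^sup>2)"
      have s: "?s = \<alpha> * 2 * R * g x" using R by (simp add: g_def power2_eq_square field_simps)
      have s0: "?s \<ge> 0" using \<alpha> R that by (intro mult_nonneg_nonneg) (auto simp: power_mono)
      have "?E - exp (- \<alpha> * (norm (x - q))\<^sup>2) = ?E * (1 - exp (- ?s))"
        by (simp add: right_diff_distrib exp_add[symmetric] algebra_simps)
      also have "\<dots> \<le> 1 * (1 - exp (- ?s))" using EF s0 by (intro mult_right_mono) auto
      also have "\<dots> \<le> ?s" using exp_ge_add_one_self[of "- ?s"] by simp
      finally show ?thesis using s by simp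
    qed
    from mult_left_mono[OF this less_imp_le[OF P(1)]] show ?thesis by (simp add: bval mult_ac)
  qed
  show ?thesis
  proof (rule that[of "P * \<alpha> * 2 * R"])
    show "0 \<le> P * \<alpha> * 2 * R" using P \<alpha> R by simp
    fix x j assume "R \<le> norm (x - q)" "norm (x - q) \<le> R + \<delta>" "j \<in> J"
    then show "u j x \<le> P * \<alpha> * 2 * R * g x"
      using main[of j x] bg[of x] by (auto simp: dist_norm norm_minus_commute)
  qed
qed

text \<open>The negative part of \<open>g\<close> has a kink on the sphere, which shows as a mean of
  the order of the scale. Centres may be off the sphere by e/8, since later the kink is tested at a
  point of the positivity set of a phase.\<close>

lemma conv_g_minus:
  obtains c where "c > 0" "\<And>e z p. 0 < e \<Longrightarrow> e \<le> R \<Longrightarrow> norm (p - q) = R \<Longrightarrow> norm (z - p) \<le> e / 8 \<Longrightarrow>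
    c * e \<le> conv (\<lambda>y. max (- g y) 0) (mollifier e) z"
proof -
  obtain b where b: "b > 0" "\<And>s (z::'a). s > 0 \<Longrightarrow> norm z \<le> (1 - 1/4) * s \<Longrightarrow> b / s ^ DIM('a) \<le> mollifier s z"
    using mollifier_lower[of "1/4"] by auto
  define c where "c = b * unit_ball_vol (DIM('a)) * (1/8) ^ DIM('a) / 8"
  have c: "c > 0" using b(1) by (simp add: c_def)
  have "c * e \<le> conv (\<lambda>y. max (- g y) 0) (mollifier e) z"
    if e: "0 < e" "e \<le> R" and p: "norm (p - q) = R" and z: "norm (z - p) \<le> e / 8" for e z p
  proof -
    \<comment> \<open>A point at depth e/2 below \<open>p\<close>. The ball of radius e/8 about it
      lies within 3e/4 of \<open>z\<close>, away from the edge of the kernel, and at depth at least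
      3e/8, so that -g \<ge> e/8 there.\<close>
    define y0 where "y0 = q + (1 - e / (2 * R)) *\<^sub>R (p - q)"
    have y0p: "norm (y0 - p) = e / 2"
    proof -
      have "y0 - p = (- (e / (2 * R))) *\<^sub>R (p - q)" by (simp add: y0_def algebra_simps)
      then show ?thesis using p e R by simp
    qed
    have y0q: "norm (y0 - q) = R - e / 2"
    proof -
      have "norm (y0 - q) = \<bar>1 - e / (2 * R)\<bar> * R" using p by (simp add: y0_def)
      also have "\<bar>1 - e / (2 * R)\<bar> = 1 - e / (2 * R)" using e R by simp
      finally show ?thesis using R by (simp add: left_diff_distrib)
    qed
    have near: "norm (z - y) \<le> (1 - 1/4) * e" "e / 8 \<le> max (- g y) 0" if y: "y \<in> ball y0 (e / 8)" for y
    proof -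
      have yy: "norm (y0 - y) < e / 8" using y by (simp add: dist_norm)
      have "norm (z - y) \<le> norm (z - p) + norm (p - y0) + norm (y0 - y)"
        using norm_triangle_ineq[of "z - p" "p - y"] norm_triangle_ineq[of "p - y0" "y0 - y"] by simp
      then show "norm (z - y) \<le> (1 - 1/4) * e" using z y0p yy by (simp add: norm_minus_commute)
      have "norm (y - q) \<le> norm (y0 - q) + norm (y0 - y)"
        using norm_triangle_ineq[of "y0 - q" "y - y0"] by (simp add: norm_minus_commute)
      then have "R - norm (y - q) \<ge> 3 * e / 8" using y0q yy by simp
      then show "e / 8 \<le> max (- g y) 0" using minus_g_ge[of y] e by simp
    qed
    have "(e / 8) * b * unit_ball_vol (DIM('a)) * ((e / 8) / e) ^ DIM('a) \<le> conv (\<lambda>y. max (- g y) 0) (mollifier e) z"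
    proof (rule conv_mollifier_lower[where y=y0])
      show "continuous_on (cball z e) (\<lambda>y. max (- g y) 0)" by (intro continuous_intros cont_g)
      show "ball y0 (e / 8) \<subseteq> ball z e" using near(1) e(1) by (force simp: dist_norm)
      show "b / e ^ DIM('a) \<le> mollifier e (z - y)" if "y \<in> ball y0 (e / 8)" for y
        by (rule b(2)[OF e(1) near(1)[OF that]])
    qed (use near(2) e b(1) in auto)
    then show ?thesis using e(1) by (simp add: c_def mult_ac)
  qed
  with c that show ?thesis by blast
qed

text \<open>The bound concerns all phases at once, so that the infimum of such m is the largest
  upper slope that any phase has at \<open>x\<^sub>0\<close> seen from outside the ball.\<close>

definition "slope_bound m \<longleftrightarrow> m \<ge> 0 \<and> (\<exists>r>0. \<forall>x. norm (x - x\<^sub>0) < r \<longrightarrow> R \<le> norm (x - q) \<longrightarrow> (\<forall>j\<in>J. u j x \<le> m * g x))"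

lemma slope_bound_mono: "slope_bound m \<Longrightarrow> m \<le> m' \<Longrightarrow> slope_bound m'"
proof -
  assume "slope_bound m" "m \<le> m'"
  then obtain r where r: "m \<ge> 0" "r > 0"
    "\<And>x j. norm (x - x\<^sub>0) < r \<Longrightarrow> R \<le> norm (x - q) \<Longrightarrow> j \<in> J \<Longrightarrow> u j x \<le> m * g x" by (auto simp: slope_bound_def)
  have "u j x \<le> m' * g x" if "norm (x - x\<^sub>0) < r" "R \<le> norm (x - q)" "j \<in> J" for x j
    using r(3)[OF that] mult_right_mono[OF \<open>m \<le> m'\<close> g_nonneg[OF that(2)]] by linarith
  then show ?thesis using r(1,2) \<open>m \<le> m'\<close> by (auto simp: slope_bound_def intro!: exI[of _ r])
qed

lemma slope_bound_exists: "\<exists>m. slope_bound m"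
proof -
  obtain A where A: "A \<ge> 0" "\<And>x j. R \<le> norm (x - q) \<Longrightarrow> norm (x - q) \<le> R + \<delta> \<Longrightarrow> j \<in> J \<Longrightarrow> u j x \<le> A * g x"
    using u_upper by blast
  have "norm (x - q) \<le> R + \<delta>" if "norm (x - x\<^sub>0) < \<delta>" for x
    using norm_triangle_ineq[of "x - x\<^sub>0" "x\<^sub>0 - q"] that x0 by simp
  then have "slope_bound A" unfolding slope_bound_def using A \<delta> by (intro conjI exI[of _ \<delta>]) auto
  then show ?thesis by blast
qed

lemma x0_in: "x\<^sub>0 \<in> \<Omega>" using cball_dom x0(1) by (auto simp: dist_norm norm_minus_commute)

text \<open>Nondegeneracy: the kink of w on the ball side gives w - V a mean of at least
  \<open>c\<^sub>1 * c * e\<close> minus 2 m e, while \<open>super_w\<close> allows only order e^2.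
  Hence the phases must grow on the other side.\<close>

lemma slope_bound_lower:
  assumes c: "c > 0" "\<And>e z p. 0 < e \<Longrightarrow> e \<le> R \<Longrightarrow> norm (p - q) = R \<Longrightarrow> norm (z - p) \<le> e / 8 \<Longrightarrow>
    c * e \<le> conv (\<lambda>y. max (- g y) 0) (mollifier e) z" and m: "slope_bound m"
  shows "c\<^sub>1 * c / 4 \<le> m"
proof -
  obtain r where r: "m \<ge> 0" "r > 0"
    "\<And>x j. norm (x - x\<^sub>0) < r \<Longrightarrow> R \<le> norm (x - q) \<Longrightarrow> j \<in> J \<Longrightarrow> u j x \<le> m * g x" using m by (auto simp: slope_bound_def)
  obtain r1 where r1: "r1 > 0" "cball x\<^sub>0 r1 \<subseteq> \<Omega>" using open_contains_cball open_dom x0_in by blast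
  have k: "mean_const TYPE('a) > 0" by (rule mean_const_pos)
  \<comment> \<open>The last bound makes the error a \<kappa> e^2 at most half of the kink's gain;
    the others keep the ball inside \<Omega> and inside the range of the slope bound.\<close>
  define e where "e = min (min (r / 2) r1) (min R (c\<^sub>1 * c / (2 * a * mean_const TYPE('a))))"
  have e: "e > 0" "e < r" "e \<le> r1" "e \<le> R" "e \<le> c\<^sub>1 * c / (2 * a * mean_const TYPE('a))"
    using r(2) r1(1) R c1_pos c(1) a_pos k by (auto simp: e_def min_less_iff_disj)
  have sub: "cball x\<^sub>0 e \<subseteq> \<Omega>" using e(3) r1(2) by (meson order_trans subset_cball)
  have cc: "continuous_on (cball x\<^sub>0 e) (\<lambda>y. w y - V y)"
    by (intro continuous_intros continuous_on_subset[OF cont_w sub] continuous_on_subset[OF cont_V sub])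
  have cm: "continuous_on (cball x\<^sub>0 e) (\<lambda>y. max (- g y) 0)" by (intro continuous_intros cont_g)
  \<comment> \<open>Outside the ball at most one phase is positive, so V obeys the slope bound, and
    there g \<le> 2 e.\<close>
  have low: "c\<^sub>1 * max (- g y) 0 + (- 2 * m * e) * 1 \<le> w y - V y" if y: "y \<in> ball x\<^sub>0 e" for y
  proof (cases "norm (y - q) \<le> R")
    case True
    have "0 \<le> 2 * m * e" using r(1) e(1) by simp
    moreover have eq: "max (- g y) 0 = - g y" using g_nonpos[OF True] by simp
    ultimately show ?thesis using w_lower[OF True] V_zero_in[OF True] unfolding eq by linarith
  next
    case False
    then have F: "R \<le> norm (y - q)" by simp
    have y\<Omega>: "y \<in> \<Omega>" and ny: "norm (y - x\<^sub>0) < e" using y sub by (auto simp: dist_norm norm_minus_commute)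
    have "g y \<le> 2 * e" by (rule g_upper[OF x0(1) less_imp_le[OF ny] e(4)])
    then have mg: "m * g y \<le> 2 * m * e" using r(1) mult_left_mono[of "g y" "2 * e" m] by simp
    have "V y \<le> m * g y"
      using V_cases[OF y\<Omega>] r(3)[of y] ny e(2) F g_nonneg[OF F] r(1) by auto
    then show ?thesis using mg w_nonneg[OF y\<Omega>] g_nonneg[OF F] by simp
  qed
  have "c\<^sub>1 * (c * e) - 2 * m * e \<le> c\<^sub>1 * conv (\<lambda>y. max (- g y) 0) (mollifier e) x\<^sub>0 + (- 2 * m * e) * conv (\<lambda>y. 1) (mollifier e) x\<^sub>0"
    unfolding conv_mollifier_const[OF e(1)]
    using mult_left_mono[OF c(2)[OF e(1,4) x0(1), of x\<^sub>0] less_imp_le[OF c1_pos]] e(1) by simp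
  also have "\<dots> = conv (\<lambda>y. c\<^sub>1 * max (- g y) 0 + (- 2 * m * e) * 1) (mollifier e) x\<^sub>0"
    by (rule conv_mollifier_linear[symmetric, OF e(1) cm]) auto
  also have "\<dots> \<le> conv (\<lambda>y. w y - V y) (mollifier e) x\<^sub>0"
    using low cm cc by (intro conv_mollifier_mono e(1)) (auto intro!: continuous_intros)
  also have "\<dots> \<le> a * mean_const TYPE('a) * e\<^sup>2"
    using super_w[OF e(1) sub] x0 V_zero_in[of x\<^sub>0] by (simp add: V_def[symmetric, abs_def] V_def[symmetric])
  finally have "e * (c\<^sub>1 * c - 2 * m) \<le> e * (a * mean_const TYPE('a) * e)" by (simp add: algebra_simps power2_eq_square)
  then have 1: "c\<^sub>1 * c - 2 * m \<le> a * mean_const TYPE('a) * e" using e(1) by simp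
  have "a * mean_const TYPE('a) * e \<le> a * mean_const TYPE('a) * (c\<^sub>1 * c / (2 * a * mean_const TYPE('a)))" using e(5) a_pos k by (intro mult_left_mono) auto
  also have "\<dots> = c\<^sub>1 * c / 2" using a_pos k by simp
  finally show ?thesis using 1 by simp
qed

text \<open>At a point where \<open>u\<^sub>j / g\<close> is almost maximal, the superharmonic function \<open>(M + \<epsilon>) g - u\<^sub>j\<close> is
  small in mean, so that phase \<open>j\<close> nearly fills a ball touching the interface from outside. Then
  \<open>w + 2 u\<^sub>j - V\<close>, which almost has a convex kink there, violates the super mean value property.\<close>

lemma no_touching_ball: False
proof -
  let ?N = "real DIM('a)" and ?\<kappa> = "mean_const TYPE('a)"
  have k: "?\<kappa> > 0" by (rule mean_const_pos)
  obtain c where c: "c > 0" "\<And>e z p. 0 < e \<Longrightarrow> e \<le> R \<Longrightarrow> norm (p - q) = R \<Longrightarrow> norm (z - p) \<le> e / 8 \<Longrightarrow>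
    c * e \<le> conv (\<lambda>y. max (- g y) 0) (mollifier e) z" using conv_g_minus by blast
  define C5 where "C5 = c\<^sub>1 * c"
  have C5: "C5 > 0" using c1_pos c(1) by (simp add: C5_def)
  \<comment> \<open>The largest upper slope at \<open>x\<^sub>0\<close>, finite by
    \<open>u_upper\<close> and positive by nondegeneracy.\<close>
  define M where "M = Inf {m. slope_bound m}"
  have lowM: "C5 / 4 \<le> m" if "slope_bound m" for m
    unfolding C5_def using slope_bound_lower[of c m] c that by blast
  have bdd: "bdd_below {m. slope_bound m}" using lowM by (intro bdd_belowI[of _ "C5 / 4"]) auto
  have M: "C5 / 4 \<le> M" unfolding M_def using slope_bound_exists lowM by (intro cInf_greatest) auto
  have Mpos: "M > 0" using M C5 by simp
  \<comment> \<open>The kink will be tested at scale \<tau> s, where it gains C5 \<tau> s; the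
    losses are of order \<tau>^2 s, so \<tau> must be small against C5. The bound 1/12 gives
    \<tau>^2 \<le> \<tau>/12, which puts the test point within \<tau> s / 8 of the sphere.\<close>
  define \<tau> where "\<tau> = min (1/12) (C5 / (36 * (M + 1) + 4 * a * ?\<kappa>))"
  have den: "36 * (M + 1) + 4 * a * ?\<kappa> > 0" using Mpos a_pos k by (simp add: add_pos_pos)
  have \<tau>: "\<tau> > 0" "\<tau> \<le> 1/12"
    unfolding \<tau>_def using divide_pos_pos[OF C5 den] by (simp, intro min.cobounded1)
  have \<tau>b: "\<tau> * (8 * (M + 1) + a * ?\<kappa>) \<le> C5 / 4"
  proof -
    have "\<tau> * (36 * (M + 1) + 4 * a * ?\<kappa>) \<le> C5 / (36 * (M + 1) + 4 * a * ?\<kappa>) * (36 * (M + 1) + 4 * a * ?\<kappa>)"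
      using den by (intro mult_right_mono) (auto simp: \<tau>_def)
    also have "\<dots> = C5" using den by simp
    finally have "\<tau> * (36 * (M + 1) + 4 * a * ?\<kappa>) \<le> C5" .
    moreover have "\<tau> * (M + 1) \<ge> 0" using \<tau>(1) Mpos by simp
    ultimately show ?thesis by (simp add: algebra_simps)
  qed
  \<comment> \<open>Half of the height \<tau>^2 (in units of s) at which a small ball is placed
    above the sphere: that ball then stays off the sphere and off the edge of the kernel of scale
    s.\<close>
  define \<theta> where "\<theta> = \<tau>\<^sup>2 / 2"
  have \<tau>2: "\<tau>\<^sup>2 \<le> \<tau> / 12" using \<tau> by (simp add: power2_eq_square mult_left_mono)
  have \<theta>: "0 < \<theta>" "\<theta> < 1" using \<tau> \<tau>2 by (auto simp: \<theta>_def)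
  obtain C where C: "C > 0" "\<And>s (z::'a). s > 0 \<Longrightarrow> mollifier s z \<le> C / s ^ DIM('a)" using mollifier_upper by blast
  obtain b where b: "b > 0" "\<And>s (z::'a). s > 0 \<Longrightarrow> norm z \<le> (1 - \<theta>) * s \<Longrightarrow> b / s ^ DIM('a) \<le> mollifier s z"
    using mollifier_lower[OF \<theta>] by blast
  \<comment> \<open>Compares the kernel of scale \<tau> s anywhere with the kernel of scale s away
    from its edge, and so carries smallness in mean from scale s to scale \<tau> s.\<close>
  define C2 where "C2 = C / (\<tau> ^ DIM('a) * b)"
  have C2: "C2 > 0" using C(1) \<tau>(1) b(1) by (simp add: C2_def)
  have comp: "mollifier (\<tau> * s) z \<le> C2 * mollifier s y" if "s > 0" "norm y \<le> (1 - \<theta>) * s" for s and y z :: 'a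
  proof -
    have "mollifier (\<tau> * s) z \<le> C / (\<tau> * s) ^ DIM('a)" using C(2) that(1) \<tau>(1) by simp
    also have "\<dots> = C2 * (b / s ^ DIM('a))" using b(1) \<tau>(1) that(1) by (simp add: C2_def power_mult_distrib)
    also have "\<dots> \<le> C2 * mollifier s y" using C2 b(2)[OF that] by (intro mult_left_mono) auto
    finally show ?thesis .
  qed
  \<comment> \<open>If phase \<open>j\<close> vanished on the small ball, \<open>h\<close> below
    would be at least M \<theta> s there and its mean at least M C3 s.\<close>
  define C3 where "C3 = \<theta> * b * unit_ball_vol ?N * \<theta> ^ DIM('a)"
  have C3: "C3 > 0" using \<theta> b(1) by (simp add: C3_def)
  \<comment> \<open>The smallness asked of the mean of \<open>h\<close>, in units of s: the first
    entry forces phase \<open>j\<close> to be positive in the small ball, the second makes the loss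
    2 C2 d an eighth of the kink's gain.\<close>
  define d where "d = min (M * C3 / 2) (C5 * \<tau> / (16 * C2))"
  have d: "d > 0" "d < M * C3" "2 * C2 * d \<le> C5 * \<tau> / 8"
  proof -
    show "d > 0" "d < M * C3" using Mpos C3 C5 \<tau> C2 by (auto simp: d_def min_less_iff_disj)
    have "2 * C2 * d \<le> 2 * C2 * (C5 * \<tau> / (16 * C2))" using C2 by (intro mult_left_mono) (auto simp: d_def)
    then show "2 * C2 * d \<le> C5 * \<tau> / 8" using C2 by simp
  qed
  \<comment> \<open>How nearly maximal the slope must be: M + \<epsilon> is a slope bound and M -
    \<epsilon> is not, and 8 \<epsilon> \<le> d.\<close>
  define \<epsilon> where "\<epsilon> = min (d / 8) (min 1 (M / 2))"
  have \<epsilon>: "\<epsilon> > 0" "\<epsilon> \<le> 1" "\<epsilon> < M" "8 * \<epsilon> \<le> d" using d Mpos by (auto simp: \<epsilon>_def min_less_iff_disj)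
  define M' where "M' = M + \<epsilon>"
  have M': "M' > 0" "M' \<le> M + 1" "M \<le> M'" using Mpos \<epsilon> by (auto simp: M'_def)
  have "\<exists>m. slope_bound m \<and> m < M'"
    using cInf_lessD[of "{m. slope_bound m}" M'] slope_bound_exists \<epsilon>(1) by (auto simp: M'_def M_def)
  then have "slope_bound M'" using slope_bound_mono less_imp_le by blast
  then obtain r where r: "r > 0"
    "\<And>x j. norm (x - x\<^sub>0) < r \<Longrightarrow> R \<le> norm (x - q) \<Longrightarrow> j \<in> J \<Longrightarrow> u j x \<le> M' * g x" by (auto simp: slope_bound_def)
  obtain r1 where r1: "r1 > 0" "cball x\<^sub>0 r1 \<subseteq> \<Omega>" using open_contains_cball open_dom x0_in by blast
  \<comment> \<open>Collects the errors of order s^2 in the mean of \<open>h\<close>: the Laplacian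
    of \<open>g\<close> and the constant in \<open>sub_u\<close>.\<close>
  define E where "E = ((M + 1) * ?N / R + a) * ?\<kappa>"
  have E: "E > 0" using Mpos R a_pos k by (simp add: E_def add_pos_pos)
  \<comment> \<open>Every point used lies within 4 r' of \<open>x\<^sub>0\<close>, hence in \<Omega>
    and in the range of the bound M'. The remaining entries ensure s \<le> R, s \<le> 1 and E s
    \<le> d/2.\<close>
  define r' where "r' = min (min (r / 4) (r1 / 4)) (min (min R 1) (d / (2 * E)))"
  have r': "r' > 0" "4 * r' \<le> r" "4 * r' \<le> r1" "r' \<le> R" "r' \<le> 1" "E * r' \<le> d / 2"
  proof -
    have "d / (2 * E) > 0" using d(1) E by simp
    then show "r' > 0" "4 * r' \<le> r" "4 * r' \<le> r1" "r' \<le> R" "r' \<le> 1"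
      unfolding r'_def using r(1) r1(1) R by linarith+
    have "E * r' \<le> E * (d / (2 * E))" using E by (intro mult_left_mono) (auto simp: r'_def)
    then show "E * r' \<le> d / 2" using E by simp
  qed
  \<comment> \<open>Failure of this bound arbitrarily close to \<open>x\<^sub>0\<close> provides the
    point where the slope is almost attained.\<close>
  have "\<not> slope_bound (M - \<epsilon>)" using cInf_lower[OF _ bdd, of "M - \<epsilon>"] \<epsilon>(1) by (auto simp: M_def)
  then obtain x j where x: "norm (x - x\<^sub>0) < r'" "R \<le> norm (x - q)" and j: "j \<in> J" and big: "u j x > (M - \<epsilon>) * g x"
    using \<epsilon>(3) r'(1) unfolding slope_bound_def by (auto simp: not_le)
  have gx0: "g x \<ge> 0" by (rule g_nonneg[OF x(2)])
  have "u j x > 0" using big \<epsilon>(3) gx0 by (smt (verit) mult_nonneg_nonneg)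
  then have xR: "norm (x - q) > R" using u_zero_in[OF j, of x] by (cases "norm (x - q) \<le> R") auto
  define s where "s = norm (x - q) - R"
  have s: "s > 0" using xR by (simp add: s_def)
  have "norm (x - q) \<le> norm (x - x\<^sub>0) + norm (x\<^sub>0 - q)" using norm_triangle_ineq[of "x - x\<^sub>0" "x\<^sub>0 - q"] by simp
  then have sr: "s < r'" using x(1) x0(1) by (simp add: s_def)
  have sR: "s \<le> R" and s1: "s \<le> 1" and Es: "E * s \<le> d / 2"
    using sr r' mult_left_mono[OF less_imp_le[OF sr] less_imp_le[OF E]] by linarith+
  \<comment> \<open>The interface argument is carried out at \<open>p\<close>, the point of the
    sphere nearest to \<open>x\<close>. It replaces \<open>x\<^sub>0\<close>, and w need not vanish
    at it.\<close>
  define \<nu> where "\<nu> = (x - q) /\<^sub>R norm (x - q)"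
  have xq0: "norm (x - q) \<noteq> 0" using xR R by linarith
  then have n\<nu>: "norm \<nu> = 1" by (simp add: \<nu>_def)
  define p where "p = q + R *\<^sub>R \<nu>"
  have pq: "norm (p - q) = R" using n\<nu> R by (simp add: p_def)
  have xp: "x = p + s *\<^sub>R \<nu>"
  proof -
    have "norm (x - q) *\<^sub>R \<nu> = x - q" using xq0 by (simp add: \<nu>_def)
    then show ?thesis by (simp add: p_def s_def algebra_simps)
  qed
  have pqR: "(p - q) /\<^sub>R R = \<nu>" using R by (simp add: p_def)
  have gp: "g (p + v) = v \<bullet> \<nu> + (norm v)\<^sup>2 / (2 * R)" for v using g_expand[OF pq, of v] pqR by simp
  have px0: "norm (p - x\<^sub>0) \<le> 2 * r'"
    using norm_triangle_ineq[of "p - x" "x - x\<^sub>0"] xp n\<nu> s x(1) sr by simp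
  have inr: "norm (y - x\<^sub>0) < r" "y \<in> \<Omega>" if "norm (y - p) \<le> 2 * s" for y
  proof -
    have *: "norm (y - x\<^sub>0) < 4 * r'" using norm_triangle_ineq[of "y - p" "p - x\<^sub>0"] that px0 sr by simp
    then show "norm (y - x\<^sub>0) < r" using r'(2) by simp
    have "y \<in> cball x\<^sub>0 r1" using * r'(3) by (simp add: dist_norm norm_minus_commute)
    then show "y \<in> \<Omega>" using r1(2) by blast
  qed
  have inx: "norm (y - p) \<le> 2 * s" if "norm (x - y) \<le> s" for y
    using norm_triangle_ineq[of "y - x" "x - p"] that xp n\<nu> s by (simp add: norm_minus_commute)
  have outx: "R \<le> norm (y - q)" if "norm (x - y) \<le> s" for y
    using norm_triangle_ineq[of "x - y" "y - q"] that by (simp add: s_def)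
  define h where "h y = M' * g y - u j y" for y
  have h0: "0 \<le> h y" if "norm (x - y) \<le> s" for y
    using r(2)[OF inr(1)[OF inx[OF that]] outx[OF that] j] by (simp add: h_def)
  have subx: "cball x s \<subseteq> \<Omega>" using inr(2)[OF inx] by (auto simp: dist_norm)
  have cux: "continuous_on (cball x s) (u j)" by (rule continuous_on_subset[OF cont_u[OF j] subx])
  have ch: "continuous_on (cball x s) h"
    unfolding h_def[abs_def] by (intro continuous_intros cont_g cux)
  \<comment> \<open>At \<open>x\<close> the deficit is at most 2 \<epsilon> g \<le> 4 \<epsilon> s,
    and by \<open>sub_u\<close> it is superharmonic up to E s^2: smallness at one point becomes
    smallness in mean.\<close>
  have hsmall: "conv h (mollifier s) x \<le> d * s"
  proof -
    have gx: "g x \<le> 2 * s" using g_upper[OF pq, of x s] xp n\<nu> s sR by simp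
    have "conv h (mollifier s) x = M' * conv g (mollifier s) x + (-1) * conv (u j) (mollifier s) x"
      unfolding h_def[abs_def] using conv_mollifier_linear[OF s cont_g cux, of M' "-1"] by simp
    also have "\<dots> \<le> M' * (g x + ?N / R * ?\<kappa> * s\<^sup>2) - (u j x - a * ?\<kappa> * s\<^sup>2)"
      using sub_u[OF j s subx] conv_g[OF s, of x] by simp
    also have "\<dots> \<le> M' * g x - u j x + E * s\<^sup>2"
    proof -
      have "M' * (?N / R * ?\<kappa> * s\<^sup>2) \<le> (M + 1) * (?N / R * ?\<kappa> * s\<^sup>2)" using M'(2) R k by (intro mult_right_mono) auto
      then show ?thesis by (simp add: E_def algebra_simps)
    qed
    also have "\<dots> \<le> 2 * \<epsilon> * g x + E * s\<^sup>2" using big by (simp add: M'_def algebra_simps)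
    also have "\<dots> \<le> 2 * \<epsilon> * (2 * s) + d / 2 * s"
    proof -
      have "2 * \<epsilon> * g x \<le> 2 * \<epsilon> * (2 * s)" using gx \<epsilon>(1) by (intro mult_left_mono) auto
      moreover have "E * s\<^sup>2 \<le> d / 2 * s" using mult_right_mono[OF Es less_imp_le[OF s]] by (simp add: power2_eq_square mult.assoc)
      ultimately show ?thesis by linarith
    qed
    also have "\<dots> \<le> d * s" using mult_right_mono[OF \<epsilon>(4) less_imp_le[OF s]] by (simp add: algebra_simps)
    finally show ?thesis .
  qed
  define z0 where "z0 = p + (\<tau>\<^sup>2 * s) *\<^sub>R \<nu>"
  \<comment> \<open>A point close to \<open>p\<close> is needed at which phase \<open>j\<close> is
    positive, since only there is an upper bound for w + 2 u - V at hand.\<close>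
  have "\<exists>z\<in>ball z0 (\<theta> * s). u j z > 0"
  proof (rule ccontr)
    assume no: "\<not> ?thesis"
    have z0x: "norm (x - z0) = (1 - \<tau>\<^sup>2) * s"
    proof -
      have "x - z0 = ((1 - \<tau>\<^sup>2) * s) *\<^sub>R \<nu>" by (simp add: xp z0_def algebra_simps)
      then show ?thesis using n\<nu> s \<tau>2 \<tau> by simp
    qed
    have near: "norm (x - y) \<le> (1 - \<theta>) * s" if "y \<in> ball z0 (\<theta> * s)" for y
      using norm_triangle_ineq[of "x - z0" "z0 - y"] z0x that by (simp add: dist_norm \<theta>_def algebra_simps)
    have near': "norm (x - y) < s" if "y \<in> ball z0 (\<theta> * s)" for y
    proof -
      have "\<theta> * s > 0" using \<theta>(1) s by simp
      then show ?thesis using near[OF that] by (simp add: algebra_simps)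
    qed
    have "(M * \<theta> * s) * b * unit_ball_vol ?N * ((\<theta> * s) / s) ^ DIM('a) \<le> conv h (mollifier s) x"
    proof (rule conv_mollifier_lower[OF s ch, where y=z0])
      show "0 \<le> h y" if "y \<in> ball x s" for y using h0 that by (simp add: dist_norm)
      show "ball z0 (\<theta> * s) \<subseteq> ball x s" using near' by (auto simp: dist_norm)
      show "b / s ^ DIM('a) \<le> mollifier s (x - y)" if "y \<in> ball z0 (\<theta> * s)" for y
        by (rule b(2)[OF s near[OF that]])
      show "M * \<theta> * s \<le> h y" if y: "y \<in> ball z0 (\<theta> * s)" for y
      proof -
        have xy: "norm (x - y) \<le> s" using near'[OF y] by simp
        have "u j y \<ge> 0" using u_nonneg[OF j] inr(2)[OF inx[OF xy]] by blast
        then have u0: "u j y = 0" using no y by force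
        have "norm (z0 - q) = R + \<tau>\<^sup>2 * s"
        proof -
          have "z0 - q = (R + \<tau>\<^sup>2 * s) *\<^sub>R \<nu>" by (simp add: z0_def p_def algebra_simps)
          then show ?thesis using n\<nu> R s by simp
        qed
        then have "norm (y - q) \<ge> R + \<theta> * s"
          using norm_triangle_ineq[of "z0 - y" "y - q"] y by (simp add: dist_norm \<theta>_def)
        then have "g y \<ge> \<theta> * s" using g_ge[OF outx[OF xy]] by simp
        then have "M * (\<theta> * s) \<le> M' * g y" using M' Mpos \<theta>(1) s by (intro mult_mono) auto
        then show ?thesis using u0 by (simp add: h_def mult.assoc)
      qed
    qed (use \<theta> s Mpos b(1) in auto)
    also have "\<dots> \<le> d * s" by (rule hsmall)
    finally have "M * C3 * s \<le> d * s" using s by (simp add: C3_def mult_ac)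
    then show False using d(2) s by simp
  qed
  then obtain z where z: "z \<in> ball z0 (\<theta> * s)" "u j z > 0" by blast
  have zp: "norm (z - p) \<le> 3/2 * \<tau>\<^sup>2 * s"
  proof -
    have "norm (z0 - p) = \<tau>\<^sup>2 * s" using n\<nu> s by (simp add: z0_def)
    then show ?thesis using norm_triangle_ineq[of "z - z0" "z0 - p"] z(1)
      by (simp add: dist_norm norm_minus_commute \<theta>_def)
  qed
  have \<tau>2s: "\<tau>\<^sup>2 * s \<le> \<tau> * s / 12" using mult_right_mono[OF \<tau>2 less_imp_le[OF s]] by simp
  have \<tau>s: "\<tau> * s > 0" "\<tau> * s \<le> s / 12" using \<tau> s by auto
  have zp': "norm (z - p) \<le> \<tau> * s / 8" using zp \<tau>2s by simp
  have z2: "norm (z - p) \<le> 2 * s" using zp' \<tau>s by simp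
  have zy: "norm (y - p) \<le> 2 * (\<tau> * s)" "norm (y - p) \<le> 2 * s" if "norm (z - y) \<le> \<tau> * s" for y
  proof -
    show "norm (y - p) \<le> 2 * (\<tau> * s)"
      using norm_triangle_ineq[of "y - z" "z - p"] that zp' \<tau>s by (simp add: norm_minus_commute)
    then show "norm (y - p) \<le> 2 * s" using \<tau>s by simp
  qed
  have subz: "cball z (\<tau> * s) \<subseteq> \<Omega>" using inr(2)[OF zy(2)] by (auto simp: dist_norm)
  define f where "f y = w y + 2 * u j y - V y" for y
  have cf: "continuous_on (cball z (\<tau> * s)) f"
    unfolding f_def[abs_def]
    by (intro continuous_intros continuous_on_subset[OF cont_w subz] continuous_on_subset[OF cont_u[OF j] subz]
        continuous_on_subset[OF cont_V subz])
  have cm: "continuous_on (cball z (\<tau> * s)) (\<lambda>y. max (- g y) 0)" by (intro continuous_intros cont_g)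
  let ?L = "5 * M' * \<tau>\<^sup>2 * s"
  have L0: "?L \<ge> 0" using M' s by simp
  \<comment> \<open>Three regions. In the ball \<open>f\<close> is w, at least
    \<open>c\<^sub>1\<close> times the negative part of \<open>g\<close>. Outside it, away from the
    edge of the ball about \<open>x\<close>, f \<ge> -2 h and the kernels compare. The rest is a
    thin sliver along the sphere, where f \<ge> -V \<ge> -M' g \<ge> -?L.\<close>
  have pw: "(- (2 * C2)) * (h y * mollifier s (x - y)) - ?L * mollifier (\<tau> * s) (z - y) +
      c\<^sub>1 * (max (- g y) 0 * mollifier (\<tau> * s) (z - y)) \<le> f y * mollifier (\<tau> * s) (z - y)" for y
  proof -
    let ?m = "mollifier (\<tau> * s) (z - y)" and ?k = "mollifier s (x - y)"
    have m0: "?m \<ge> 0" and k0: "?k \<ge> 0" using mollifier_nonneg \<tau>s(1) s by auto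
    have hk: "0 \<le> h y * ?k"
    proof (cases "norm (x - y) < s")
      case True then show ?thesis using h0[of y] k0 by simp
    next
      case False then show ?thesis using mollifier_eq_0[OF s, of "x - y"] by simp
    qed
    have hk2: "(- (2 * C2)) * (h y * ?k) \<le> 0" using hk C2 by (simp add: mult_nonneg_nonneg)
    show ?thesis
    proof (cases "norm (z - y) < \<tau> * s")
      case False
      then have "?m = 0" using mollifier_eq_0[OF \<tau>s(1), of "z - y"] by simp
      then show ?thesis using hk2 by simp
    next
      case True
      note y = zy[OF less_imp_le[OF True]]
      have y\<Omega>: "y \<in> \<Omega>" using inr(2)[OF y(2)] .
      show ?thesis
      proof (cases "norm (y - q) \<le> R")
        case True
        have "f y = w y" using u_zero_in[OF j True] V_zero_in[OF True] by (simp add: f_def)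
        moreover have "max (- g y) 0 = - g y" using g_nonpos[OF True] by simp
        ultimately have "c\<^sub>1 * max (- g y) 0 \<le> f y" using w_lower[OF True] by simp
        from mult_right_mono[OF this m0] have "c\<^sub>1 * (max (- g y) 0 * ?m) \<le> f y * ?m" by (simp add: mult.assoc)
        moreover have "0 \<le> ?L * ?m" using L0 m0 by (rule mult_nonneg_nonneg)
        ultimately show ?thesis using hk2 by linarith
      next
        case False
        then have yR: "R \<le> norm (y - q)" by simp
        have gy: "g y \<ge> 0" by (rule g_nonneg[OF yR])
        have ub: "u l y \<le> M' * g y" if "l \<in> J" for l by (rule r(2)[OF inr(1)[OF y(2)] yR that])
        have Vb: "V y \<le> M' * g y" using V_cases[OF y\<Omega>] ub gy M' by auto
        have mg: "max (- g y) 0 = 0" using gy by simp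
        have "(- (2 * C2)) * (h y * ?k) - ?L * ?m \<le> f y * ?m"
        proof (cases "norm (x - y) \<le> (1 - \<theta>) * s")
          case True
          have "\<theta> * s > 0" using \<theta>(1) s by simp
          then have "norm (x - y) \<le> s" using True by (simp add: algebra_simps)
          then have hy: "0 \<le> h y" by (rule h0)
          have "f y \<ge> - 2 * h y"
            using Vb w_nonneg[OF y\<Omega>] mult_nonneg_nonneg[OF less_imp_le[OF M'(1)] gy] by (simp add: f_def h_def)
          from mult_right_mono[OF this m0] have 1: "- 2 * (h y * ?m) \<le> f y * ?m" by (simp add: mult.assoc)
          have "h y * ?m \<le> h y * (C2 * ?k)" using comp[OF s True, of "z - y"] hy by (intro mult_left_mono) auto
          moreover have "0 \<le> ?L * ?m" using L0 m0 by (rule mult_nonneg_nonneg)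
          moreover have "h y * (C2 * ?k) = C2 * (h y * ?k)" "(- (2 * C2)) * (h y * ?k) = - 2 * (C2 * (h y * ?k))"
            by simp_all
          ultimately show ?thesis using 1 by linarith
        next
          case False
          \<comment> \<open>Points of the sliver are outside both tangent balls up to a thin margin,
            so their height above the tangent plane at \<open>p\<close> is of second order: at most
            5/2 \<tau>^2 s, and the curvature of the sphere adds at most 2 \<tau>^2 s to
            \<open>g\<close>.\<close>
          define v where "v = y - p"
          have nv: "norm v \<le> 2 * (\<tau> * s)" using y(1) by (simp add: v_def)
          have nv2: "(norm v)\<^sup>2 \<le> 4 * (\<tau>\<^sup>2 * s\<^sup>2)"
            using power_mono[OF nv, of 2] by (simp add: power_mult_distrib)
          have "(norm (x - y))\<^sup>2 = (norm v)\<^sup>2 - 2 * s * (v \<bullet> \<nu>) + s\<^sup>2"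
          proof -
            have xy: "x - y = s *\<^sub>R \<nu> - v" by (simp add: xp v_def)
            have "(norm (x - y))\<^sup>2 = s\<^sup>2 * (\<nu> \<bullet> \<nu>) - 2 * s * (v \<bullet> \<nu>) + v \<bullet> v"
              unfolding xy power2_norm_eq_inner by (simp add: inner_diff inner_commute power2_eq_square algebra_simps)
            then show ?thesis using n\<nu> by (simp add: power2_norm_eq_inner[symmetric])
          qed
          moreover have "((1 - \<theta>) * s)\<^sup>2 \<le> (norm (x - y))\<^sup>2" using False \<theta> s by (intro power_mono) auto
          moreover have "(1 - \<tau>\<^sup>2) * s\<^sup>2 \<le> ((1 - \<theta>) * s)\<^sup>2"
            by (simp add: power_mult_distrib power2_diff \<theta>_def mult_right_mono)
          ultimately have "2 * s * (v \<bullet> \<nu>) \<le> (norm v)\<^sup>2 + \<tau>\<^sup>2 * s\<^sup>2" by (simp add: left_diff_distrib)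
          then have "s * (2 * (v \<bullet> \<nu>)) \<le> s * (5 * \<tau>\<^sup>2 * s)" using nv2 by (simp add: power2_eq_square algebra_simps)
          then have v1: "v \<bullet> \<nu> \<le> 5/2 * \<tau>\<^sup>2 * s" using s by simp
          have v2: "(norm v)\<^sup>2 / (2 * R) \<le> 2 * \<tau>\<^sup>2 * s"
          proof -
            have "(norm v)\<^sup>2 / (2 * R) \<le> 4 * (\<tau>\<^sup>2 * s\<^sup>2) / (2 * R)" using nv2 R by (intro divide_right_mono) auto
            also have "\<dots> = 2 * \<tau>\<^sup>2 * s * (s / R)" by (simp add: power2_eq_square)
            also have "\<dots> \<le> 2 * \<tau>\<^sup>2 * s * 1" using sR R s by (intro mult_left_mono) auto
            finally show ?thesis by simp
          qed
          have "g y = v \<bullet> \<nu> + (norm v)\<^sup>2 / (2 * R)" using gp[of v] by (simp add: v_def)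
          then have "g y \<le> 5/2 * \<tau>\<^sup>2 * s + 2 * \<tau>\<^sup>2 * s" using v1 v2 by linarith
          moreover have "\<tau>\<^sup>2 * s \<ge> 0" using s by simp
          ultimately have "g y \<le> 5 * \<tau>\<^sup>2 * s" by linarith
          from mult_left_mono[OF this less_imp_le[OF M'(1)]] have "M' * g y \<le> ?L" by (simp add: mult_ac)
          then have "- ?L \<le> f y" using Vb w_nonneg[OF y\<Omega>] u_nonneg[OF j y\<Omega>] by (simp add: f_def)
          from mult_right_mono[OF this m0] show ?thesis using hk2 by simp
        qed
        then show ?thesis unfolding mg by simp
      qed
    qed
  qed
  have ih: "integrable lborel (\<lambda>y. h y * mollifier s (x - y))" by (rule conv_mollifier_integrable[OF s ch])
  have im: "integrable lborel (\<lambda>y. mollifier (\<tau> * s) (z - y))" by (rule mollifier_integrable(1)[OF \<tau>s(1)])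
  have ig: "integrable lborel (\<lambda>y. max (- g y) 0 * mollifier (\<tau> * s) (z - y))" by (rule conv_mollifier_integrable[OF \<tau>s(1) cm])
  have if': "integrable lborel (\<lambda>y. f y * mollifier (\<tau> * s) (z - y))" by (rule conv_mollifier_integrable[OF \<tau>s(1) cf])
  have "(LINT y|lborel. (- (2 * C2)) * (h y * mollifier s (x - y)) - ?L * mollifier (\<tau> * s) (z - y) +
      c\<^sub>1 * (max (- g y) 0 * mollifier (\<tau> * s) (z - y))) \<le> (LINT y|lborel. f y * mollifier (\<tau> * s) (z - y))"
    by (rule integral_mono[OF _ if' pw])
      (intro Bochner_Integration.integrable_add Bochner_Integration.integrable_diff integrable_mult_right ih im ig)
  moreover have "(LINT y|lborel. (- (2 * C2)) * (h y * mollifier s (x - y)) - ?L * mollifier (\<tau> * s) (z - y) +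
      c\<^sub>1 * (max (- g y) 0 * mollifier (\<tau> * s) (z - y))) =
      (- (2 * C2)) * conv h (mollifier s) x - ?L * 1 + c\<^sub>1 * conv (\<lambda>y. max (- g y) 0) (mollifier (\<tau> * s)) z"
    unfolding conv_def using ih im ig mollifier_integrable(2)[OF \<tau>s(1), of z] by simp
  ultimately have low: "(- (2 * C2)) * conv h (mollifier s) x - ?L + c\<^sub>1 * conv (\<lambda>y. max (- g y) 0) (mollifier (\<tau> * s)) z
      \<le> conv f (mollifier (\<tau> * s)) z" by (simp add: conv_def)
  have "c * (\<tau> * s) \<le> conv (\<lambda>y. max (- g y) 0) (mollifier (\<tau> * s)) z"
    by (rule c(2)[OF \<tau>s(1) _ pq zp']) (use \<tau>s s sR in linarith)
  \<comment> \<open>The gain is linear in \<tau>, in contrast to the losses.\<close>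
  from mult_left_mono[OF this less_imp_le[OF c1_pos]]
  have kink: "C5 * \<tau> * s \<le> c\<^sub>1 * conv (\<lambda>y. max (- g y) 0) (mollifier (\<tau> * s)) z" by (simp add: C5_def mult.assoc)
  have z\<Omega>: "z \<in> \<Omega>" using inr(2)[OF z2] .
  have "norm (z - q) > R" using u_zero_in[OF j, of z] z(2) by (cases "norm (z - q) \<le> R") auto
  then have uz: "u j z \<le> M' * g z" using r(2)[OF inr(1)[OF z2] _ j] by simp
  have "g z \<le> 2 * (3/2 * \<tau>\<^sup>2 * s)"
    by (rule g_upper[OF pq zp]) (use \<tau>2s \<tau>s s sR in linarith)
  from mult_left_mono[OF this less_imp_le[OF M'(1)]] have gz: "M' * g z \<le> 3 * M' * \<tau>\<^sup>2 * s" by (simp add: mult_ac)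
  have "conv f (mollifier (\<tau> * s)) z \<le> f z + a * ?\<kappa> * (\<tau> * s)\<^sup>2"
    using super_wu[OF j \<tau>s(1) subz] by (simp add: f_def[abs_def] V_def[abs_def])
  \<comment> \<open>Positivity of phase \<open>j\<close> at \<open>z\<close> makes w and the other
    phases vanish there; so \<open>f\<close> equals \<open>u j\<close>, of order \<tau>^2 s since
    \<open>z\<close> is that close to the sphere.\<close>
  also have "f z = u j z" using V_eq[OF j z\<Omega> z(2)] by (simp add: f_def)
  also have "a * ?\<kappa> * (\<tau> * s)\<^sup>2 \<le> a * ?\<kappa> * \<tau>\<^sup>2 * s"
  proof -
    have "(\<tau> * s)\<^sup>2 \<le> \<tau>\<^sup>2 * s" using s s1 by (simp add: power_mult_distrib power2_eq_square[of s] mult_left_mono mult_left_le)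
    then show ?thesis using a_pos k mult_left_mono[of "(\<tau> * s)\<^sup>2" "\<tau>\<^sup>2 * s" "a * ?\<kappa>"] by (simp add: mult.assoc)
  qed
  finally have up: "conv f (mollifier (\<tau> * s)) z \<le> 3 * M' * \<tau>\<^sup>2 * s + a * ?\<kappa> * \<tau>\<^sup>2 * s" using uz gz by simp
  have "2 * C2 * conv h (mollifier s) x \<le> 2 * C2 * (d * s)" using hsmall C2 by (intro mult_left_mono) auto
  also have "\<dots> \<le> C5 * \<tau> / 8 * s" using mult_right_mono[OF d(3) less_imp_le[OF s]] by (simp add: mult.assoc)
  finally have hb: "2 * C2 * conv h (mollifier s) x \<le> C5 * \<tau> / 8 * s" .
  \<comment> \<open>The kink's gain against all losses: 3 M' from the value at \<open>z\<close>, 5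
    M' from the sliver, the error of \<open>super_wu\<close>, and the deficit. They add up to at
    most 3/8 of the gain.\<close>
  have "C5 * \<tau> * s \<le> 8 * M' * \<tau>\<^sup>2 * s + a * ?\<kappa> * \<tau>\<^sup>2 * s + C5 * \<tau> / 8 * s"
    using low kink up hb by simp
  also have "8 * M' * \<tau>\<^sup>2 * s \<le> 8 * (M + 1) * \<tau>\<^sup>2 * s" using M'(2) s by (intro mult_right_mono) auto
  also have "8 * (M + 1) * \<tau>\<^sup>2 * s + a * ?\<kappa> * \<tau>\<^sup>2 * s + C5 * \<tau> / 8 * s =
      (\<tau> * (8 * (M + 1) + a * ?\<kappa>)) * (\<tau> * s) + C5 * \<tau> / 8 * s" by (simp add: power2_eq_square algebra_simps)
  also have "\<dots> \<le> C5 / 4 * (\<tau> * s) + C5 * \<tau> / 8 * s" by (intro add_right_mono mult_right_mono \<tau>b less_imp_le[OF \<tau>s(1)])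
  finally have "C5 * (\<tau> * s) \<le> C5 / 4 * (\<tau> * s) + C5 / 8 * (\<tau> * s)" by (simp add: mult.assoc)
  moreover have "C5 * (\<tau> * s) > 0" using C5 \<tau>s(1) by simp
  ultimately show False by simp
qed

end

context interface
begin

lemma no_interface:
  assumes "x \<in> \<Omega>" "x \<in> frontier {x \<in> \<Omega>. w x > 0}" shows False
proof -
  let ?B = "{x \<in> \<Omega>. w x > 0}"
  have B: "open ?B"
  proof -
    have "open (\<Omega> \<inter> w -` {0<..})" using continuous_open_preimage[OF cont_w open_dom, of "{0<..}"] by simp
    moreover have "\<Omega> \<inter> w -` {0<..} = ?B" by auto
    ultimately show ?thesis by simp
  qed
  obtain r where r: "r > 0" "cball x r \<subseteq> \<Omega>" using open_contains_cball open_dom assms(1) by blast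
  have "x \<in> closure ?B" "x \<notin> ?B" using assms(2) B by (auto simp: frontier_def interior_open)
  \<comment> \<open>Start from a positive point so near to \<open>x\<close> that its nearest zero
    still lies inside \<Omega> with room to spare; that zero is the touching point, and need not be
    \<open>x\<close>.\<close>
  then obtain q where q: "q \<in> ?B" "dist q x < r / 4"
    using r(1) closure_approachable[of x ?B] by (meson divide_pos_pos zero_less_numeral)
  have ne: "- ?B \<noteq> {}" using \<open>x \<notin> ?B\<close> by blast
  have cl: "closed (- ?B)" using B by (simp add: closed_Compl)
  obtain x0 where x0: "x0 \<in> - ?B" "\<And>y. y \<in> - ?B \<Longrightarrow> dist q x0 \<le> dist q y"
    using distance_attains_inf[OF cl ne, of q] by blast
  define R where "R = dist q x0"
  have R: "R > 0" using x0(1) q(1) by (auto simp: R_def)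
  have R4: "R < r / 4" using x0(2)[of x] \<open>x \<notin> ?B\<close> q(2) by (simp add: R_def)
  have "cball q (R + r / 4) \<subseteq> cball x r"
  proof
    fix y assume "y \<in> cball q (R + r / 4)"
    then show "y \<in> cball x r" using dist_triangle[of x y q] q(2) R4 r(1) by (simp add: dist_commute)
  qed
  then have big: "cball q (R + r / 4) \<subseteq> \<Omega>" using r(2) by blast
  have "x0 \<in> \<Omega>" using big r(1) by (force simp: R_def)
  then have w0: "w x0 = 0" using x0(1) w_nonneg[of x0] by auto
  have bp: "ball q R \<subseteq> ?B" using x0(2) by (force simp: R_def)
  interpret touching_ball \<Omega> J w u a q R "r / 4" x0
    by unfold_locales (use R r(1) bp big w0 in \<open>auto simp: R_def dist_norm norm_minus_commute\<close>)
  show False by (rule no_touching_ball)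
qed

end

section \<open>Boundary behaviour\<close>

lemma smooth_on_has_derivative_grad:
  "smooth_on S f \<Longrightarrow> x \<in> S \<Longrightarrow> (f has_derivative (\<lambda>v. grad f x \<bullet> v)) (at x)"
proof -
  assume "smooth_on S f" "x \<in> S"
  then have D: "(f has_derivative frechet_derivative f (at x)) (at x)" by (rule smooth_on_has_derivative)
  then show ?thesis by (rule has_derivative_eq_rhs) (use has_derivative_grad[OF D] in auto)
qed

lemma smooth_local_lipschitz:
  assumes "smooth_on U f" "cball p r \<subseteq> U"
  shows "\<exists>B\<ge>0. \<forall>x\<in>cball p r. \<bar>f x - f p\<bar> \<le> B * norm (x - p)"
proof (cases "r < 0")
  case False
  have "compact (grad f ` cball p r)"
    by (intro compact_continuous_image continuous_on_subset[OF smooth_on_continuous_grad[OF assms(1)] assms(2)]) auto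
  then obtain B where B: "B > 0" "\<And>x. x \<in> cball p r \<Longrightarrow> norm (grad f x) \<le> B"
    using compact_imp_bounded[of "grad f ` cball p r"] unfolding bounded_pos by auto
  have "norm (f x - f p) \<le> B * norm (x - p)" if "x \<in> cball p r" for x
  proof (rule differentiable_bound[of "cball p r" f "\<lambda>x v. grad f x \<bullet> v"])
    show "(f has_derivative (\<lambda>v. grad f y \<bullet> v)) (at y within cball p r)" if "y \<in> cball p r" for y
      using smooth_on_has_derivative_grad[OF assms(1)] assms(2) that has_derivative_at_withinI by blast
    show "onorm (\<lambda>v. grad f y \<bullet> v) \<le> B" if "y \<in> cball p r" for y
      using B(2)[OF that] by (intro onorm_le) (auto intro!: order_trans[OF Cauchy_Schwarz_ineq2] mult_right_mono)
  qed (use that False in auto)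
  then show ?thesis using B(1) by (intro exI[of _ B]) auto
qed (intro exI[of _ 0], auto)

lemma smooth_taylor2:
  fixes f :: "'a::euclidean_space \<Rightarrow> real"
  assumes "smooth_on U f" "open U" "p \<in> U"
  obtains r B where "r > 0" "B \<ge> 0" "cball p r \<subseteq> U"
    "\<And>h. norm h \<le> r \<Longrightarrow> \<bar>f (p + h) - f p - grad f p \<bullet> h\<bar> \<le> B * (norm h)\<^sup>2"
proof -
  obtain r where r: "r > 0" "cball p r \<subseteq> U" using assms(2,3) open_contains_cball by blast
  have "\<exists>B\<ge>0. \<forall>x\<in>cball p r. \<bar>frechet_derivative f (at x) b - frechet_derivative f (at p) b\<bar> \<le> B * norm (x - p)" for b
    by (rule smooth_local_lipschitz[OF smooth_on_frechet_derivative[OF assms(1)] r(2)])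
  then obtain B where B: "\<And>b. B b \<ge> 0"
    "\<And>b x. x \<in> cball p r \<Longrightarrow> \<bar>frechet_derivative f (at x) b - frechet_derivative f (at p) b\<bar> \<le> B b * norm (x - p)"
    by metis
  define C where "C = (\<Sum>b\<in>(Basis::'a set). B b)"
  have C: "C \<ge> 0" unfolding C_def using B(1) by (intro sum_nonneg)
  have lip: "norm (grad f x - grad f p) \<le> C * norm (x - p)" if "x \<in> cball p r" for x
  proof -
    have "norm (grad f x - grad f p) \<le> (\<Sum>b\<in>Basis. \<bar>(grad f x - grad f p) \<bullet> b\<bar>)" by (rule norm_le_l1)
    also have "\<dots> \<le> (\<Sum>b\<in>Basis. B b * norm (x - p))"
      by (intro sum_mono) (use B(2)[OF that] in \<open>simp add: inner_diff_left grad_inner_Basis\<close>)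
    finally show ?thesis by (simp add: C_def sum_distrib_right)
  qed
  have "\<bar>f (p + h) - f p - grad f p \<bullet> h\<bar> \<le> C * (norm h)\<^sup>2" if h: "norm h \<le> r" for h
  proof -
    have seg: "closed_segment p (p + h) \<subseteq> cball p r"
      by (intro closed_segment_subset) (use h r(1) in \<open>auto simp: dist_norm\<close>)
    have "norm (f (p + h) - f p - (\<lambda>v. grad f p \<bullet> v) (p + h - p)) \<le> norm (p + h - p) * (C * norm h)"
    proof (rule differentiable_bound_linearization[where S="closed_segment p (p + h)" and f'="\<lambda>x v. grad f x \<bullet> v"])
      show "(f has_derivative (\<lambda>v. grad f x \<bullet> v)) (at x within closed_segment p (p + h))"
        if "x \<in> closed_segment p (p + h)" for x
        using smooth_on_has_derivative_grad[OF assms(1)] that seg r(2) has_derivative_at_withinI by blast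
      show "p + t *\<^sub>R (p + h - p) \<in> closed_segment p (p + h)" if "t \<in> {0..1}" for t
        using that by (auto simp: in_segment algebra_simps intro!: exI[of _ t])
      show "onorm ((\<lambda>v. grad f x \<bullet> v) - (\<lambda>v. grad f p \<bullet> v)) \<le> C * norm h" if "x \<in> closed_segment p (p + h)" for x
      proof (rule onorm_le)
        fix v
        have "norm (x - p) \<le> norm h" using segment_bound(1)[OF that] by simp
        then have "norm (grad f x - grad f p) \<le> C * norm h"
          using lip[of x] that seg C by (meson mult_left_mono order_trans subsetD)
        then show "norm (((\<lambda>v. grad f x \<bullet> v) - (\<lambda>v. grad f p \<bullet> v)) v) \<le> C * norm h * norm v"
          using Cauchy_Schwarz_ineq2[of "grad f x - grad f p" v]
          by (simp add: inner_diff_left) (meson mult_right_mono norm_ge_zero order_trans)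
      qed
    qed auto
    then show ?thesis by (simp add: power2_eq_square mult_ac)
  qed
  then show ?thesis using that r C by blast
qed

lemma smooth_domainE:
  assumes "smooth_domain \<Omega>" "p \<in> frontier \<Omega>"
  obtains U \<rho> where "open U" "p \<in> U" "smooth_on U \<rho>" "grad \<rho> p \<noteq> 0" "\<rho> p = 0"
    "\<And>x. x \<in> U \<Longrightarrow> x \<in> \<Omega> \<longleftrightarrow> \<rho> x < 0" "\<And>x. x \<in> U \<Longrightarrow> x \<in> closure \<Omega> \<Longrightarrow> \<rho> x \<le> 0"
proof -
  obtain U \<rho> where U: "open U" "p \<in> U" "smooth_on U \<rho>" "\<forall>x\<in>U. frechet_derivative \<rho> (at x) \<noteq> (\<lambda>v. 0)"
    "\<Omega> \<inter> U = {x\<in>U. \<rho> x < 0}" and op: "open \<Omega>"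
    using assms unfolding smooth_domain_def by blast
  have mem: "x \<in> \<Omega> \<longleftrightarrow> \<rho> x < 0" if "x \<in> U" for x using U(5) that by blast
  have cl: "\<rho> x \<le> 0" if x: "x \<in> U" "x \<in> closure \<Omega>" for x
  proof (rule ccontr)
    assume "\<not> ?thesis"
    then have "x \<in> U \<inter> \<rho> -` {0<..}" using x(1) by simp
    moreover have "open (U \<inter> \<rho> -` {0<..})"
      using continuous_open_preimage[OF smooth_on_imp_continuous_on[OF U(3)] U(1)] by simp
    ultimately have "(U \<inter> \<rho> -` {0<..}) \<inter> \<Omega> \<noteq> {}" using x(2) open_Int_closure_eq_empty by blast
    then show False using mem by force
  qed
  have pf: "p \<in> closure \<Omega>" "p \<notin> \<Omega>" using assms(2) op by (auto simp: frontier_def interior_open)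
  have "\<rho> p = 0" using cl[OF U(2) pf(1)] mem[OF U(2)] pf(2) by simp
  moreover have "grad \<rho> p \<noteq> 0"
  proof
    assume "grad \<rho> p = 0"
    then have "frechet_derivative \<rho> (at p) = (\<lambda>v. 0)"
      using frechet_derivative_eqI[OF smooth_on_has_derivative_grad[OF U(3,2)]] by simp
    then show False using U(4,2) by blast
  qed
  ultimately show ?thesis using that U(1-3) mem cl by blast
qed

text \<open>On the closure of the domain the defining function is nonpositive, so with n its
  gradient at p Taylor gives n . h \<le> B |h|^2, whereas h in the ball tangent from outside
  satisfies |h|^2 \<le> 2 R h . \<nu>, with \<nu> = n / |n|. For small R both hold only for h =
  0.\<close>

lemma exterior_ball:
  fixes \<Omega> :: "'a::euclidean_space set"
  assumes "smooth_domain \<Omega>" "p \<in> frontier \<Omega>"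
  obtains q R where "R > 0" "norm (p - q) = R" "\<And>x. x \<in> closure \<Omega> \<Longrightarrow> x \<noteq> p \<Longrightarrow> R < norm (x - q)"
proof -
  obtain U \<rho> where U: "open U" "p \<in> U" "smooth_on U \<rho>" "grad \<rho> p \<noteq> 0" "\<rho> p = 0"
    "\<And>x. x \<in> U \<Longrightarrow> x \<in> closure \<Omega> \<Longrightarrow> \<rho> x \<le> 0" by (rule smooth_domainE[OF assms]) blast
  obtain r B where r: "r > 0" "B \<ge> 0" "cball p r \<subseteq> U"
    "\<And>h. norm h \<le> r \<Longrightarrow> \<bar>\<rho> (p + h) - \<rho> p - grad \<rho> p \<bullet> h\<bar> \<le> B * (norm h)\<^sup>2"
    by (rule smooth_taylor2[OF U(3,1,2)]) blast
  let ?n = "grad \<rho> p"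
  have n: "norm ?n > 0" using U(4) by simp
  \<comment> \<open>R \<le> r/2 keeps the ball in the range of the Taylor bound; the second entry
    gives 2 R B < |n| strictly, so that \<open>p\<close> is the only contact point.\<close>
  define R where "R = min (r / 2) (norm ?n / (4 * (B + 1)))"
  have R: "R > 0" "2 * R \<le> r" "2 * R * B < norm ?n"
  proof -
    have "norm ?n / (4 * (B + 1)) > 0" using n r(2) by simp
    then show "R > 0" "2 * R \<le> r" unfolding R_def using r(1) by linarith+
    have "R * (4 * (B + 1)) \<le> norm ?n / (4 * (B + 1)) * (4 * (B + 1))"
      using r(2) by (intro mult_right_mono) (auto simp: R_def)
    also have "\<dots> = norm ?n" using r(2) by simp
    finally have "R * (4 * (B + 1)) \<le> norm ?n" .
    moreover have "R * B \<ge> 0" using r(2) \<open>R > 0\<close> by simp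
    ultimately show "2 * R * B < norm ?n" using \<open>R > 0\<close> by (simp add: algebra_simps)
  qed
  define \<nu> where "\<nu> = ?n /\<^sub>R norm ?n"
  have \<nu>: "norm \<nu> = 1" "?n = norm ?n *\<^sub>R \<nu>" using n by (auto simp: \<nu>_def)
  have "R < norm (x - (p + R *\<^sub>R \<nu>))" if x: "x \<in> closure \<Omega>" "x \<noteq> p" for x
  proof (rule ccontr)
    assume "\<not> ?thesis"
    then have le: "norm (x - (p + R *\<^sub>R \<nu>)) \<le> R" by simp
    define h where "h = x - p"
    have h0: "norm h > 0" using x(2) by (simp add: h_def)
    have le': "norm (h - R *\<^sub>R \<nu>) \<le> R" using le by (simp add: h_def algebra_simps)
    have hr: "norm h \<le> r"
      using norm_triangle_ineq[of "h - R *\<^sub>R \<nu>" "R *\<^sub>R \<nu>"] le' \<nu>(1) R by simp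
    have "(norm (h - R *\<^sub>R \<nu>))\<^sup>2 \<le> R\<^sup>2" using le' by (intro power_mono) auto
    moreover have "(norm (h - R *\<^sub>R \<nu>))\<^sup>2 = (norm h)\<^sup>2 - 2 * R * (h \<bullet> \<nu>) + R\<^sup>2 * (norm \<nu>)\<^sup>2"
      unfolding power2_norm_eq_inner by (simp add: inner_diff inner_commute power2_eq_square algebra_simps)
    ultimately have hn: "(norm h)\<^sup>2 \<le> 2 * R * (h \<bullet> \<nu>)" using \<nu>(1) by simp
    have "?n \<bullet> h = norm ?n * (h \<bullet> \<nu>)" by (subst \<nu>(2)) (simp add: inner_commute)
    moreover have "x \<in> U" using r(3) hr by (auto simp: h_def dist_norm norm_minus_commute)
    then have "\<rho> x \<le> 0" using U(6) x(1) by blast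
    ultimately have "norm ?n * (h \<bullet> \<nu>) \<le> B * (norm h)\<^sup>2"
      using r(4)[OF hr] U(5) by (simp add: h_def)
    then have "norm ?n * (2 * R * (h \<bullet> \<nu>)) \<le> 2 * R * B * (norm h)\<^sup>2"
      using mult_left_mono[of "norm ?n * (h \<bullet> \<nu>)" "B * (norm h)\<^sup>2" "2 * R"] R(1) by (simp add: mult_ac)
    moreover have "norm ?n * (norm h)\<^sup>2 \<le> norm ?n * (2 * R * (h \<bullet> \<nu>))" using hn by (intro mult_left_mono) auto
    moreover have "2 * R * B * (norm h)\<^sup>2 < norm ?n * (norm h)\<^sup>2" using R(3) h0 by (intro mult_strict_right_mono) auto
    ultimately show False by linarith
  qed
  then show ?thesis using that[of R "p + R *\<^sub>R \<nu>"] R(1) \<nu>(1) by simp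
qed

lemma connected_subset_Un_open:
  assumes "connected S" "open A" "open B" "A \<inter> B = {}" "S \<subseteq> A \<union> B" "S \<inter> A \<noteq> {}"
  shows "S \<subseteq> A"
  using assms unfolding connected_def by blast

text \<open>Points of the domain near \<open>p\<close> are joined inside the domain, by segments transversal to the
  boundary, to one fixed small ball.\<close>

lemma boundary_locally_one_side:
  fixes \<Omega> :: "'a::euclidean_space set"
  assumes "smooth_domain \<Omega>" "p \<in> frontier \<Omega>" and W: "open W" "p \<in> W"
    and AB: "open A" "open B" "A \<inter> B = {}" "\<Omega> \<inter> W \<subseteq> A \<union> B"
  shows "\<exists>N. open N \<and> p \<in> N \<and> (\<Omega> \<inter> N \<subseteq> A \<or> \<Omega> \<inter> N \<subseteq> B)"
proof -
  obtain U \<rho> where U: "open U" "p \<in> U" "smooth_on U \<rho>" "grad \<rho> p \<noteq> 0" "\<rho> p = 0"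
    "\<And>x. x \<in> U \<Longrightarrow> x \<in> \<Omega> \<longleftrightarrow> \<rho> x < 0" by (rule smooth_domainE[OF assms(1,2)]) blast
  let ?n = "grad \<rho> p"
  have n: "norm ?n > 0" using U(4) by simp
  \<comment> \<open>Where the gradient still has a positive component along \<open>?n\<close>,
    moving along - \<open>?n\<close> lowers \<rho> and cannot leave the domain.\<close>
  define D where "D = U \<inter> (\<lambda>x. grad \<rho> x \<bullet> ?n) -` {0<..}"
  have "continuous_on U (\<lambda>x. grad \<rho> x \<bullet> ?n)" by (intro continuous_intros smooth_on_continuous_grad U(3))
  then have D: "open D" unfolding D_def by (rule continuous_open_preimage[OF _ U(1)]) simp
  have "p \<in> D \<inter> W" using U(2,4) W(2) by (simp add: D_def)
  then obtain r where r: "r > 0" "ball p (2 * r) \<subseteq> D \<inter> W"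
    using open_contains_ball[of "D \<inter> W"] D W(1) by (metis field_sum_of_halves half_gt_zero mult_2 open_Int)
  \<comment> \<open>All segments are translates of one vector of length r/2, so that starting points
    near \<open>p\<close> have end points near \<open>c\<close>, in a ball inside the
    domain.\<close>
  define T where "T = r / (2 * norm ?n)"
  have T: "T > 0" "norm (T *\<^sub>R ?n) < r" using r n by (auto simp: T_def)
  have inball: "x - t *\<^sub>R ?n \<in> ball p (2 * r)" if "norm (x - p) < r" "0 \<le> t" "t \<le> T" for x t
  proof -
    have "norm (t *\<^sub>R ?n) \<le> norm (T *\<^sub>R ?n)" using that T by (simp add: mult_right_mono)
    then show ?thesis
      using norm_triangle_ineq4[of "x - p" "t *\<^sub>R ?n"] that(1) T(2) by (simp add: dist_norm norm_minus_commute algebra_simps)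
  qed
  have dec: "\<rho> (x - t *\<^sub>R ?n) < \<rho> x" if x: "norm (x - p) < r" "0 < t" "t \<le> T" for x t
  proof -
    have "\<rho> (x - t *\<^sub>R ?n) < \<rho> (x - 0 *\<^sub>R ?n)"
    proof (rule DERIV_neg_imp_decreasing[OF x(2)])
      fix s assume s: "0 \<le> s" "s \<le> t"
      then have m: "x - s *\<^sub>R ?n \<in> D" using inball[OF x(1), of s] x(3) r(2) by auto
      then have mU: "x - s *\<^sub>R ?n \<in> U" by (simp add: D_def)
      have "((\<lambda>s. \<rho> (x - s *\<^sub>R ?n)) has_derivative (\<lambda>d. grad \<rho> (x - s *\<^sub>R ?n) \<bullet> (- (d *\<^sub>R ?n)))) (at s)"
        by (rule has_derivative_compose[where f="\<lambda>s. x - s *\<^sub>R ?n" and g=\<rho>, OF _ smooth_on_has_derivative_grad[OF U(3) mU]])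
          (auto intro!: derivative_eq_intros)
      then have "((\<lambda>s. \<rho> (x - s *\<^sub>R ?n)) has_real_derivative - (grad \<rho> (x - s *\<^sub>R ?n) \<bullet> ?n)) (at s)"
        unfolding has_field_derivative_def by (rule has_derivative_eq_rhs) (auto simp: mult.commute)
      then show "\<exists>y. ((\<lambda>s. \<rho> (x - s *\<^sub>R ?n)) has_real_derivative y) (at s) \<and> y < 0"
        using m by (intro exI[of _ "- (grad \<rho> (x - s *\<^sub>R ?n) \<bullet> ?n)"]) (simp add: D_def)
    qed
    then show ?thesis by simp
  qed
  define c where "c = p - T *\<^sub>R ?n"
  have cin: "c \<in> ball p (2 * r)" unfolding c_def using inball[of p T] r(1) T(1) by simp
  have "c \<in> U" using cin r(2) by (auto simp: D_def)
  moreover have "\<rho> c < 0" using dec[of p T] r(1) T(1) U(5) by (simp add: c_def)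
  ultimately have "c \<in> \<Omega>" using U(6) by blast
  then have "c \<in> \<Omega> \<inter> ball p (2 * r)" using cin by blast
  moreover have "open (\<Omega> \<inter> ball p (2 * r))" using assms(1) by (auto simp: smooth_domain_def)
  ultimately obtain e where e: "e > 0" "ball c e \<subseteq> \<Omega> \<inter> ball p (2 * r)" using open_contains_ball by blast
  define N where "N = ball p (min e r)"
  have seg: "closed_segment x (x - T *\<^sub>R ?n) \<subseteq> \<Omega> \<inter> W" if x: "x \<in> \<Omega> \<inter> N" for x
  proof
    fix y assume "y \<in> closed_segment x (x - T *\<^sub>R ?n)"
    then obtain s where s: "0 \<le> s" "s \<le> 1" "y = (1 - s) *\<^sub>R x + s *\<^sub>R (x - T *\<^sub>R ?n)" by (auto simp: in_segment)
    have y: "y = x - (s * T) *\<^sub>R ?n" using s(3) by (simp add: algebra_simps)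
    have xr: "norm (x - p) < r" using x by (auto simp: N_def dist_norm norm_minus_commute)
    have sT: "0 \<le> s * T" "s * T \<le> T" using s T(1) mult_right_mono[of s 1 T] by auto
    have yb: "y \<in> ball p (2 * r)" unfolding y by (rule inball[OF xr sT])
    have "x \<in> U" using r inball[OF xr, of 0] T(1) by (auto simp: D_def)
    then have "\<rho> x < 0" using U(6) x by blast
    moreover have "\<rho> y \<le> \<rho> x" using dec[OF xr, of "s * T"] sT y by (cases "s * T = 0") auto
    ultimately have "y \<in> \<Omega>" using U(6)[of y] yb r(2) by (auto simp: D_def)
    then show "y \<in> \<Omega> \<inter> W" using yb r(2) by blast
  qed
  have endp: "x - T *\<^sub>R ?n \<in> ball c e" if "x \<in> N" for x
    using that by (simp add: N_def c_def dist_norm)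
  have bc: "ball c e \<subseteq> A \<union> B" using e(2) r(2) AB(4) by blast
  have side: "\<Omega> \<inter> N \<subseteq> X" if "open X" "open Y" "X \<inter> Y = {}" "\<Omega> \<inter> W \<subseteq> X \<union> Y" "ball c e \<subseteq> X" for X Y
  proof
    fix x assume x: "x \<in> \<Omega> \<inter> N"
    have "closed_segment x (x - T *\<^sub>R ?n) \<subseteq> X"
    proof (rule connected_subset_Un_open[OF _ that(1,2,3)])
      show "closed_segment x (x - T *\<^sub>R ?n) \<subseteq> X \<union> Y" using seg[OF x] that(4) by blast
      have "x - T *\<^sub>R ?n \<in> X" using endp[of x] x that(5) by blast
      then show "closed_segment x (x - T *\<^sub>R ?n) \<inter> X \<noteq> {}" using ends_in_segment(2) by blast
    qed simp
    then show "x \<in> X" by auto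
  qed
  have "open N" "p \<in> N" using e(1) r(1) by (auto simp: N_def)
  moreover have "\<Omega> \<inter> N \<subseteq> A \<or> \<Omega> \<inter> N \<subseteq> B"
  proof (cases "ball c e \<inter> A = {}")
    case True
    then have "ball c e \<subseteq> B" using bc by blast
    then show ?thesis using side[of B A] AB by (simp add: Int_commute Un_commute)
  next
    case False
    then have "ball c e \<subseteq> A" using connected_subset_Un_open[OF connected_ball AB(1,2,3) bc] by blast
    then show ?thesis using side[of A B] AB by blast
  qed
  ultimately show ?thesis by blast
qed

text \<open>A nonempty open set is not negligible. Through this, almost everywhere facts reach the
  continuous representatives.\<close>

lemma continuous_AE_nonneg:
  fixes f :: "'a::euclidean_space \<Rightarrow> real"
  assumes "open \<Omega>" "continuous_on \<Omega> f" "AE x in lebesgue_on \<Omega>. f x \<ge> 0" "x \<in> \<Omega>"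
  shows "f x \<ge> 0"
proof (rule ccontr)
  assume neg: "\<not> ?thesis"
  let ?S = "\<Omega> \<inter> f -` {..<0}"
  have S: "open ?S" using continuous_open_preimage[OF assms(2,1)] by simp
  have "AE x in lebesgue. x \<in> \<Omega> \<longrightarrow> f x \<ge> 0" using assms(1,3) by (simp add: AE_restrict_space_iff)
  then have "AE x in lebesgue. x \<notin> ?S" by eventually_elim auto
  then have "?S \<in> null_sets lebesgue" using S by (simp add: AE_iff_null_sets)
  then have "negligible ?S" by (simp add: negligible_iff_null_sets)
  moreover have "x \<in> ?S" using neg assms(4) by simp
  ultimately show False using open_not_negligible[OF S] by blast
qed

lemma L2_tendsto_integral_inner:
  assumes "\<And>n. sq_int M (gn n)" "sq_int M g" "sq_int M w" "(\<lambda>n. LINT x|M. (norm (gn n x - g x))\<^sup>2) \<longlonglongrightarrow> 0"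
  shows "(\<lambda>n. LINT x|M. w x \<bullet> gn n x) \<longlonglongrightarrow> (LINT x|M. w x \<bullet> g x)"
proof -
  let ?W = "LINT x|M. (norm (w x))\<^sup>2"
  have d: "sq_int M (\<lambda>x. gn n x - g x)" for n using sq_int_diff assms by blast
  have "(\<lambda>n. sqrt (?W * (LINT x|M. (norm (gn n x - g x))\<^sup>2))) \<longlonglongrightarrow> sqrt (?W * 0)"
    by (intro tendsto_intros assms)
  then have s: "(\<lambda>n. sqrt (?W * (LINT x|M. (norm (gn n x - g x))\<^sup>2))) \<longlonglongrightarrow> 0" by simp
  have "(\<lambda>n. LINT x|M. w x \<bullet> (gn n x - g x)) \<longlonglongrightarrow> 0"
  proof (rule Lim_null_comparison[OF _ s], intro always_eventually allI)
    fix n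
    have "\<bar>LINT x|M. w x \<bullet> (gn n x - g x)\<bar> \<le> (LINT x|M. norm (w x) * norm (gn n x - g x))"
      by (rule abs_integral_le[OF sq_int_mult_integrable[OF sq_int_norm[OF assms(3)] sq_int_norm[OF d]]])
        (rule Cauchy_Schwarz_ineq2)
    also have "\<dots> \<le> sqrt (?W * (LINT x|M. (norm (gn n x - g x))\<^sup>2))"
      using integral_Cauchy_Schwarz[OF sq_int_norm[OF assms(3)] sq_int_norm[OF d]] by (rule real_le_rsqrt)
    finally show "norm (LINT x|M. w x \<bullet> (gn n x - g x)) \<le> sqrt (?W * (LINT x|M. (norm (gn n x - g x))\<^sup>2))" by simp
  qed
  moreover have "(LINT x|M. w x \<bullet> (gn n x - g x)) = (LINT x|M. w x \<bullet> gn n x) - (LINT x|M. w x \<bullet> g x)" for n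
    using sq_int_inner_integrable[OF assms(3,1)] sq_int_inner_integrable[OF assms(3,2)] by (simp add: inner_diff_right)
  ultimately show ?thesis by (simp add: LIM_zero_iff)
qed

text \<open>No boundary term arises, as \<open>v\<close> is an H1 limit of test functions;
  smoothness up to the boundary is only asked of \<open>f\<close>.\<close>

lemma H10_green:
  assumes \<Omega>: "bounded \<Omega>" "open \<Omega>" and f: "smooth_on UNIV f" and v: "v \<in> H10 \<Omega>" "wgrad \<Omega> v h"
  shows "(LINT x|lebesgue_on \<Omega>. grad f x \<bullet> h x) = - (LINT x|lebesgue_on \<Omega>. laplacian f x * v x)"
proof -
  obtain h' \<psi> where \<psi>: "\<And>n. test_function \<Omega> (\<psi> n)" "H1_tendsto \<Omega> \<psi> (\<lambda>n. grad (\<psi> n)) v h'"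
    using v(1) unfolding H10_iff[OF \<Omega>(2)] by blast
  have t: "H1_tendsto \<Omega> \<psi> (\<lambda>n. grad (\<psi> n)) v h" by (rule H1_tendsto_cong_limit[OF \<Omega>(2) \<psi>(2) v(2)]) simp
  note t' = t[unfolded H1_tendsto_def]
  note s = test_function_sq_int[OF \<psi>(1) \<Omega>(2)]
  have sl: "sq_int (lebesgue_on \<Omega>) (laplacian f)" and sg: "sq_int (lebesgue_on \<Omega>) (grad f)"
    by (intro continuous_bounded_sq_int \<Omega> smooth_on_imp_continuous_on smooth_on_laplacian smooth_on_continuous_grad f; simp)+
  have "(\<lambda>n. LINT x|lebesgue_on \<Omega>. grad f x \<bullet> grad (\<psi> n) x) \<longlonglongrightarrow> (LINT x|lebesgue_on \<Omega>. grad f x \<bullet> h x)"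
    using t' by (intro L2_tendsto_integral_inner s(2) wgradD(2)[OF v(2)] sg) auto
  moreover have "(\<lambda>n. LINT x|lebesgue_on \<Omega>. \<psi> n x * laplacian f x) \<longlonglongrightarrow> (LINT x|lebesgue_on \<Omega>. v x * laplacian f x)"
    using t' by (intro L2_tendsto_integral_mult s(1) wgradD(1)[OF v(2)] sl) auto
  then have "(\<lambda>n. - (LINT x|lebesgue_on \<Omega>. laplacian f x * \<psi> n x)) \<longlonglongrightarrow> - (LINT x|lebesgue_on \<Omega>. laplacian f x * v x)"
    by (intro tendsto_minus) (simp add: mult.commute)
  ultimately show ?thesis using smooth_green[OF \<Omega> f \<psi>(1)] LIMSEQ_unique by simp
qed

lemma H1_sum:
  "open \<Omega> \<Longrightarrow> (\<And>i. i \<in> I \<Longrightarrow> u i \<in> H1 \<Omega>) \<Longrightarrow> (\<lambda>x. \<Sum>i\<in>I. u i x) \<in> H1 \<Omega>"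
proof -
  assume "open \<Omega>" "\<And>i. i \<in> I \<Longrightarrow> u i \<in> H1 \<Omega>"
  then have "wgrad \<Omega> (\<lambda>x. \<Sum>i\<in>I. u i x) (\<lambda>x. \<Sum>i\<in>I. weak_grad \<Omega> (u i) x)"
    by (intro wgrad_sum wgrad_weak_grad)
  then show ?thesis by (rule wgrad_in_H1)
qed

lemma H10_sum:
  "open \<Omega> \<Longrightarrow> (\<And>i. i \<in> I \<Longrightarrow> u i \<in> H10 \<Omega>) \<Longrightarrow> (\<lambda>x. \<Sum>i\<in>I. u i x) \<in> H10 \<Omega>"
  by (induction I rule: infinite_finite_induct) (auto intro: H10_0 H10_add)

lemma H1_cmult: "u \<in> H1 \<Omega> \<Longrightarrow> (\<lambda>x. c * u x) \<in> H1 \<Omega>"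
  using wgrad_cmult unfolding H1_iff_wgrad by blast

context segregated_minimizer
begin

text \<open>The Gaussian of an exterior ball gives a subsolution below the boundary values of
  \<open>2 u\<^sub>i - U\<close> that is positive at \<open>p\<close>.\<close>

lemma boundary_positive:
  assumes i: "i \<in> {1..k}" and cont: "\<And>j. j \<in> {1..k} \<Longrightarrow> continuous_on \<Omega> (u j)"
    and p: "p \<in> frontier \<Omega>" "\<phi> i p > 0" "\<And>j. j \<in> {1..k} \<Longrightarrow> j \<noteq> i \<Longrightarrow> \<phi> j p = 0"
    and R: "R > 0" "norm (p - q) = R" "\<And>x. x \<in> closure \<Omega> \<Longrightarrow> x \<noteq> p \<Longrightarrow> R < norm (x - q)"
  shows "\<exists>N. open N \<and> p \<in> N \<and> (\<forall>x\<in>\<Omega> \<inter> N. u i x > 0)"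
proof -
  have "\<exists>\<Phi>. \<Phi> \<in> H1 \<Omega> \<and> continuous_on (closure \<Omega>) \<Phi> \<and> (\<forall>x\<in>frontier \<Omega>. \<Phi> x = \<phi> j x) \<and>
      (\<lambda>x. u j x - \<Phi> x) \<in> H10 \<Omega>" if "j \<in> {1..k}" for j
    using has_trace[OF that] by (auto simp: has_trace_def)
  then obtain \<Phi> where \<Phi>: "\<And>j. j \<in> {1..k} \<Longrightarrow> \<Phi> j \<in> H1 \<Omega>" "\<And>j. j \<in> {1..k} \<Longrightarrow> continuous_on (closure \<Omega>) (\<Phi> j)"
    "\<And>j x. j \<in> {1..k} \<Longrightarrow> x \<in> frontier \<Omega> \<Longrightarrow> \<Phi> j x = \<phi> j x" "\<And>j. j \<in> {1..k} \<Longrightarrow> (\<lambda>x. u j x - \<Phi> j x) \<in> H10 \<Omega>"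
    by metis
  let ?f = "\<lambda>x. 2 * u i x - (\<Sum>j=1..k. u j x)" and ?F = "\<lambda>x. 2 *\<^sub>R G i x - (\<Sum>j=1..k. G j x)"
  \<comment> \<open>A continuous function with the trace of \<open>?f\<close>. At \<open>p\<close>
    the data of the other phases vanish, so its value there is \<open>\<phi> i p\<close>, above the
    level \<delta> near \<open>p\<close>.\<close>
  define \<Psi> where "\<Psi> x = 2 * \<Phi> i x - (\<Sum>j=1..k. \<Phi> j x)" for x
  have c\<Psi>: "continuous_on (closure \<Omega>) \<Psi>" unfolding \<Psi>_def[abs_def] using i by (intro continuous_intros \<Phi>(2)) auto
  have H\<Psi>: "\<Psi> \<in> H1 \<Omega>" unfolding \<Psi>_def[abs_def] using i by (intro H1_diff H1_cmult H1_sum open_dom \<Phi>(1)) auto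
  have "(\<lambda>x. 2 * (u i x - \<Phi> i x) - (\<Sum>j=1..k. u j x - \<Phi> j x)) \<in> H10 \<Omega>"
    using i by (intro H10_diff H10_cmult H10_sum open_dom \<Phi>(4)) auto
  then have h1: "(\<lambda>x. -1 * (2 * (u i x - \<Phi> i x) - (\<Sum>j=1..k. u j x - \<Phi> j x))) \<in> H10 \<Omega>" by (rule H10_cmult[OF open_dom])
  have h: "(\<lambda>x. \<Psi> x - ?f x) \<in> H10 \<Omega>"
    by (rule back_subst[where P="\<lambda>h. h \<in> H10 \<Omega>", OF h1]) (auto simp: \<Psi>_def sum_subtractf algebra_simps)
  have pc: "p \<in> closure \<Omega>" using p(1) by (simp add: frontier_def)
  have \<Psi>p: "\<Psi> p = \<phi> i p"
  proof -
    have "(\<Sum>j=1..k. \<Phi> j p) = \<Phi> i p"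
      using i p(3) \<Phi>(3)[OF _ p(1)] by (subst sum.remove[of _ i]) (auto intro!: sum.neutral)
    then show ?thesis using \<Phi>(3)[OF i p(1)] by (simp add: \<Psi>_def)
  qed
  define \<delta> where "\<delta> = \<phi> i p / 2"
  have \<delta>: "\<delta> > 0" using p(2) by (simp add: \<delta>_def)
  obtain r where r: "r > 0" "\<And>x. x \<in> closure \<Omega> \<Longrightarrow> dist x p < r \<Longrightarrow> \<Psi> x > \<delta>"
  proof -
    obtain r where r: "r > 0" "\<forall>x\<in>closure \<Omega>. dist x p < r \<longrightarrow> dist (\<Psi> x) (\<Psi> p) < \<delta>"
      using c\<Psi> pc \<delta> unfolding continuous_on_iff by blast
    have "\<Psi> x > \<delta>" if "x \<in> closure \<Omega>" "dist x p < r" for x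
    proof -
      have "\<bar>\<Psi> x - \<Psi> p\<bar> < \<delta>" using r(2) that by (simp add: dist_real_def)
      then show ?thesis using \<Psi>p unfolding \<delta>_def by linarith
    qed
    then show ?thesis using that[of r] r(1) by simp
  qed
  define \<alpha> where "\<alpha> = DIM('a) / R\<^sup>2"
  have \<alpha>: "\<alpha> > 0" using R(1) by (simp add: \<alpha>_def)
  let ?E = "exp (- \<alpha> * R\<^sup>2)"
  have cg: "continuous_on T (gaussian \<alpha> q)" for T
    using smooth_on_imp_continuous_on[OF smooth_on_gaussian] continuous_on_subset by blast
  have Rle: "R \<le> norm (x - q)" if "x \<in> closure \<Omega>" for x
    using R(2) R(3)[OF that] by (cases "x = p") auto
  have gE: "gaussian \<alpha> q x \<le> ?E" if "x \<in> closure \<Omega>" for x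
    using Rle[OF that] R(1) \<alpha> by (simp add: gaussian_def power_mono)
  define Z where "Z = frontier \<Omega> - ball p r"
  have Z: "compact Z" unfolding Z_def by (intro compact_diff compact_frontier_bounded bounded_dom) auto
  have Zc: "Z \<subseteq> closure \<Omega>" by (auto simp: Z_def frontier_def)
  obtain m where m: "m > 0" "\<And>x. x \<in> Z \<Longrightarrow> m \<le> ?E - gaussian \<alpha> q x"
  proof (cases "Z = {}")
    case True
    then show ?thesis using that[of 1] by simp
  next
    case False
    have "continuous_on Z (\<lambda>x. ?E - gaussian \<alpha> q x)" by (intro continuous_intros cg)
    from continuous_attains_inf[OF Z False this] obtain z where z: "z \<in> Z"
      "\<And>y. y \<in> Z \<Longrightarrow> ?E - gaussian \<alpha> q z \<le> ?E - gaussian \<alpha> q y" by blast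
    have "z \<noteq> p" using z(1) r(1) by (auto simp: Z_def)
    then have "R < norm (z - q)" using R(3)[of z] z(1) Zc by blast
    then have "R\<^sup>2 < (norm (z - q))\<^sup>2" using R(1) by (intro power_strict_mono) auto
    then have "?E - gaussian \<alpha> q z > 0" using \<alpha> by (simp add: gaussian_def)
    then show ?thesis using that z(2) by blast
  qed
  have "compact (closure \<Omega>)" using bounded_dom by simp
  obtain S where S: "S > 0" "\<And>x. x \<in> closure \<Omega> \<Longrightarrow> \<bar>\<Psi> x\<bar> \<le> S"
    using compact_imp_bounded[OF compact_continuous_image[OF c\<Psi> \<open>compact (closure \<Omega>)\<close>]] unfolding bounded_pos by auto
  obtain s where s: "s > 0" "\<And>x. x \<in> closure \<Omega> \<Longrightarrow> s \<le> gaussian \<alpha> q x"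
  proof -
    have "closure \<Omega> \<noteq> {}" using pc by auto
    from continuous_attains_inf[OF \<open>compact (closure \<Omega>)\<close> this cg[where T="closure \<Omega>"]]
    obtain z where "\<forall>y\<in>closure \<Omega>. gaussian \<alpha> q z \<le> gaussian \<alpha> q y" by blast
    moreover have "gaussian \<alpha> q z > 0" by (simp add: gaussian_def)
    ultimately show ?thesis using that by blast
  qed
  define l where "l = 2 * (real DIM('a))\<^sup>2 / R\<^sup>2 * s"
  have l: "l > 0" using R(1) s(1) by (simp add: l_def)
  \<comment> \<open>The first summand pushes the barrier below the least value of \<Psi> on the
    frontier away from \<open>p\<close>, the second makes its Laplacian at least \<mu> + 1.\<close>
  define A where "A = (\<delta> + S) / m + (\<mu> + 1) / l"
  have A: "A > 0" "A * m \<ge> \<delta> + S" "A * l \<ge> \<mu> + 1"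
  proof -
    have p1: "(\<delta> + S) / m > 0" and p2: "(\<mu> + 1) / l > 0" using \<delta> S m(1) l lam_pos by auto
    then show "A > 0" by (simp add: A_def)
    have "A * m \<ge> (\<delta> + S) / m * m" using p2 m(1) unfolding A_def by (intro mult_right_mono) auto
    then show "A * m \<ge> \<delta> + S" using m(1) by simp
    have "A * l \<ge> (\<mu> + 1) / l * l" using p1 l unfolding A_def by (intro mult_right_mono) auto
    then show "A * l \<ge> \<mu> + 1" using l by simp
  qed
  \<comment> \<open>Normalized to equal \<delta> at \<open>p\<close>; on the closure it is at most
    \<delta>, because the Gaussian is largest at the contact point of the exterior ball.\<close>
  define b where "b x = A * gaussian \<alpha> q x + (\<delta> - A * ?E)" for x
  have bs: "smooth_on UNIV b" unfolding b_def[abs_def] by (rule smooth_on_gaussian_affine)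
  have cb: "continuous_on T b" for T using smooth_on_imp_continuous_on[OF bs] continuous_on_subset by blast
  have wb: "wgrad \<Omega> b (grad b)" by (rule smooth_bounded_wgrad[OF bounded_dom open_dom bs])
  have lap: "\<mu> + 1 \<le> laplacian b x" if "x \<in> closure \<Omega>" for x
  proof -
    have g: "2 * (real DIM('a))\<^sup>2 / R\<^sup>2 \<le> 4 * \<alpha>\<^sup>2 * (norm (x - q))\<^sup>2 - 2 * \<alpha> * DIM('a)"
      by (rule gaussian_subharmonic[OF R(1) \<alpha>_def Rle[OF that]])
    have "0 \<le> 2 * (real DIM('a))\<^sup>2 / R\<^sup>2" by simp
    then have "0 \<le> 4 * \<alpha>\<^sup>2 * (norm (x - q))\<^sup>2 - 2 * \<alpha> * DIM('a)" using g by (rule order_trans)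
    from mult_mono[OF g s(2)[OF that] this less_imp_le[OF s(1)]]
    have "l \<le> (4 * \<alpha>\<^sup>2 * (norm (x - q))\<^sup>2 - 2 * \<alpha> * DIM('a)) * gaussian \<alpha> q x" by (simp only: l_def)
    from mult_left_mono[OF this less_imp_le[OF A(1)]] A(3)
    show ?thesis unfolding b_def[abs_def] laplacian_gaussian by (simp add: mult.assoc)
  qed
  let ?v = "\<lambda>x. max (b x - ?f x) 0" and ?g = "\<lambda>x. if b x - ?f x > 0 then grad b x - ?F x else 0"
  have wv: "wgrad \<Omega> ?v ?g" by (rule wgrad_pos[OF open_dom wgrad_diff[OF open_dom wb wgrad_hat[OF i]]])
  have v: "?v \<in> H10 \<Omega>"
  proof (rule H10_dominated[OF open_dom bounded_dom _ _ h])
    show "(\<lambda>x. b x - \<Psi> x) \<in> H1 \<Omega>" by (rule H1_diff[OF open_dom wgrad_in_H1[OF wb] H\<Psi>])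
    show "continuous_on (closure \<Omega>) (\<lambda>x. b x - \<Psi> x)" by (intro continuous_intros cb c\<Psi>)
    show "?v \<in> H1 \<Omega>" by (rule wgrad_in_H1[OF wv])
    show "AE x in M. 0 \<le> ?v x \<and> ?v x \<le> max (b x - \<Psi> x + (\<Psi> x - ?f x)) 0" by simp
    fix z assume z: "z \<in> frontier \<Omega>"
    then have zc: "z \<in> closure \<Omega>" by (simp add: frontier_def)
    have "b z \<le> \<Psi> z"
    proof (cases "z \<in> Z")
      case True
      have "A * (?E - gaussian \<alpha> q z) \<ge> A * m" using m(2)[OF True] A(1) by (intro mult_left_mono) auto
      then show ?thesis using A(2) S(2)[OF zc] by (simp add: b_def algebra_simps abs_le_iff)
    next
      case False
      then have "\<Psi> z > \<delta>" using r(2)[OF zc] z by (auto simp: Z_def dist_commute)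
      moreover have "A * gaussian \<alpha> q z \<le> A * ?E" using gE[OF zc] A(1) by (intro mult_left_mono) auto
      ultimately show ?thesis by (simp add: b_def)
    qed
    then show "b z - \<Psi> z \<le> 0 \<or> (\<exists>U. open U \<and> z \<in> U \<and> (AE x in M. x \<in> U \<longrightarrow> ?v x = 0))" by simp
  qed
  have fin: "finite_measure M" by (rule bounded_open_finite_measure[OF open_dom bounded_dom])
  have vi: "integrable M ?v" by (rule sq_int_integrable[OF fin wgradD(1)[OF wv]])
  \<comment> \<open>The excess of the barrier over \<open>?f\<close> is a legitimate test function
    whatever the sign of \<open>?f\<close>, hence \<sigma> = -1.\<close>
  have 1: "- 1 * \<mu> * (LINT x|M. ?v x) \<le> (LINT x|M. ?F x \<bullet> ?g x)"
    by (rule hat_supersolution[OF i v wv]) auto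
  have 2: "(LINT x|M. grad b x \<bullet> ?g x) = - (LINT x|M. laplacian b x * ?v x)"
    by (rule H10_green[OF bounded_dom open_dom bs v wv])
  have sl: "sq_int M (laplacian b)"
    by (intro continuous_bounded_sq_int bounded_dom open_dom smooth_on_imp_continuous_on smooth_on_laplacian bs) simp
  have 3: "(\<mu> + 1) * (LINT x|M. ?v x) \<le> (LINT x|M. laplacian b x * ?v x)"
  proof -
    have "(\<mu> + 1) * (LINT x|M. ?v x) = (LINT x|M. (\<mu> + 1) * ?v x)" by simp
    also have "\<dots> \<le> (LINT x|M. laplacian b x * ?v x)"
    proof (rule integral_mono)
      show "integrable M (\<lambda>x. laplacian b x * ?v x)" by (rule sq_int_mult_integrable[OF sl wgradD(1)[OF wv]])
      show "integrable M (\<lambda>x. (\<mu> + 1) * ?v x)" using vi by simp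
      fix x assume "x \<in> space M"
      then have "x \<in> closure \<Omega>" using closure_subset by auto
      then show "(\<mu> + 1) * ?v x \<le> laplacian b x * ?v x" by (intro mult_right_mono lap) auto
    qed
    finally show ?thesis .
  qed
  \<comment> \<open>The integral is that of |grad v|^2. The margin 1 in \<mu> + 1 leaves minus the
    integral of \<open>?v\<close> on the right, so \<open>?v\<close> vanishes without recourse to a
    Poincare inequality.\<close>
  have "0 \<le> (LINT x|M. grad b x \<bullet> ?g x - ?F x \<bullet> ?g x)"
    by (rule Bochner_Integration.integral_nonneg) (auto simp: inner_diff_left[symmetric])
  also have "\<dots> = (LINT x|M. grad b x \<bullet> ?g x) - (LINT x|M. ?F x \<bullet> ?g x)"
    by (rule Bochner_Integration.integral_diff)
      (intro sq_int_inner_integrable wgradD(2)[OF wb] wgradD(2)[OF wv] wgradD(2)[OF wgrad_hat[OF i]])+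
  also have "\<dots> \<le> - (LINT x|M. ?v x)" using 1 2 3 by (simp add: algebra_simps)
  finally have "(LINT x|M. ?v x) \<le> 0" by simp
  then have "(LINT x|M. ?v x) = 0" by (intro antisym Bochner_Integration.integral_nonneg) auto
  then have "AE x in M. ?v x = 0" using vi by (subst (asm) integral_nonneg_eq_0_iff_AE) auto
  then have ae: "AE x in M. ?f x - b x \<ge> 0" by eventually_elim (auto simp: max_def split: if_splits)
  have fb: "?f x - b x \<ge> 0" if "x \<in> \<Omega>" for x
    using cont i by (intro continuous_AE_nonneg[OF open_dom _ ae that] continuous_intros cb) auto
  have un: "u j x \<ge> 0" if "j \<in> {1..k}" "x \<in> \<Omega>" for j x
    by (rule continuous_AE_nonneg[OF open_dom cont[OF that(1)] nonneg_AE[OF that(1)] that(2)])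
  have "b p = \<delta>" using R(2) by (simp add: b_def gaussian_def)
  then have "p \<in> b -` {0<..}" using \<delta> by simp
  moreover have "open (b -` {0<..})" by (rule open_vimage[OF _ cb]) simp
  \<comment> \<open>As \<open>?f\<close> never exceeds \<open>u i\<close>, positivity of the barrier
    passes to phase \<open>i\<close> itself.\<close>
  moreover have "u i x > 0" if "x \<in> \<Omega> \<inter> b -` {0<..}" for x
  proof -
    have "u i x \<le> (\<Sum>j=1..k. u j x)" using i un that by (intro member_le_sum) auto
    then show ?thesis using fb[of x] that by auto
  qed
  ultimately show ?thesis by blast
qed

end

section \<open>Splitting off a component\<close>

lemma has_trace_add:
  assumes "open \<Omega>" "has_trace \<Omega> u \<phi>" "has_trace \<Omega> v \<eta>"
  shows "has_trace \<Omega> (\<lambda>x. u x + v x) (\<lambda>x. \<phi> x + \<eta> x)"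
proof -
  have add: "(\<lambda>x. f x + g x) \<in> H1 \<Omega>" if "f \<in> H1 \<Omega>" "g \<in> H1 \<Omega>" for f g
    using wgrad_in_H1[OF wgrad_add[OF assms(1) wgrad_weak_grad[OF that(1)] wgrad_weak_grad[OF that(2)]]] .
  obtain \<Phi> where \<Phi>: "\<Phi> \<in> H1 \<Omega>" "continuous_on (closure \<Omega>) \<Phi>" "\<forall>x\<in>frontier \<Omega>. \<Phi> x = \<phi> x"
    "(\<lambda>x. u x - \<Phi> x) \<in> H10 \<Omega>" using assms(2) by (auto simp: has_trace_def)
  obtain \<Psi> where \<Psi>: "\<Psi> \<in> H1 \<Omega>" "continuous_on (closure \<Omega>) \<Psi>" "\<forall>x\<in>frontier \<Omega>. \<Psi> x = \<eta> x"
    "(\<lambda>x. v x - \<Psi> x) \<in> H10 \<Omega>" using assms(3) by (auto simp: has_trace_def)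
  have "(\<lambda>x. (u x + v x) - (\<Phi> x + \<Psi> x)) \<in> H10 \<Omega>"
    using H10_add[OF assms(1) \<Phi>(4) \<Psi>(4)] by (simp add: algebra_simps)
  moreover have "(\<lambda>x. u x + v x) \<in> H1 \<Omega>" using assms(2,3) add by (simp add: has_trace_def)
  ultimately show ?thesis unfolding has_trace_def
    using add[OF \<Phi>(1) \<Psi>(1)] continuous_on_add[OF \<Phi>(2) \<Psi>(2)] \<Phi>(3) \<Psi>(3)
    by (intro conjI exI[of _ "\<lambda>x. \<Phi> x + \<Psi> x"]) auto
qed

lemma energy_cong:
  assumes "\<And>i. i \<in> {1..k} \<Longrightarrow> u i = v i" "\<And>i. i \<in> {1..k} \<Longrightarrow> lam i = lam' i"
  shows "energy \<Omega> k lam u = energy \<Omega> k lam' v"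
  unfolding energy_def using assms by (intro sum.cong) auto

lemma sum_merge:
  assumes "finite J" "j \<in> J"
  shows "(\<Sum>l\<in>J. (v(j := \<lambda>x. v j x + w x)) l y) = (\<Sum>l\<in>J. v l y) + (w y :: 'b::comm_monoid_add)"
proof -
  have "(\<Sum>l\<in>J. (v(j := \<lambda>x. v j x + w x)) l y) = (\<Sum>l\<in>J. v l y + (if j = l then w y else 0))"
    by (intro sum.cong) auto
  also have "\<dots> = (\<Sum>l\<in>J. v l y) + w y" using assms by (simp add: sum.distrib)
  finally show ?thesis .
qed

text \<open>Almost everywhere at most one of the two merged phases, hence at most one of their
  gradients, is nonzero, so the squared gradients add. The linear terms add because both phases
  carry the same multiplier \<mu>.\<close>

lemma admissible_merge:
  assumes \<Omega>: "open \<Omega>" "bounded \<Omega>" and j: "j \<in> {1..k}"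
    and adm: "admissible \<Omega> (Suc k) (\<phi>(Suc k := \<lambda>x. 0)) v"
  defines "v' \<equiv> v(j := \<lambda>x. v j x + v (Suc k) x)"
  shows "admissible \<Omega> k \<phi> v'" "energy \<Omega> k (\<lambda>i. \<mu>) v' = energy \<Omega> (Suc k) (\<lambda>i. \<mu>) v"
proof -
  have tr: "has_trace \<Omega> (v i) (\<phi> i)" if "i \<in> {1..k}" for i
    using adm that by (auto simp: admissible_def dest!: bspec[of _ _ i])
  have tr0: "has_trace \<Omega> (v (Suc k)) (\<lambda>x. 0)" using adm by (auto simp: admissible_def dest!: bspec[of _ _ "Suc k"])
  have seg: "AE x in lebesgue_on \<Omega>. v i x * v l x = 0" if "i \<in> {1..Suc k}" "l \<in> {1..Suc k}" "i \<noteq> l" for i l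
    using adm that by (auto simp: admissible_def)
  have "has_trace \<Omega> (v' i) (\<phi> i)" if "i \<in> {1..k}" for i
    using has_trace_add[OF \<Omega>(1) tr[OF that] tr0] tr[OF that] by (cases "i = j") (auto simp: v'_def)
  moreover have "AE x in lebesgue_on \<Omega>. v' i x * v' l x = 0" if il: "i \<in> {1..k}" "l \<in> {1..k}" "i \<noteq> l" for i l
  proof -
    have 1: "AE x in lebesgue_on \<Omega>. v i x * v l x = 0" using il by (intro seg) auto
    have 2: "AE x in lebesgue_on \<Omega>. v i x * v (Suc k) x = 0" using il by (intro seg) auto
    have 3: "AE x in lebesgue_on \<Omega>. v l x * v (Suc k) x = 0" using il by (intro seg) auto
    from 1 2 3 show ?thesis by eventually_elim (use il(3) in \<open>auto simp: v'_def\<close>)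
  qed
  ultimately show "admissible \<Omega> k \<phi> v'" by (auto simp: admissible_def)
  define H where "H i = weak_grad \<Omega> (v i)" for i
  have wH: "wgrad \<Omega> (v i) (H i)" if "i \<in> {1..Suc k}" for i
  proof -
    have "v i \<in> H1 \<Omega>" using tr[of i] tr0 that by (cases "i = Suc k") (auto simp: has_trace_def)
    then show ?thesis unfolding H_def by (rule wgrad_weak_grad)
  qed
  define H' where "H' = H(j := \<lambda>x. H j x + H (Suc k) x)"
  have wH': "wgrad \<Omega> (v' i) (H' i)" if "i \<in> {1..k}" for i
    using wgrad_add[OF \<Omega>(1) wH[of j] wH[of "Suc k"]] wH[of i] that j by (auto simp: v'_def H'_def)
  note E = energy_eq[OF \<Omega>, of k v' H' "\<lambda>i. \<mu>" \<mu>, OF wH' refl] energy_eq[OF \<Omega>, of "Suc k" v H "\<lambda>i. \<mu>" \<mu>, OF wH refl]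
  have "AE x in lebesgue_on \<Omega>. v j x * v (Suc k) x = 0" using j by (intro seg) auto
  moreover have "AE x in lebesgue_on \<Omega>. v j x = 0 \<longrightarrow> H j x = 0"
    using j by (intro wgrad_0_on_zero_set[OF \<Omega>(1) wH]) auto
  moreover have "AE x in lebesgue_on \<Omega>. v (Suc k) x = 0 \<longrightarrow> H (Suc k) x = 0"
    by (intro wgrad_0_on_zero_set[OF \<Omega>(1) wH]) auto
  ultimately have "AE x in lebesgue_on \<Omega>. phase_density k \<mu> v' H' x = phase_density (Suc k) \<mu> v H x"
  proof eventually_elim
    case (elim x)
    then have "H j x = 0 \<or> H (Suc k) x = 0" by auto
    then have n: "(norm (H j x + H (Suc k) x))\<^sup>2 = (norm (H j x))\<^sup>2 + (norm (H (Suc k) x))\<^sup>2" by auto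
    define f where "f i x = (norm (H i x))\<^sup>2 - 2 * \<mu> * v i x" for i x
    have "phase_density k \<mu> v' H' x = (\<Sum>i=1..k. (f(j := \<lambda>x. f j x + f (Suc k) x)) i x)"
      unfolding phase_density_def by (intro sum.cong) (auto simp: v'_def H'_def f_def n algebra_simps)
    also have "\<dots> = (\<Sum>i=1..k. f i x) + f (Suc k) x" using j by (intro sum_merge) auto
    finally show ?case by (simp add: phase_density_def f_def)
  qed
  then have "(LINT x|lebesgue_on \<Omega>. phase_density k \<mu> v' H' x) = (LINT x|lebesgue_on \<Omega>. phase_density (Suc k) \<mu> v H x)"
    using E(2,4) by (intro integral_cong_AE) auto
  then show "energy \<Omega> k (\<lambda>i. \<mu>) v' = energy \<Omega> (Suc k) (\<lambda>i. \<mu>) v" using E(1,3) by simp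
qed

context segregated_minimizer
begin

lemma pointwise_nonneg:
  assumes "i \<in> {1..k}" "continuous_on \<Omega> (u i)" "x \<in> \<Omega>" shows "u i x \<ge> 0"
  by (rule continuous_AE_nonneg[OF open_dom assms(2) nonneg_AE[OF assms(1)] assms(3)])

lemma pointwise_segregated:
  assumes "i \<in> {1..k}" "j \<in> {1..k}" "i \<noteq> j" "continuous_on \<Omega> (u i)" "continuous_on \<Omega> (u j)" "x \<in> \<Omega>"
  shows "u i x * u j x = 0"
proof -
  have "AE x in M. u i x * u j x = 0"
    using segregated_AE by eventually_elim (use assms(1-3) in auto)
  then have "AE x in M. - \<bar>u i x * u j x\<bar> \<ge> 0" by eventually_elim simp
  then have "- \<bar>u i x * u j x\<bar> \<ge> 0"
    by (intro continuous_AE_nonneg[OF open_dom _ _ assms(6)] continuous_intros assms(4,5))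
  then show ?thesis by simp
qed

text \<open>With \<sigma> = -1 this holds across interfaces; \<sigma> = 1 is for balls inside the
  positivity set, where it yields the strict inequality for the free phase.\<close>

lemma hat_mean:
  assumes i: "i \<in> {1..k}" and cont: "\<And>j. j \<in> {1..k} \<Longrightarrow> continuous_on \<Omega> (u j)"
    and e: "e > 0" "cball x e \<subseteq> \<Omega>" and \<sigma>: "\<sigma> = -1 \<or> \<sigma> = 1 \<and> (\<forall>y\<in>cball x e. u i y > 0)"
  shows "conv (\<lambda>y. 2 * u i y - (\<Sum>j=1..k. u j y)) (mollifier e) x \<le>
    2 * u i x - (\<Sum>j=1..k. u j x) - \<sigma> * \<mu> * mean_const TYPE('a) * e\<^sup>2"
proof (rule mean_value_supersolution[OF open_dom wgrad_hat[OF i] _ e])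
  show "continuous_on \<Omega> (\<lambda>y. 2 * u i y - (\<Sum>j=1..k. u j y))" using i by (intro continuous_intros cont)
  fix \<psi> :: "'a \<Rightarrow> real" assume \<psi>: "test_function \<Omega> \<psi>" "\<And>y. 0 \<le> \<psi> y" "\<And>y. y \<notin> cball x e \<Longrightarrow> \<psi> y = 0"
  have "y \<in> cball x e" if "\<psi> y > 0" for y using \<psi>(3)[of y] that by fastforce
  then show "\<sigma> * \<mu> * (LINT y|M. \<psi> y) \<le> (LINT y|M. (2 *\<^sub>R G i y - (\<Sum>j=1..k. G j y)) \<bullet> grad \<psi> y)"
    using \<sigma> \<psi>(2)
    by (intro hat_supersolution[OF i test_function_H10[OF open_dom \<psi>(1)] test_function_wgrad[OF open_dom \<psi>(1)]]) auto
qed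

lemma phase_mean:
  assumes i: "i \<in> {1..k}" and cont: "continuous_on \<Omega> (u i)" and e: "e > 0" "cball x e \<subseteq> \<Omega>"
  shows "u i x \<le> conv (u i) (mollifier e) x + \<mu> * mean_const TYPE('a) * e\<^sup>2"
proof -
  have "conv (\<lambda>y. -1 * u i y) (mollifier e) x \<le> -1 * u i x - (- \<mu>) * mean_const TYPE('a) * e\<^sup>2"
  proof (rule mean_value_supersolution[OF open_dom wgrad_cmult[OF wgrad[OF i]] _ e])
    show "continuous_on \<Omega> (\<lambda>y. -1 * u i y)" by (intro continuous_intros cont)
    fix \<psi> :: "'a \<Rightarrow> real" assume \<psi>: "test_function \<Omega> \<psi>" "\<And>y. 0 \<le> \<psi> y"
    have "(LINT y|M. G i y \<bullet> grad \<psi> y) \<le> \<mu> * (LINT y|M. \<psi> y)"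
      using \<psi>(2) by (intro subsolution[OF i test_function_H10[OF open_dom \<psi>(1)] test_function_wgrad[OF open_dom \<psi>(1)]]) auto
    then show "- \<mu> * (LINT y|M. \<psi> y) \<le> (LINT y|M. (-1 *\<^sub>R G i y) \<bullet> grad \<psi> y)" by simp
  qed
  then show ?thesis by (simp add: conv_def)
qed

text \<open>A component of \<open>{u\<^sub>i > 0}\<close> that stays away from the boundary data can be declared a phase
  \<open>k + 1\<close> of its own with zero data, or be given to any other phase, at no change of energy.\<close>

lemma no_free_component:
  assumes i: "i \<in> {1..k}" and cont: "\<And>j. j \<in> {1..k} \<Longrightarrow> continuous_on \<Omega> (u j)" and conn: "connected \<Omega>"
    and AB: "open A" "open B" "A \<inter> B = {}" "A \<noteq> {}" "B \<noteq> {}" "{x \<in> \<Omega>. u i x > 0} = A \<union> B"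
    and bd: "\<And>p. p \<in> frontier \<Omega> \<Longrightarrow> \<phi> i p > 0 \<Longrightarrow> \<exists>N. open N \<and> p \<in> N \<and> \<Omega> \<inter> N \<subseteq> A"
  shows False
proof -
  let ?K = "Suc k" and ?c = "mean_const TYPE('a)"
  have un: "u j x \<ge> 0" if "j \<in> {1..k}" "x \<in> \<Omega>" for j x
    by (rule pointwise_nonneg[OF that(1) cont[OF that(1)] that(2)])
  have us: "u j x * u l x = 0" if "j \<in> {1..k}" "l \<in> {1..k}" "j \<noteq> l" "x \<in> \<Omega>" for j l x
    by (rule pointwise_segregated[OF that(1-3) cont[OF that(1)] cont[OF that(2)] that(4)])
  define w where "w x = (if x \<in> B then u i x else 0)" for x
  define wg where "wg x = (if x \<in> B then G i x else 0)" for x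
  have ww: "wgrad \<Omega> w wg" unfolding w_def[abs_def] wg_def[abs_def]
    by (rule wgrad_restrict_component[OF open_dom bounded_dom wgrad[OF i] cont[OF i] AB(1-3,6) un[OF i]])
  have w01: "w x = 0 \<or> w x = u i x" for x by (simp add: w_def)
  have B\<Omega>: "B \<subseteq> \<Omega>" using AB(6) by blast
  have Bpos: "{x \<in> \<Omega>. w x > 0} = B" using AB(6) B\<Omega> by (auto simp: w_def split: if_splits)
  \<comment> \<open>Gluing along the relatively closed sets \<Omega> - A and \<Omega> - B: a point
    in both is outside the positivity set, so \<open>u i\<close> is 0 there.\<close>
  have cw: "continuous_on \<Omega> w"
  proof -
    have un\<Omega>: "(\<Omega> - A) \<union> (\<Omega> - B) = \<Omega>" using AB(3) by blast
    have "continuous_on ((\<Omega> - A) \<union> (\<Omega> - B)) w" unfolding w_def[abs_def]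
    proof (rule continuous_on_cases_local)
      have "closedin (top_of_set \<Omega>) (\<Omega> - C)" if "open C" for C
        unfolding Diff_eq using that by (intro closedin_closed_Int closed_Compl)
      then show "closedin (top_of_set ((\<Omega> - A) \<union> (\<Omega> - B))) (\<Omega> - A)"
        "closedin (top_of_set ((\<Omega> - A) \<union> (\<Omega> - B))) (\<Omega> - B)" unfolding un\<Omega> using AB(1,2) by auto
      show "continuous_on (\<Omega> - A) (u i)" using cont[OF i] continuous_on_subset by blast
      fix x assume "x \<in> \<Omega> - A \<and> x \<notin> B \<or> x \<in> \<Omega> - B \<and> x \<in> B"
      then have "x \<in> \<Omega>" "x \<notin> A \<union> B" by auto
      then show "u i x = 0" using AB(6) un[OF i] by force
    qed simp
    then show ?thesis unfolding un\<Omega> .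
  qed
  have w0: "w \<in> H10 \<Omega>"
  proof -
    obtain \<Phi> where \<Phi>: "\<Phi> \<in> H1 \<Omega>" "continuous_on (closure \<Omega>) \<Phi>" "\<forall>x\<in>frontier \<Omega>. \<Phi> x = \<phi> i x"
      "(\<lambda>x. u i x - \<Phi> x) \<in> H10 \<Omega>" using has_trace[OF i] by (auto simp: has_trace_def)
    show ?thesis
    proof (rule H10_dominated[OF open_dom bounded_dom \<Phi>(1,2,4) wgrad_in_H1[OF ww]])
      show "AE x in M. 0 \<le> w x \<and> w x \<le> max (\<Phi> x + (u i x - \<Phi> x)) 0"
        using un[OF i] by (intro AE_I2) (auto simp: w_def)
      fix p assume p: "p \<in> frontier \<Omega>"
      show "\<Phi> p \<le> 0 \<or> (\<exists>U. open U \<and> p \<in> U \<and> (AE x in M. x \<in> U \<longrightarrow> w x = 0))"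
      proof (cases "\<phi> i p > 0")
        case True
        then obtain N where N: "open N" "p \<in> N" "\<Omega> \<inter> N \<subseteq> A" using bd[OF p] by blast
        have "AE x in M. x \<in> N \<longrightarrow> w x = 0" by (rule AE_I2) (use N(3) AB(3) in \<open>auto simp: w_def\<close>)
        then show ?thesis using N by blast
      qed (use \<Phi>(3) p in auto)
    qed
  qed
  define v where "v l = (if l = ?K then w else if l = i then (\<lambda>x. u i x - w x) else u l)" for l
  define H where "H l = (if l = ?K then wg else if l = i then (\<lambda>x. G i x - wg x) else G l)" for l
  have vw: "v ?K = w" by (simp add: v_def)
  have wv: "wgrad \<Omega> (v l) (H l)" if "l \<in> {1..?K}" for l
    unfolding v_def H_def using ww wgrad_diff[OF open_dom wgrad[OF i] ww] wgrad[of l] that by auto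
  have cv: "continuous_on \<Omega> (v l)" if "l \<in> {1..?K}" for l
    unfolding v_def using cw continuous_on_diff[OF cont[OF i] cw] cont[of l] that by auto
  have v_nonneg: "v l x \<ge> 0" if "l \<in> {1..?K}" "x \<in> \<Omega>" for l x
    using un[of l x] un[OF i that(2)] w01[of x] that by (auto simp: v_def)
  have wv_seg: "w x * v m x = 0" if "m \<in> {1..k}" "x \<in> \<Omega>" for m x
    using us[OF i that(1) _ that(2)] w01[of x] that(1) by (auto simp: v_def)
  have v_zero: "v m x = 0" if "u m x = 0" "m \<in> {1..k}" for m x
    using that w01[of x] by (auto simp: v_def)
  have v_seg: "v l x * v m x = 0" if "l \<in> {1..?K}" "m \<in> {1..?K}" "l \<noteq> m" "x \<in> \<Omega>" for l m x
  proof -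
    note lm = that(1-3)
    consider "l = ?K" "m \<in> {1..k}" | "m = ?K" "l \<in> {1..k}" | "l \<in> {1..k}" "m \<in> {1..k}"
      using lm by (fastforce simp: le_Suc_eq)
    then show ?thesis
    proof cases
      case 1 then show ?thesis using wv_seg[OF 1(2) that(4)] by (simp only: vw)
    next
      case 2 then show ?thesis using wv_seg[OF 2(2) that(4)] by (simp only: vw mult.commute)
    next
      case 3
      have "u l x = 0 \<or> u m x = 0" using us[OF 3 that(3,4)] by simp
      then show ?thesis using v_zero 3 by auto
    qed
  qed
  have adm: "admissible \<Omega> ?K (\<phi>(?K := \<lambda>x. 0)) v"
  proof -
    have "has_trace \<Omega> w (\<lambda>x. 0)" unfolding has_trace_def
      using w0 wgrad_in_H1[OF ww] wgrad_in_H1[OF wgrad_0] by (intro conjI exI[of _ "\<lambda>x. 0"]) auto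
    moreover have "has_trace \<Omega> (\<lambda>x. u i x - w x) (\<phi> i)"
      by (rule has_trace_perturb[OF open_dom has_trace[OF i]]) (use H10_cmult[OF open_dom w0, of "-1"] in simp)
    ultimately have "has_trace \<Omega> (v l) ((\<phi>(?K := \<lambda>x. 0)) l)" if "l \<in> {1..?K}" for l
      using has_trace[of l] that by (auto simp: v_def)
    moreover have "AE x in M. v l x * v m x = 0" if "l \<in> {1..?K}" "m \<in> {1..?K}" "l \<noteq> m" for l m
      using v_seg[OF that] by (intro AE_I2) simp
    ultimately show ?thesis by (auto simp: admissible_def)
  qed
  let ?m = "\<lambda>j v. v(j := \<lambda>x. v j x + v ?K x) :: nat \<Rightarrow> 'a \<Rightarrow> real"
  have min: "energy \<Omega> k (\<lambda>i. \<mu>) u \<le> energy \<Omega> k (\<lambda>i. \<mu>) z" if "admissible \<Omega> k \<phi> z" for z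
  proof -
    have "energy \<Omega> k (\<lambda>i. \<mu>) y = energy \<Omega> k lam y" for y by (intro energy_cong) (auto simp: lam)
    then show ?thesis using minimizer that by (simp add: is_minimizer_def)
  qed
  \<comment> \<open>Merging the new phase back into phase \<open>i\<close> restores
    \<open>u\<close>, which fixes the energy of the split configuration.\<close>
  have "energy \<Omega> k (\<lambda>i. \<mu>) (?m i v) = energy \<Omega> k (\<lambda>i. \<mu>) u"
    using i by (intro energy_cong) (auto simp: v_def)
  then have Ev: "energy \<Omega> ?K (\<lambda>i. \<mu>) v = energy \<Omega> k (\<lambda>i. \<mu>) u"
    using admissible_merge(2)[OF open_dom bounded_dom i adm] by simp
  \<comment> \<open>Every competitor with k + 1 phases becomes one with k phases and the same energy
    when its last phase is merged, so the split configuration is minimal for the larger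
    problem.\<close>
  have S: "segregated_minimizer \<Omega> ?K (\<lambda>i. \<mu>) \<mu> (\<phi>(?K := \<lambda>x. 0)) v H"
  proof
    show "is_minimizer \<Omega> ?K (\<lambda>i. \<mu>) (\<phi>(?K := \<lambda>x. 0)) v" unfolding is_minimizer_def
    proof (intro conjI allI impI adm)
      fix z assume z: "admissible \<Omega> ?K (\<phi>(?K := \<lambda>x. 0)) z"
      note mg = admissible_merge[OF open_dom bounded_dom i z]
      show "energy \<Omega> ?K (\<lambda>i. \<mu>) v \<le> energy \<Omega> ?K (\<lambda>i. \<mu>) z"
        using min[OF mg(1)] mg(2)[of \<mu>] Ev by linarith
    qed
  qed (use open_dom bounded_dom lam_pos data_nonneg wv in auto)
  have Sj: "segregated_minimizer \<Omega> k (\<lambda>i. \<mu>) \<mu> \<phi> (?m j v) (H(j := \<lambda>x. H j x + H ?K x))" if j: "j \<in> {1..k}" for j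
  proof
    note mg = admissible_merge[OF open_dom bounded_dom j adm]
    show "is_minimizer \<Omega> k (\<lambda>i. \<mu>) \<phi> (?m j v)" unfolding is_minimizer_def
      using mg(1) mg(2)[of \<mu>] min Ev by simp
    show "wgrad \<Omega> (?m j v l) ((H(j := \<lambda>x. H j x + H ?K x)) l)" if "l \<in> {1..k}" for l
      using wgrad_add[OF open_dom wv[of j] wv[of ?K]] wv[of l] that j by auto
  qed (use open_dom bounded_dom lam_pos data_nonneg in auto)
  have "interface \<Omega> {1..k} w v \<mu>"
  proof
    have cK: "\<And>j. j \<in> {1..?K} \<Longrightarrow> continuous_on \<Omega> (v j)" by (rule cv)
    have hatK: "2 * v ?K y - (\<Sum>l=1..?K. v l y) = w y - (\<Sum>l=1..k. v l y)" for y by (simp add: vw)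
    show "w x \<ge> 0" if "x \<in> \<Omega>" for x using v_nonneg[of ?K x] that vw by simp
    show "w x * v j x = 0" if "j \<in> {1..k}" "x \<in> \<Omega>" for j x using that by (rule wv_seg)
    show "conv w (mollifier e) x \<le> w x - \<mu> * ?c * e\<^sup>2" if e: "e > 0" "cball x e \<subseteq> {x \<in> \<Omega>. w x > 0}" for x e
    proof -
      have c\<Omega>: "cball x e \<subseteq> \<Omega>" using e(2) by blast
      \<comment> \<open>Where w is positive the sum of the other phases vanishes, so the inequality
        for w - V with \<sigma> = 1 is one for w alone.\<close>
      have z: "(\<Sum>l=1..k. v l y) = 0" if "y \<in> cball x e" for y
        using wv_seg[of _ y] that e(2) by (intro sum.neutral) force
      have "conv w (mollifier e) x = conv (\<lambda>y. w y - (\<Sum>l=1..k. v l y)) (mollifier e) x"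
        by (rule conv_mollifier_cong[OF e(1)]) (use z ball_subset_cball in auto)
      then show ?thesis
        using segregated_minimizer.hat_mean[OF S _ cK e(1) c\<Omega>, of ?K 1] e z[of x] unfolding hatK by (auto simp: vw)
    qed
    show "conv (\<lambda>y. w y - (\<Sum>l=1..k. v l y)) (mollifier e) x \<le> w x - (\<Sum>l=1..k. v l x) + \<mu> * ?c * e\<^sup>2"
      if e: "e > 0" "cball x e \<subseteq> \<Omega>" for x e
      using segregated_minimizer.hat_mean[OF S _ cK e, of ?K "-1"] unfolding hatK by simp
    show "conv (\<lambda>y. w y + 2 * v j y - (\<Sum>l=1..k. v l y)) (mollifier e) x
        \<le> w x + 2 * v j x - (\<Sum>l=1..k. v l x) + \<mu> * ?c * e\<^sup>2"
      if j: "j \<in> {1..k}" and e: "e > 0" "cball x e \<subseteq> \<Omega>" for x e j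
    proof -
      have "continuous_on \<Omega> (?m j v l)" if "l \<in> {1..k}" for l
        using continuous_on_add[OF cv[of j] cv[of ?K]] cv[of l] that j by auto
      note hm = segregated_minimizer.hat_mean[OF Sj[OF j] j this e, of "-1"]
      have eq: "2 * ?m j v j y - (\<Sum>l=1..k. ?m j v l y) = w y + 2 * v j y - (\<Sum>l=1..k. v l y)" for y
        using j by (subst sum_merge) (auto simp: vw)
      show ?thesis using hm[unfolded eq] by simp
    qed
    show "v j x \<le> conv (v j) (mollifier e) x + \<mu> * ?c * e\<^sup>2"
      if "j \<in> {1..k}" "e > 0" "cball x e \<subseteq> \<Omega>" for x e j
      using that by (intro segregated_minimizer.phase_mean[OF S] cv) auto
  qed (use open_dom lam_pos cw cv v_nonneg v_seg in auto)
  from interface.no_interface[OF this] have "\<Omega> \<inter> frontier B = {}" unfolding Bpos by blast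
  moreover have "\<Omega> \<inter> frontier B \<noteq> {}"
    using AB(3-6) by (intro connected_Int_frontier[OF conn]) blast+
  ultimately show False by blast
qed

end

lemma connected_data_connected_phase:
  assumes \<Omega>: "bounded \<Omega>" "smooth_domain \<Omega>"
    and min: "segregated_minimizer \<Omega> k lam \<mu> \<phi> u G" and i: "i \<in> {1..k}"
    and cont: "\<And>j. j \<in> {1..k} \<Longrightarrow> continuous_on \<Omega> (u j)"
    and seg: "\<And>j p. j \<in> {1..k} \<Longrightarrow> j \<noteq> i \<Longrightarrow> p \<in> frontier \<Omega> \<Longrightarrow> \<phi> i p * \<phi> j p = 0"
    and conn: "connected {p \<in> frontier \<Omega>. \<phi> i p > 0}"
  shows "connected {x \<in> \<Omega>. u i x > 0}"
proof (rule ccontr)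
  interpret segregated_minimizer \<Omega> k lam \<mu> \<phi> u G by (rule min)
  let ?P = "{x \<in> \<Omega>. u i x > 0}" and ?Q = "{p \<in> frontier \<Omega>. \<phi> i p > 0}"
  have con\<Omega>: "connected \<Omega>" using \<Omega>(2) by (simp add: smooth_domain_def)
  have "?P = \<Omega> \<inter> u i -` {0<..}" by auto
  then have P: "open ?P" using continuous_open_preimage[OF cont[OF i] open_dom, of "{0<..}"] by simp
  assume "\<not> connected ?P"
  then obtain A0 B0 where AB0: "open A0" "open B0" "?P \<subseteq> A0 \<union> B0" "A0 \<inter> B0 \<inter> ?P = {}" "A0 \<inter> ?P \<noteq> {}" "B0 \<inter> ?P \<noteq> {}"
    unfolding connected_def by blast
  define A B where "A = A0 \<inter> ?P" and "B = B0 \<inter> ?P"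
  have AB: "open A" "open B" "A \<inter> B = {}" "A \<noteq> {}" "B \<noteq> {}" "?P = A \<union> B"
    using AB0 P unfolding A_def B_def by (auto simp: open_Int simp del: Collect_conj_eq)
  have side: "\<exists>N. open N \<and> p \<in> N \<and> (\<Omega> \<inter> N \<subseteq> A \<or> \<Omega> \<inter> N \<subseteq> B)" if p: "p \<in> ?Q" for p
  proof -
    have pf: "p \<in> frontier \<Omega>" "\<phi> i p > 0" using p by auto
    obtain q R where R: "R > 0" "norm (p - q) = R" "\<And>x. x \<in> closure \<Omega> \<Longrightarrow> x \<noteq> p \<Longrightarrow> R < norm (x - q)"
      by (rule exterior_ball[OF \<Omega>(2) pf(1)]) blast
    have z: "\<phi> j p = 0" if "j \<in> {1..k}" "j \<noteq> i" for j using seg[OF that pf(1)] pf(2) by simp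
    obtain W where W: "open W" "p \<in> W" "\<forall>x\<in>\<Omega> \<inter> W. u i x > 0"
      using boundary_positive[OF i cont pf z R] by blast
    have "\<Omega> \<inter> W \<subseteq> A \<union> B" unfolding AB(6)[symmetric] using W(3) by blast
    from boundary_locally_one_side[OF \<Omega>(2) pf(1) W(1,2) AB(1-3) this] show ?thesis .
  qed
  \<comment> \<open>A union of open sets of the whole space, as the definition of connectedness of
    the positive part of the boundary requires; only the trace of such sets in the domain is
    controlled.\<close>
  define near where "near C = \<Union>{N. open N \<and> \<Omega> \<inter> N \<subseteq> C}" for C
  have near: "open (near C)" for C unfolding near_def by (rule open_Union) blast
  have nearD: "\<exists>N. open N \<and> p \<in> N \<and> \<Omega> \<inter> N \<subseteq> C" if "p \<in> near C" for p C using that unfolding near_def by blast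
  have "?Q \<subseteq> near A \<union> near B"
  proof
    fix p assume "p \<in> ?Q"
    from side[OF this] show "p \<in> near A \<union> near B" unfolding near_def by blast
  qed
  \<comment> \<open>Every neighbourhood of a frontier point meets the domain, so the domain near
    such a point cannot lie in \<open>A\<close> and in \<open>B\<close> at once.\<close>
  moreover have "near A \<inter> near B \<inter> ?Q = {}"
  proof (rule ccontr)
    assume "\<not> ?thesis"
    then obtain p where p: "p \<in> near A" "p \<in> near B" "p \<in> frontier \<Omega>" by blast
    obtain N where N: "open N" "p \<in> N" "\<Omega> \<inter> N \<subseteq> A" using nearD[OF p(1)] by blast
    obtain N' where N': "open N'" "p \<in> N'" "\<Omega> \<inter> N' \<subseteq> B" using nearD[OF p(2)] by blast
    have "p \<in> closure \<Omega>" using p(3) by (simp add: frontier_def)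
    then have "(N \<inter> N') \<inter> closure \<Omega> \<noteq> {}" using N(2) N'(2) by blast
    then have "(N \<inter> N') \<inter> \<Omega> \<noteq> {}" using open_Int_closure_eq_empty[OF open_Int[OF N(1) N'(1)]] by blast
    then show False using N(3) N'(3) AB(3) by blast
  qed
  ultimately have "near A \<inter> ?Q = {} \<or> near B \<inter> ?Q = {}" using conn near unfolding connected_def by blast
  then have "?Q \<subseteq> near B \<or> ?Q \<subseteq> near A" using \<open>?Q \<subseteq> near A \<union> near B\<close> by blast
  then show False
  proof
    assume "?Q \<subseteq> near A"
    then have *: "\<exists>N. open N \<and> p \<in> N \<and> \<Omega> \<inter> N \<subseteq> A" if "p \<in> frontier \<Omega>" "\<phi> i p > 0" for p
      using that by (intro nearD) blast
    from no_free_component[OF i cont con\<Omega> AB *] show False .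
  next
    assume "?Q \<subseteq> near B"
    then have *: "\<exists>N. open N \<and> p \<in> N \<and> \<Omega> \<inter> N \<subseteq> B" if "p \<in> frontier \<Omega>" "\<phi> i p > 0" for p
      using that by (intro nearD) blast
    have "B \<inter> A = {}" "?P = B \<union> A" using AB(3,6) by auto
    from no_free_component[OF i cont con\<Omega> AB(2,1) this(1) AB(5,4) this(2) *] show False .
  qed
qed

theorem proposition1p10:
  fixes \<Omega> :: "(real ^ 'n) set"
    and k :: nat
    and lam :: "nat \<Rightarrow> real"
    and lam_bar :: real
    and \<phi> u :: "nat \<Rightarrow> real ^ 'n \<Rightarrow> real"
  assumes dim: "CARD('n) \<ge> 2"
    and dom: "bounded \<Omega>" "smooth_domain \<Omega>"
    and k: "k \<ge> 1"
    and lam: "lam_bar > 0" "\<forall>i\<in>{1..k}. lam i = lam_bar"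
    and lipschitz: "\<forall>i\<in>{1..k}. \<exists>L. L-lipschitz_on (frontier \<Omega>) (\<phi> i)"
    and nonneg: "\<forall>i\<in>{1..k}. \<forall>x\<in>frontier \<Omega>. \<phi> i x \<ge> 0"
    and nontrivial: "\<forall>i\<in>{1..k}. \<exists>x\<in>frontier \<Omega>. \<phi> i x \<noteq> 0"
    and segregated: "\<forall>i\<in>{1..k}. \<forall>j\<in>{1..k}. i \<noteq> j \<longrightarrow> (\<forall>x\<in>frontier \<Omega>. \<phi> i x * \<phi> j x = 0)"
    and connected_data: "\<forall>i\<in>{1..k}. connected {x \<in> frontier \<Omega>. \<phi> i x > 0}"
    and minimizer: "is_minimizer \<Omega> k lam \<phi> u"
    and continuous_rep: "\<forall>i\<in>{1..k}. continuous_on \<Omega> (u i)"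
  shows "\<forall>i\<in>{1..k}. connected {x \<in> \<Omega>. u i x > 0}"
proof
  fix i assume i: "i \<in> {1..k}"
  have "segregated_minimizer \<Omega> k lam lam_bar \<phi> u (\<lambda>i. weak_grad \<Omega> (u i))"
    using dom lam nonneg minimizer
    by unfold_locales (auto simp: smooth_domain_def is_minimizer_def admissible_def has_trace_def intro: wgrad_weak_grad)
  from connected_data_connected_phase[OF dom this i]
  show "connected {x \<in> \<Omega>. u i x > 0}" using continuous_rep segregated connected_data i by auto
qed

end
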